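(* Let $K$ be the eyebolted Vicsek cross, with its normalized $\alpha$-dimensional Hausdorff measure $\mu$, $\alpha=\log 21/\log 9$. Then the critical exponents of the Besov spaces $B^{\sigma}_{2,\infty}$ on $(K,\mu)$ are $$\sigma^*=\sigma^\#=\frac12\Big(1+\frac{\log 21}{\log 9}\Big).$$ Moreover: (i) $B^{\sigma^*}_{2,\infty}$ (which is contained in $C(K)$) is dense in $L^2(K,\mu)$, but is not dense in $C(K)$. (ii) There are two kinds of (non-primal) local regular Dirichlet forms that can be constructed on $K$: there exists one, $(\mathcal E^{(1)},\mathcal F^{(1)})$, that satisfies the energy self-similar identity, and there exists another, $(\mathcal E^{(2)},\mathcal F^{(2)})$, that is obtained from the reverse recursive construction. Their domains are different from $B^{\sigma^*}_{2,\infty}$, i.e. $\mathcal F^{(1)}\neq B^{\sigma^*}_{2,\infty}$ and $\mathcal F^{(2)}\neq B^{\sigma^*}_{2,\infty}$.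
   Context: **Eyebolted Vicsek cross.** In $\mathbb R^2$ let $p_0=(0,0)$, $p_1=(-\frac12,-\frac12)$, $p_2=(\frac12,-\frac12)$, $p_3=(\frac12,\frac12)$, $p_4=(-\frac12,\frac12)$, and let $S$ be the unit square with vertices $p_1,\dots,p_4$, divided into $81$ sub-squares of side $1/9$; the sub-square with index $(i,j)$, $-4\le i,j\le 4$, has center $(i/9,j/9)$. Select the following $21$ sub-squares: the nine $(k,k)$, $|k|\le 4$ (along $\overline{p_1p_3}$); the eight $(k,-k)$, $1\le |k|\le 4$ (along $\overline{p_2p_4}$); and two "eyebolts", the lower-right one consisting of the pair $(3,-1),(4,-2)$ or the pair $(1,-3),(2,-4)$, and the upper-left one consisting of the pair $(-3,1),(-4,2)$ or the pair $(-1,3),(-2,4)$ (a fixed choice is made for each eyebolt; the assertions do not depend on it). Let $a_1,\dots,a_{21}$ be the centers of the selected sub-squares ($a_1,\dots,a_9$ those along $\overline{p_1p_3}$), $F_i(x)=\frac19x+a_i$, and let $K$ be the nonempty compact set with $K=\bigcup_{i=1}^{21}F_i(K)$. Put $V_0=\{p_1,p_2,p_3,p_4\}$, $V_n=\bigcup_{i}F_i(V_{n-1})$, $V_*=\bigcup_nV_n$; for a word $\omega=\omega_1\cdots\omega_n$ let $|\omega|=n$, $F_\omega=F_{\omega_1}\circ\cdots\circ F_{\omega_n}$, $V_\omega=F_\omega(V_0)$. The set $K$ is a post-critically finite self-similar set with boundary $V_0$. **Besov spaces.** For $\sigma>0$, $[u]^2_{B^\sigma_{2,\infty}}=\sup_{0<r<1}r^{-\alpha-2\sigma}\int_K\int_{B(x,r)}|u(x)-u(y)|^2d\mu(y)d\mu(x)$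 and $B^\sigma_{2,\infty}=\{u\in L^2(K,\mu):\|u\|_2+[u]_{B^\sigma_{2,\infty}}<\infty\}$. When $2\sigma>\alpha$, elements of $B^\sigma_{2,\infty}$ have continuous representatives and $B^\sigma_{2,\infty}$ is regarded as a subset of $C(K)$. The critical exponents are $\sigma^*=\sup\{\sigma: B^\sigma_{2,\infty}\cap C(K)\text{ is dense in }C(K)\}$ (sup norm) and $\sigma^\#=\sup\{\sigma: B^\sigma_{2,\infty}\text{ contains non-constant functions}\}$. **Dirichlet forms.** A Dirichlet form on $L^2(K,\nu)$ ($\nu$ a Radon measure with support $K$) is a closed, non-negative definite, densely defined symmetric bilinear form $\mathcal E$ with domain $\mathcal F$ having the Markov property; write $\mathcal E[u]=\mathcal E(u,u)$. It is regular if $\mathcal F\cap C(K)$ is dense in $C(K)$ (sup norm) and in $\mathcal F$ (norm $(\mathcal E[u]+\|u\|_2^2)^{1/2}$), and local if $\mathcal E(u,v)=0$ whenever $u,v\in\mathcal F$ have disjoint compact supports. A Dirichlet form "on $K$" means one on $L^2(K,\nu)$ for some Radon measure $\nu$ of full support. The forms "constructed on $K$" are those obtained as follows. One has energies $\mathcal E_n[u]=\sum_{|\omega|=n}\sum_{\{x,y\}\subset V_\omega}c_\omega(x,y)|u(x)-u(y)|^2$ on $V_n$ ($n\ge0$) with positive conductances $c_\omega(x,y)$, compatible in the sense that $\min\{\mathcal E_n[v]:v:V_n\to\mathbb R,\ v|_{V_{n-1}}=u\}=\mathcal E_{n-1}[u]$ for all $n\ge1$ and $u:V_{n-1}\to\mathbb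 R$; then $\mathcal E[u]=\lim_n\mathcal E_n[u]$ and $\mathcal F=\{u\in C(K):\mathcal E[u]<\infty\}$. "Non-primal" means that the $\mathcal E_n$ are not all scalar multiples of the primal energies $E_n[u]=\sum_{|\omega|=n}\sum_{\{x,y\}\subset V_\omega}|u(x)-u(y)|^2$. *Energy self-similar identity:* there are $0<\tau_i<1$ with $\mathcal E[u]=\sum_{i=1}^{21}\tau_i^{-1}\mathcal E[u\circ F_i]$ for all $u\in\mathcal F$. *Reverse recursive construction:* the conductances on level $n$ are the same on every $n$-cell, $c_\omega(F_\omega(p),F_\omega(q))=c_n(p,q)$ for all $|\omega|=n$ and $p\ne q$ in $V_0$; one fixes the data $c_0$ on $V_0$ and finds positive $c_n$, $n\ge1$, making the sequence $(\mathcal E_n)$ compatible, i.e. such that $\min\{\mathcal E_n[v]:v:V_n\to\mathbb R,\ v|_{V_{n-1}}=u\}=\mathcal E_{n-1}[u]$ for all $n\ge1$ and $u:V_{n-1}\to\mathbb R$. *)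

theory Defs
  imports "HOL-Analysis.Analysis"
begin

section \<open>Hausdorff measure\<close>

text \<open>Intended for \<open>s > 0\<close>: since \<open>0 powr s = 0\<close>, empty members of a cover cost nothing,
  so countable covers also account for finite ones. The library's \<^const>\<open>diameter\<close> is only
  meaningful on bounded sets.\<close>

definition hausdorff_content :: "real \<Rightarrow> real \<Rightarrow> 'a::metric_space set \<Rightarrow> ennreal" where
  "hausdorff_content s \<delta> A =
     (INF U \<in> {U :: nat \<Rightarrow> 'a set. A \<subseteq> (\<Union>i. U i) \<and> (\<forall>i. bounded (U i) \<and> diameter (U i) \<le> \<delta>)}.
        (\<Sum>i. ennreal (diameter (U i) powr s)))"

definition hausdorff_outer :: "real \<Rightarrow> 'a::metric_space set \<Rightarrow> ennreal" where
  "hausdorff_outer s A = (SUP \<delta> \<in> {0<..}. hausdorff_content s \<delta> A)"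

definition normalized_hausdorff :: "real \<Rightarrow> 'a::metric_space set \<Rightarrow> 'a measure" where
  "normalized_hausdorff s K =
     measure_of K (sets (restrict_space borel K)) (\<lambda>A. hausdorff_outer s A / hausdorff_outer s K)"


section \<open>Function spaces on a compact set\<close>

text \<open>A function on \<open>K\<close> is a function on the ambient type, and only its values on \<open>K\<close> matter:
  the measures below have space \<open>K\<close>, and the function spaces defined below are closed under changing
  a function outside \<open>K\<close>.\<close>

definition cont_funs :: "'a::topological_space set \<Rightarrow> ('a \<Rightarrow> real) set" where
  "cont_funs K = {u. continuous_on K u}"

definition lsq :: "'a measure \<Rightarrow> ('a \<Rightarrow> real) set" where
  "lsq M = {u \<in> borel_measurable M. integrable M (\<lambda>x. (u x)\<^sup>2)}"

definition lsq_norm :: "'a measure \<Rightarrow> ('a \<Rightarrow> real) \<Rightarrow> real" where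
  "lsq_norm M u = sqrt (LINT x|M. (u x)\<^sup>2)"

definition dense_in_cont :: "'a::topological_space set \<Rightarrow> ('a \<Rightarrow> real) set \<Rightarrow> bool" where
  "dense_in_cont K A \<longleftrightarrow>
     (\<forall>f \<in> cont_funs K. \<forall>\<epsilon>>0. \<exists>u \<in> A. \<forall>x\<in>K. \<bar>u x - f x\<bar> < \<epsilon>)"

definition dense_in_lsq :: "'a measure \<Rightarrow> ('a \<Rightarrow> real) set \<Rightarrow> bool" where
  "dense_in_lsq M A \<longleftrightarrow>
     (\<forall>f \<in> lsq M. \<forall>\<epsilon>>0. \<exists>u \<in> A. lsq_norm M (\<lambda>x. u x - f x) < \<epsilon>)"


section \<open>Besov spaces and critical exponents\<close>

definition besov_seminorm_sq ::
    "real \<Rightarrow> 'a::metric_space measure \<Rightarrow> real \<Rightarrow> ('a \<Rightarrow> real) \<Rightarrow> ennreal" where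
  "besov_seminorm_sq \<alpha> M \<sigma> u =
     (SUP r \<in> {0<..<1}. ennreal (r powr (- \<alpha> - 2 * \<sigma>)) *
        (\<integral>\<^sup>+ x. (\<integral>\<^sup>+ y. ennreal (\<bar>u x - u y\<bar>\<^sup>2) * indicator (ball x r) y \<partial>M) \<partial>M))"

definition besov :: "real \<Rightarrow> 'a::metric_space measure \<Rightarrow> real \<Rightarrow> ('a \<Rightarrow> real) set" where
  "besov \<alpha> M \<sigma> = {u \<in> lsq M. besov_seminorm_sq \<alpha> M \<sigma> u < \<infinity>}"

text \<open>The suprema are taken in the extended reals, so that a finite value includes boundedness.\<close>

definition sigma_star :: "'a::metric_space set \<Rightarrow> real \<Rightarrow> 'a measure \<Rightarrow> ereal" where
  "sigma_star K \<alpha> M =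
     (SUP \<sigma> \<in> {\<sigma>. 0 < \<sigma> \<and> dense_in_cont K (besov \<alpha> M \<sigma> \<inter> cont_funs K)}. ereal \<sigma>)"

definition sigma_sharp :: "real \<Rightarrow> 'a::metric_space measure \<Rightarrow> ereal" where
  "sigma_sharp \<alpha> M =
     (SUP \<sigma> \<in> {\<sigma>. 0 < \<sigma> \<and> (\<exists>u \<in> besov \<alpha> M \<sigma>. \<not> (\<exists>k. AE x in M. u x = k))}. ereal \<sigma>)"


section \<open>Dirichlet forms\<close>

text \<open>On a compact set, a Radon measure is the same as a finite Borel measure.\<close>

definition full_radon_measure :: "'a::metric_space set \<Rightarrow> 'a measure \<Rightarrow> bool" where
  "full_radon_measure K \<nu> \<longleftrightarrow>
     sets \<nu> = sets (restrict_space borel K) \<and> finite_measure \<nu> \<and>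
     (\<forall>U. open U \<and> U \<inter> K \<noteq> {} \<longrightarrow> emeasure \<nu> (U \<inter> K) > 0)"

definition form_norm_sq ::
    "'a measure \<Rightarrow> (('a \<Rightarrow> real) \<Rightarrow> ('a \<Rightarrow> real) \<Rightarrow> real) \<Rightarrow> ('a \<Rightarrow> real) \<Rightarrow> real" where
  "form_norm_sq \<nu> E u = E u u + (lsq_norm \<nu> u)\<^sup>2"

text \<open>The domain \<open>F\<close> is a space of functions representing its \<open>\<nu>\<close>-classes, not necessarily
  containing all representatives of a class; accordingly \<open>E\<close> has to respect
  \<open>\<nu>\<close>-almost everywhere equality, and the truncation of \<open>u\<close> lies in \<open>F\<close> up to the choice of a
  representative.\<close>

definition dirichlet_form ::
    "'a measure \<Rightarrow> (('a \<Rightarrow> real) \<Rightarrow> ('a \<Rightarrow> real) \<Rightarrow> real) \<Rightarrow> ('a \<Rightarrow> real) set \<Rightarrow> bool" where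
  "dirichlet_form \<nu> E F \<longleftrightarrow>
     F \<subseteq> lsq \<nu> \<and>
     (\<lambda>x. 0) \<in> F \<and>
     (\<forall>u\<in>F. \<forall>v\<in>F. (\<lambda>x. u x + v x) \<in> F) \<and>
     (\<forall>u\<in>F. \<forall>k. (\<lambda>x. k * u x) \<in> F) \<and>
     dense_in_lsq \<nu> F \<and>
     \<comment> \<open>well-defined on classes\<close>
     (\<forall>u\<in>F. \<forall>v\<in>F. \<forall>w\<in>F. (AE x in \<nu>. u x = v x) \<longrightarrow> E u w = E v w) \<and>
     \<comment> \<open>symmetric, bilinear, non-negative definite\<close>
     (\<forall>u\<in>F. \<forall>v\<in>F. E u v = E v u) \<and>
     (\<forall>u\<in>F. \<forall>v\<in>F. \<forall>w\<in>F. E (\<lambda>x. u x + v x) w = E u w + E v w) \<and>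
     (\<forall>u\<in>F. \<forall>v\<in>F. \<forall>k. E (\<lambda>x. k * u x) v = k * E u v) \<and>
     (\<forall>u\<in>F. 0 \<le> E u u) \<and>
     \<comment> \<open>closed\<close>
     (\<forall>f. (\<forall>n::nat. f n \<in> F) \<and>
        (\<forall>\<epsilon>>0. \<exists>N. \<forall>m\<ge>N. \<forall>n\<ge>N. form_norm_sq \<nu> E (\<lambda>x. f m x - f n x) < \<epsilon>) \<longrightarrow>
        (\<exists>u\<in>F. (\<lambda>n. form_norm_sq \<nu> E (\<lambda>x. f n x - u x)) \<longlonglongrightarrow> 0)) \<and>
     \<comment> \<open>Markov property\<close>
     (\<forall>u\<in>F. \<exists>v\<in>F. (AE x in \<nu>. v x = min 1 (max 0 (u x))) \<and> E v v \<le> E u u)"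

definition regular_form ::
    "'a::topological_space set \<Rightarrow> 'a measure \<Rightarrow> (('a \<Rightarrow> real) \<Rightarrow> ('a \<Rightarrow> real) \<Rightarrow> real) \<Rightarrow>
     ('a \<Rightarrow> real) set \<Rightarrow> bool" where
  "regular_form K \<nu> E F \<longleftrightarrow>
     dense_in_cont K (F \<inter> cont_funs K) \<and>
     (\<forall>u\<in>F. \<forall>\<epsilon>>0. \<exists>v \<in> F \<inter> cont_funs K. sqrt (form_norm_sq \<nu> E (\<lambda>x. u x - v x)) < \<epsilon>)"

text \<open>The support of the measure \<open>\<bar>u\<bar> d\<nu>\<close>, i.e. the complement of the largest open set on which
  \<open>u = 0\<close> almost everywhere. For continuous \<open>u\<close> and \<open>\<nu>\<close> of full support it is the closure of
  \<open>{u \<noteq> 0}\<close> in \<open>K\<close>.\<close>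

definition ae_support ::
    "'a::topological_space set \<Rightarrow> 'a measure \<Rightarrow> ('a \<Rightarrow> real) \<Rightarrow> 'a set" where
  "ae_support K \<nu> u = {x\<in>K. \<forall>U. open U \<and> x \<in> U \<longrightarrow> \<not> (AE y in \<nu>. y \<in> U \<longrightarrow> u y = 0)}"

definition local_form ::
    "'a::topological_space set \<Rightarrow> 'a measure \<Rightarrow> (('a \<Rightarrow> real) \<Rightarrow> ('a \<Rightarrow> real) \<Rightarrow> real) \<Rightarrow>
     ('a \<Rightarrow> real) set \<Rightarrow> bool" where
  "local_form K \<nu> E F \<longleftrightarrow>
     (\<forall>u\<in>F. \<forall>v\<in>F.
        compact (ae_support K \<nu> u) \<and> compact (ae_support K \<nu> v) \<and>
        ae_support K \<nu> u \<inter> ae_support K \<nu> v = {} \<longrightarrow> E u v = 0)"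

definition local_regular_dirichlet_form_on ::
    "'a::metric_space set \<Rightarrow> (('a \<Rightarrow> real) \<Rightarrow> ('a \<Rightarrow> real) \<Rightarrow> real) \<Rightarrow> ('a \<Rightarrow> real) set \<Rightarrow> bool" where
  "local_regular_dirichlet_form_on K E F \<longleftrightarrow>
     (\<exists>\<nu>. full_radon_measure K \<nu> \<and> dirichlet_form \<nu> E F \<and>
          regular_form K \<nu> E F \<and> local_form K \<nu> E F)"


section \<open>The eyebolted Vicsek cross\<close>

type_synonym cell = "int \<times> int"
type_synonym point = "real \<times> real"

text \<open>The two Boolean parameters record the choices made for the lower-right and the upper-left
  eyebolt. The maps \<open>F\<^sub>i\<close> are indexed by the selected sub-squares \<open>(i, j)\<close> themselves
  instead of by \<open>1, \<dots>, 21\<close>.\<close>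

definition cross_cells :: "bool \<Rightarrow> bool \<Rightarrow> cell set" where
  "cross_cells lr ul =
     {(k, k) |k. \<bar>k\<bar> \<le> 4} \<union> {(k, - k) |k. 1 \<le> \<bar>k\<bar> \<and> \<bar>k\<bar> \<le> 4} \<union>
     (if lr then {(3, -1), (4, -2)} else {(1, -3), (2, -4)}) \<union>
     (if ul then {(-3, 1), (-4, 2)} else {(-1, 3), (-2, 4)})"

lemma card_cross_cells: "card (cross_cells lr ul) = 21"
proof -
  have 0: "{k. \<bar>k\<bar> \<le> 4} = {-4, -3, -2, -1, 0, 1, 2, 3, 4::int}"
    "{k. 1 \<le> \<bar>k\<bar> \<and> \<bar>k\<bar> \<le> 4} = {-4, -3, -2, -1, 1, 2, 3, 4::int}"
    by (rule set_eqI, simp, presburger)+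
  show ?thesis
    unfolding cross_cells_def setcompr_eq_image 0 by (cases lr; cases ul; simp)
qed

definition cell_map :: "cell \<Rightarrow> point \<Rightarrow> point" where
  "cell_map c x = (1/9) *\<^sub>R x + (real_of_int (fst c) / 9, real_of_int (snd c) / 9)"

primrec word_map :: "cell list \<Rightarrow> point \<Rightarrow> point" where
  "word_map [] = id"
| "word_map (c # w) = cell_map c \<circ> word_map w"

definition words :: "cell set \<Rightarrow> nat \<Rightarrow> cell list set" where
  "words I n = {w. set w \<subseteq> I \<and> length w = n}"

definition corners :: "point set" where
  "corners = {(-1/2, -1/2), (1/2, -1/2), (1/2, 1/2), (-1/2, 1/2)}"

primrec vertices :: "cell set \<Rightarrow> nat \<Rightarrow> point set" where
  "vertices I 0 = corners"
| "vertices I (Suc n) = (\<Union>c\<in>I. cell_map c ` vertices I n)"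

definition word_vertices :: "cell list \<Rightarrow> point set" where
  "word_vertices w = word_map w ` corners"


section \<open>Forms constructed from compatible energies\<close>

text \<open>\<open>c w x y\<close> is the conductance of the pair \<open>{x, y}\<close> of distinct vertices of the cell \<open>w\<close>.\<close>

type_synonym conductances = "cell list \<Rightarrow> point \<Rightarrow> point \<Rightarrow> real"

definition positive_conductances :: "cell set \<Rightarrow> conductances \<Rightarrow> bool" where
  "positive_conductances I c \<longleftrightarrow>
     (\<forall>n. \<forall>w \<in> words I n. \<forall>x \<in> word_vertices w. \<forall>y \<in> word_vertices w.
        x \<noteq> y \<longrightarrow> 0 < c w x y \<and> c w x y = c w y x)"

text \<open>The factor \<open>1/2\<close> turns the sum over ordered pairs into one over unordered pairs; the
  diagonal terms vanish.\<close>

definition level_energy :: "cell set \<Rightarrow> conductances \<Rightarrow> nat \<Rightarrow> (point \<Rightarrow> real) \<Rightarrow> real" where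
  "level_energy I c n u =
     (\<Sum>w \<in> words I n.
        1/2 * (\<Sum>x \<in> word_vertices w. \<Sum>y \<in> word_vertices w. c w x y * \<bar>u x - u y\<bar>\<^sup>2))"

definition compatible :: "cell set \<Rightarrow> conductances \<Rightarrow> bool" where
  "compatible I c \<longleftrightarrow>
     (\<forall>n u. let S = {level_energy I c (Suc n) v |v. \<forall>x \<in> vertices I n. v x = u x}
            in level_energy I c n u \<in> S \<and> (\<forall>e\<in>S. level_energy I c n u \<le> e))"

definition non_primal :: "cell set \<Rightarrow> conductances \<Rightarrow> bool" where
  "non_primal I c \<longleftrightarrow>
     \<not> (\<forall>n. \<exists>k. \<forall>u. level_energy I c n u = k * level_energy I (\<lambda>w x y. 1) n u)"

definition limit_energy :: "cell set \<Rightarrow> conductances \<Rightarrow> (point \<Rightarrow> real) \<Rightarrow> ennreal" where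
  "limit_energy I c u = lim (\<lambda>n. ennreal (level_energy I c n u))"

definition energy_domain :: "cell set \<Rightarrow> point set \<Rightarrow> conductances \<Rightarrow> (point \<Rightarrow> real) set" where
  "energy_domain I K c = {u \<in> cont_funs K. limit_energy I c u < \<infinity>}"

text \<open>Polarization of the quadratic form; meaningful on the domain, where all energies are finite.\<close>

definition energy_form ::
    "cell set \<Rightarrow> conductances \<Rightarrow> (point \<Rightarrow> real) \<Rightarrow> (point \<Rightarrow> real) \<Rightarrow> real" where
  "energy_form I c u v =
     (enn2real (limit_energy I c (\<lambda>x. u x + v x)) - enn2real (limit_energy I c (\<lambda>x. u x - v x))) / 4"

definition constructed_form :: "cell set \<Rightarrow> point set \<Rightarrow> conductances \<Rightarrow> bool" where
  "constructed_form I K c \<longleftrightarrow>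
     positive_conductances I c \<and> compatible I c \<and>
     local_regular_dirichlet_form_on K (energy_form I c) (energy_domain I K c)"

definition energy_self_similar :: "cell set \<Rightarrow> point set \<Rightarrow> conductances \<Rightarrow> bool" where
  "energy_self_similar I K c \<longleftrightarrow>
     (\<exists>\<tau>. (\<forall>i\<in>I. 0 < \<tau> i \<and> \<tau> i < 1) \<and>
          (\<forall>u \<in> energy_domain I K c.
             limit_energy I c u = (\<Sum>i\<in>I. ennreal (inverse (\<tau> i)) * limit_energy I c (u \<circ> cell_map i))))"

text \<open>Conductances depending only on the level and on the position inside the cell. That the
  resulting sequence is positive and compatible is part of \<^const>\<open>constructed_form\<close>.\<close>

definition reverse_recursive :: "cell set \<Rightarrow> conductances \<Rightarrow> bool" where
  "reverse_recursive I c \<longleftrightarrow>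
     (\<exists>cn :: nat \<Rightarrow> point \<Rightarrow> point \<Rightarrow> real.
        \<forall>n. \<forall>w \<in> words I n. \<forall>p \<in> corners. \<forall>q \<in> corners.
          p \<noteq> q \<longrightarrow> c w (word_map w p) (word_map w q) = cn n p q)"

end

theory Submission
  imports Defs
begin

text \<open>Each cell carries a resistor network of the shape of a star: two arms of resistance \<open>a\<close> from its centre
to the vertices \<open>p\<^sub>1, p\<^sub>3\<close> and two arms of resistance \<open>b\<close> to \<open>p\<^sub>2, p\<^sub>4\<close>. The cells of the first level
form a tree except for the two cycles closed by the eyebolts, so the series and parallel laws reduce
their network to a single star. Along the diagonal \<open>\<overline>p\<^sub>1\<overline>p\<^sub>3\<close> nine cells in series give the arm
resistance \<open>9 a\<close>. Along \<open>\<overline>p\<^sub>2\<overline>p\<^sub>4\<close> the eyebolt is a detour parallel to a part of the arm, and the arm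
resistance is only \<open>b (7 + 2 \<kappa> - b / (a + b))\<close>, where \<open>\<kappa> = 1\<close> for equal cells and, more generally,
\<open>\<kappa>\<close> is the factor by which the resistances of the two end cells are scaled
(\<open>level1_energy_lower\<close>, \<open>level1_minimizer\<close>). For equal cells the ratio \<open>t = b / a\<close> hence becomes
\<open>t (1 - t / (9 (1 + t)))\<close>: going from fine to coarse levels it decreases to \<open>0\<close>, but only like \<open>1 / n\<close>.

The Hausdorff measure gives mass \<open>21\<^sup>-\<^sup>n\<close> to every cell of level \<open>n\<close>. For \<open>2 \<sigma> > \<alpha>\<close> this turns the
Besov condition into a discrete one: \<open>B\<^sup>\<sigma>\<close> consists of the continuous functions whose sum of squared
differences over the vertices of the cells of level \<open>n\<close> is \<open>O(l\<^sup>-\<^sup>n)\<close> with \<open>l = 9 powr (2 \<sigma> - \<alpha>)\<close>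
(\<open>besov_if_vertex_energy\<close>, \<open>besov_continuous_representative\<close>). The claimed critical exponent is the
one with \<open>l = 9\<close>, the factor by which the resistance of \<open>\<overline>p\<^sub>1\<overline>p\<^sub>3\<close> scales.

 \<^item> Above it, the reduction of the network of equal cells of level \<open>n\<close> to the four corners of a cell
  bounds the squared differences at the corners by a multiple of \<open>(9 / l)\<^sup>n\<close>, so all functions are
  constant.

 \<^item> At it, the reduced networks keep the resistance of \<open>\<overline>p\<^sub>1\<overline>p\<^sub>3\<close>, but that of \<open>\<overline>p\<^sub>2\<overline>p\<^sub>4\<close> tends to \<open>0\<close>.
  So every function in the space has \<open>u(p\<^sub>2) = u(p\<^sub>4)\<close>, and the space is not dense in \<open>C(K)\<close>. Conversely, a function
  that agrees at \<open>p\<^sub>2\<close> and \<open>p\<^sub>4\<close> of each cell of some level extends to one in the space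
  (\<open>spine_extension\<close>). This constraint affects only \<open>O(9\<^sup>m)\<close> of the \<open>21\<^sup>m\<close> subcells of a cell, so
  the space is still dense in \<open>L\<^sup>2\<close>.

 \<^item> Below it, one scales the end cells by the \<open>\<kappa>\<close> for which a given ratio \<open>t\<close> is preserved. This defines
  a self-similar form whose resistances decay like \<open>(9 / \<kappa>)\<^sup>-\<^sup>n\<close>. As \<open>\<kappa>\<close> tends to \<open>1\<close> with \<open>t\<close> tending to \<open>0\<close>, its domain,
  which is dense in \<open>C(K)\<close>, lies in \<open>B\<^sup>\<sigma>\<close> for small \<open>t\<close>.

Every compatible family of stars whose resistances decay geometrically defines a local regular
Dirichlet form (locale \<open>star_form\<close>). The two required forms are the self-similar one with \<open>t = 2\<close> and
the one with equal cells on each level whose ratios are found by following the ratio map backwards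
from \<open>2\<close>; a ratio grows by at most the factor \<open>9 / 8\<close> in each step back, so that the resistances decay
like \<open>8\<^sup>-\<^sup>n\<close>. Their domains are dense in \<open>C(K)\<close>, and the critical Besov space is not.\<close>

section \<open>Words, cells and their position on the grid\<close>

text \<open>The cell of the word \<open>w\<close> has its centre at \<open>word_index w / 9 ^ length w\<close>.\<close>

primrec word_index :: "cell list \<Rightarrow> int \<times> int" where
  "word_index [] = (0, 0)"
| "word_index (c # w) =
     (fst (word_index w) + 9 ^ length w * fst c, snd (word_index w) + 9 ^ length w * snd c)"

lemma word_map_eq:
  "word_map w x = ((fst x + of_int (fst (word_index w))) / 9 ^ length w,
                   (snd x + of_int (snd (word_index w))) / 9 ^ length w)"
  by (induction w) (auto simp: cell_map_def field_simps prod_eq_iff)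

lemma word_map_append: "word_map (u @ v) = word_map u \<circ> word_map v"
  by (induction u) auto

lemma inj_word_map: "inj (word_map w)"
  by (rule injI) (auto simp: word_map_eq prod_eq_iff)

lemma word_map_eq_iff [simp]: "word_map w x = word_map w y \<longleftrightarrow> x = y"
  using inj_word_map[of w] by (rule inj_eq)

lemma dist_word_map: "dist (word_map w x) (word_map w y) = dist x y / 9 ^ length w"
proof (induction w)
  case (Cons c w)
  have "dist (word_map (c # w) x) (word_map (c # w) y) = norm ((1/9) *\<^sub>R (word_map w x - word_map w y))"
    by (simp add: dist_norm cell_map_def scaleR_diff_right)
  then show ?case using Cons by (simp add: dist_norm)
qed auto

lemma continuous_on_word_map: "continuous_on A (word_map w)"
  unfolding continuous_on_iff
proof (intro ballI allI impI)
  fix x e assume "x \<in> A" "(0::real) < e"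
  then show "\<exists>d>0. \<forall>x'\<in>A. dist x' x < d \<longrightarrow> dist (word_map w x') (word_map w x) < e"
    by (intro exI[of _ "e * 9 ^ length w"]) (auto simp: dist_word_map field_simps)
qed

lemma words_0 [simp]: "words I 0 = {[]}"
  by (auto simp: words_def)

lemma finite_cross_cells [simp]: "finite (cross_cells lr ul)"
  using card_cross_cells[of lr ul] by (metis card.infinite zero_neq_numeral)

lemma finite_words [simp]: "finite I \<Longrightarrow> finite (words I n)"
  unfolding words_def by (rule finite_lists_length_eq)

lemma card_words: "finite I \<Longrightarrow> card (words I n) = card I ^ n"
  unfolding words_def by (rule card_lists_length_eq)

lemma words_append: "u \<in> words I m \<Longrightarrow> v \<in> words I n \<Longrightarrow> u @ v \<in> words I (m + n)"
  by (auto simp: words_def)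

lemma length_words: "w \<in> words I n \<Longrightarrow> length w = n"
  by (auto simp: words_def)

lemma bij_words_append: "bij_betw (\<lambda>(u, v). u @ v) (words I m \<times> words I n) (words I (m + n))"
proof (rule bij_betwI[where g="\<lambda>w. (take m w, drop m w)"])
  show "(\<lambda>w. (take m w, drop m w)) \<in> words I (m + n) \<rightarrow> words I m \<times> words I n"
    by (auto simp: words_def dest: in_set_takeD in_set_dropD)
qed (auto simp: words_def)

lemma sum_words_append:
  "(\<Sum>w\<in>words I (m + n). f w) = (\<Sum>u\<in>words I m. \<Sum>v\<in>words I n. f (u @ v))"
  unfolding sum.cartesian_product sum.reindex_bij_betw[OF bij_words_append, symmetric]
  by (simp add: case_prod_beta)

lemma words_Suc: "words I (Suc n) = (\<Union>c\<in>I. (#) c ` words I n)"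
proof -
  have "w \<in> (\<Union>c\<in>I. (#) c ` words I n)" if "w \<in> words I (Suc n)" for w
    using that by (cases w) (auto simp: words_def)
  then show ?thesis by (auto simp: words_def)
qed

lemma words_1: "words I (Suc 0) = (\<lambda>i. [i]) ` I"
proof -
  have "w \<in> (\<lambda>i. [i]) ` I" if "w \<in> words I (Suc 0)" for w
    using that by (cases w) (auto simp: words_def)
  then show ?thesis by (auto simp: words_def)
qed

lemma sum_words_1: "(\<Sum>w\<in>words I (Suc 0). f w) = (\<Sum>i\<in>I. f [i])"
  unfolding words_1 by (subst sum.reindex) (auto simp: inj_on_def)

lemma sum_words_snoc:
  "(\<Sum>w\<in>words I (Suc n). f w) = (\<Sum>w\<in>words I n. \<Sum>i\<in>I. f (w @ [i]))"
  using sum_words_append[of f I n 1] by (simp add: sum_words_1)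

lemma sum_words_Cons:
  "(\<Sum>w\<in>words I (Suc n). f w) = (\<Sum>i\<in>I. \<Sum>w\<in>words I n. f (i # w))"
  using sum_words_append[of f I 1 n] by (simp add: sum_words_1)

lemma words_snocE:
  assumes "w \<in> words I (Suc n)"
  obtains u i where "u \<in> words I n" "i \<in> I" "w = u @ [i]"
  using assms by (cases w rule: rev_cases) (auto simp: words_def)

lemma words_snoc: "u \<in> words I n \<Longrightarrow> i \<in> I \<Longrightarrow> u @ [i] \<in> words I (Suc n)"
  by (auto simp: words_def)

lemma words_appendE:
  assumes "w \<in> words I (m + n)"
  obtains u v where "u \<in> words I m" "v \<in> words I n" "w = u @ v"
proof -
  have "w \<in> (\<lambda>(u, v). u @ v) ` (words I m \<times> words I n)"
    using assms bij_words_append[of I m n] by (simp add: bij_betw_def)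
  then show ?thesis using that by auto
qed

lemma cross_cells_bounds:
  assumes "c \<in> cross_cells lr ul"
  shows "\<bar>fst c\<bar> \<le> 4" "\<bar>snd c\<bar> \<le> 4" "even (fst c + snd c)"
  using assms by (auto simp: cross_cells_def split: if_splits)

context
  fixes I :: "cell set" and lr ul :: bool
  assumes I: "I = cross_cells lr ul"
begin

lemma word_index_bound:
  assumes "w \<in> words I n"
  shows "2 * \<bar>fst (word_index w)\<bar> + 1 \<le> 9 ^ n" "2 * \<bar>snd (word_index w)\<bar> + 1 \<le> 9 ^ n"
proof -
  have "2 * \<bar>fst (word_index w)\<bar> + 1 \<le> 9 ^ length w \<and> 2 * \<bar>snd (word_index w)\<bar> + 1 \<le> 9 ^ length w"
    if "set w \<subseteq> I" using that
  proof (induction w)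
    case (Cons c w)
    have c: "\<bar>fst c\<bar> \<le> 4" "\<bar>snd c\<bar> \<le> 4"
      using cross_cells_bounds[of c lr ul] Cons.prems I by auto
    have 1: "\<bar>9 ^ length w * fst c\<bar> \<le> 9 ^ length w * 4" "\<bar>9 ^ length w * snd c\<bar> \<le> 9 ^ length w * 4"
      using c by (simp_all add: abs_mult)
    have 2: "2 * \<bar>fst (word_index w)\<bar> + 1 \<le> 9 ^ length w" "2 * \<bar>snd (word_index w)\<bar> + 1 \<le> 9 ^ length w"
      using Cons by auto
    have "\<bar>fst (word_index w) + 9 ^ length w * fst c\<bar> \<le> \<bar>fst (word_index w)\<bar> + \<bar>9 ^ length w * fst c\<bar>"
      "\<bar>snd (word_index w) + 9 ^ length w * snd c\<bar> \<le> \<bar>snd (word_index w)\<bar> + \<bar>9 ^ length w * snd c\<bar>"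
      by (rule abs_triangle_ineq)+
    with 1 2 show ?case by simp
  qed auto
  then show "2 * \<bar>fst (word_index w)\<bar> + 1 \<le> 9 ^ n" "2 * \<bar>snd (word_index w)\<bar> + 1 \<le> 9 ^ n"
    using assms by (auto simp: words_def)
qed

text \<open>The leading digit of an expansion in base 9 with digits \<open>-4, \<dots>, 4\<close> is unique, since the remaining
  digits contribute less than half a unit of the next place.\<close>

lemma grid_digit_unique:
  fixes a b c d N :: int
  assumes "a + N * c = b + N * d" "2 * \<bar>a\<bar> + 1 \<le> N" "2 * \<bar>b\<bar> + 1 \<le> N"
  shows "c = d"
proof (rule ccontr)
  assume "c \<noteq> d"
  then have "1 \<le> \<bar>c - d\<bar>" by linarith
  then have "N * 1 \<le> N * \<bar>c - d\<bar>" using assms(2) by (intro mult_left_mono) auto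
  also have "N * \<bar>c - d\<bar> = \<bar>N * (c - d)\<bar>" using assms(2) by (simp add: abs_mult)
  also have "N * (c - d) = b - a" using assms(1) by (simp add: algebra_simps)
  finally show False using assms(2,3) by linarith
qed

lemma word_index_inj:
  assumes "v \<in> words I n" "w \<in> words I n" "word_index v = word_index w"
  shows "v = w"
  using assms
proof (induction n arbitrary: v w)
  case (Suc n)
  obtain c v' where v: "v = c # v'" "v' \<in> words I n" using Suc.prems(1) by (cases v) (auto simp: words_def)
  obtain d w' where w: "w = d # w'" "w' \<in> words I n" using Suc.prems(2) by (cases w) (auto simp: words_def)
  have e: "fst (word_index v') + 9 ^ n * fst c = fst (word_index w') + 9 ^ n * fst d"
      "snd (word_index v') + 9 ^ n * snd c = snd (word_index w') + 9 ^ n * snd d"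
    using Suc.prems(3) v w by (auto simp: words_def)
  have "fst c = fst d" "snd c = snd d"
    using grid_digit_unique[OF e(1)] grid_digit_unique[OF e(2)]
      word_index_bound[OF v(2)] word_index_bound[OF w(2)] by auto
  with e Suc.IH[OF v(2) w(2)] v w show ?case by (auto simp: prod_eq_iff)
qed auto

text \<open>All selected sub-squares lie on the sublattice of even \<open>i + j\<close>, so the same is true on every level.
  Two distinct cells that touch are therefore diagonal neighbours and meet in a single vertex.\<close>

lemma word_index_even:
  assumes "w \<in> words I n"
  shows "even (fst (word_index w) + snd (word_index w))"
proof -
  have "even (fst (word_index w) + snd (word_index w))" if "set w \<subseteq> I" using that
  proof (induction w)
    case (Cons c w)
    have "even (fst c + snd c)" using cross_cells_bounds[of c lr ul] Cons.prems I by auto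
    then have "even ((fst (word_index w) + snd (word_index w)) + 9 ^ length w * (fst c + snd c))"
      using Cons by auto
    then show ?case by (simp add: algebra_simps)
  qed auto
  then show ?thesis using assms by (auto simp: words_def)
qed

end

definition unit_square :: "point set" where
  "unit_square = {x. \<bar>fst x\<bar> \<le> 1/2 \<and> \<bar>snd x\<bar> \<le> 1/2}"

definition neighbours :: "cell list \<Rightarrow> cell list \<Rightarrow> bool" where
  "neighbours v w \<longleftrightarrow> \<bar>fst (word_index v) - fst (word_index w)\<bar> \<le> 1 \<and>
                     \<bar>snd (word_index v) - snd (word_index w)\<bar> \<le> 1"

lemma neighbours_refl [simp]: "neighbours w w" by (simp add: neighbours_def)

lemma neighbours_sym: "neighbours v w \<longleftrightarrow> neighbours w v" by (auto simp: neighbours_def)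

lemma corners_iff: "p \<in> corners \<longleftrightarrow> \<bar>fst p\<bar> = 1/2 \<and> \<bar>snd p\<bar> = 1/2"
  by (cases p) (auto simp: corners_def abs_if split: if_splits)

lemma corners_subset_square: "corners \<subseteq> unit_square"
  by (auto simp: corners_iff unit_square_def)

lemma finite_corners [simp]: "finite corners" by (simp add: corners_def)

lemma close_cells_are_neighbours:
  assumes "length v = n" "length w = n" "x \<in> unit_square" "y \<in> unit_square"
    and "dist (word_map v x) (word_map w y) < 1 / 9 ^ n"
  shows "neighbours v w"
proof -
  have *: "\<bar>i - j\<bar> \<le> 1"
    if "\<bar>(s + of_int i) / 9 ^ n - (t + of_int j) / 9 ^ n\<bar> < 1 / 9 ^ n" "\<bar>s\<bar> \<le> 1/2" "\<bar>t\<bar> \<le> 1/2"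
    for s t :: real and i j :: int
  proof -
    have "\<bar>(s + of_int i) - (t + of_int j)\<bar> / 9 ^ n < 1 / 9 ^ n"
      using that(1) by (simp add: diff_divide_distrib[symmetric])
    then have "\<bar>(s + of_int i) - (t + of_int j)\<bar> < 1" by (simp add: divide_less_cancel)
    then have "of_int \<bar>i - j\<bar> < (2::real)" using that(2,3) by linarith
    then show ?thesis by linarith
  qed
  have "\<bar>fst (word_map v x) - fst (word_map w y)\<bar> < 1 / 9 ^ n"
       "\<bar>snd (word_map v x) - snd (word_map w y)\<bar> < 1 / 9 ^ n"
    using assms(5) dist_fst_le[of "word_map v x" "word_map w y"] dist_snd_le[of "word_map v x" "word_map w y"]
    by (auto simp: dist_real_def)
  then show ?thesis unfolding neighbours_def using assms(1-4)
    by (auto simp: word_map_eq unit_square_def intro!: *)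
qed

lemma neighbour_index_cases:
  assumes I: "I = cross_cells lr ul" and v: "v \<in> words I n" and w: "w \<in> words I n" and "neighbours v w"
  shows "v = w \<or> (\<bar>fst (word_index v) - fst (word_index w)\<bar> = 1 \<and>
                   \<bar>snd (word_index v) - snd (word_index w)\<bar> = 1)"
proof -
  obtain i j k l where ij: "word_index v = (i, j)" "word_index w = (k, l)" by fastforce
  have "even (i + j)" "even (k + l)" using word_index_even[OF I v] word_index_even[OF I w] ij by auto
  moreover have "\<bar>i - k\<bar> \<le> 1" "\<bar>j - l\<bar> \<le> 1" using assms(4) ij by (auto simp: neighbours_def)
  ultimately have "(i = k \<and> j = l) \<or> (\<bar>i - k\<bar> = 1 \<and> \<bar>j - l\<bar> = 1)" by presburger
  then show ?thesis using word_index_inj[OF I v w] ij by auto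
qed

lemma neighbours_share_vertex:
  assumes I: "I = cross_cells lr ul" and v: "v \<in> words I n" and w: "w \<in> words I n" and "neighbours v w"
  obtains p q where "p \<in> corners" "q \<in> corners" "word_map v p = word_map w q"
proof (cases "v = w")
  case True
  then show ?thesis using that[of "(1/2,1/2)" "(1/2,1/2)"] by (auto simp: corners_iff)
next
  case False
  let ?d = "fst (word_index w) - fst (word_index v)" and ?e = "snd (word_index w) - snd (word_index v)"
  have "\<bar>?d\<bar> = 1" "\<bar>?e\<bar> = 1" using neighbour_index_cases[OF assms] False by auto
  then have de: "\<bar>real_of_int ?d\<bar> = 1" "\<bar>real_of_int ?e\<bar> = 1" by linarith+
  show ?thesis
    by (rule that[of "(of_int ?d / 2, of_int ?e / 2)" "(- of_int ?d / 2, - of_int ?e / 2)"])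
       (use de length_words[OF v] length_words[OF w] in \<open>auto simp: corners_iff word_map_eq field_simps\<close>)
qed

lemma cells_overlap_at_corners:
  assumes I: "I = cross_cells lr ul" and v: "v \<in> words I n" and w: "w \<in> words I n" and "v \<noteq> w"
    and "x \<in> unit_square" "y \<in> unit_square" "word_map v x = word_map w y"
  shows "x \<in> corners"
proof -
  have "neighbours v w"
    using close_cells_are_neighbours[of v n w x y] assms length_words[OF v] length_words[OF w] by auto
  then have "\<bar>fst (word_index v) - fst (word_index w)\<bar> = 1" "\<bar>snd (word_index v) - snd (word_index w)\<bar> = 1"
    using neighbour_index_cases[OF I v w] \<open>v \<noteq> w\<close> by auto
  moreover have "fst x + of_int (fst (word_index v)) = fst y + of_int (fst (word_index w))"
    "snd x + of_int (snd (word_index v)) = snd y + of_int (snd (word_index w))"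
    using assms(7) length_words[OF v] length_words[OF w] by (auto simp: word_map_eq)
  ultimately show ?thesis using assms(5,6) by (auto simp: unit_square_def corners_iff abs_if split: if_splits)
qed

lemma card_neighbours:
  assumes I: "I = cross_cells lr ul" and w: "w \<in> words I n"
  shows "card {v \<in> words I n. neighbours v w} \<le> 9"
proof -
  let ?B = "{fst (word_index w) - 1..fst (word_index w) + 1} \<times> {snd (word_index w) - 1..snd (word_index w) + 1}"
  have "card {v \<in> words I n. neighbours v w} \<le> card ?B"
  proof (rule card_inj_on_le)
    show "inj_on word_index {v \<in> words I n. neighbours v w}"
      using word_index_inj[OF I] by (auto simp: inj_on_def)
    have "fst (word_index w) - 1 \<le> fst (word_index v)" "fst (word_index v) \<le> fst (word_index w) + 1"
      "snd (word_index w) - 1 \<le> snd (word_index v)" "snd (word_index v) \<le> snd (word_index w) + 1"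
      if "neighbours v w" for v
      using that unfolding neighbours_def by linarith+
    then show "word_index ` {v \<in> words I n. neighbours v w} \<subseteq> ?B"
      by (intro image_subsetI) (simp add: mem_Times_iff)
  qed simp
  also have "card ?B = 9" by simp
  finally show ?thesis .
qed

section \<open>The attractor\<close>

lemma vertices_eq: "vertices I n = (\<Union>w\<in>words I n. word_map w ` corners)"
proof (induction n)
  case (Suc n)
  then show ?case by (simp add: words_Suc image_UN image_image) blast
qed simp

locale eyebolted_cross =
  fixes I :: "cell set" and lr ul :: bool and K :: "point set"
  assumes I: "I = cross_cells lr ul"
    and compact_K: "compact K" and K_ne: "K \<noteq> {}" and K_eq: "K = (\<Union>i\<in>I. cell_map i ` K)"
begin

lemma finite_I [simp]: "finite I" by (simp add: I)
lemma card_I: "card I = 21" by (simp add: I card_cross_cells)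
lemma card_words_I: "card (words I n) = 21 ^ n" by (simp add: card_words card_I)

lemma K_cells: "K = (\<Union>w\<in>words I n. word_map w ` K)"
proof (induction n)
  case (Suc n)
  have "K = (\<Union>i\<in>I. cell_map i ` (\<Union>w\<in>words I n. word_map w ` K))"
    using K_eq Suc by simp
  also have "\<dots> = (\<Union>w\<in>words I (Suc n). word_map w ` K)"
    by (simp add: words_Suc image_UN image_image) blast
  finally show ?case .
qed auto

lemma K_cellE:
  assumes "x \<in> K"
  obtains w y where "w \<in> words I n" "y \<in> K" "x = word_map w y"
  using assms K_cells[of n] by blast

lemma word_map_in_K: "w \<in> words I n \<Longrightarrow> x \<in> K \<Longrightarrow> word_map w x \<in> K"
  using K_cells[of n] by blast

lemma K_subset_square: "K \<subseteq> unit_square"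
proof -
  have *: "\<bar>h x\<bar> \<le> 1/2" if cont: "continuous_on K h"
    and h: "\<And>c y. h (cell_map c y) = h y / 9 + of_int (g c) / 9"
    and g: "\<And>c. c \<in> I \<Longrightarrow> \<bar>g c\<bar> \<le> 4" and x: "x \<in> K"
    for h :: "point \<Rightarrow> real" and g :: "cell \<Rightarrow> int" and x
  proof -
    \<comment> \<open>Where \<open>\<bar>h\<bar>\<close> is maximal on \<open>K\<close>, self-similarity gives \<open>\<bar>h\<bar> \<le> \<bar>h\<bar> / 9 + 4 / 9\<close>.\<close>
    obtain m where m: "m \<in> K" "\<And>y. y \<in> K \<Longrightarrow> \<bar>h y\<bar> \<le> \<bar>h m\<bar>"
      using continuous_attains_sup[OF compact_K K_ne continuous_on_rabs[OF cont]] by blast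
    obtain c y where cy: "c \<in> I" "y \<in> K" "m = cell_map c y" using m(1) K_eq by blast
    have "\<bar>h m\<bar> \<le> \<bar>h y\<bar> / 9 + of_int \<bar>g c\<bar> / 9" using h[of c y] cy(3) by (simp add: abs_triangle_ineq)
    also have "\<dots> \<le> \<bar>h m\<bar> / 9 + 4 / 9" using m(2)[OF cy(2)] g[OF cy(1)] by linarith
    finally have "\<bar>h m\<bar> \<le> 1/2" by simp
    then show ?thesis using m(2)[OF x] by simp
  qed
  have b: "\<bar>fst c\<bar> \<le> 4" "\<bar>snd c\<bar> \<le> 4" if "c \<in> I" for c
    using cross_cells_bounds[of c lr ul] that I by auto
  have c: "continuous_on K fst" "continuous_on K snd"
    by (rule continuous_on_fst[OF continuous_on_id], rule continuous_on_snd[OF continuous_on_id])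
  have "\<bar>fst x\<bar> \<le> 1/2" if "x \<in> K" for x
  proof (rule *[where h=fst and g=fst])
    show "fst (cell_map c y) = fst y / 9 + of_int (fst c) / 9" for c y
      by (simp add: cell_map_def)
  qed (fact c(1), fact b(1), fact that)
  moreover have "\<bar>snd x\<bar> \<le> 1/2" if "x \<in> K" for x
  proof (rule *[where h=snd and g=snd])
    show "snd (cell_map c y) = snd y / 9 + of_int (snd c) / 9" for c y
      by (simp add: cell_map_def)
  qed (fact c(2), fact b(2), fact that)
  ultimately show ?thesis by (auto simp: unit_square_def)
qed

lemma K_diameter: "x \<in> K \<Longrightarrow> y \<in> K \<Longrightarrow> dist x y \<le> 3/2"
proof -
  assume "x \<in> K" "y \<in> K"
  then have "x \<in> unit_square" "y \<in> unit_square" using K_subset_square by auto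
  then have "\<bar>fst x - fst y\<bar> \<le> 1" "\<bar>snd x - snd y\<bar> \<le> 1" by (auto simp: unit_square_def)
  then have "(fst x - fst y)\<^sup>2 \<le> 1" "(snd x - snd y)\<^sup>2 \<le> 1" by (auto simp: abs_square_le_1)
  then have "sqrt ((fst x - fst y)\<^sup>2 + (snd x - snd y)\<^sup>2) \<le> sqrt ((3/2)\<^sup>2)"
    by (intro real_sqrt_le_mono) (simp add: power2_eq_square)
  then show ?thesis by (simp add: dist_prod_def dist_real_def)
qed

lemma cell_diameter:
  assumes "x \<in> word_map w ` K" "y \<in> word_map w ` K" "w \<in> words I n"
  shows "dist x y \<le> 3/2 / 9 ^ n"
proof -
  obtain a b where "a \<in> K" "x = word_map w a" "b \<in> K" "y = word_map w b" using assms by blast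
  then show ?thesis using K_diameter[of a b] length_words[OF assms(3)]
    by (simp add: dist_word_map) (simp add: field_simps)
qed

lemma corner_fixed:
  assumes "p \<in> corners"
  obtains c where "c \<in> I" "cell_map c p = p"
proof -
  have *: "(4,4) \<in> I" "(-4,-4) \<in> I" "(4,-4) \<in> I" "(-4,4) \<in> I"
    unfolding I cross_cells_def by auto
  have "\<exists>c\<in>I. cell_map c p = p"
    using assms unfolding corners_def
    by (auto simp: cell_map_def) (use * in \<open>force+\<close>)
  then show ?thesis using that by blast
qed

text \<open>A corner is the limit of the iterates, on any point of \<open>K\<close>, of the contraction that fixes it.\<close>

lemma corners_in_K: "corners \<subseteq> K"
proof
  fix p assume "p \<in> corners"
  then obtain c where c: "c \<in> I" "cell_map c p = p" using corner_fixed by blast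
  obtain x where x: "x \<in> K" using K_ne by blast
  define f where "f n = word_map (replicate n c) x" for n
  have w: "replicate n c \<in> words I n" for n using c by (auto simp: words_def)
  have fp: "word_map (replicate n c) p = p" for n by (induction n) (auto simp: c)
  have "dist (f n) p = dist x p / 9 ^ n" for n
    using dist_word_map[of "replicate n c" x p] by (simp add: f_def fp)
  moreover have "(\<lambda>n. dist x p / 9 ^ n) \<longlonglongrightarrow> 0"
    using LIMSEQ_divide_realpow_zero[of 9 "dist x p"] by simp
  ultimately have "f \<longlonglongrightarrow> p" by (subst tendsto_dist_iff) simp
  moreover have "f n \<in> K" for n using word_map_in_K[OF w x] by (simp add: f_def)
  ultimately show "p \<in> K" using compact_imp_closed[OF compact_K] closed_sequentially by blast
qed

lemma corners_in_square: "p \<in> corners \<Longrightarrow> p \<in> unit_square"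
  using corners_subset_square by auto

definition all_vertices :: "point set" where
  "all_vertices = (\<Union>n. vertices I n)"

lemma vertex_in_K: "w \<in> words I n \<Longrightarrow> p \<in> corners \<Longrightarrow> word_map w p \<in> K"
  using word_map_in_K corners_in_K by blast

lemma all_vertices_in_K: "all_vertices \<subseteq> K"
  using vertex_in_K by (auto simp: all_vertices_def vertices_eq)

lemma vertices_Suc_mono: "vertices I n \<subseteq> vertices I (Suc n)"
proof
  fix x assume "x \<in> vertices I n"
  then obtain w p where w: "w \<in> words I n" "p \<in> corners" "x = word_map w p" by (auto simp: vertices_eq)
  obtain c where c: "c \<in> I" "cell_map c p = p" using corner_fixed[OF w(2)] by blast
  have "x = word_map (w @ [c]) p" using w c by (simp add: word_map_append)
  then show "x \<in> vertices I (Suc n)" unfolding vertices_eq using w c words_snoc by blast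
qed

lemma vertices_mono: "m \<le> n \<Longrightarrow> vertices I m \<subseteq> vertices I n"
  by (rule lift_Suc_mono_le[of "vertices I"]) (use vertices_Suc_mono in auto)

lemma all_vertices_dense: "closure all_vertices = K"
proof
  show "closure all_vertices \<subseteq> K"
    using all_vertices_in_K compact_imp_closed[OF compact_K] by (rule closure_minimal)
  show "K \<subseteq> closure all_vertices"
  proof
    fix x assume x: "x \<in> K"
    show "x \<in> closure all_vertices" unfolding closure_approachable
    proof (intro allI impI)
      fix e :: real assume "e > 0"
      have "(\<lambda>n. (3/2) / 9 ^ n :: real) \<longlonglongrightarrow> 0"
        by (rule LIMSEQ_divide_realpow_zero) simp
      then obtain n where n: "(3/2) / 9 ^ n < e"
        using \<open>e > 0\<close> by (metis (mono_tags, lifting) order_tendstoD(2) eventually_sequentially le_refl)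
      obtain w y where w: "w \<in> words I n" "y \<in> K" "x = word_map w y" using K_cellE[OF x] by blast
      let ?p = "(1/2,1/2) :: point"
      have p: "?p \<in> corners" by (simp add: corners_iff)
      have "dist (word_map w ?p) x \<le> 3/2 / 9 ^ n"
        using cell_diameter[of "word_map w ?p" w x n] w p corners_in_K by blast
      moreover have "word_map w ?p \<in> all_vertices"
        using w p by (auto simp: all_vertices_def vertices_eq)
      ultimately show "\<exists>y\<in>all_vertices. dist y x < e" using n by force
    qed
  qed
qed

end

section \<open>Hausdorff measure is a Borel measure\<close>

lemma diameter_leI:
  assumes "\<And>x y. x \<in> S \<Longrightarrow> y \<in> S \<Longrightarrow> dist x y \<le> d" "0 \<le> d"
  shows "diameter S \<le> d"
  using assms by (auto simp: diameter_def intro!: cSUP_least)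

lemma hausdorff_content_le:
  assumes "A \<subseteq> (\<Union>i. U i)" "\<And>i. bounded (U i)" "\<And>i. diameter (U i) \<le> \<delta>"
  shows "hausdorff_content s \<delta> A \<le> (\<Sum>i. ennreal (diameter (U i) powr s))"
  unfolding hausdorff_content_def by (rule INF_lower) (use assms in auto)

lemma hausdorff_content_greatest:
  assumes "\<And>U. A \<subseteq> (\<Union>i::nat. U i) \<Longrightarrow> (\<And>i. bounded (U i)) \<Longrightarrow> (\<And>i. diameter (U i) \<le> \<delta>) \<Longrightarrow>
    x \<le> (\<Sum>i. ennreal (diameter (U i) powr s))"
  shows "x \<le> hausdorff_content s \<delta> A"
  unfolding hausdorff_content_def by (rule INF_greatest) (use assms in auto)

lemma hausdorff_content_mono:
  assumes "A \<subseteq> B" "\<delta>' \<le> \<delta>"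
  shows "hausdorff_content s \<delta> A \<le> hausdorff_content s \<delta>' B"
proof (rule hausdorff_content_greatest)
  fix U assume U: "B \<subseteq> (\<Union>i::nat. U i)" "\<And>i. bounded (U i)" "\<And>i. diameter (U i) \<le> \<delta>'"
  then show "hausdorff_content s \<delta> A \<le> (\<Sum>i. ennreal (diameter (U i) powr s))"
    using assms order_trans[OF U(3) assms(2)] by (intro hausdorff_content_le) auto
qed

lemma hausdorff_content_empty: "0 \<le> \<delta> \<Longrightarrow> hausdorff_content s \<delta> {} = 0"
  using hausdorff_content_le[of "{}" "\<lambda>_. {}" \<delta> s] by simp

text \<open>Nearly optimal covers of the \<open>A i\<close>, with errors \<open>e / 2 ^ Suc i\<close>, are combined into one sequence.\<close>

lemma hausdorff_content_subadditive:
  "hausdorff_content s \<delta> (\<Union>i. A i) \<le> (\<Sum>i. hausdorff_content s \<delta> (A i))"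
proof (rule ennreal_le_epsilon)
  let ?O = "hausdorff_content s \<delta>"
  fix e :: real assume "0 < e" and "(\<Sum>n. ?O (A n)) < top"
  then have *: "?O (A n) < ?O (A n) + e * (1/2)^Suc n" for n
    by (auto simp add: less_top dest!: ennreal_suminf_lessD)
  have "\<exists>B. A n \<subseteq> (\<Union>i::nat. B i) \<and> (\<forall>i. bounded (B i) \<and> diameter (B i) \<le> \<delta>) \<and>
     (\<Sum>i. ennreal (diameter (B i) powr s)) \<le> ?O (A n) + e * (1/2)^(Suc n)" for n
  proof (rule ccontr)
    assume "\<not> ?thesis"
    then have "?O (A n) + e * (1/2)^(Suc n) \<le> ?O (A n)"
      by (intro hausdorff_content_greatest) (meson linear)
    with *[of n] show False by simp
  qed
  then obtain B where sbB: "\<And>n. A n \<subseteq> (\<Union>i::nat. B n i)"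
      and B: "\<And>n i. bounded (B n i)" "\<And>n i. diameter (B n i) \<le> \<delta>"
      and Ble: "\<And>n. (\<Sum>i. ennreal (diameter (B n i) powr s)) \<le> ?O (A n) + e * (1/2)^(Suc n)"
    by metis
  define C where "C = case_prod B o prod_decode"
  have A_C: "(\<Union>i. A i) \<subseteq> (\<Union>i. C i)"
    using sbB by (auto simp add: C_def subset_eq) (metis prod.case prod_encode_inverse)
  have "?O (\<Union>i. A i) \<le> (\<Sum>i. ennreal (diameter (C i) powr s))"
    using A_C by (rule hausdorff_content_le) (auto simp: C_def B split: prod.splits)
  also have "\<dots> = (\<Sum>n. \<Sum>i. ennreal (diameter (B n i) powr s))"
  proof -
    have "(\<Sum>i. (\<lambda>(n, i). ennreal (diameter (B n i) powr s)) (prod_decode i)) =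
      (\<Sum>n. \<Sum>i. ennreal (diameter (B n i) powr s))"
      by (rule suminf_ennreal_2dimen) simp
    then show ?thesis by (simp only: C_def comp_def case_prod_beta)
  qed
  also have "\<dots> \<le> (\<Sum>n. ?O (A n) + e * (1/2) ^ Suc n)"
    by (intro suminf_le suminf_nonneg allI Ble) auto
  also have "... = (\<Sum>n. ?O (A n)) + (\<Sum>n. ennreal e * ennreal ((1/2) ^ Suc n))"
    using \<open>0 < e\<close> by (subst suminf_add[symmetric])
                     (auto simp del: ennreal_suminf_cmult simp add: ennreal_mult[symmetric])
  also have "\<dots> = (\<Sum>n. ?O (A n)) + e"
    unfolding ennreal_suminf_cmult
    by (subst suminf_ennreal_eq[OF zero_le_power power_half_series]) auto
  finally show "?O (\<Union>i. A i) \<le> (\<Sum>n. ?O (A n)) + e" .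
qed

lemma hausdorff_content_le_outer: "0 < \<delta> \<Longrightarrow> hausdorff_content s \<delta> A \<le> hausdorff_outer s A"
  unfolding hausdorff_outer_def by (rule SUP_upper) auto

lemma hausdorff_outer_mono: "A \<subseteq> B \<Longrightarrow> hausdorff_outer s A \<le> hausdorff_outer s B"
  unfolding hausdorff_outer_def by (rule SUP_mono) (auto intro: hausdorff_content_mono)

lemma hausdorff_outer_empty [simp]: "hausdorff_outer s {} = 0"
  unfolding hausdorff_outer_def by (simp add: hausdorff_content_empty)

lemma hausdorff_outer_subadditive:
  "hausdorff_outer s (\<Union>i. A i) \<le> (\<Sum>i. hausdorff_outer s (A i))"
  unfolding hausdorff_outer_def[of s "\<Union>i. A i"]
proof (rule SUP_least)
  fix \<delta> :: real assume "\<delta> \<in> {0<..}"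
  then show "hausdorff_content s \<delta> (\<Union>i. A i) \<le> (\<Sum>i. hausdorff_outer s (A i))"
    by (intro order_trans[OF hausdorff_content_subadditive] suminf_le hausdorff_content_le_outer) auto
qed

lemma hausdorff_outer_Un: "hausdorff_outer s (A \<union> B) \<le> hausdorff_outer s A + hausdorff_outer s B"
proof -
  have "hausdorff_outer s (\<Union>i. (\<lambda>i::nat. if i = 0 then A else if i = 1 then B else {}) i) \<le>
    (\<Sum>i. hausdorff_outer s ((\<lambda>i::nat. if i = 0 then A else if i = 1 then B else {}) i))"
    by (rule hausdorff_outer_subadditive)
  also have "(\<Sum>i. hausdorff_outer s ((\<lambda>i::nat. if i = 0 then A else if i = 1 then B else {}) i)) =
    (\<Sum>i\<in>{0,1}. hausdorff_outer s ((\<lambda>i::nat. if i = 0 then A else if i = 1 then B else {}) i))"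
    by (rule suminf_finite) auto
  also have "(\<Union>i. (\<lambda>i::nat. if i = 0 then A else if i = 1 then B else {}) i) = A \<union> B"
    by (auto split: if_splits)
  finally show ?thesis by simp
qed

lemma outer_measure_space_hausdorff: "outer_measure_space (Pow UNIV) (hausdorff_outer s)"
  unfolding outer_measure_space_def
  by (auto simp: positive_def increasing_def countably_subadditive_def hausdorff_outer_mono
        hausdorff_outer_subadditive)

text \<open>Sets at positive distance are never met by the same small set of a cover.\<close>

lemma hausdorff_outer_separated:
  fixes A B :: "'a::metric_space set"
  assumes "0 < e" and sep: "\<And>x y. x \<in> A \<Longrightarrow> y \<in> B \<Longrightarrow> e \<le> dist x y"
  shows "hausdorff_outer s A + hausdorff_outer s B \<le> hausdorff_outer s (A \<union> B)"
proof -
  let ?c = "hausdorff_content s"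
  have small: "?c \<delta> A + ?c \<delta> B \<le> ?c \<delta> (A \<union> B)" if "0 < \<delta>" "\<delta> < e" for \<delta>
  proof (rule hausdorff_content_greatest)
    fix U assume U: "A \<union> B \<subseteq> (\<Union>i::nat. U i)" "\<And>i. bounded (U i)" "\<And>i. diameter (U i) \<le> \<delta>"
    define V where "V C i = (if U i \<inter> C = {} then {} else U i)" for C i
    have V: "?c \<delta> C \<le> (\<Sum>i. ennreal (diameter (V C i) powr s))" if "C \<subseteq> A \<union> B" for C
    proof (rule hausdorff_content_le)
      have "C \<subseteq> (\<Union>i. U i)" using that U(1) by blast
      then show "C \<subseteq> (\<Union>i. V C i)" by (fastforce simp: V_def)
    qed (use U \<open>0 < \<delta>\<close> in \<open>auto simp: V_def\<close>)
    have one: "ennreal (diameter (V A i) powr s) + ennreal (diameter (V B i) powr s)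
       \<le> ennreal (diameter (U i) powr s)" for i
    proof (cases "U i \<inter> A = {} \<or> U i \<inter> B = {}")
      case False
      then obtain x y where xy: "x \<in> U i" "x \<in> A" "y \<in> U i" "y \<in> B" by blast
      then have "dist x y < e"
        using diameter_bounded_bound[OF U(2) xy(1,3)] U(3)[of i] \<open>\<delta> < e\<close> by linarith
      with sep[OF xy(2,4)] show ?thesis by simp
    qed (auto simp: V_def)
    have "?c \<delta> A + ?c \<delta> B \<le> (\<Sum>i. ennreal (diameter (V A i) powr s)) + (\<Sum>i. ennreal (diameter (V B i) powr s))"
      by (intro add_mono V) auto
    also have "\<dots> = (\<Sum>i. ennreal (diameter (V A i) powr s) + ennreal (diameter (V B i) powr s))"
      by (rule suminf_add) auto
    also have "\<dots> \<le> (\<Sum>i. ennreal (diameter (U i) powr s))"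
      by (intro suminf_le one) auto
    finally show "?c \<delta> A + ?c \<delta> B \<le> (\<Sum>i. ennreal (diameter (U i) powr s))" .
  qed
  have "(SUP \<delta>\<in>{0<..}. ?c \<delta> A) + (SUP \<delta>\<in>{0<..}. ?c \<delta> B) = (SUP \<delta>\<in>{0<..}. ?c \<delta> A + ?c \<delta> B)"
  proof (rule SUP_add_directed_ennreal[symmetric])
    fix i j :: real assume "i \<in> {0<..}" "j \<in> {0<..}"
    then show "\<exists>k\<in>{0<..}. ?c i A + ?c j B \<le> ?c k A + ?c k B"
      by (intro bexI[of _ "min i j"]) (auto intro!: add_mono hausdorff_content_mono)
  qed
  also have "\<dots> \<le> hausdorff_outer s (A \<union> B)"
  proof (rule SUP_least)
    fix \<delta> :: real assume d: "\<delta> \<in> {0<..}"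
    let ?d = "min \<delta> (e/2)"
    have "?c \<delta> A + ?c \<delta> B \<le> ?c ?d A + ?c ?d B"
      by (auto intro!: add_mono hausdorff_content_mono)
    also have "\<dots> \<le> ?c ?d (A \<union> B)" using d \<open>0 < e\<close> by (intro small) auto
    also have "\<dots> \<le> hausdorff_outer s (A \<union> B)" using d \<open>0 < e\<close> by (intro hausdorff_content_le_outer) auto
    finally show "?c \<delta> A + ?c \<delta> B \<le> hausdorff_outer s (A \<union> B)" .
  qed
  finally show ?thesis by (simp add: hausdorff_outer_def)
qed

lemma ennreal_tail_tendsto_zero:
  fixes f :: "nat \<Rightarrow> ennreal"
  assumes "(\<Sum>i. f i) \<noteq> \<infinity>"
  shows "(\<lambda>n. \<Sum>i. f (i + n)) \<longlonglongrightarrow> 0"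
proof -
  have fin: "f i < top" for i
    using assms by (metis ennreal_suminf_lessD infinity_ennreal_def less_top)
  define g where "g i = enn2real (f i)" for i
  have fg: "f i = ennreal (g i)" for i using fin[of i] by (simp add: g_def less_top)
  have g0: "0 \<le> g i" for i by (simp add: g_def)
  have sm: "summable g"
    by (rule summable_suminf_not_top) (use g0 assms in \<open>auto simp: fg\<close>)
  have "(\<lambda>n. \<Sum>i. g (i + n)) = (\<lambda>n. suminf g - (\<Sum>i<n. g i))"
  proof
    show "(\<Sum>i. g (i + n)) = suminf g - (\<Sum>i<n. g i)" for n
      using suminf_split_initial_segment[OF sm, of n] by simp
  qed
  moreover have "(\<lambda>n. suminf g - (\<Sum>i<n. g i)) \<longlonglongrightarrow> suminf g - suminf g"
    by (intro tendsto_intros summable_LIMSEQ sm)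
  ultimately have "(\<lambda>n. \<Sum>i. g (i + n)) \<longlonglongrightarrow> 0" by simp
  moreover have "(\<Sum>i. f (i + n)) = ennreal (\<Sum>i. g (i + n))" for n
    unfolding fg by (rule suminf_ennreal2[OF g0 summable_ignore_initial_segment[OF sm]])
  ultimately show ?thesis
    using tendsto_ennrealI[of "\<lambda>n. \<Sum>i. g (i + n)" 0 sequentially] by (simp only: ennreal_0)
qed

text \<open>Caratheodory's criterion for metric outer measures: the part of \<open>X\<close> off the closed set \<open>F\<close>
  is exhausted by the sets of points at distance at least \<open>1/(n+1)\<close> from \<open>F\<close>, and the layers between
  consecutive ones, taken two apart, are at positive distance, so that their measures are summable.\<close>

lemma closed_in_lambda_system_hausdorff:
  fixes F :: "'a::metric_space set"
  assumes "closed F"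
  shows "F \<in> lambda_system UNIV (Pow UNIV) (hausdorff_outer s)"
proof -
  let ?H = "hausdorff_outer s"
  have ge: "?H (X \<inter> F) + ?H (X - F) \<le> ?H X" if ne: "F \<noteq> {}" for X
  proof (cases "?H X = \<infinity>")
    case False
    define A where "A n = {x \<in> X. 1 / real (Suc n) \<le> infdist x F}" for n
    define R where "R k = {x \<in> X. 1 / real (Suc (Suc k)) \<le> infdist x F \<and> infdist x F < 1 / real (Suc k)}" for k
    have RX: "R k \<subseteq> X" for k by (auto simp: R_def)
    have two: "?H (\<Union>k<N. R (2 * k + j)) \<ge> (\<Sum>k<N. ?H (R (2 * k + j)))" for N j
    proof (induction N)
      case (Suc N)
      let ?A = "\<Union>k<N. R (2 * k + j)" and ?B = "R (2 * N + j)"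
      have e: "0 < 1 / real (2 * N + j) - 1 / real (Suc (2 * N + j))" if "0 < N"
      proof -
        have "0 < real (2 * N + j)" using that by simp
        then show ?thesis by (simp del: of_nat_add of_nat_mult add: divide_strict_left_mono)
      qed
      have "?H ?A + ?H ?B \<le> ?H (?A \<union> ?B)"
      proof (cases "N = 0")
        case False
        show ?thesis
        proof (rule hausdorff_outer_separated[OF e])
          fix x y assume x: "x \<in> ?A" and y: "y \<in> ?B"
          obtain k where k: "k < N" "x \<in> R (2 * k + j)" using x by blast
          have "1 / real (2 * N + j) \<le> 1 / real (Suc (Suc (2 * k + j)))"
            using k by (intro divide_left_mono) auto
          also have "\<dots> \<le> infdist x F" using k by (auto simp: R_def)
          finally have "1 / real (2 * N + j) \<le> infdist x F" .
          moreover have "infdist y F < 1 / real (Suc (2 * N + j))" using y by (auto simp: R_def)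
          moreover have "infdist x F \<le> infdist y F + dist x y" by (rule infdist_triangle)
          ultimately show "1 / real (2 * N + j) - 1 / real (Suc (2 * N + j)) \<le> dist x y" by linarith
        qed (use False in auto)
      qed auto
      then have "(\<Sum>k<N. ?H (R (2 * k + j))) + ?H ?B \<le> ?H (?A \<union> ?B)"
        using add_right_mono[OF Suc, of "?H ?B"] by (rule order_trans[rotated])
      then show ?case by (simp add: lessThan_Suc Un_commute add.commute)
    qed simp
    have two': "(\<Sum>k<N. ?H (R (2 * k + j))) \<le> ?H X" for N j
      by (rule order_trans[OF two hausdorff_outer_mono]) (use RX in auto)
    have "(\<Sum>k<2 * N. ?H (R k)) \<le> ?H X + ?H X" for N
    proof -
      have "(\<Sum>k<2 * N. ?H (R k)) = (\<Sum>k<N. ?H (R (2 * k + 0))) + (\<Sum>k<N. ?H (R (2 * k + 1)))"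
        by (induction N) (auto simp: ac_simps)
      also have "\<dots> \<le> ?H X + ?H X" by (intro add_mono two')
      finally show ?thesis .
    qed
    then have "(\<Sum>k<N. ?H (R k)) \<le> ?H X + ?H X" for N
      using order_trans[OF sum_mono2[of "{..<2 * N}" "{..<N}" "\<lambda>k. ?H (R k)"]] by auto
    then have "(\<Sum>k. ?H (R k)) \<le> ?H X + ?H X" by (intro suminf_le_const summableI)
    then have "(\<Sum>k. ?H (R k)) \<noteq> \<infinity>" using False by (auto simp: top_unique)
    then have tail: "(\<lambda>n. \<Sum>k. ?H (R (k + n))) \<longlonglongrightarrow> 0" by (rule ennreal_tail_tendsto_zero)
    have bd: "?H (X \<inter> F) + ?H (X - F) \<le> ?H X + (\<Sum>k. ?H (R (k + n)))" for n
    proof -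
      have "X - F \<subseteq> A n \<union> (\<Union>k. R (k + n))"
      proof
        fix x assume x: "x \<in> X - F"
        then have pos: "0 < infdist x F"
          using ne assms infdist_pos_not_in_closed by blast
        show "x \<in> A n \<union> (\<Union>k. R (k + n))"
        proof (cases "1 / real (Suc n) \<le> infdist x F")
          case False
          obtain k0 where m0: "inverse (real (Suc k0)) < infdist x F" using reals_Archimedean[OF pos] by auto
          define m where "m = (LEAST m. 1 / real (Suc m) \<le> infdist x F)"
          have m1: "1 / real (Suc m) \<le> infdist x F" unfolding m_def
            by (rule LeastI[of _ k0]) (use m0 in \<open>simp add: inverse_eq_divide less_imp_le\<close>)
          have m2: "infdist x F < 1 / real (Suc k)" if "k < m" for k
            using not_less_Least[of k "\<lambda>m. 1 / real (Suc m) \<le> infdist x F"] that by (auto simp: m_def)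
          have "n < m"
          proof (rule ccontr)
            assume "\<not> n < m"
            then have "1 / real (Suc n) \<le> 1 / real (Suc m)" by (intro divide_left_mono) auto
            with m1 False show False by linarith
          qed
          then obtain k where k: "m = Suc (k + n)" by (metis add.commute less_iff_Suc_add add_Suc_right)
          have "x \<in> R (k + n)" using m1 m2[of "k + n"] x k by (auto simp: R_def)
          then show ?thesis by blast
        qed (use x in \<open>auto simp: A_def\<close>)
      qed
      then have "?H (X - F) \<le> ?H (A n \<union> (\<Union>k. R (k + n)))" by (rule hausdorff_outer_mono)
      also have "\<dots> \<le> ?H (A n) + (\<Sum>k. ?H (R (k + n)))"
        by (intro order_trans[OF hausdorff_outer_Un] add_left_mono hausdorff_outer_subadditive)
      finally have "?H (X \<inter> F) + ?H (X - F) \<le> (?H (X \<inter> F) + ?H (A n)) + (\<Sum>k. ?H (R (k + n)))"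
        by (simp add: add.assoc add_left_mono)
      also have "?H (X \<inter> F) + ?H (A n) \<le> ?H (X \<inter> F \<union> A n)"
      proof (rule hausdorff_outer_separated)
        fix x y assume "x \<in> X \<inter> F" "y \<in> A n"
        then have "1 / real (Suc n) \<le> infdist y F" "infdist y F \<le> dist y x"
          by (auto simp: A_def intro: infdist_le)
        then show "1 / real (Suc n) \<le> dist x y" by (simp add: dist_commute)
      qed simp
      also have "\<dots> \<le> ?H X" by (rule hausdorff_outer_mono) (auto simp: A_def)
      finally show ?thesis by (simp add: add_right_mono)
    qed
    have "(\<lambda>n. ?H X + (\<Sum>k. ?H (R (k + n)))) \<longlonglongrightarrow> ?H X + 0"
      by (intro tendsto_add tendsto_const tail)
    then have "?H (X \<inter> F) + ?H (X - F) \<le> ?H X + 0"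
      by (rule LIMSEQ_le_const) (use bd in blast)
    then show ?thesis by simp
  qed auto
  have ge': "?H (X \<inter> F) + ?H (X - F) \<le> ?H X" for X using ge[of X] by (cases "F = {}") auto
  have "?H (X \<inter> F) + ?H (X - F) = ?H X" for X
  proof (rule antisym[OF ge'])
    have "X = (X \<inter> F) \<union> (X - F)" by blast
    then show "?H X \<le> ?H (X \<inter> F) + ?H (X - F)" using hausdorff_outer_Un[of s "X \<inter> F" "X - F"] by simp
  qed
  then show ?thesis by (subst algebra.lambda_system_eq[OF algebra_Pow]) auto
qed

lemma measure_space_hausdorff:
  "measure_space UNIV (sets (borel :: 'a::metric_space measure)) (hausdorff_outer s)"
proof -
  let ?L = "lambda_system UNIV (Pow (UNIV :: 'a set)) (hausdorff_outer s)"
  have L: "measure_space UNIV ?L (hausdorff_outer s)"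
    using sigma_algebra.caratheodory_lemma[OF sigma_algebra_Pow outer_measure_space_hausdorff] .
  then have sa: "sigma_algebra UNIV ?L" by (simp add: measure_space_def)
  have "U \<in> ?L" if "open U" for U :: "'a set"
  proof -
    have "UNIV - (- U) \<in> ?L"
      using sigma_algebra.axioms(1)[OF sa] closed_in_lambda_system_hausdorff[of "- U" s] that
      by (intro algebra.compl_sets[OF sigma_algebra.axioms(1)[OF sa]]) auto
    then show ?thesis by (simp add: double_complement Compl_eq_Diff_UNIV[symmetric])
  qed
  then have "sets (borel :: 'a measure) \<subseteq> ?L"
    unfolding sets_borel by (intro sigma_algebra.sigma_sets_subset[OF sa]) auto
  then show ?thesis using measure_down[OF L] by (metis sets.sigma_algebra_axioms space_borel)
qed

lemma normalized_hausdorff_facts: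
  fixes K :: "'a::metric_space set"
  assumes "closed K"
  shows "space (normalized_hausdorff s K) = K"
    and "sets (normalized_hausdorff s K) = sets (restrict_space borel K)"
    and "A \<in> sets (restrict_space borel K) \<Longrightarrow>
      emeasure (normalized_hausdorff s K) A = hausdorff_outer s A / hausdorff_outer s K"
proof -
  let ?S = "sets (restrict_space borel K)" and ?f = "\<lambda>A. hausdorff_outer s A / hausdorff_outer s K"
  have S: "?S \<subseteq> Pow K" using sets.space_closed[of "restrict_space borel K"] by (simp add: space_restrict_space)
  have sig: "sigma_sets K ?S = ?S"
    using sets.sigma_sets_eq[of "restrict_space borel K"] by (simp add: space_restrict_space)
  show "space (normalized_hausdorff s K) = K" "sets (normalized_hausdorff s K) = ?S"
    by (simp_all add: normalized_hausdorff_def S sig)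
  assume A: "A \<in> ?S"
  have sub: "?S \<subseteq> sets borel"
    using assms by (auto simp: sets_restrict_space)
  have ca: "countably_additive ?S ?f"
  proof (rule countably_additiveI)
    fix B :: "nat \<Rightarrow> 'a set" assume B: "range B \<subseteq> ?S" "disjoint_family B" "\<Union>(range B) \<in> ?S"
    have "(\<Sum>i. hausdorff_outer s (B i)) = hausdorff_outer s (\<Union>i. B i)"
    proof -
      have "countably_additive (sets borel) (hausdorff_outer s :: 'a set \<Rightarrow> _)"
        using measure_space_hausdorff[of s] unfolding measure_space_def by blast
      then show ?thesis unfolding countably_additive_def using B sub by blast
    qed
    then show "(\<Sum>i. ?f (B i)) = ?f (\<Union>i. B i)" by (simp only: ennreal_suminf_divide)
  qed
  show "emeasure (normalized_hausdorff s K) A = ?f A"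
    unfolding normalized_hausdorff_def
    by (rule emeasure_measure_of_sigma)
       (use A ca sets.sigma_algebra_axioms[of "restrict_space borel K"]
         in \<open>auto simp: positive_def space_restrict_space\<close>)
qed

text \<open>The images of the members of a cover form a cover whose diameters are at most \<open>c\<close> times as large.\<close>

lemma hausdorff_outer_lipschitz_image:
  fixes f :: "'a::metric_space \<Rightarrow> 'b::metric_space"
  assumes c: "0 < c" and s: "0 < s"
    and lip: "\<And>x y. x \<in> A \<Longrightarrow> y \<in> A \<Longrightarrow> dist (f x) (f y) \<le> c * dist x y"
  shows "hausdorff_outer s (f ` A) * ennreal (c powr - s) \<le> hausdorff_outer s A"
proof -
  have inv: "ennreal (c powr s) * ennreal (c powr - s) = 1"
    using c by (simp add: ennreal_mult[symmetric] powr_add[symmetric])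
  have 1: "hausdorff_content s (c * \<delta>) (f ` A) * ennreal (c powr - s) \<le> hausdorff_content s \<delta> A" for \<delta>
  proof (rule hausdorff_content_greatest)
    fix U assume U: "A \<subseteq> (\<Union>i::nat. U i)" "\<And>i. bounded (U i)" "\<And>i. diameter (U i) \<le> \<delta>"
    have d: "dist x y \<le> c * diameter (U i)" if xy: "x \<in> f ` (U i \<inter> A)" "y \<in> f ` (U i \<inter> A)" for i x y
    proof -
      obtain a b where ab: "a \<in> U i" "a \<in> A" "x = f a" "b \<in> U i" "b \<in> A" "y = f b" using xy by blast
      have "dist x y \<le> c * dist a b" using lip ab by simp
      also have "\<dots> \<le> c * diameter (U i)"
        using c diameter_bounded_bound[OF U(2) ab(1,4)] by simp
      finally show ?thesis .
    qed
    have D: "diameter (f ` (U i \<inter> A)) \<le> c * diameter (U i)" for i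
      using c diameter_ge_0[OF U(2)] by (intro diameter_leI d) auto
    have bdd: "bounded (f ` (U i \<inter> A))" for i
      unfolding bounded_two_points using d by blast
    have "hausdorff_content s (c * \<delta>) (f ` A) \<le> (\<Sum>i. ennreal (diameter (f ` (U i \<inter> A)) powr s))"
    proof (rule hausdorff_content_le)
      show "f ` A \<subseteq> (\<Union>i. f ` (U i \<inter> A))" using U(1) by blast
      show "diameter (f ` (U i \<inter> A)) \<le> c * \<delta>" for i
        using D[of i] U(3)[of i] c by (meson mult_left_mono order_trans less_imp_le)
    qed (rule bdd)
    also have "\<dots> \<le> (\<Sum>i. ennreal (c powr s) * ennreal (diameter (U i) powr s))"
    proof (intro suminf_le allI summableI)
      fix i
      have "diameter (f ` (U i \<inter> A)) powr s \<le> (c * diameter (U i)) powr s"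
        using D[of i] diameter_ge_0[OF bdd] s by (intro powr_mono2) auto
      also have "\<dots> = c powr s * diameter (U i) powr s"
        using c diameter_ge_0[OF U(2)] by (simp add: powr_mult)
      finally show "ennreal (diameter (f ` (U i \<inter> A)) powr s) \<le> ennreal (c powr s) * ennreal (diameter (U i) powr s)"
        by (simp add: ennreal_mult[symmetric] ennreal_leI)
    qed
    also have "\<dots> = ennreal (c powr s) * (\<Sum>i. ennreal (diameter (U i) powr s))" by simp
    finally have "hausdorff_content s (c * \<delta>) (f ` A) * ennreal (c powr - s) \<le>
        (ennreal (c powr s) * (\<Sum>i. ennreal (diameter (U i) powr s))) * ennreal (c powr - s)"
      by (rule mult_right_mono) simp
    also have "\<dots> = (ennreal (c powr s) * ennreal (c powr - s)) * (\<Sum>i. ennreal (diameter (U i) powr s))"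
      by (simp only: ac_simps)
    finally show "hausdorff_content s (c * \<delta>) (f ` A) * ennreal (c powr - s) \<le> (\<Sum>i. ennreal (diameter (U i) powr s))"
      by (simp add: inv)
  qed
  show ?thesis unfolding hausdorff_outer_def[of s "f ` A"] SUP_mult_right_ennreal
  proof (rule SUP_least)
    fix \<delta> :: real assume d: "\<delta> \<in> {0<..}"
    have "hausdorff_content s \<delta> (f ` A) * ennreal (c powr - s) \<le> hausdorff_content s (\<delta> / c) A"
      using 1[of "\<delta> / c"] c by simp
    also have "\<dots> \<le> hausdorff_outer s A" using c d by (intro hausdorff_content_le_outer) auto
    finally show "hausdorff_content s \<delta> (f ` A) * ennreal (c powr - s) \<le> hausdorff_outer s A" .
  qed
qed


section \<open>The self-similar measure\<close>

lemma cells_scaling_dimension: "9 powr (ln 21 / ln 9) = (21::real)"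
  by (simp add: powr_def)

lemma power9_powr: "((1::real) / 9 ^ n) powr (- (ln 21 / ln 9)) = 21 ^ n"
proof -
  have "((1::real) / 9 ^ n) powr (- (ln 21 / ln 9)) = (9 ^ n) powr (ln 21 / ln 9)"
    by (simp add: powr_minus powr_divide divide_simps)
  also have "\<dots> = (9 powr (ln 21 / ln 9)) ^ n"
    by (simp add: powr_realpow[symmetric] powr_powr powr_power mult.commute)
  finally show ?thesis by (simp only: cells_scaling_dimension)
qed

lemma power9_powr': "((1::real) / 9 ^ n) powr (ln 21 / ln 9) = 1 / 21 ^ n"
  using power9_powr[of n] by (simp add: powr_minus field_simps)

lemma scale_between_powers:
  fixes D :: real
  assumes "0 < D" "D < 1"
  obtains n :: nat where "1 / 9 ^ Suc n \<le> D" "D < 1 / 9 ^ n"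
proof -
  have ex: "\<exists>n. 1 / 9 ^ n \<le> D"
  proof -
    have "(\<lambda>n. 1 / 9 ^ n :: real) \<longlonglongrightarrow> 0" by (rule LIMSEQ_divide_realpow_zero) simp
    then have "\<forall>\<^sub>F n in sequentially. 1 / 9 ^ n < D" using assms(1) by (rule order_tendstoD)
    then obtain n where "1 / 9 ^ n < D" by (auto simp: eventually_sequentially)
    then show ?thesis by (auto intro: less_imp_le)
  qed
  define m where "m = (LEAST n. 1 / 9 ^ n \<le> D)"
  have m: "1 / 9 ^ m \<le> D" unfolding m_def by (rule LeastI_ex[OF ex])
  with assms have "m \<noteq> 0" by (cases m) auto
  then obtain n where n: "m = Suc n" by (cases m) auto
  have "\<not> 1 / 9 ^ n \<le> D" using not_less_Least[of n "\<lambda>n. 1 / 9 ^ n \<le> D"] n by (auto simp: m_def)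
  with m n show ?thesis by (intro that[of n]) auto
qed

context eyebolted_cross
begin

abbreviation "dimH \<equiv> ln 21 / ln (9::real)"

definition \<mu> :: "point measure" where "\<mu> = normalized_hausdorff dimH K"

lemma dimH_pos: "0 < dimH" by simp

text \<open>The cover by the \<open>21 ^ n\<close> cells of a fine level \<open>n\<close> has diameters at most \<open>(3/2) / 9 ^ n\<close>.\<close>

lemma hausdorff_content_K: "hausdorff_content dimH \<delta> K \<le> ennreal ((3/2) powr dimH)" if "0 < \<delta>" for \<delta>
proof -
  have "(\<lambda>n. (3/2) / 9 ^ n :: real) \<longlonglongrightarrow> 0" by (rule LIMSEQ_divide_realpow_zero) simp
  then have "\<forall>\<^sub>F n in sequentially. (3/2) / 9 ^ n < \<delta>" using that by (rule order_tendstoD)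
  then obtain n where n: "(3/2) / 9 ^ n < \<delta>" by (auto simp: eventually_sequentially)
  obtain h where h: "bij_betw h {0..<card (words I n)} (words I n)"
    using ex_bij_betw_nat_finite[of "words I n"] by auto
  define U where "U i = (if i < 21 ^ n then word_map (h i) ` K else {})" for i
  have hi: "h i \<in> words I n" if "i < 21 ^ n" for i
    using bij_betwE[OF h] that by (auto simp: card_words_I)
  have dU: "diameter (U i) \<le> 3/2 / 9 ^ n" for i
    by (rule diameter_leI) (use cell_diameter hi in \<open>auto simp: U_def split: if_splits\<close>)
  have bU: "bounded (U i)" for i
    unfolding bounded_two_points
    by (rule exI[of _ "3/2 / 9 ^ n"]) (use cell_diameter[OF _ _ hi] in \<open>auto simp: U_def\<close>)
  have "hausdorff_content dimH \<delta> K \<le> (\<Sum>i. ennreal (diameter (U i) powr dimH))"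
  proof (rule hausdorff_content_le)
    show "K \<subseteq> (\<Union>i. U i)"
    proof
      fix x assume "x \<in> K"
      then obtain w y where w: "w \<in> words I n" "y \<in> K" "x = word_map w y" using K_cellE by blast
      then obtain i where "i < 21 ^ n" "h i = w"
        using h unfolding bij_betw_def card_words_I by (metis imageE atLeastLessThan_iff)
      then have "x \<in> U i" using w by (simp add: U_def)
      then show "x \<in> (\<Union>i. U i)" by blast
    qed
    show "diameter (U i) \<le> \<delta>" for i using dU[of i] n by linarith
  qed (rule bU)
  also have "\<dots> = (\<Sum>i<21 ^ n. ennreal (diameter (U i) powr dimH))"
    by (rule suminf_finite) (auto simp: U_def)
  also have "\<dots> \<le> (\<Sum>i<(21::nat) ^ n. ennreal (((3/2) * (1 / 9 ^ n)) powr dimH))"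
    using dU diameter_ge_0[OF bU] by (intro sum_mono ennreal_leI powr_mono2) auto
  also have "((3/2) * (1 / 9 ^ n)) powr dimH = (3/2) powr dimH * (1 / 21 ^ n)"
    by (simp only: powr_mult[of "3/2" "1 / 9 ^ n"] power9_powr')
  also have "(\<Sum>i<(21::nat) ^ n. ennreal ((3/2) powr dimH * (1 / 21 ^ n))) = ennreal ((3/2) powr dimH)"
  proof -
    have "(21::ennreal) ^ n = ennreal (21 ^ n)" by (metis ennreal_numeral ennreal_power zero_le_numeral)
    then show ?thesis by (simp add: ennreal_mult[symmetric])
  qed
  finally show ?thesis .
qed

lemma hausdorff_K_finite: "hausdorff_outer dimH K < \<infinity>"
proof -
  have "hausdorff_outer dimH K \<le> ennreal ((3/2) powr dimH)"
    unfolding hausdorff_outer_def by (rule SUP_least) (use hausdorff_content_K in auto)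
  then show ?thesis by (rule le_less_trans) simp
qed

text \<open>A set of diameter \<open>D < 9\<^sup>-\<^sup>n\<close> meets at most nine cells of level \<open>n\<close>, hence at most
  \<open>9 \<cdot> 21\<^sup>N\<^sup>-\<^sup>n\<close> cells of a later level \<open>N\<close>; a cover has to meet all \<open>21\<^sup>N\<close> of them.
  The constant is \<open>9 \<cdot> 21\<close>, where \<open>21\<close> accounts for \<open>D\<close> being possibly as small as \<open>9\<^sup>-\<^sup>(\<^sup>n\<^sup>+\<^sup>1\<^sup>)\<close>.\<close>

lemma finite_cover_lower_bound:
  fixes V :: "nat \<Rightarrow> point set" and D :: "nat \<Rightarrow> real"
  assumes "finite J" and cov: "K \<subseteq> (\<Union>i\<in>J. V i)"
    and D: "\<And>i. 0 < D i" "\<And>i. D i < 1"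
    and diam: "\<And>i x y. x \<in> V i \<Longrightarrow> y \<in> V i \<Longrightarrow> dist x y \<le> D i"
  shows "1 \<le> 189 * (\<Sum>i\<in>J. D i powr dimH)"
proof -
  have "\<forall>i. \<exists>n::nat. 1 / 9 ^ Suc n \<le> D i \<and> D i < 1 / 9 ^ n"
    using scale_between_powers[OF D] by metis
  then obtain n :: "nat \<Rightarrow> nat" where n: "\<And>i. 1 / 9 ^ Suc (n i) \<le> D i" "\<And>i. D i < 1 / 9 ^ n i" by metis
  define N where "N = Max (insert 0 (n ` J))"
  have nN: "n i \<le> N" if "i \<in> J" for i using that \<open>finite J\<close> by (auto simp: N_def)
  define Y where "Y m i = {w \<in> words I m. word_map w ` K \<inter> V i \<noteq> {}}" for m i
  have cY: "card (Y (n i) i) \<le> 9" for i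
  proof (cases "Y (n i) i = {}")
    case False
    then obtain v where v: "v \<in> Y (n i) i" by blast
    have "neighbours w v" if w: "w \<in> Y (n i) i" for w
    proof -
      obtain x y where xy: "x \<in> K" "word_map w x \<in> V i" "y \<in> K" "word_map v y \<in> V i"
        using v w by (auto simp: Y_def)
      have "dist (word_map w x) (word_map v y) < 1 / 9 ^ n i"
        using diam[OF xy(2,4)] n(2)[of i] by linarith
      then show ?thesis using v w xy K_subset_square
        by (intro close_cells_are_neighbours[of w "n i" v x y]) (auto simp: Y_def length_words)
    qed
    then have "Y (n i) i \<subseteq> {w \<in> words I (n i). neighbours w v}" by (auto simp: Y_def)
    then have "card (Y (n i) i) \<le> card {w \<in> words I (n i). neighbours w v}" by (intro card_mono) auto
    also have "\<dots> \<le> 9" using v by (intro card_neighbours[OF I]) (auto simp: Y_def)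
    finally show ?thesis .
  qed simp
  have cYN: "card (Y N i) \<le> 9 * 21 ^ (N - n i)" if i: "i \<in> J" for i
  proof -
    have "Y N i \<subseteq> (\<lambda>(u, v). u @ v) ` (Y (n i) i \<times> words I (N - n i))"
    proof
      fix w assume w: "w \<in> Y N i"
      then have "w \<in> words I (n i + (N - n i))" using nN[OF i] by (simp add: Y_def)
      then obtain u v where uv: "u \<in> words I (n i)" "v \<in> words I (N - n i)" "w = u @ v"
        using words_appendE by blast
      obtain x where "x \<in> K" "word_map w x \<in> V i" using w by (auto simp: Y_def)
      then have "word_map u (word_map v x) \<in> word_map u ` K \<inter> V i"
        using uv word_map_in_K by (auto simp: word_map_append)
      then have "u \<in> Y (n i) i" using uv by (auto simp: Y_def)
      then show "w \<in> (\<lambda>(u, v). u @ v) ` (Y (n i) i \<times> words I (N - n i))" using uv by force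
    qed
    then have "card (Y N i) \<le> card ((\<lambda>(u, v). u @ v) ` (Y (n i) i \<times> words I (N - n i)))"
      by (intro card_mono finite_imageI finite_cartesian_product) (auto simp: Y_def)
    also have "\<dots> \<le> card (Y (n i) i \<times> words I (N - n i))"
      by (intro card_image_le finite_cartesian_product) (auto simp: Y_def)
    also have "\<dots> \<le> 9 * 21 ^ (N - n i)"
      using cY[of i] by (simp add: card_cartesian_product card_words_I)
    finally show ?thesis .
  qed
  have "words I N \<subseteq> (\<Union>i\<in>J. Y N i)"
  proof
    fix w assume w: "w \<in> words I N"
    obtain x where x: "x \<in> K" using K_ne by blast
    then obtain i where "i \<in> J" "word_map w x \<in> V i" using cov word_map_in_K[OF w x] by blast
    then show "w \<in> (\<Union>i\<in>J. Y N i)" using w x by (auto simp: Y_def)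
  qed
  then have "card (words I N) \<le> card (\<Union>i\<in>J. Y N i)"
    using \<open>finite J\<close> by (intro card_mono) (auto simp: Y_def)
  also have "\<dots> \<le> (\<Sum>i\<in>J. card (Y N i))" by (rule card_UN_le) fact
  also have "\<dots> \<le> (\<Sum>i\<in>J. 9 * 21 ^ (N - n i))" by (intro sum_mono cYN)
  finally have "real (21 ^ N) \<le> real (\<Sum>i\<in>J. 9 * 21 ^ (N - n i))" by (simp only: card_words_I of_nat_le_iff)
  then have "21 ^ N \<le> (\<Sum>i\<in>J. 9 * 21 ^ (N - n i) :: real)" by simp
  also have "\<dots> \<le> (\<Sum>i\<in>J. 21 ^ N * (189 * D i powr dimH))"
  proof (rule sum_mono)
    fix i assume i: "i \<in> J"
    have "1 / 21 ^ Suc (n i) \<le> D i powr dimH"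
      unfolding power9_powr'[symmetric] using n(1)[of i] by (intro powr_mono2) auto
    then have "1 \<le> 21 ^ Suc (n i) * D i powr dimH" by (simp add: field_simps)
    then have "9 * 21 ^ (N - n i) * 1 \<le> 9 * 21 ^ (N - n i) * (21 ^ Suc (n i) * D i powr dimH)"
      by (intro mult_left_mono) auto
    also have "\<dots> = 189 * (21 ^ (N - n i) * 21 ^ n i) * D i powr dimH" by simp
    also have "(21::real) ^ (N - n i) * 21 ^ n i = 21 ^ N"
      using nN[OF i] by (simp add: power_add[symmetric])
    finally show "9 * 21 ^ (N - n i) \<le> 21 ^ N * (189 * D i powr dimH)"
      by (simp only: mult_1_right mult_ac)
  qed
  finally have "21 ^ N * 1 \<le> 21 ^ N * (189 * (\<Sum>i\<in>J. D i powr dimH))"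
    by (simp add: sum_distrib_left)
  then show ?thesis by (subst (asm) mult_le_cancel_left_pos) auto
qed

text \<open>A countable cover is reduced to a finite one by compactness, after its members have been enlarged
  to open sets at little cost. The sum over the finite cover is at least \<open>1 / 189\<close>, which leaves room for
  the error \<open>e = 1 / 400\<close> twice.\<close>

lemma hausdorff_K_pos: "0 < hausdorff_outer dimH K"
proof -
  define e :: real where "e = 1/400"
  have "ennreal e \<le> hausdorff_content dimH (1/2) K"
  proof (rule hausdorff_content_greatest)
    fix U assume U: "K \<subseteq> (\<Union>i::nat. U i)" "\<And>i. bounded (U i)" "\<And>i. diameter (U i) \<le> 1/2"
    show "ennreal e \<le> (\<Sum>i. ennreal (diameter (U i) powr dimH))"
    proof (rule ccontr)
      assume "\<not> ?thesis"
      then have less: "(\<Sum>i. ennreal (diameter (U i) powr dimH)) < ennreal e" by simp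
      let ?d = "\<lambda>i. diameter (U i)"
      have d0: "0 \<le> ?d i" for i using diameter_ge_0[OF U(2)] .
      have "\<exists>\<epsilon>>0. (?d i + 2 * \<epsilon>) powr dimH \<le> ?d i powr dimH + e * (1/2) ^ Suc i \<and> ?d i + 2 * \<epsilon> < 1" for i
      proof -
        have "((\<lambda>\<epsilon>. (?d i + 2 * \<epsilon>) powr dimH) \<longlongrightarrow> (?d i + 2 * 0) powr dimH) (at_right 0)"
          by (rule tendsto_powr') (use d0[of i] dimH_pos in \<open>auto intro!: tendsto_eq_intros eventually_at_right_less[THEN eventually_mono] \<close>)
        then have "\<forall>\<^sub>F \<epsilon> in at_right 0. (?d i + 2 * \<epsilon>) powr dimH < ?d i powr dimH + e * (1/2) ^ Suc i"
          by (rule order_tendstoD) (simp add: e_def)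
        moreover have "\<forall>\<^sub>F \<epsilon> in at_right 0. (0::real) < \<epsilon>" by (rule eventually_at_right_less)
        moreover have "\<forall>\<^sub>F \<epsilon> in at_right (0::real). \<epsilon> < 1/4"
          by (auto simp: eventually_at_right_field intro!: exI[of _ "1/4"])
        ultimately have "\<forall>\<^sub>F \<epsilon> in at_right 0. 0 < \<epsilon> \<and> (?d i + 2 * \<epsilon>) powr dimH \<le> ?d i powr dimH + e * (1/2) ^ Suc i \<and> ?d i + 2 * \<epsilon> < 1"
          by eventually_elim (use U(3)[of i] in auto)
        then show ?thesis using eventually_happens'[OF trivial_limit_at_right_real] by blast
      qed
      then obtain \<epsilon> where \<epsilon>: "\<And>i. \<epsilon> i > 0"
        "\<And>i. (?d i + 2 * \<epsilon> i) powr dimH \<le> ?d i powr dimH + e * (1/2) ^ Suc i" "\<And>i. ?d i + 2 * \<epsilon> i < 1"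
        by metis
      define V where "V i = (\<Union>a\<in>U i. ball a (\<epsilon> i))" for i
      have UV: "U i \<subseteq> V i" for i using \<epsilon>(1)[of i] by (force simp: V_def)
      have cov: "K \<subseteq> (\<Union>i\<in>UNIV. V i)" using U(1) UV by blast
      have "open (V i)" for i by (auto simp: V_def)
      then obtain J where "J \<subseteq> UNIV" and J: "finite J" "K \<subseteq> (\<Union>i\<in>J. V i)"
        by (rule compactE_image[OF compact_K _ cov])
      have "1 \<le> 189 * (\<Sum>i\<in>J. (?d i + 2 * \<epsilon> i) powr dimH)"
      proof (rule finite_cover_lower_bound[OF J])
        fix i x y assume "x \<in> V i" "y \<in> V i"
        then obtain a b where ab: "a \<in> U i" "b \<in> U i" "dist a x < \<epsilon> i" "dist b y < \<epsilon> i" by (auto simp: V_def)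
        have "dist a b \<le> ?d i" using diameter_bounded_bound[OF U(2) ab(1,2)] .
        moreover have "dist x y \<le> dist a x + dist a b + dist b y"
          using dist_triangle[of x y a] dist_triangle[of a y b] by (simp add: dist_commute)
        ultimately show "dist x y \<le> ?d i + 2 * \<epsilon> i" using ab by linarith
      next
        show "0 < ?d i + 2 * \<epsilon> i" for i using d0[of i] \<epsilon>(1)[of i] by linarith
      qed (rule \<epsilon>(3))
      also have "(\<Sum>i\<in>J. (?d i + 2 * \<epsilon> i) powr dimH) \<le> (\<Sum>i\<in>J. ?d i powr dimH) + (\<Sum>i\<in>J. e * (1/2) ^ Suc i)"
        unfolding sum.distrib[symmetric] by (intro sum_mono \<epsilon>(2))
      also have "(\<Sum>i\<in>J. e * (1/2) ^ Suc i) \<le> (\<Sum>i. e * (1/2) ^ Suc i)"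
        by (rule sum_le_suminf) (use J power_half_series in \<open>auto simp: e_def sums_iff intro!: summable_mult\<close>)
      also have "(\<Sum>i. e * (1/2) ^ Suc i) = e"
        using sums_mult[OF power_half_series, of e] by (simp add: sums_iff)
      also have "(\<Sum>i\<in>J. ?d i powr dimH) \<le> e"
      proof -
        have "ennreal (\<Sum>i\<in>J. ?d i powr dimH) = (\<Sum>i\<in>J. ennreal (?d i powr dimH))"
          by (rule sum_ennreal[symmetric]) simp
        also have "\<dots> \<le> (\<Sum>i. ennreal (?d i powr dimH))" by (rule sum_le_suminf) (use J in auto)
        also have "\<dots> \<le> ennreal e" using less by simp
        finally show ?thesis by (subst (asm) ennreal_le_iff) (auto simp: e_def)
      qed
      finally show False by (simp add: e_def)
    qed
  qed
  also have "\<dots> \<le> hausdorff_outer dimH K" by (rule hausdorff_content_le_outer) simp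
  finally show ?thesis by (rule less_le_trans[rotated]) (simp add: e_def)
qed

text \<open>The map of a word and its inverse are Lipschitz with reciprocal constants.\<close>

lemma hausdorff_cell:
  assumes w: "w \<in> words I n"
  shows "hausdorff_outer dimH (word_map w ` K) = hausdorff_outer dimH K * ennreal (1 / 21 ^ n)"
proof (rule antisym)
  let ?H = "hausdorff_outer dimH"
  have inv: "ennreal (21 ^ n) * ennreal (1 / 21 ^ n) = 1" by (simp add: ennreal_mult[symmetric])
  have "?H (word_map w ` K) * ennreal ((1 / 9 ^ n) powr - dimH) \<le> ?H K"
    by (rule hausdorff_outer_lipschitz_image) (auto simp: dist_word_map length_words[OF w])
  then have "?H (word_map w ` K) * ennreal (21 ^ n) \<le> ?H K" by (simp only: power9_powr)
  then have "?H (word_map w ` K) * ennreal (21 ^ n) * ennreal (1 / 21 ^ n) \<le> ?H K * ennreal (1 / 21 ^ n)"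
    by (rule mult_right_mono) simp
  then show "?H (word_map w ` K) \<le> ?H K * ennreal (1 / 21 ^ n)" by (simp only: mult.assoc inv mult_1_right)
  have "?H (inv (word_map w) ` word_map w ` K) * ennreal ((9 ^ n) powr - dimH) \<le> ?H (word_map w ` K)"
    by (rule hausdorff_outer_lipschitz_image)
       (auto simp: dist_word_map length_words[OF w] inv_f_f[OF inj_word_map])
  also have "inv (word_map w) ` word_map w ` K = K" by (simp add: image_comp inv_o_cancel[OF inj_word_map])
  also have "(9 ^ n) powr - dimH = (1 / 9 ^ n) powr dimH" by (simp add: powr_minus powr_divide divide_simps)
  finally show "?H K * ennreal (1 / 21 ^ n) \<le> ?H (word_map w ` K)" by (simp only: power9_powr')
qed

lemma space_\<mu> [simp]: "space \<mu> = K"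
  and sets_\<mu>: "sets \<mu> = sets (restrict_space borel K)"
  using normalized_hausdorff_facts[OF compact_imp_closed[OF compact_K]] by (auto simp: \<mu>_def)

lemma closed_in_sets_\<mu>: "closed A \<Longrightarrow> A \<subseteq> K \<Longrightarrow> A \<in> sets \<mu>"
  unfolding sets_\<mu> using compact_imp_closed[OF compact_K]
  by (auto simp: sets_restrict_space_iff)

lemma closed_cell: "closed (word_map w ` K)"
  by (intro compact_imp_closed compact_continuous_image continuous_on_word_map compact_K)

lemma cell_subset_K: "w \<in> words I n \<Longrightarrow> word_map w ` K \<subseteq> K"
  using word_map_in_K by blast

lemma cell_in_sets [measurable]: "w \<in> words I n \<Longrightarrow> word_map w ` K \<in> sets \<mu>"
  by (intro closed_in_sets_\<mu> closed_cell cell_subset_K)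

lemma emeasure_cell:
  assumes w: "w \<in> words I n"
  shows "emeasure \<mu> (word_map w ` K) = ennreal (1 / 21 ^ n)"
proof -
  let ?H = "hausdorff_outer dimH"
  have "emeasure \<mu> (word_map w ` K) = ?H (word_map w ` K) / ?H K"
    using normalized_hausdorff_facts(3)[OF compact_imp_closed[OF compact_K]] cell_in_sets[OF w]
    by (simp add: \<mu>_def sets_\<mu>[unfolded \<mu>_def])
  also have "\<dots> = ennreal (1 / 21 ^ n)"
    unfolding hausdorff_cell[OF w] using hausdorff_K_finite hausdorff_K_pos
    by (simp add: divide_ennreal_def mult.assoc mult.commute ennreal_divide_self[unfolded divide_ennreal_def] less_top mult.left_commute)
  finally show ?thesis .
qed

lemma emeasure_K: "emeasure \<mu> K = 1"
  using emeasure_cell[of "[]" 0] by simp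

lemma finite_measure_\<mu>: "finite_measure \<mu>"
  by (rule finite_measureI) (simp add: emeasure_K)

lemma measure_cell: "w \<in> words I n \<Longrightarrow> measure \<mu> (word_map w ` K) = 1 / 21 ^ n"
  by (simp add: measure_def emeasure_cell)

lemma small_cell_in_ball:
  assumes "x \<in> K" "0 < e"
  obtains n w where "w \<in> words I n" "x \<in> word_map w ` K" "word_map w ` K \<subseteq> ball x e"
proof -
  have "(\<lambda>n. (3/2) / 9 ^ n :: real) \<longlonglongrightarrow> 0" by (rule LIMSEQ_divide_realpow_zero) simp
  then have "\<forall>\<^sub>F n in sequentially. (3/2) / 9 ^ n < e" using assms(2) by (rule order_tendstoD)
  then obtain n where n: "(3/2) / 9 ^ n < e" by (auto simp: eventually_sequentially)
  obtain w y where w: "w \<in> words I n" "y \<in> K" "x = word_map w y" using K_cellE[OF assms(1)] by blast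
  have "word_map w ` K \<subseteq> ball x e"
  proof
    fix z assume "z \<in> word_map w ` K"
    then have "dist x z \<le> 3/2 / 9 ^ n" using w cell_diameter[of x w z n] by blast
    with n show "z \<in> ball x e" by simp
  qed
  with w show ?thesis using that by blast
qed

lemma full_support_\<mu>: "full_radon_measure K \<mu>"
  unfolding full_radon_measure_def
proof (intro conjI allI impI)
  fix U :: "point set" assume U: "open U \<and> U \<inter> K \<noteq> {}"
  then obtain x where x: "x \<in> U" "x \<in> K" by blast
  then obtain e where e: "0 < e" "ball x e \<subseteq> U" using U open_contains_ball by blast
  obtain n w where w: "w \<in> words I n" "word_map w ` K \<subseteq> ball x e" using small_cell_in_ball[OF x(2) e(1)] by blast
  have "0 < emeasure \<mu> (word_map w ` K)" by (simp add: emeasure_cell[OF w(1)])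
  also have "\<dots> \<le> emeasure \<mu> (U \<inter> K)"
    using U w e cell_subset_K[OF w(1)] compact_imp_closed[OF compact_K]
    by (intro emeasure_mono) (auto simp: sets_\<mu> sets_restrict_space_iff)
  finally show "0 < emeasure \<mu> (U \<inter> K)" .
qed (auto simp: sets_\<mu> finite_measure_\<mu>)

end

section \<open>Star networks\<close>

text \<open>The energy of a star with centre potential \<open>z\<close>, and its minimum over \<open>z\<close>. The latter is the energy of
  the equivalent complete network on the four end points (star-mesh transformation).\<close>

definition springs :: "real \<Rightarrow> real \<Rightarrow> real \<Rightarrow> real \<Rightarrow> real \<Rightarrow> real \<Rightarrow> real \<Rightarrow> real" where
  "springs a b z x1 x2 x3 x4 = ((x1 - z)\<^sup>2 + (x3 - z)\<^sup>2) / a + ((x2 - z)\<^sup>2 + (x4 - z)\<^sup>2) / b"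

definition star4 :: "real \<Rightarrow> real \<Rightarrow> real \<Rightarrow> real \<Rightarrow> real \<Rightarrow> real \<Rightarrow> real" where
  "star4 a b x1 x2 x3 x4 =
     ((1/a)\<^sup>2 * (x1 - x3)\<^sup>2 + (1/b)\<^sup>2 * (x2 - x4)\<^sup>2 +
      (1/a) * (1/b) * ((x1 - x2)\<^sup>2 + (x1 - x4)\<^sup>2 + (x3 - x2)\<^sup>2 + (x3 - x4)\<^sup>2)) / (2/a + 2/b)"

lemma springs_eq_star4:
  fixes a b z x1 x2 x3 x4 :: real
  assumes "0 < a" "0 < b"
  defines "m \<equiv> ((x1 + x3) / a + (x2 + x4) / b) / (2/a + 2/b)"
  shows "springs a b z x1 x2 x3 x4 = star4 a b x1 x2 x3 x4 + (2/a + 2/b) * (z - m)\<^sup>2"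
proof -
  define A B where "A = 1/a" and "B = 1/b"
  have G: "0 < 2 * A + 2 * B" using assms(1,2) by (simp add: A_def B_def add_pos_pos)
  have m: "(2 * A + 2 * B) * m = A * (x1 + x3) + B * (x2 + x4)"
    using G by (simp add: m_def A_def B_def)
  have "(2 * A + 2 * B) * (A * ((x1 - z)\<^sup>2 + (x3 - z)\<^sup>2) + B * ((x2 - z)\<^sup>2 + (x4 - z)\<^sup>2)) =
     (A\<^sup>2 * (x1 - x3)\<^sup>2 + B\<^sup>2 * (x2 - x4)\<^sup>2 +
      A * B * ((x1 - x2)\<^sup>2 + (x1 - x4)\<^sup>2 + (x3 - x2)\<^sup>2 + (x3 - x4)\<^sup>2)) +
     ((2 * A + 2 * B) * z - (A * (x1 + x3) + B * (x2 + x4)))\<^sup>2"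
    by (simp add: algebra_simps power2_eq_square)
  also have "(2 * A + 2 * B) * z - (A * (x1 + x3) + B * (x2 + x4)) = (2 * A + 2 * B) * (z - m)"
    by (simp add: m right_diff_distrib)
  finally have "A * ((x1 - z)\<^sup>2 + (x3 - z)\<^sup>2) + B * ((x2 - z)\<^sup>2 + (x4 - z)\<^sup>2) =
     (A\<^sup>2 * (x1 - x3)\<^sup>2 + B\<^sup>2 * (x2 - x4)\<^sup>2 +
      A * B * ((x1 - x2)\<^sup>2 + (x1 - x4)\<^sup>2 + (x3 - x2)\<^sup>2 + (x3 - x4)\<^sup>2)) / (2 * A + 2 * B) +
     (2 * A + 2 * B) * (z - m)\<^sup>2"
    using G by (simp add: field_simps power2_eq_square)
  then show ?thesis by (simp add: springs_def star4_def A_def B_def)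
qed

lemma star4_le_springs: "0 < a \<Longrightarrow> 0 < b \<Longrightarrow> star4 a b x1 x2 x3 x4 \<le> springs a b z x1 x2 x3 x4"
  using springs_eq_star4[of a b z x1 x2 x3 x4] by (simp add: add_pos_pos)

lemma star4_attained:
  assumes "0 < a" "0 < b"
  obtains z where "star4 a b x1 x2 x3 x4 = springs a b z x1 x2 x3 x4"
proof (rule that)
  show "star4 a b x1 x2 x3 x4 = springs a b (((x1 + x3) / a + (x2 + x4) / b) / (2/a + 2/b)) x1 x2 x3 x4"
    by (subst springs_eq_star4[OF assms]) simp
qed

text \<open>Two resistors in series, by completing the square in \<open>y\<close>.\<close>

lemma series_law:
  fixes x y z :: real
  assumes "0 < r" "0 < s"
  shows "(x - z)\<^sup>2 / (r + s) \<le> (x - y)\<^sup>2 / r + (y - z)\<^sup>2 / s"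
proof -
  have "r * s * (x - z)\<^sup>2 \<le> (r + s) * (s * (x - y)\<^sup>2 + r * (y - z)\<^sup>2)"
  proof -
    have "(r + s) * (s * (x - y)\<^sup>2 + r * (y - z)\<^sup>2) - r * s * (x - z)\<^sup>2 = (s * (x - y) - r * (y - z))\<^sup>2"
      by (simp add: algebra_simps power2_eq_square)
    then show ?thesis by (metis diff_ge_0_iff_ge zero_le_power2)
  qed
  then show ?thesis using assms by (simp add: field_simps)
qed

text \<open>Discarding two of the four arms leaves two resistors in series.\<close>

lemma star4_ge_through:
  assumes "0 < a" "0 < b"
  shows "(x1 - x3)\<^sup>2 / (2 * a) \<le> star4 a b x1 x2 x3 x4"
    and "(x2 - x4)\<^sup>2 / (2 * b) \<le> star4 a b x1 x2 x3 x4"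
    and "(x1 - x2)\<^sup>2 / (a + b) \<le> star4 a b x1 x2 x3 x4"
    and "(x1 - x4)\<^sup>2 / (a + b) \<le> star4 a b x1 x2 x3 x4"
    and "(x3 - x2)\<^sup>2 / (a + b) \<le> star4 a b x1 x2 x3 x4"
    and "(x3 - x4)\<^sup>2 / (a + b) \<le> star4 a b x1 x2 x3 x4"
proof -
  obtain z where z: "star4 a b x1 x2 x3 x4 = springs a b z x1 x2 x3 x4"
    using star4_attained[OF assms] by blast
  have s: "springs a b z x1 x2 x3 x4 = (x1 - z)\<^sup>2 / a + (x3 - z)\<^sup>2 / a + (x2 - z)\<^sup>2 / b + (x4 - z)\<^sup>2 / b"
    by (simp add: springs_def add_divide_distrib)
  have p: "0 \<le> (x1 - z)\<^sup>2 / a" "0 \<le> (x3 - z)\<^sup>2 / a" "0 \<le> (x2 - z)\<^sup>2 / b" "0 \<le> (x4 - z)\<^sup>2 / b"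
    using assms by auto
  have c: "(x - y)\<^sup>2 = (y - x)\<^sup>2" for x y :: real by (rule power2_commute)
  note sl = series_law[where y=z]
  show "(x1 - x3)\<^sup>2 / (2 * a) \<le> star4 a b x1 x2 x3 x4"
    using sl[of a a x1 x3, OF assms(1) assms(1), unfolded c[of z x3]] p unfolding z s mult_2 by linarith
  show "(x2 - x4)\<^sup>2 / (2 * b) \<le> star4 a b x1 x2 x3 x4"
    using sl[of b b x2 x4, OF assms(2) assms(2), unfolded c[of z x4]] p unfolding z s mult_2 by linarith
  show "(x1 - x2)\<^sup>2 / (a + b) \<le> star4 a b x1 x2 x3 x4"
    using sl[of a b x1 x2, OF assms, unfolded c[of z x2]] p unfolding z s mult_2 by linarith
  show "(x1 - x4)\<^sup>2 / (a + b) \<le> star4 a b x1 x2 x3 x4"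
    using sl[of a b x1 x4, OF assms, unfolded c[of z x4]] p unfolding z s mult_2 by linarith
  show "(x3 - x2)\<^sup>2 / (a + b) \<le> star4 a b x1 x2 x3 x4"
    using sl[of a b x3 x2, OF assms, unfolded c[of z x2]] p unfolding z s mult_2 by linarith
  show "(x3 - x4)\<^sup>2 / (a + b) \<le> star4 a b x1 x2 x3 x4"
    using sl[of a b x3 x4, OF assms, unfolded c[of z x4]] p unfolding z s mult_2 by linarith
qed

definition arm_conductance :: "real \<Rightarrow> real \<Rightarrow> point \<Rightarrow> real" where
  "arm_conductance a b p = (if fst p = snd p then 1 / a else 1 / b)"

text \<open>The conductances of the star-mesh transformation: the products of the conductances of two arms,
  divided by the total conductance of the star.\<close>

definition mesh :: "real \<Rightarrow> real \<Rightarrow> point \<Rightarrow> point \<Rightarrow> real" where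
  "mesh a b p q = arm_conductance a b p * arm_conductance a b q / (2/a + 2/b)"

definition star_energy :: "real \<Rightarrow> real \<Rightarrow> (point \<Rightarrow> real) \<Rightarrow> real" where
  "star_energy a b f = 1/2 * (\<Sum>p\<in>corners. \<Sum>q\<in>corners. mesh a b p q * (f p - f q)\<^sup>2)"

lemma sum_corners:
  "(\<Sum>p\<in>corners. h p) = h (-1/2, -1/2) + h (1/2, -1/2) + h (1/2, 1/2) + (h (-1/2, 1/2) :: real)"
  by (simp add: corners_def add.assoc)

lemma star_energy_eq:
  "star_energy a b f = star4 a b (f (-1/2, -1/2)) (f (1/2, -1/2)) (f (1/2, 1/2)) (f (-1/2, 1/2))"
proof -
  have poly: "1/2 * (A * A / G * (x1 - x1)\<^sup>2 + A * B / G * (x1 - x2)\<^sup>2 + A * A / G * (x1 - x3)\<^sup>2 + A * B / G * (x1 - x4)\<^sup>2 +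
      (B * A / G * (x2 - x1)\<^sup>2 + B * B / G * (x2 - x2)\<^sup>2 + B * A / G * (x2 - x3)\<^sup>2 + B * B / G * (x2 - x4)\<^sup>2) +
      (A * A / G * (x3 - x1)\<^sup>2 + A * B / G * (x3 - x2)\<^sup>2 + A * A / G * (x3 - x3)\<^sup>2 + A * B / G * (x3 - x4)\<^sup>2) +
      (B * A / G * (x4 - x1)\<^sup>2 + B * B / G * (x4 - x2)\<^sup>2 + B * A / G * (x4 - x3)\<^sup>2 + B * B / G * (x4 - x4)\<^sup>2)) =
     (A\<^sup>2 * (x1 - x3)\<^sup>2 + B\<^sup>2 * (x2 - x4)\<^sup>2 + A * B * ((x1 - x2)\<^sup>2 + (x1 - x4)\<^sup>2 + (x3 - x2)\<^sup>2 + (x3 - x4)\<^sup>2)) / G"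
    for A B G x1 x2 x3 x4 :: real
    by (simp add: power2_commute[of x2 x1] power2_commute[of x3 x1] power2_commute[of x4 x1]
        power2_commute[of x2 x3] power2_commute[of x4 x2] power2_commute[of x4 x3]
        add_divide_distrib power2_eq_square[of A] power2_eq_square[of B] distrib_left mult.commute[of B A])
  have arm: "arm_conductance a b (-1/2, -1/2) = 1/a" "arm_conductance a b (1/2, -1/2) = 1/b"
    "arm_conductance a b (1/2, 1/2) = 1/a" "arm_conductance a b (-1/2, 1/2) = 1/b"
    by (simp_all add: arm_conductance_def)
  show ?thesis
    unfolding star_energy_def sum_corners star4_def mesh_def arm by (rule poly)
qed

lemma mesh_pos: "0 < a \<Longrightarrow> 0 < b \<Longrightarrow> 0 < mesh a b p q"
  by (simp add: mesh_def arm_conductance_def add_pos_pos)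

lemma mesh_sym: "mesh a b p q = mesh a b q p"
  by (simp add: mesh_def mult.commute)

lemma star_energy_nonneg: "0 < a \<Longrightarrow> 0 < b \<Longrightarrow> 0 \<le> star_energy a b f"
  unfolding star_energy_def by (intro mult_nonneg_nonneg sum_nonneg) (auto intro: less_imp_le[OF mesh_pos])

lemma star_energy_contraction:
  assumes "0 < a" "0 < b" "\<And>p q. p \<in> corners \<Longrightarrow> q \<in> corners \<Longrightarrow> \<bar>g p - g q\<bar> \<le> \<bar>f p - f q\<bar>"
  shows "star_energy a b g \<le> star_energy a b f"
  unfolding star_energy_def
  using assms by (intro mult_left_mono sum_mono) (auto intro: less_imp_le[OF mesh_pos] simp: abs_le_square_iff)

lemma star_energy_cong: "(\<And>p. p \<in> corners \<Longrightarrow> f p = g p) \<Longrightarrow> star_energy a b f = star_energy a b g"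
  unfolding star_energy_def by (intro arg_cong2[of _ _ _ _ "(*)"] sum.cong refl) auto

lemma star_energy_ge_diff:
  assumes "0 < a" "0 < b" "p \<in> corners" "q \<in> corners" "a \<le> r" "b \<le> r"
  shows "(f p - f q)\<^sup>2 / (2 * r) \<le> star_energy a b f"
proof -
  note t = star4_ge_through[OF assms(1,2), where ?x1.0="f (-1/2, -1/2)" and ?x2.0="f (1/2, -1/2)"
      and ?x3.0="f (1/2, 1/2)" and ?x4.0="f (-1/2, 1/2)", folded star_energy_eq]
  have r: "d / (2 * r) \<le> star_energy a b f" if "d / s \<le> star_energy a b f" "s \<le> 2 * r" "0 < s" "0 \<le> d" for d s
  proof -
    have "d / (2 * r) \<le> d / s" using that by (intro divide_left_mono) auto
    with that show ?thesis by linarith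
  qed
  have c: "(f x - f y)\<^sup>2 = (f y - f x)\<^sup>2" for x y by (rule power2_commute)
  have "0 < r" using assms by linarith
  have z: "0 \<le> star_energy a b f" by (rule star_energy_nonneg) fact+
  show ?thesis using assms(3,4) unfolding corners_def
    apply (elim insertE emptyE)
    using z r[OF t(1)] r[OF t(2)] r[OF t(3)] r[OF t(4)] r[OF t(5)] r[OF t(6)] assms(1,2,5,6) \<open>0 < r\<close>
      c[of "(1/2, -1/2)" "(-1/2, -1/2)"] c[of "(1/2, 1/2)" "(-1/2, -1/2)"]
        c[of "(-1/2, 1/2)" "(-1/2, -1/2)"] c[of "(1/2, -1/2)" "(1/2, 1/2)"] c[of "(-1/2, 1/2)" "(1/2, -1/2)"]
        c[of "(-1/2, 1/2)" "(1/2, 1/2)"] by simp_all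
qed

section \<open>The first-level network\<close>

text \<open>Level-one vertices in coordinates along the two diagonals: the cell \<open>(i, j)\<close> has the vertices
  \<open>vt (i + j \<mp> 1) (i - j)\<close> and \<open>vt (i + j) (i - j \<plusminus> 1)\<close>.\<close>

definition vt :: "int \<Rightarrow> int \<Rightarrow> point" where
  "vt s d = (of_int (s + d) / 18, of_int (s - d) / 18)"

lemma cell_map_corners:
  "cell_map (i, j) (-1/2, -1/2) = vt (i + j - 1) (i - j)"
  "cell_map (i, j) (1/2, -1/2) = vt (i + j) (i - j + 1)"
  "cell_map (i, j) (1/2, 1/2) = vt (i + j + 1) (i - j)"
  "cell_map (i, j) (-1/2, 1/2) = vt (i + j) (i - j - 1)"
  by (simp_all add: cell_map_def vt_def field_simps)

lemma corner_vt:
  "(-1/2, -1/2) = vt (- 9) 0" "(1/2, -1/2) = vt 0 9" "(1/2, 1/2) = vt 9 0" "(-1/2, 1/2) = vt 0 (- 9)"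
  by (simp_all add: vt_def)

lemma sum_cross_cells:
  fixes h :: "cell \<Rightarrow> real"
  shows "(\<Sum>c\<in>cross_cells lr ul. h c) = h (0, 0) +
    (h (1, 1) + h (2, 2) + h (3, 3) + h (4, 4)) + (h (-1, -1) + h (-2, -2) + h (-3, -3) + h (-4, -4)) +
    (h (1, -1) + h (2, -2) + h (3, -3) + h (4, -4) + (if lr then h (3, -1) + h (4, -2) else h (1, -3) + h (2, -4))) +
    (h (-1, 1) + h (-2, 2) + h (-3, 3) + h (-4, 4) + (if ul then h (-3, 1) + h (-4, 2) else h (-1, 3) + h (-2, 4)))"
proof -
  have 0: "{k. \<bar>k\<bar> \<le> 4} = {-4, -3, -2, -1, 0, 1, 2, 3, 4::int}"
    "{k. 1 \<le> \<bar>k\<bar> \<and> \<bar>k\<bar> \<le> 4} = {-4, -3, -2, -1, 1, 2, 3, 4::int}"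
    by (rule set_eqI, simp, presburger)+
  show ?thesis
    unfolding cross_cells_def setcompr_eq_image 0 by (cases lr; cases ul; simp)
qed

text \<open>The two cells at the ends of the diagonal \<open>\<overline>p\<^sub>2\<overline>p\<^sub>4\<close> may have larger resistances than the others.\<close>

definition cell_scale :: "real \<Rightarrow> cell \<Rightarrow> real" where
  "cell_scale \<kappa> c = (if c = (4, -4) \<or> c = (-4, 4) then \<kappa> else 1)"

text \<open>The resistance from the centre to \<open>p\<^sub>2\<close> in the network of the first level. Outside the loop there are
  half of the central cell, one full cell, halves of the cells \<open>(2, -2)\<close> and \<open>(3, -3)\<close>, and the end
  cell, together \<open>b + 2 b + b + b + 2 \<kappa> b\<close>. Between the centres of \<open>(2, -2)\<close> and \<open>(3, -3)\<close>, the direct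
  connection \<open>2 b\<close> is parallel to the detour \<open>a + (a + b) + (a + b) + a\<close> through the eyebolt, which amounts to
  \<open>2 b - b\<^sup>2 / (a + b)\<close>.\<close>

definition renorm :: "real \<Rightarrow> real \<Rightarrow> real \<Rightarrow> real" where
  "renorm \<kappa> a b = b * (7 + 2 * \<kappa> - b / (a + b))"

lemma renorm_pos: "0 < a \<Longrightarrow> 0 < b \<Longrightarrow> 0 < \<kappa> \<Longrightarrow> 0 < renorm \<kappa> a b"
proof -
  assume "0 < a" "0 < b" "0 < \<kappa>"
  then have "b / (a + b) < 7 + 2 * \<kappa>" by (simp add: field_simps add_pos_pos)
  then show ?thesis using \<open>0 < b\<close> by (simp add: renorm_def)
qed

definition level1_energy :: "bool \<Rightarrow> bool \<Rightarrow> real \<Rightarrow> real \<Rightarrow> real \<Rightarrow> (point \<Rightarrow> real) \<Rightarrow> real" where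
  "level1_energy lr ul \<kappa> a b f =
     (\<Sum>c\<in>cross_cells lr ul. star_energy (cell_scale \<kappa> c * a) (cell_scale \<kappa> c * b) (f \<circ> cell_map c))"

lemma cell_energy:
  "star_energy a b (f \<circ> cell_map (i, j)) =
     star4 a b (f (vt (i + j - 1) (i - j))) (f (vt (i + j) (i - j + 1)))
               (f (vt (i + j + 1) (i - j))) (f (vt (i + j) (i - j - 1)))"
  by (simp only: star_energy_eq comp_apply cell_map_corners)

text \<open>One half cell and four cells in series.\<close>

lemma straight_arm:
  fixes a :: real
  assumes "0 < a"
  shows "(y9 - z)\<^sup>2 / (9 * a) \<le> (y1 - z)\<^sup>2 / a + ((y3 - y1)\<^sup>2 / (2 * a) + (y5 - y3)\<^sup>2 / (2 * a) +
      (y7 - y5)\<^sup>2 / (2 * a) + (y9 - y7)\<^sup>2 / (2 * a))"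
proof -
  have 1: "(y3 - z)\<^sup>2 / (2 * a + a) \<le> (y3 - y1)\<^sup>2 / (2 * a) + (y1 - z)\<^sup>2 / a"
    using assms by (intro series_law) auto
  have 2: "(y5 - z)\<^sup>2 / (2 * a + 3 * a) \<le> (y5 - y3)\<^sup>2 / (2 * a) + (y3 - z)\<^sup>2 / (3 * a)"
    using assms by (intro series_law) auto
  have 3: "(y7 - z)\<^sup>2 / (2 * a + 5 * a) \<le> (y7 - y5)\<^sup>2 / (2 * a) + (y5 - z)\<^sup>2 / (5 * a)"
    using assms by (intro series_law) auto
  have 4: "(y9 - z)\<^sup>2 / (2 * a + 7 * a) \<le> (y9 - y7)\<^sup>2 / (2 * a) + (y7 - z)\<^sup>2 / (7 * a)"
    using assms by (intro series_law) auto
  show ?thesis using 1 2 3 4 by simp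
qed

text \<open>The potentials at the vertices \<open>(0, d)\<close> of the diagonal are \<open>y\<^sub>d\<close>, those at the vertices of the
  detour \<open>h\<^sub>4, h\<^sub>5, h\<^sub>6\<close>, those at the centres of the cells \<open>(2, -2)\<close> and \<open>(3, -3)\<close> are \<open>z2\<close> and \<open>z3\<close>.\<close>

lemma loop_arm:
  fixes a b \<kappa> :: real
  assumes "0 < a" "0 < b" "0 < \<kappa>"
  shows "(x - z)\<^sup>2 / renorm \<kappa> a b \<le>
    (y1 - z)\<^sup>2 / b + (y3 - y1)\<^sup>2 / (2 * b) +
    ((y3 - z2)\<^sup>2 / b + (y5 - z2)\<^sup>2 / b + (h4 - z2)\<^sup>2 / a) +
    (h5 - h4)\<^sup>2 / (a + b) + (h6 - h5)\<^sup>2 / (a + b) +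
    ((h6 - z3)\<^sup>2 / a + (y5 - z3)\<^sup>2 / b + (y7 - z3)\<^sup>2 / b) +
    (x - y7)\<^sup>2 / (2 * (\<kappa> * b))"
proof -
  let ?L = "b * (2 * a + b) / (a + b)"
  have L: "0 < ?L" using assms by (simp add: add_pos_pos)
  have c: "(x - y)\<^sup>2 = (y - x)\<^sup>2" for x y :: real by (rule power2_commute)
  have s1: "(z2 - z)\<^sup>2 / (b + (2 * b + b)) \<le> (z2 - y3)\<^sup>2 / b + ((y3 - y1)\<^sup>2 / (2 * b) + (y1 - z)\<^sup>2 / b)"
    using series_law[of b "2 * b + b" z2 z y3] series_law[of "2 * b" b y3 z y1] assms by linarith
  have s2: "(z3 - z2)\<^sup>2 / (b + b) \<le> (z3 - y5)\<^sup>2 / b + (y5 - z2)\<^sup>2 / b"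
    using assms by (intro series_law) auto
  have s3: "(z3 - z2)\<^sup>2 / (a + ((a + b) + ((a + b) + a))) \<le>
      (z3 - h6)\<^sup>2 / a + ((h6 - h5)\<^sup>2 / (a + b) + ((h5 - h4)\<^sup>2 / (a + b) + (h4 - z2)\<^sup>2 / a))"
    using series_law[of a "(a + b) + ((a + b) + a)" z3 z2 h6] series_law[of "a + b" "(a + b) + a" h6 z2 h5]
      series_law[of "a + b" a h5 z2 h4] assms by linarith
  have par: "(z3 - z2)\<^sup>2 / (b + b) + (z3 - z2)\<^sup>2 / (a + ((a + b) + ((a + b) + a))) = (z3 - z2)\<^sup>2 / ?L"
  proof -
    have "1 / (b + b) + 1 / (a + ((a + b) + ((a + b) + a))) = 1 / ?L"
    proof -
      have "a + ((a + b) + ((a + b) + a)) = 2 * (2 * a + b)" "b + b = 2 * b" by simp_all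
      moreover have "1 / (2 * b) + 1 / (2 * (2 * a + b)) = 1 / ?L"
        using assms add_pos_pos[of "2 * a" b] by (simp add: divide_simps) (simp add: algebra_simps)
      ultimately show ?thesis by (simp only:)
    qed
    then have "(z3 - z2)\<^sup>2 * (1 / (b + b) + 1 / (a + ((a + b) + ((a + b) + a)))) = (z3 - z2)\<^sup>2 * (1 / ?L)" by simp
    then show ?thesis by (simp only: distrib_left times_divide_eq_right mult_1_right)
  qed
  have s4: "(x - z3)\<^sup>2 / (2 * (\<kappa> * b) + b) \<le> (x - y7)\<^sup>2 / (2 * (\<kappa> * b)) + (y7 - z3)\<^sup>2 / b"
    using assms by (intro series_law) auto
  have s5: "(z3 - z)\<^sup>2 / (?L + (b + (2 * b + b))) \<le> (z3 - z2)\<^sup>2 / ?L + (z2 - z)\<^sup>2 / (b + (2 * b + b))"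
    using assms L by (intro series_law) auto
  have s6: "(x - z)\<^sup>2 / ((2 * (\<kappa> * b) + b) + (?L + (b + (2 * b + b)))) \<le>
      (x - z3)\<^sup>2 / (2 * (\<kappa> * b) + b) + (z3 - z)\<^sup>2 / (?L + (b + (2 * b + b)))"
    using assms L by (intro series_law) (auto intro: add_pos_pos)
  have B: "(2 * (\<kappa> * b) + b) + (?L + (b + (2 * b + b))) = renorm \<kappa> a b"
    using assms by (simp add: renorm_def field_simps)
  have "(x - z)\<^sup>2 / renorm \<kappa> a b \<le>
    (x - y7)\<^sup>2 / (2 * (\<kappa> * b)) + (y7 - z3)\<^sup>2 / b +
    ((z3 - y5)\<^sup>2 / b + (y5 - z2)\<^sup>2 / b + ((z3 - h6)\<^sup>2 / a + ((h6 - h5)\<^sup>2 / (a + b) + ((h5 - h4)\<^sup>2 / (a + b) + (h4 - z2)\<^sup>2 / a)))) +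
    ((z2 - y3)\<^sup>2 / b + ((y3 - y1)\<^sup>2 / (2 * b) + (y1 - z)\<^sup>2 / b))"
    using s1 s2 s3 s4 s5 s6 par unfolding B by linarith
  then show ?thesis by (simp add: c[of z3 y5] c[of z3 h6] c[of z2 y3] algebra_simps)
qed

lemma springs_ge_three:
  assumes "0 < a" "0 < b"
  shows "(x2 - z)\<^sup>2 / b + (x4 - z)\<^sup>2 / b + (x1 - z)\<^sup>2 / a \<le> springs a b z x1 x2 x3 x4"
    and "(x2 - z)\<^sup>2 / b + (x4 - z)\<^sup>2 / b + (x3 - z)\<^sup>2 / a \<le> springs a b z x1 x2 x3 x4"
  using assms by (simp_all add: springs_def add_divide_distrib)

lemma cell_scale_simps:
  "cell_scale \<kappa> (k, k) = 1" "cell_scale \<kappa> (4, -4) = \<kappa>" "cell_scale \<kappa> (-4, 4) = \<kappa>"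
  "cell_scale \<kappa> (1, -1) = 1" "cell_scale \<kappa> (2, -2) = 1" "cell_scale \<kappa> (3, -3) = 1"
  "cell_scale \<kappa> (-1, 1) = 1" "cell_scale \<kappa> (-2, 2) = 1" "cell_scale \<kappa> (-3, 3) = 1"
  "cell_scale \<kappa> (3, -1) = 1" "cell_scale \<kappa> (4, -2) = 1" "cell_scale \<kappa> (1, -3) = 1" "cell_scale \<kappa> (2, -4) = 1"
  "cell_scale \<kappa> (-3, 1) = 1" "cell_scale \<kappa> (-4, 2) = 1" "cell_scale \<kappa> (-1, 3) = 1" "cell_scale \<kappa> (-2, 4) = 1"
  by (auto simp: cell_scale_def)

text \<open>Dropping from each star the arms that carry no current for any values on the corners leaves four
  branches of resistors in series and parallel between the central potential \<open>z\<close> and the corners.\<close>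

lemma level1_energy_lower:
  assumes a: "0 < a" and b: "0 < b" and \<kappa>: "0 < \<kappa>"
  shows "star_energy (9 * a) (renorm \<kappa> a b) f \<le> level1_energy lr ul \<kappa> a b f"
proof -
  define g where "g s d = f (vt s d)" for s d
  note ab = a b
  have kb: "0 < \<kappa> * a" "0 < \<kappa> * b" using a b \<kappa> by auto
  define E where "E c = star_energy (cell_scale \<kappa> c * a) (cell_scale \<kappa> c * b) (f \<circ> cell_map c)" for c
  have E: "E (i, j) = star4 (cell_scale \<kappa> (i, j) * a) (cell_scale \<kappa> (i, j) * b) (g (i + j - 1) (i - j)) (g (i + j) (i - j + 1))
               (g (i + j + 1) (i - j)) (g (i + j) (i - j - 1))" for i j
    by (simp add: E_def cell_energy g_def)
  have att: "\<exists>z. E (i, j) = springs a b z (g (i + j - 1) (i - j)) (g (i + j) (i - j + 1))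
               (g (i + j + 1) (i - j)) (g (i + j) (i - j - 1))" if "cell_scale \<kappa> (i, j) = 1" for i j
  proof -
    obtain z where "star4 a b (g (i + j - 1) (i - j)) (g (i + j) (i - j + 1)) (g (i + j + 1) (i - j)) (g (i + j) (i - j - 1)) =
      springs a b z (g (i + j - 1) (i - j)) (g (i + j) (i - j + 1)) (g (i + j + 1) (i - j)) (g (i + j) (i - j - 1))"
      by (rule star4_attained[OF ab])
    then show ?thesis using that E[of i j] by auto
  qed
  note th = star4_ge_through
  have c: "(x - y)\<^sup>2 = (y - x)\<^sup>2" for x y :: real by (rule power2_commute)
  obtain z where "E (0, 0) = springs a b z (g (-1) 0) (g 0 1) (g 1 0) (g 0 (-1))"
    using att[of 0 0] by (auto simp: cell_scale_simps)
  then have E0: "E (0, 0) = (g (-1) 0 - z)\<^sup>2 / a + (g 1 0 - z)\<^sup>2 / a + (g 0 1 - z)\<^sup>2 / b + (g 0 (-1) - z)\<^sup>2 / b"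
    by (simp add: springs_def add_divide_distrib)
  have D: "(g (2 * k + 1) 0 - g (2 * k - 1) 0)\<^sup>2 / (2 * a) \<le> E (k, k)" for k
    using th(1)[OF ab, of "g (2 * k - 1) 0" "g (2 * k + 1) 0"] E[of k k] c[of "g (2 * k + 1) 0" "g (2 * k - 1) 0"]
    by (simp add: cell_scale_simps)
  have D1: "(g 3 0 - g 1 0)\<^sup>2 / (2 * a) \<le> E (1, 1)" "(g 5 0 - g 3 0)\<^sup>2 / (2 * a) \<le> E (2, 2)"
    "(g 7 0 - g 5 0)\<^sup>2 / (2 * a) \<le> E (3, 3)" "(g 9 0 - g 7 0)\<^sup>2 / (2 * a) \<le> E (4, 4)"
    using D[of 1] D[of 2] D[of 3] D[of 4] by simp_all
  have D3: "(g (-3) 0 - g (-1) 0)\<^sup>2 / (2 * a) \<le> E (-1, -1)" "(g (-5) 0 - g (-3) 0)\<^sup>2 / (2 * a) \<le> E (-2, -2)"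
    "(g (-7) 0 - g (-5) 0)\<^sup>2 / (2 * a) \<le> E (-3, -3)" "(g (-9) 0 - g (-7) 0)\<^sup>2 / (2 * a) \<le> E (-4, -4)"
    using th(1)[OF ab, of "g (-3) 0" "g (-1) 0"] th(1)[OF ab, of "g (-5) 0" "g (-3) 0"]
      th(1)[OF ab, of "g (-7) 0" "g (-5) 0"] th(1)[OF ab, of "g (-9) 0" "g (-7) 0"]
      E[of "-1" "-1"] E[of "-2" "-2"] E[of "-3" "-3"] E[of "-4" "-4"] by (simp_all add: cell_scale_simps)
  have A3: "(g 9 0 - z)\<^sup>2 / (9 * a) \<le> (g 1 0 - z)\<^sup>2 / a + (E (1, 1) + E (2, 2) + E (3, 3) + E (4, 4))"
    by (rule order_trans[OF straight_arm[OF a, of "g 9 0" z "g 1 0" "g 3 0" "g 5 0" "g 7 0"]]) (intro add_mono order_refl D1)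
  have A1: "(g (-9) 0 - z)\<^sup>2 / (9 * a) \<le> (g (-1) 0 - z)\<^sup>2 / a + (E (-1, -1) + E (-2, -2) + E (-3, -3) + E (-4, -4))"
    by (rule order_trans[OF straight_arm[OF a, of "g (-9) 0" z "g (-1) 0" "g (-3) 0" "g (-5) 0" "g (-7) 0"]]) (intro add_mono order_refl D3)
  have A2: "(g 0 9 - z)\<^sup>2 / renorm \<kappa> a b \<le> (g 0 1 - z)\<^sup>2 / b + (E (1, -1) + E (2, -2) + E (3, -3) + E (4, -4) +
      (if lr then E (3, -1) + E (4, -2) else E (1, -3) + E (2, -4)))"
  proof -
    have e1: "(g 0 3 - g 0 1)\<^sup>2 / (2 * b) \<le> E (1, -1)"
      using th(2)[OF ab, of "g 0 3" "g 0 1"] E[of 1 "-1"] by (simp add: cell_scale_simps)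
    have e4: "(g 0 9 - g 0 7)\<^sup>2 / (2 * (\<kappa> * b)) \<le> E (4, -4)"
      using th(2)[OF kb, of "g 0 9" "g 0 7"] E[of 4 "-4"] by (simp add: cell_scale_simps)
    obtain z2 where z2: "E (2, -2) = springs a b z2 (g (-1) 4) (g 0 5) (g 1 4) (g 0 3)"
      using att[of 2 "-2"] by (auto simp: cell_scale_simps)
    obtain z3 where z3: "E (3, -3) = springs a b z3 (g (-1) 6) (g 0 7) (g 1 6) (g 0 5)"
      using att[of 3 "-3"] by (auto simp: cell_scale_simps)
    note s2 = springs_ge_three[OF ab, where z=z2 and ?x2.0="g 0 5" and ?x4.0="g 0 3" and ?x1.0="g (-1) 4" and ?x3.0="g 1 4", folded z2]
      springs_ge_three[OF ab, where z=z3 and ?x2.0="g 0 7" and ?x4.0="g 0 5" and ?x1.0="g (-1) 6" and ?x3.0="g 1 6", folded z3]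
    note l = loop_arm[OF a b \<kappa>, where z=z and x="g 0 9" and ?y1.0="g 0 1" and ?y3.0="g 0 3" and ?y5.0="g 0 5"
        and ?y7.0="g 0 7" and ?z2.0=z2 and ?z3.0=z3]
    show ?thesis
    proof (cases lr)
      case True
      have "(g 2 5 - g 1 4)\<^sup>2 / (a + b) \<le> E (3, -1)" "(g 1 6 - g 2 5)\<^sup>2 / (a + b) \<le> E (4, -2)"
        using th(3)[OF ab, of "g 1 4" "g 2 5"] th(4)[OF ab, of "g 1 6" "g 2 5"] E[of 3 "-1"] E[of 4 "-2"]
          c[of "g 2 5" "g 1 4"] by (simp_all add: cell_scale_simps)
      then show ?thesis
        using s2 e1 e4 l[where ?h4.0="g 1 4" and ?h5.0="g 2 5" and ?h6.0="g 1 6"]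
        unfolding if_P[OF True] by linarith
    next
      case False
      have "(g (-2) 5 - g (-1) 4)\<^sup>2 / (a + b) \<le> E (1, -3)" "(g (-1) 6 - g (-2) 5)\<^sup>2 / (a + b) \<le> E (2, -4)"
        using th(5)[OF ab, of "g (-1) 4" "g (-2) 5"] th(6)[OF ab, of "g (-1) 6" "g (-2) 5"] E[of 1 "-3"] E[of 2 "-4"]
          c[of "g (-2) 5" "g (-1) 4"] by (simp_all add: cell_scale_simps)
      then show ?thesis
        using s2 e1 e4 l[where ?h4.0="g (-1) 4" and ?h5.0="g (-2) 5" and ?h6.0="g (-1) 6"]
        unfolding if_not_P[OF False] by linarith
    qed
  qed
  have A4: "(g 0 (-9) - z)\<^sup>2 / renorm \<kappa> a b \<le> (g 0 (-1) - z)\<^sup>2 / b + (E (-1, 1) + E (-2, 2) + E (-3, 3) + E (-4, 4) +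
      (if ul then E (-3, 1) + E (-4, 2) else E (-1, 3) + E (-2, 4)))"
  proof -
    have e1: "(g 0 (-3) - g 0 (-1))\<^sup>2 / (2 * b) \<le> E (-1, 1)"
      using th(2)[OF ab, of "g 0 (-1)" "g 0 (-3)"] E[of "-1" 1] c[of "g 0 (-1)"] by (simp add: cell_scale_simps)
    have e4: "(g 0 (-9) - g 0 (-7))\<^sup>2 / (2 * (\<kappa> * b)) \<le> E (-4, 4)"
      using th(2)[OF kb, of "g 0 (-7)" "g 0 (-9)"] E[of "-4" 4] c[of "g 0 (-7)"] by (simp add: cell_scale_simps)
    obtain z2 where z2: "E (-2, 2) = springs a b z2 (g (-1) (-4)) (g 0 (-3)) (g 1 (-4)) (g 0 (-5))"
      using att[of "-2" 2] by (auto simp: cell_scale_simps)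
    obtain z3 where z3: "E (-3, 3) = springs a b z3 (g (-1) (-6)) (g 0 (-5)) (g 1 (-6)) (g 0 (-7))"
      using att[of "-3" 3] by (auto simp: cell_scale_simps)
    note s2 = springs_ge_three[OF ab, where z=z2 and ?x2.0="g 0 (-3)" and ?x4.0="g 0 (-5)" and ?x1.0="g (-1) (-4)" and ?x3.0="g 1 (-4)", folded z2]
      springs_ge_three[OF ab, where z=z3 and ?x2.0="g 0 (-5)" and ?x4.0="g 0 (-7)" and ?x1.0="g (-1) (-6)" and ?x3.0="g 1 (-6)", folded z3]
    note l = loop_arm[OF a b \<kappa>, where z=z and x="g 0 (-9)" and ?y1.0="g 0 (-1)" and ?y3.0="g 0 (-3)" and ?y5.0="g 0 (-5)"
        and ?y7.0="g 0 (-7)" and ?z2.0=z2 and ?z3.0=z3]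
    show ?thesis
    proof (cases ul)
      case True
      have "(g (-2) (-5) - g (-1) (-4))\<^sup>2 / (a + b) \<le> E (-3, 1)" "(g (-1) (-6) - g (-2) (-5))\<^sup>2 / (a + b) \<le> E (-4, 2)"
        using th(6)[OF ab, of "g (-1) (-4)" "g (-2) (-5)"] th(5)[OF ab, of "g (-1) (-6)" "g (-2) (-5)"] E[of "-3" 1] E[of "-4" 2]
          c[of "g (-2) (-5)" "g (-1) (-4)"] by (simp_all add: cell_scale_simps)
      then show ?thesis
        using s2 e1 e4 l[where ?h4.0="g (-1) (-4)" and ?h5.0="g (-2) (-5)" and ?h6.0="g (-1) (-6)"]
        unfolding if_P[OF True] by linarith
    next
      case False
      have "(g 2 (-5) - g 1 (-4))\<^sup>2 / (a + b) \<le> E (-1, 3)" "(g 1 (-6) - g 2 (-5))\<^sup>2 / (a + b) \<le> E (-2, 4)"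
        using th(4)[OF ab, of "g 1 (-4)" "g 2 (-5)"] th(3)[OF ab, of "g 1 (-6)" "g 2 (-5)"] E[of "-1" 3] E[of "-2" 4]
          c[of "g 2 (-5)" "g 1 (-4)"] by (simp_all add: cell_scale_simps)
      then show ?thesis
        using s2 e1 e4 l[where ?h4.0="g 1 (-4)" and ?h5.0="g 2 (-5)" and ?h6.0="g 1 (-6)"]
        unfolding if_not_P[OF False] by linarith
    qed
  qed
  have "star_energy (9 * a) (renorm \<kappa> a b) f = star4 (9 * a) (renorm \<kappa> a b) (g (-9) 0) (g 0 9) (g 9 0) (g 0 (-9))"
    unfolding star_energy_eq corner_vt g_def ..
  also have "\<dots> \<le> springs (9 * a) (renorm \<kappa> a b) z (g (-9) 0) (g 0 9) (g 9 0) (g 0 (-9))"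
    using a renorm_pos[OF a b \<kappa>] by (intro star4_le_springs) auto
  also have "\<dots> = (g (-9) 0 - z)\<^sup>2 / (9 * a) + (g 9 0 - z)\<^sup>2 / (9 * a) + (g 0 9 - z)\<^sup>2 / renorm \<kappa> a b + (g 0 (-9) - z)\<^sup>2 / renorm \<kappa> a b"
    by (simp add: springs_def add_divide_distrib)
  also have "\<dots> \<le> level1_energy lr ul \<kappa> a b f"
    unfolding level1_energy_def E_def[symmetric] sum_cross_cells
    using A1 A2 A3 A4 E0 by linarith
  finally show ?thesis .
qed

text \<open>The potential, relative to the centre of the square, of the vertex at position \<open>(s, d)\<close> of the arm
  of \<open>p\<^sub>2\<close> when a unit current flows along the arm; \<open>s > 0\<close> on the side of the eyebolt. The fraction \<open>h\<close> of the
  current takes the detour, and \<open>L\<close> is the potential difference between the two ends of the loop.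
  Vertices through which no current flows have the potential of the centre of their cell.\<close>

definition arm_potential :: "real \<Rightarrow> real \<Rightarrow> real \<Rightarrow> int \<Rightarrow> int \<Rightarrow> real" where
  "arm_potential \<kappa> a b s d =
    (let h = b / (2 * (a + b)); L = 2 * h * (2 * a + b) in
     if s = 1 \<and> d = 4 then 4 * b + a * h
     else if s = 1 \<and> d = 6 then 4 * b + L - a * h
     else if s \<ge> 2 \<and> d \<le> 4 then 4 * b + 2 * a * h
     else if s \<ge> 2 \<and> d \<ge> 6 then 4 * b + L - 2 * a * h
     else if d \<le> 4 then of_int d * b
     else if d = 5 then 4 * b + L / 2
     else if d = 6 then 4 * b + L
     else if d = 7 then 5 * b + L
     else if d = 8 then 5 * b + \<kappa> * b + L
     else 5 * b + 2 * \<kappa> * b + L)"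

lemma renorm_eq_loop:
  assumes "0 < a" "0 < b"
  defines "h \<equiv> b / (2 * (a + b))"
  shows "renorm \<kappa> a b = 5 * b + 2 * \<kappa> * b + 2 * h * (2 * a + b)"
proof -
  have ab: "a + b \<noteq> 0" using assms by simp
  have "2 * h = b / (a + b)" using assms by (simp add: h_def divide_simps)
  then have "2 * h * (2 * a + b) = b * (2 * a + b) / (a + b)" by simp
  also have "\<dots> = b * (2 - b / (a + b))" using ab by (simp add: field_simps)
  finally show ?thesis by (simp add: renorm_def algebra_simps)
qed

lemma star4_affine_le:
  assumes "0 < a" "0 < b"
  shows "star4 a b (z + J * r1) (z + J * r2) (z + J * r3) (z + J * r4) \<le> J\<^sup>2 * springs a b r r1 r2 r3 r4"
proof -
  have e: "(z + J * s - (z + J * r))\<^sup>2 = J\<^sup>2 * (s - r)\<^sup>2" for s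
    by (simp add: power_mult_distrib[symmetric] right_diff_distrib)
  have "springs a b (z + J * r) (z + J * r1) (z + J * r2) (z + J * r3) (z + J * r4) = J\<^sup>2 * springs a b r r1 r2 r3 r4"
    unfolding springs_def e by (simp add: distrib_left add_divide_distrib)
  then show ?thesis using star4_le_springs[OF assms] by metis
qed

lemma star4_swap13: "star4 a b x1 x2 x3 x4 = star4 a b x3 x2 x1 x4"
  and star4_swap24: "star4 a b x1 x2 x3 x4 = star4 a b x1 x4 x3 x2"
  by (simp_all add: star4_def power2_commute[of x1 x3] power2_commute[of x2 x4] add_ac)

text \<open>The energy of the current \<open>J\<close> in an arm without the half of the central cell. The eyebolt lies on the
  side \<open>s > 0\<close> if \<open>\<sigma>\<close> holds.\<close>

lemma loop_arm_upper:
  fixes G :: "int \<Rightarrow> int \<Rightarrow> real"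
  assumes a: "0 < a" and b: "0 < b" and \<kappa>: "0 < \<kappa>"
    and G: "\<And>s d. d \<ge> 2 \<or> s = 0 \<and> d = 1 \<Longrightarrow> G s d = z + J * arm_potential \<kappa> a b (if (s > 0) = \<sigma> then \<bar>s\<bar> else 0) d"
  defines "C k S D \<equiv> star4 (k * a) (k * b) (G (S - 1) D) (G S (D + 1)) (G (S + 1) D) (G S (D - 1))"
  shows "C 1 0 2 + C 1 0 4 + C 1 0 6 + C \<kappa> 0 8 + (if \<sigma> then C 1 2 4 + C 1 2 6 else C 1 (-2) 4 + C 1 (-2) 6)
    \<le> J\<^sup>2 * (renorm \<kappa> a b - b)"
proof -
  define h where "h = b / (2 * (a + b))"
  define L where "L = 2 * h * (2 * a + b)"
  let ?R = "\<lambda>s d. arm_potential \<kappa> a b (if (s > 0) = \<sigma> then \<bar>s\<bar> else 0) d"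
  have R: "arm_potential \<kappa> a b s d =
    (if s = 1 \<and> d = 4 then 4 * b + a * h
     else if s = 1 \<and> d = 6 then 4 * b + L - a * h
     else if s \<ge> 2 \<and> d \<le> 4 then 4 * b + 2 * a * h
     else if s \<ge> 2 \<and> d \<ge> 6 then 4 * b + L - 2 * a * h
     else if d \<le> 4 then of_int d * b
     else if d = 5 then 4 * b + L / 2
     else if d = 6 then 4 * b + L
     else if d = 7 then 5 * b + L
     else if d = 8 then 5 * b + \<kappa> * b + L
     else 5 * b + 2 * \<kappa> * b + L)" for s d
    by (simp add: arm_potential_def Let_def h_def L_def)
  have bound: "C k S D \<le> J\<^sup>2 * springs (k * a) (k * b) r (?R (S - 1) D) (?R S (D + 1)) (?R (S + 1) D) (?R S (D - 1))"
    if "0 < k" "3 \<le> D \<or> (S = 0 \<and> D = 2)" for k S D r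
  proof -
    have d: "2 \<le> D \<or> S - 1 = 0 \<and> D = 1" "2 \<le> D + 1 \<or> S = 0 \<and> D + 1 = 1"
      "2 \<le> D \<or> S + 1 = 0 \<and> D = 1" "2 \<le> D - 1 \<or> S = 0 \<and> D - 1 = 1"
      using that(2) by linarith+
    show ?thesis unfolding C_def G[OF d(1)] G[OF d(2)] G[OF d(3)] G[OF d(4)]
      using a b that(1) by (intro star4_affine_le) simp_all
  qed
  have c1: "C 1 0 2 \<le> J\<^sup>2 * (2 * b)"
    using bound[of 1 2 0 "2 * b"] b by (cases \<sigma>) (simp_all add: R springs_def power2_eq_square)
  have c2: "C 1 0 4 \<le> J\<^sup>2 * (a * h\<^sup>2 + (L / 2)\<^sup>2 / b + b)"
    using bound[of 1 4 0 "4 * b"] a b by (cases \<sigma>) (simp_all add: R springs_def power2_eq_square add_divide_distrib add_ac mult_ac)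
  have c3: "C 1 0 6 \<le> J\<^sup>2 * (a * h\<^sup>2 + (L / 2)\<^sup>2 / b + b)"
    using bound[of 1 6 0 "4 * b + L"] a b by (cases \<sigma>) (simp_all add: R springs_def power2_eq_square add_divide_distrib add_ac mult_ac)
  have c4: "C \<kappa> 0 8 \<le> J\<^sup>2 * (2 * \<kappa> * b)"
    using bound[of \<kappa> 8 0 "5 * b + \<kappa> * b + L"] b \<kappa> by (cases \<sigma>) (simp_all add: R springs_def power2_eq_square)
  have e: "(if \<sigma> then C 1 2 4 + C 1 2 6 else C 1 (-2) 4 + C 1 (-2) 6) \<le> J\<^sup>2 * (2 * (a * h\<^sup>2 + (L / 2 - 2 * a * h)\<^sup>2 / b))"
  proof (cases \<sigma>)
    case True
    have "C 1 2 4 \<le> J\<^sup>2 * (a * h\<^sup>2 + (L / 2 - 2 * a * h)\<^sup>2 / b)" "C 1 2 6 \<le> J\<^sup>2 * (a * h\<^sup>2 + (L / 2 - 2 * a * h)\<^sup>2 / b)"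
      using bound[of 1 4 2 "4 * b + 2 * a * h"] bound[of 1 6 2 "4 * b + L - 2 * a * h"] a b True
      by (simp_all add: R springs_def power2_eq_square power2_commute[of "2 * a * h" "L/2"] algebra_simps)
    then show ?thesis using True by (simp add: algebra_simps)
  next
    case False
    have "C 1 (-2) 4 \<le> J\<^sup>2 * (a * h\<^sup>2 + (L / 2 - 2 * a * h)\<^sup>2 / b)" "C 1 (-2) 6 \<le> J\<^sup>2 * (a * h\<^sup>2 + (L / 2 - 2 * a * h)\<^sup>2 / b)"
      using bound[of 1 4 "-2" "4 * b + 2 * a * h"] bound[of 1 6 "-2" "4 * b + L - 2 * a * h"] a b False
      by (simp_all add: R springs_def power2_eq_square algebra_simps)
    then show ?thesis using False by (simp add: algebra_simps)
  qed
  have bh: "L / 2 - 2 * a * h = b * h" by (simp add: L_def algebra_simps)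
  have "2 * b + 2 * (a * h\<^sup>2 + (L / 2)\<^sup>2 / b + b) + 2 * \<kappa> * b + 2 * (a * h\<^sup>2 + (b * h)\<^sup>2 / b) =
      4 * b + 2 * \<kappa> * b + (4 * a * h\<^sup>2 + 2 * b * h\<^sup>2 + 2 * (h * (2 * a + b))\<^sup>2 / b)"
    using b by (simp add: L_def power2_eq_square)
  also have "2 * (h * (2 * a + b))\<^sup>2 / b = 2 * h\<^sup>2 * (2 * a + b) * ((2 * a + b) / b)"
    by (simp add: power2_eq_square)
  also have "4 * a * h\<^sup>2 + 2 * b * h\<^sup>2 + 2 * h\<^sup>2 * (2 * a + b) * ((2 * a + b) / b) =
      2 * h * (2 * a + b) * (h * (1 + (2 * a + b) / b))"
    by (simp add: algebra_simps power2_eq_square)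
  also have "h * (1 + (2 * a + b) / b) = 1"
    using a b by (simp add: h_def divide_simps) 
  finally have sum: "2 * b + 2 * (a * h\<^sup>2 + (L / 2)\<^sup>2 / b + b) + 2 * \<kappa> * b + 2 * (a * h\<^sup>2 + (b * h)\<^sup>2 / b)
      = renorm \<kappa> a b - b"
    by (simp add: renorm_eq_loop[OF a b] h_def)
  define X where "X = a * h\<^sup>2 + (L / 2)\<^sup>2 / b + b"
  define Y where "Y = a * h\<^sup>2 + (b * h)\<^sup>2 / b"
  have "C 1 0 2 + C 1 0 4 + C 1 0 6 + C \<kappa> 0 8 + (if \<sigma> then C 1 2 4 + C 1 2 6 else C 1 (-2) 4 + C 1 (-2) 6)
      \<le> J\<^sup>2 * (2 * b) + J\<^sup>2 * X + J\<^sup>2 * X + J\<^sup>2 * (2 * \<kappa> * b) + J\<^sup>2 * (2 * Y)"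
    using c1 c2 c3 c4 e unfolding bh X_def[symmetric] Y_def[symmetric] by linarith
  also have "\<dots> = J\<^sup>2 * (2 * b + 2 * X + 2 * \<kappa> * b + 2 * Y)" by (simp add: algebra_simps)
  finally have "C 1 0 2 + C 1 0 4 + C 1 0 6 + C \<kappa> 0 8 + (if \<sigma> then C 1 2 4 + C 1 2 6 else C 1 (-2) 4 + C 1 (-2) 6)
      \<le> J\<^sup>2 * (2 * b + 2 * X + 2 * \<kappa> * b + 2 * Y)" .
  then show ?thesis unfolding X_def Y_def sum .
qed

text \<open>The potential with value \<open>z\<close> at the centre and values \<open>x1, \<dots>, x4\<close> at the corners, in diagonal
  coordinates.\<close>

definition level1_ext :: "bool \<Rightarrow> bool \<Rightarrow> real \<Rightarrow> real \<Rightarrow> real \<Rightarrow> real \<Rightarrow> real \<Rightarrow> real \<Rightarrow> real \<Rightarrow> real \<Rightarrow> int \<Rightarrow> int \<Rightarrow> real" where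
  "level1_ext lr ul \<kappa> a b z x1 x2 x3 x4 s d =
    (if \<bar>d\<bar> \<le> 1 \<and> s \<noteq> 0 then z + (if s > 0 then (x3 - z) / 9 else (z - x1) / 9) * of_int s
     else if d > 0 then z + (x2 - z) / renorm \<kappa> a b * arm_potential \<kappa> a b (if (s > 0) = lr then \<bar>s\<bar> else 0) d
     else z + (x4 - z) / renorm \<kappa> a b * arm_potential \<kappa> a b (if (s < 0) = ul then \<bar>s\<bar> else 0) (- d))"

lemma floor_vt:
  "\<lfloor>9 * (fst (vt s d) + snd (vt s d))\<rfloor> = s" "\<lfloor>9 * (fst (vt s d) - snd (vt s d))\<rfloor> = d"
proof -
  have "9 * (fst (vt s d) + snd (vt s d)) = of_int s" "9 * (fst (vt s d) - snd (vt s d)) = of_int d"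
    by (simp_all add: vt_def field_simps)
  then show "\<lfloor>9 * (fst (vt s d) + snd (vt s d))\<rfloor> = s" "\<lfloor>9 * (fst (vt s d) - snd (vt s d))\<rfloor> = d"
    by (simp_all only: floor_of_int)
qed

definition of_diagonal_coords :: "(int \<Rightarrow> int \<Rightarrow> real) \<Rightarrow> point \<Rightarrow> real" where
  "of_diagonal_coords g x = g \<lfloor>9 * (fst x + snd x)\<rfloor> \<lfloor>9 * (fst x - snd x)\<rfloor>"

lemma of_diagonal_coords_vt [simp]: "of_diagonal_coords g (vt s d) = g s d"
  by (simp only: of_diagonal_coords_def floor_vt)

text \<open>When \<open>z\<close> is the centre potential of the reduced star, the currents in the four arms of the network
  dissipate the energy of the reduced star.\<close>

lemma level1_energy_upper:
  fixes f :: "point \<Rightarrow> real"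
  assumes a: "0 < a" and b: "0 < b" and \<kappa>: "0 < \<kappa>"
  shows "\<exists>v. (\<forall>p\<in>corners. v p = f p) \<and>
    level1_energy lr ul \<kappa> a b v \<le> star_energy (9 * a) (renorm \<kappa> a b) f"
proof -
  define x1 x2 x3 x4 where x: "x1 = f (vt (-9) 0)" "x2 = f (vt 0 9)" "x3 = f (vt 9 0)" "x4 = f (vt 0 (-9))"
  let ?R = "renorm \<kappa> a b"
  have R: "0 < ?R" by (rule renorm_pos[OF a b \<kappa>])
  obtain z where z: "star4 (9 * a) ?R x1 x2 x3 x4 = springs (9 * a) ?R z x1 x2 x3 x4"
    by (rule star4_attained[of "9 * a" ?R]) (use a R in auto)
  define g where "g = level1_ext lr ul \<kappa> a b z x1 x2 x3 x4"
  define J2 J4 where J: "J2 = (x2 - z) / ?R" "J4 = (x4 - z) / ?R"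
  have pot9: "arm_potential \<kappa> a b 0 9 = ?R"
    by (simp add: arm_potential_def Let_def renorm_eq_loop[OF a b])
  have gc: "g (-9) 0 = x1" "g 0 9 = x2" "g 9 0 = x3" "g 0 (-9) = x4"
  proof -
    have "z + (x - z) / ?R * ?R = x" for x using R by simp
    then show "g 0 9 = x2" "g 0 (-9) = x4"
      by (simp_all add: g_def level1_ext_def pot9 if_distrib[of abs] cong: if_cong)
  qed (simp_all add: g_def level1_ext_def diff_divide_distrib)
  define E where "E c = star_energy (cell_scale \<kappa> c * a) (cell_scale \<kappa> c * b) (of_diagonal_coords g \<circ> cell_map c)" for c
  have E: "E (i, j) = star4 (cell_scale \<kappa> (i, j) * a) (cell_scale \<kappa> (i, j) * b) (g (i + j - 1) (i - j)) (g (i + j) (i - j + 1))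
               (g (i + j + 1) (i - j)) (g (i + j) (i - j - 1))" for i j
    by (simp add: E_def cell_energy)
  define C where "C G k S D = star4 (k * a) (k * b) (G (S - 1) D) (G S (D + 1)) (G (S + 1) D) (G S (D - 1))" for G :: "int \<Rightarrow> int \<Rightarrow> real" and k S D
  have A2: "E (1, -1) + E (2, -2) + E (3, -3) + E (4, -4) + (if lr then E (3, -1) + E (4, -2) else E (1, -3) + E (2, -4))
      \<le> J2\<^sup>2 * (?R - b)"
  proof -
    have "C g 1 0 2 + C g 1 0 4 + C g 1 0 6 + C g \<kappa> 0 8 + (if lr then C g 1 2 4 + C g 1 2 6 else C g 1 (-2) 4 + C g 1 (-2) 6)
        \<le> J2\<^sup>2 * (?R - b)"
      unfolding C_def
    proof (rule loop_arm_upper[OF a b \<kappa>, where z=z])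
      fix s d :: int assume "d \<ge> 2 \<or> s = 0 \<and> d = 1"
      then show "g s d = z + J2 * arm_potential \<kappa> a b (if (s > 0) = lr then \<bar>s\<bar> else 0) d"
        by (simp add: g_def level1_ext_def J) auto
    qed
    then show ?thesis by (cases lr) (simp_all add: E C_def cell_scale_simps)
  qed
  have A4: "E (-1, 1) + E (-2, 2) + E (-3, 3) + E (-4, 4) + (if ul then E (-3, 1) + E (-4, 2) else E (-1, 3) + E (-2, 4))
      \<le> J4\<^sup>2 * (?R - b)"
  proof -
    define G where "G s d = g (- s) (- d)" for s d
    have sw: "star4 r t (G (S - 1) D) (G S (D + 1)) (G (S + 1) D) (G S (D - 1)) =
        star4 r t (g (- S - 1) (- D)) (g (- S) (- D + 1)) (g (- S + 1) (- D)) (g (- S) (- D - 1))" for r t S D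
      by (subst star4_swap13, subst star4_swap24) (simp add: G_def)
    have "C G 1 0 2 + C G 1 0 4 + C G 1 0 6 + C G \<kappa> 0 8 + (if ul then C G 1 2 4 + C G 1 2 6 else C G 1 (-2) 4 + C G 1 (-2) 6)
        \<le> J4\<^sup>2 * (?R - b)"
      unfolding C_def
    proof (rule loop_arm_upper[OF a b \<kappa>, where z=z])
      fix s d :: int assume "d \<ge> 2 \<or> s = 0 \<and> d = 1"
      then show "G s d = z + J4 * arm_potential \<kappa> a b (if (s > 0) = ul then \<bar>s\<bar> else 0) d"
        by (simp add: G_def g_def level1_ext_def J) auto
    qed
    then show ?thesis unfolding C_def sw by (cases ul) (simp_all add: E cell_scale_simps)
  qed
  have arm: "star4 a b (y - r) y (y + r) y \<le> 2 * (r\<^sup>2 / a)" for y r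
    using star4_le_springs[OF a b, where z=y and ?x1.0="y - r" and ?x2.0=y and ?x3.0="y + r" and ?x4.0=y]
    by (simp add: springs_def)
  have A3: "E (1, 1) + E (2, 2) + E (3, 3) + E (4, 4) \<le> 8 * (((x3 - z) / 9)\<^sup>2 / a)"
  proof -
    have "E (k, k) \<le> 2 * (((x3 - z) / 9)\<^sup>2 / a)" if "1 \<le> k" for k
    proof -
      define r where "r = (x3 - z) / 9"
      have "E (k, k) = star4 a b (z + r * (2 * of_int k) - r) (z + r * (2 * of_int k))
          (z + r * (2 * of_int k) + r) (z + r * (2 * of_int k))"
        using that by (simp add: E cell_scale_simps g_def level1_ext_def r_def[symmetric]) (simp add: algebra_simps)
      then show ?thesis using arm by (simp add: r_def)
    qed
    from this[of 1] this[of 2] this[of 3] this[of 4] show ?thesis by simp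
  qed
  have A1: "E (-1, -1) + E (-2, -2) + E (-3, -3) + E (-4, -4) \<le> 8 * (((z - x1) / 9)\<^sup>2 / a)"
  proof -
    have "E (k, k) \<le> 2 * (((z - x1) / 9)\<^sup>2 / a)" if "k \<le> -1" for k
    proof -
      define r where "r = (z - x1) / 9"
      have "E (k, k) = star4 a b (z + r * (2 * of_int k) - r) (z + r * (2 * of_int k))
          (z + r * (2 * of_int k) + r) (z + r * (2 * of_int k))"
        using that by (simp add: E cell_scale_simps g_def level1_ext_def r_def[symmetric]) (simp add: algebra_simps)
      then show ?thesis using arm by (simp add: r_def)
    qed
    from this[of "-1"] this[of "-2"] this[of "-3"] this[of "-4"] show ?thesis by simp
  qed
  have A0: "E (0, 0) \<le> ((z - x1) / 9)\<^sup>2 / a + ((x3 - z) / 9)\<^sup>2 / a + J2\<^sup>2 * b + J4\<^sup>2 * b"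
  proof -
    have pot1: "arm_potential \<kappa> a b 0 1 = b" by (simp add: arm_potential_def Let_def)
    have "g (-1) 0 = z - (z - x1) / 9" "g 1 0 = z + (x3 - z) / 9" "g 0 1 = z + J2 * b" "g 0 (-1) = z + J4 * b"
      by (simp_all add: g_def level1_ext_def J pot1 if_distrib[of abs] cong: if_cong)
    then have "E (0, 0) = star4 a b (z - (z - x1) / 9) (z + J2 * b) (z + (x3 - z) / 9) (z + J4 * b)"
      by (simp add: E cell_scale_simps)
    also have "\<dots> \<le> springs a b z (z - (z - x1) / 9) (z + J2 * b) (z + (x3 - z) / 9) (z + J4 * b)"
      by (rule star4_le_springs[OF a b])
    also have "\<dots> = ((z - x1) / 9)\<^sup>2 / a + ((x3 - z) / 9)\<^sup>2 / a + J2\<^sup>2 * b + J4\<^sup>2 * b"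
      using b by (simp add: springs_def power_mult_distrib add_divide_distrib power2_eq_square[of b] power2_commute[of x1 z])
    finally show ?thesis .
  qed
  have sq: "9 * (((z - x1) / 9)\<^sup>2 / a) = (x1 - z)\<^sup>2 / (9 * a)" "9 * (((x3 - z) / 9)\<^sup>2 / a) = (x3 - z)\<^sup>2 / (9 * a)"
    by (simp_all add: power_divide power2_commute[of z x1])
  have JR: "J2\<^sup>2 * ?R = (x2 - z)\<^sup>2 / ?R" "J4\<^sup>2 * ?R = (x4 - z)\<^sup>2 / ?R"
    using R by (simp_all add: J power_divide power2_eq_square[of ?R])
  have "level1_energy lr ul \<kappa> a b (of_diagonal_coords g) \<le>
      9 * (((z - x1) / 9)\<^sup>2 / a) + 9 * (((x3 - z) / 9)\<^sup>2 / a) + J2\<^sup>2 * ?R + J4\<^sup>2 * ?R"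
    unfolding level1_energy_def E_def[symmetric] sum_cross_cells
    using A0 A1 A2 A3 A4 unfolding right_diff_distrib by linarith
  also have "\<dots> = springs (9 * a) ?R z x1 x2 x3 x4"
    unfolding sq JR springs_def add_divide_distrib by simp
  also have "\<dots> = star_energy (9 * a) ?R f"
    unfolding star_energy_eq corner_vt x[symmetric] by (rule z[symmetric])
  finally have "level1_energy lr ul \<kappa> a b (of_diagonal_coords g) \<le> star_energy (9 * a) ?R f" .
  moreover have "\<forall>p\<in>corners. of_diagonal_coords g p = f p"
    unfolding corners_def corner_vt using gc by (simp add: x)
  ultimately show ?thesis by blast
qed

lemma abs_clamp_diff_le:
  fixes x y m M :: real
  shows "\<bar>max m (min M x) - max m (min M y)\<bar> \<le> \<bar>x - y\<bar>"
  by (auto simp: max_def min_def)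

lemma clamp_id: "m \<le> y \<Longrightarrow> y \<le> M \<Longrightarrow> max m (min M y) = (y :: real)"
  by simp

lemma star_energy_clamp:
  "0 < a \<Longrightarrow> 0 < b \<Longrightarrow> star_energy a b (\<lambda>x. max m (min M (f x))) \<le> star_energy a b f"
  by (intro star_energy_contraction abs_clamp_diff_le) auto

lemma cell_scale_pos: "0 < \<kappa> \<Longrightarrow> 0 < cell_scale \<kappa> c"
  by (simp add: cell_scale_def)

text \<open>Cutting the minimizer off at the extreme values on the corners does not increase its energy:
  the maximum principle.\<close>

lemma level1_minimizer:
  fixes f :: "point \<Rightarrow> real"
  assumes a: "0 < a" and b: "0 < b" and \<kappa>: "0 < \<kappa>" and f: "\<And>p. p \<in> corners \<Longrightarrow> m \<le> f p \<and> f p \<le> M"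
  shows "\<exists>v. (\<forall>p\<in>corners. v p = f p) \<and> (\<forall>x. m \<le> v x \<and> v x \<le> M) \<and>
    level1_energy lr ul \<kappa> a b v = star_energy (9 * a) (renorm \<kappa> a b) f"
proof -
  obtain v where v: "\<forall>p\<in>corners. v p = f p" "level1_energy lr ul \<kappa> a b v \<le> star_energy (9 * a) (renorm \<kappa> a b) f"
    using level1_energy_upper[OF a b \<kappa>] by blast
  define u where "u x = max m (min M (v x))" for x
  have u: "\<forall>p\<in>corners. u p = f p" using v(1) f by (simp add: u_def clamp_id)
  have "(1/2, 1/2) \<in> corners" by (simp add: corners_def)
  then have "m \<le> M" using f by force
  then have range: "\<forall>x. m \<le> u x \<and> u x \<le> M" by (auto simp: u_def)
  have "level1_energy lr ul \<kappa> a b u \<le> level1_energy lr ul \<kappa> a b v"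
    unfolding level1_energy_def
  proof (rule sum_mono)
    fix c
    have "u \<circ> cell_map c = (\<lambda>x. max m (min M ((v \<circ> cell_map c) x)))" by (auto simp: u_def)
    then show "star_energy (cell_scale \<kappa> c * a) (cell_scale \<kappa> c * b) (u \<circ> cell_map c)
        \<le> star_energy (cell_scale \<kappa> c * a) (cell_scale \<kappa> c * b) (v \<circ> cell_map c)"
      using a b cell_scale_pos[OF \<kappa>] star_energy_clamp[of _ _ m M "v \<circ> cell_map c"] by simp
  qed
  moreover have "star_energy (9 * a) (renorm \<kappa> a b) u \<le> level1_energy lr ul \<kappa> a b u"
    by (rule level1_energy_lower[OF a b \<kappa>])
  moreover have "star_energy (9 * a) (renorm \<kappa> a b) u = star_energy (9 * a) (renorm \<kappa> a b) f"
    by (rule star_energy_cong) (use u in auto)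
  ultimately show ?thesis using v(2) u range by (intro exI[of _ u]) auto
qed

text \<open>The degenerate case \<open>b = 0\<close>, in which the diagonal \<open>\<overline>p\<^sub>2\<overline>p\<^sub>4\<close> of every cell is a perfect conductor.
  Admissible functions agree at \<open>p\<^sub>2\<close> and \<open>p\<^sub>4\<close>; they are extended linearly along \<open>\<overline>p\<^sub>1\<overline>p\<^sub>3\<close> and by a
  constant along \<open>\<overline>p\<^sub>2\<overline>p\<^sub>4\<close>, and nine cells in series divide the energy by nine.\<close>

definition spine_energy :: "(point \<Rightarrow> real) \<Rightarrow> real" where
  "spine_energy f = (f (-1/2, -1/2) - f (1/2, -1/2))\<^sup>2 + (f (1/2, 1/2) - f (1/2, -1/2))\<^sup>2"

lemma spine_extension:
  fixes f :: "point \<Rightarrow> real"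
  assumes eq: "f (1/2, -1/2) = f (-1/2, 1/2)" and f: "\<And>p. p \<in> corners \<Longrightarrow> m \<le> f p \<and> f p \<le> M"
  shows "\<exists>v. (\<forall>p\<in>corners. v p = f p) \<and> (\<forall>x. m \<le> v x \<and> v x \<le> M) \<and>
    (\<forall>c\<in>cross_cells lr ul. v (cell_map c (1/2, -1/2)) = v (cell_map c (-1/2, 1/2))) \<and>
    (\<Sum>c\<in>cross_cells lr ul. spine_energy (v \<circ> cell_map c)) \<le> spine_energy f / 9"
proof -
  define x1 x2 x3 where x: "x1 = f (vt (-9) 0)" "x2 = f (vt 0 9)" "x3 = f (vt 9 0)"
  define g where "g s d = (if \<bar>d\<bar> \<le> 1 then x2 + (if s > 0 then (x3 - x2) / 9 else (x2 - x1) / 9) * of_int s else x2)" for s d :: int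
  define v where "v y = max m (min M (of_diagonal_coords g y))" for y
  have vg: "v (vt s d) = max m (min M (g s d))" for s d by (simp add: v_def)
  have "(1/2, 1/2) \<in> corners" by (simp add: corners_def)
  then have "m \<le> M" using f by force
  have x4: "f (vt 0 (-9)) = x2" using eq unfolding corner_vt x ..
  have gc: "g (-9) 0 = x1" "g 0 9 = x2" "g 9 0 = x3" "g 0 (-9) = x2"
    by (simp_all add: g_def field_simps)
  have "\<forall>p\<in>corners. of_diagonal_coords g p = f p"
    unfolding corners_def corner_vt using gc x4 by (simp add: x)
  then have v: "\<forall>p\<in>corners. v p = f p" using f by (simp add: v_def clamp_id)
  have range: "\<forall>x. m \<le> v x \<and> v x \<le> M" using \<open>m \<le> M\<close> by (auto simp: v_def)
  have sym: "g s (d + 1) = g s (d - 1)" if "s = 0 \<or> d = 0 \<or> \<bar>d\<bar> \<ge> 3" for s d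
    using that by (auto simp: g_def)
  have cells: "i + j = 0 \<or> i - j = 0 \<or> \<bar>i - j\<bar> \<ge> 3" if "(i, j) \<in> cross_cells lr ul" for i j
    using that by (auto simp: cross_cells_def split: if_splits)
  have cond: "\<forall>c\<in>cross_cells lr ul. v (cell_map c (1/2, -1/2)) = v (cell_map c (-1/2, 1/2))"
  proof
    fix c assume c: "c \<in> cross_cells lr ul"
    obtain i j where ij: "c = (i, j)" by fastforce
    show "v (cell_map c (1/2, -1/2)) = v (cell_map c (-1/2, 1/2))"
      unfolding ij cell_map_corners vg sym[OF cells[OF c[unfolded ij]]] ..
  qed
  define E where "E c = spine_energy (v \<circ> cell_map c)" for c
  have E: "E (i, j) \<le> (g (i + j - 1) (i - j) - g (i + j) (i - j + 1))\<^sup>2 + (g (i + j + 1) (i - j) - g (i + j) (i - j + 1))\<^sup>2" for i j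
    unfolding E_def spine_energy_def comp_apply cell_map_corners vg
    by (intro add_mono) (simp_all add: abs_le_square_iff[symmetric] abs_clamp_diff_le)
  have off: "E (i, j) \<le> 0" if "i - j \<ge> 2 \<or> i - j \<le> - 2" "i + j = 0 \<or> \<bar>i - j\<bar> \<ge> 3" for i j
    by (rule order_trans[OF E]) (use that in \<open>auto simp: g_def\<close>)
  have sq: "(q / 9)\<^sup>2 = q\<^sup>2 / 81" for q :: real by (simp add: power_divide)
  have pos: "E (k, k) \<le> 2 * ((x3 - x2)\<^sup>2 / 81)" if "1 \<le> k" for k
  proof -
    have e: "g (2 * k - 1) 0 - g (2 * k) 1 = - ((x3 - x2) / 9)" "g (2 * k + 1) 0 - g (2 * k) 1 = (x3 - x2) / 9"
      using that by (simp_all add: g_def field_simps)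
    have "E (k, k) \<le> (g (2 * k - 1) 0 - g (2 * k) 1)\<^sup>2 + (g (2 * k + 1) 0 - g (2 * k) 1)\<^sup>2"
      using E[of k k] by simp
    then show ?thesis unfolding e power2_minus sq by simp
  qed
  have neg: "E (k, k) \<le> 2 * ((x1 - x2)\<^sup>2 / 81)" if "k \<le> -1" for k
  proof -
    have e: "g (2 * k - 1) 0 - g (2 * k) 1 = (x1 - x2) / 9" "g (2 * k + 1) 0 - g (2 * k) 1 = - ((x1 - x2) / 9)"
      using that by (simp_all add: g_def field_simps)
    have "E (k, k) \<le> (g (2 * k - 1) 0 - g (2 * k) 1)\<^sup>2 + (g (2 * k + 1) 0 - g (2 * k) 1)\<^sup>2"
      using E[of k k] by simp
    then show ?thesis unfolding e power2_minus sq by simp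
  qed
  have zero: "E (0, 0) \<le> (x1 - x2)\<^sup>2 / 81 + (x3 - x2)\<^sup>2 / 81"
  proof -
    have e: "g (- 1) 0 - g 0 1 = (x1 - x2) / 9" "g 1 0 - g 0 1 = (x3 - x2) / 9"
      by (simp_all add: g_def field_simps)
    have "E (0, 0) \<le> (g (- 1) 0 - g 0 1)\<^sup>2 + (g 1 0 - g 0 1)\<^sup>2"
      using E[of 0 0] by simp
    then show ?thesis unfolding e sq by simp
  qed
  have "(\<Sum>c\<in>cross_cells lr ul. E c) \<le> 9 * ((x1 - x2)\<^sup>2 / 81) + 9 * ((x3 - x2)\<^sup>2 / 81)"
  proof -
    have u: "E (1, 1) + E (2, 2) + E (3, 3) + E (4, 4) \<le> 8 * ((x3 - x2)\<^sup>2 / 81)"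
      using pos[of 1] pos[of 2] pos[of 3] pos[of 4] by simp
    have d: "E (-1, -1) + E (-2, -2) + E (-3, -3) + E (-4, -4) \<le> 8 * ((x1 - x2)\<^sup>2 / 81)"
      using neg[of "-1"] neg[of "-2"] neg[of "-3"] neg[of "-4"] by simp
    have r: "E (1, -1) + E (2, -2) + E (3, -3) + E (4, -4) + (if lr then E (3, -1) + E (4, -2) else E (1, -3) + E (2, -4)) \<le> 0"
      using off[of 1 "-1"] off[of 2 "-2"] off[of 3 "-3"] off[of 4 "-4"] off[of 3 "-1"] off[of 4 "-2"] off[of 1 "-3"] off[of 2 "-4"]
      by simp
    have l: "E (-1, 1) + E (-2, 2) + E (-3, 3) + E (-4, 4) + (if ul then E (-3, 1) + E (-4, 2) else E (-1, 3) + E (-2, 4)) \<le> 0"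
      using off[of "-1" 1] off[of "-2" 2] off[of "-3" 3] off[of "-4" 4] off[of "-3" 1] off[of "-4" 2] off[of "-1" 3] off[of "-2" 4]
      by simp
    show ?thesis unfolding sum_cross_cells using u d r l zero by linarith
  qed
  also have "\<dots> = spine_energy f / 9"
    unfolding spine_energy_def corner_vt x by simp
  finally show ?thesis unfolding E_def using v range cond by blast
qed

text \<open>A function that is almost constant on every first-level cell is almost constant: every cell is
  joined to the corner cell \<open>(-4, -4)\<close> by a chain of at most nine cells.\<close>

lemma level1_chain:
  fixes f :: "point \<Rightarrow> real"
  assumes I: "I = cross_cells lr ul"
    and osc: "\<And>c p q. c \<in> I \<Longrightarrow> p \<in> corners \<Longrightarrow> q \<in> corners \<Longrightarrow> \<bar>f (cell_map c p) - f (cell_map c q)\<bar> \<le> \<delta>"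
    and c: "c \<in> I" and p: "p \<in> corners"
  shows "\<bar>f (cell_map c p) - f (-1/2, -1/2)\<bar> \<le> 10 * \<delta>"
proof -
  let ?p1 = "(-1/2, -1/2)::point" and ?p2 = "(1/2, -1/2)::point" and ?p3 = "(1/2, 1/2)::point" and ?p4 = "(-1/2, 1/2)::point"
  have pc: "?p1 \<in> corners" "?p2 \<in> corners" "?p3 \<in> corners" "?p4 \<in> corners" by (simp_all add: corners_def)
  \<comment> \<open>\<open>B n c\<close> holds for the \<open>n\<close>-th cell of a chain.\<close>
  define B where "B n c \<longleftrightarrow> (\<forall>p\<in>corners. \<bar>f (cell_map c p) - f ?p1\<bar> \<le> of_nat n * \<delta>)" for n :: nat and c
  have step: "B (Suc n) c'" if "B n c" "c' \<in> I" "p \<in> corners" "q \<in> corners" "cell_map c p = cell_map c' q" for n c c' p q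
    unfolding B_def
  proof
    fix r assume r: "r \<in> corners"
    have "\<bar>f (cell_map c p) - f ?p1\<bar> \<le> of_nat n * \<delta>" using that by (auto simp: B_def)
    moreover have "\<bar>f (cell_map c' r) - f (cell_map c' q)\<bar> \<le> \<delta>" by (rule osc) (use that r in auto)
    ultimately show "\<bar>f (cell_map c' r) - f ?p1\<bar> \<le> of_nat (Suc n) * \<delta>"
      using that(5) by (simp add: distrib_right)
  qed
  have d0: "0 \<le> \<delta>" using osc[OF c p p] by simp
  have mono: "B n c" if "B m c" "m \<le> n" for m n c
    using that d0 unfolding B_def by (meson mult_right_mono of_nat_mono order_trans)
  have inI: "(k, k) \<in> I" "(k, - k) \<in> I" if "\<bar>k\<bar> \<le> 4" for k
    using that unfolding I cross_cells_def by (cases "k = 0"; force)+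
  have b0: "B 1 (-4, -4)"
  proof -
    have "cell_map (-4, -4) ?p1 = ?p1" by (simp add: cell_map_def)
    then show ?thesis unfolding B_def using osc[OF inI(1)[of "-4"] _ pc(1)] by simp
  qed
  have up: "B (Suc n) (k + 1, k + 1)" if "B n (k, k)" "-4 \<le> k" "k < 4" for n k
    by (rule step[OF that(1) inI(1)[of "k + 1"] pc(3) pc(1)]) (unfold cell_map_corners, use that in \<open>simp_all add: algebra_simps\<close>)
  have right: "B (Suc n) (k + 1, - (k + 1))" if "B n (k, - k)" "-4 \<le> k" "k < 4" for n k
    by (rule step[OF that(1) inI(2)[of "k + 1"] pc(2) pc(4)]) (unfold cell_map_corners, use that in \<open>simp_all add: algebra_simps\<close>)
  have left: "B (Suc n) (k - 1, - (k - 1))" if "B n (k, - k)" "-4 < k" "k \<le> 4" for n k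
    by (rule step[OF that(1) inI(2)[of "k - 1"] pc(4) pc(2)]) (unfold cell_map_corners, use that in \<open>simp_all add: algebra_simps\<close>)
  have b3: "B 2 (-3, -3)" using up[OF b0] by (simp add: numeral_eq_Suc)
  have b2: "B 3 (-2, -2)" using up[OF b3] by (simp add: numeral_eq_Suc)
  have b1: "B 4 (-1, -1)" using up[OF b2] by (simp add: numeral_eq_Suc)
  have z: "B 5 (0, 0)" using up[OF b1] by (simp add: numeral_eq_Suc)
  have u1: "B 6 (1, 1)" using up[OF z] by (simp add: numeral_eq_Suc)
  have u2: "B 7 (2, 2)" using up[OF u1] by (simp add: numeral_eq_Suc)
  have u3: "B 8 (3, 3)" using up[OF u2] by (simp add: numeral_eq_Suc)
  have u4: "B 9 (4, 4)" using up[OF u3] by (simp add: numeral_eq_Suc)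
  have r1: "B 6 (1, -1)" using right[of 5 0] z by (simp add: numeral_eq_Suc)
  have r2: "B 7 (2, -2)" using right[of 6 1] r1 by (simp add: numeral_eq_Suc)
  have r3: "B 8 (3, -3)" using right[of 7 2] r2 by (simp add: numeral_eq_Suc)
  have r4: "B 9 (4, -4)" using right[of 8 3] r3 by (simp add: numeral_eq_Suc)
  have l1: "B 6 (-1, 1)" using left[of 5 0] z by (simp add: numeral_eq_Suc)
  have l2: "B 7 (-2, 2)" using left[of 6 "-1"] l1 by (simp add: numeral_eq_Suc)
  have l3: "B 8 (-3, 3)" using left[of 7 "-2"] l2 by (simp add: numeral_eq_Suc)
  have l4: "B 9 (-4, 4)" using left[of 8 "-3"] l3 by (simp add: numeral_eq_Suc)
  have e1: "B 9 (3, -1) \<and> B 9 (4, -2)" if lr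
  proof -
    have "B (Suc 7) (3, -1)" by (rule step[OF r2 _ pc(3) pc(1)]) (unfold cell_map_corners, use that in \<open>simp_all add: I cross_cells_def\<close>)
    moreover have "B (Suc 8) (4, -2)" by (rule step[OF r3 _ pc(3) pc(1)]) (unfold cell_map_corners, use that in \<open>simp_all add: I cross_cells_def\<close>)
    ultimately show ?thesis by (auto intro: mono)
  qed
  have e2: "B 9 (1, -3) \<and> B 9 (2, -4)" if "\<not> lr"
  proof -
    have "B (Suc 7) (1, -3)" by (rule step[OF r2 _ pc(1) pc(3)]) (unfold cell_map_corners, use that in \<open>simp_all add: I cross_cells_def\<close>)
    moreover have "B (Suc 8) (2, -4)" by (rule step[OF r3 _ pc(1) pc(3)]) (unfold cell_map_corners, use that in \<open>simp_all add: I cross_cells_def\<close>)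
    ultimately show ?thesis by (auto intro: mono)
  qed
  have e3: "B 9 (-3, 1) \<and> B 9 (-4, 2)" if ul
  proof -
    have "B (Suc 7) (-3, 1)" by (rule step[OF l2 _ pc(1) pc(3)]) (unfold cell_map_corners, use that in \<open>simp_all add: I cross_cells_def\<close>)
    moreover have "B (Suc 8) (-4, 2)" by (rule step[OF l3 _ pc(1) pc(3)]) (unfold cell_map_corners, use that in \<open>simp_all add: I cross_cells_def\<close>)
    ultimately show ?thesis by (auto intro: mono)
  qed
  have e4: "B 9 (-1, 3) \<and> B 9 (-2, 4)" if "\<not> ul"
  proof -
    have "B (Suc 7) (-1, 3)" by (rule step[OF l2 _ pc(3) pc(1)]) (unfold cell_map_corners, use that in \<open>simp_all add: I cross_cells_def\<close>)
    moreover have "B (Suc 8) (-2, 4)" by (rule step[OF l3 _ pc(3) pc(1)]) (unfold cell_map_corners, use that in \<open>simp_all add: I cross_cells_def\<close>)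
    ultimately show ?thesis by (auto intro: mono)
  qed
  have "B 10 c"
  proof -
    have diag: "B 10 (k, k)" "B 10 (k, - k)" if "\<bar>k\<bar> \<le> 4" for k
    proof -
      have "k \<in> {-4, -3, -2, -1, 0, 1, 2, 3, 4}" using that by auto
      then show "B 10 (k, k)" "B 10 (k, - k)"
        using b0 b1 b2 b3 z u1 u2 u3 u4 r1 r2 r3 r4 l1 l2 l3 l4 by (auto intro: mono)
    qed
    show ?thesis using c diag e1 e2 e3 e4 unfolding I cross_cells_def
      by (auto split: if_splits intro: mono)
  qed
  then show ?thesis using p by (auto simp: B_def)
qed

section \<open>Oscillation on cells\<close>

definition geom_const :: "real \<Rightarrow> real" where
  "geom_const l = (1 / (1 - 1 / sqrt l))\<^sup>2"

text \<open>Minkowski's inequality: the \<open>\<ell>\<^sup>2\<close> norm of the sum over \<open>m\<close> is at most the sum of the \<open>\<ell>\<^sup>2\<close> norms, a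
  geometric series with ratio \<open>1 / sqrt l\<close>.\<close>

lemma sum_squares_geometric:
  fixes d :: "nat \<Rightarrow> 'w \<Rightarrow> real"
  assumes W: "finite W" and l: "1 < l" and C: "0 \<le> C"
    and d0: "\<And>m w. w \<in> W \<Longrightarrow> 0 \<le> d m w"
    and d: "\<And>m. (\<Sum>w\<in>W. (d m w)\<^sup>2) \<le> C / l ^ m"
  shows "w \<in> W \<Longrightarrow> summable (\<lambda>m. d m w)"
    and "(\<Sum>w\<in>W. (\<Sum>m. d m w)\<^sup>2) \<le> C * geom_const l"
proof -
  let ?q = "1 / sqrt l"
  have q: "0 < ?q" "?q < 1" using l by (auto simp: real_less_rsqrt)
  have sq: "sqrt (C / l ^ m) = sqrt C * ?q ^ m" for m
    by (simp add: real_sqrt_divide real_sqrt_power power_divide)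
  have L: "L2_set (d m) W \<le> sqrt C * ?q ^ m" for m
    unfolding L2_set_def sq[symmetric] using d by (rule real_sqrt_le_mono)
  have gs: "summable (\<lambda>m. sqrt C * ?q ^ m)" using q by (intro summable_mult summable_geometric) simp
  have le: "d m w \<le> sqrt C * ?q ^ m" if "w \<in> W" for m w
  proof -
    have "d m w \<le> L2_set (d m) W" by (rule member_le_L2_set[OF W that])
    with L[of m] show ?thesis by linarith
  qed
  have sm: "summable (\<lambda>m. d m w)" if "w \<in> W" for w
    by (rule summable_comparison_test'[OF gs, of 0]) (use le[OF that] d0[OF that] in simp)
  then show "w \<in> W \<Longrightarrow> summable (\<lambda>m. d m w)" .
  have fin: "(\<Sum>w\<in>W. (\<Sum>m<M. d m w)\<^sup>2) \<le> C * geom_const l" for M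
  proof -
    have "L2_set (\<lambda>w. \<Sum>m<M. d m w) W \<le> (\<Sum>m<M. L2_set (d m) W)"
    proof (induction M)
      case (Suc M)
      have "L2_set (\<lambda>w. (\<Sum>m<M. d m w) + d M w) W \<le> L2_set (\<lambda>w. \<Sum>m<M. d m w) W + L2_set (d M) W"
        by (rule L2_set_triangle_ineq)
      with Suc show ?case by simp
    qed (simp add: L2_set_def)
    also have "\<dots> \<le> (\<Sum>m<M. sqrt C * ?q ^ m)" by (intro sum_mono L)
    also have "\<dots> \<le> (\<Sum>m. sqrt C * ?q ^ m)" using q C by (intro sum_le_suminf gs) auto
    also have "\<dots> = sqrt C * (1 / (1 - ?q))" using q by (subst suminf_mult) (auto simp: suminf_geometric intro: summable_geometric)
    finally have "(L2_set (\<lambda>w. \<Sum>m<M. d m w) W)\<^sup>2 \<le> (sqrt C * (1 / (1 - ?q)))\<^sup>2"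
      by (intro power_mono) (auto simp: L2_set_nonneg)
    then show ?thesis using C
      by (simp add: L2_set_def sum_nonneg power_mult_distrib power_divide geom_const_def)
  qed
  have "(\<lambda>M. \<Sum>w\<in>W. (\<Sum>m<M. d m w)\<^sup>2) \<longlonglongrightarrow> (\<Sum>w\<in>W. (\<Sum>m. d m w)\<^sup>2)"
    by (intro tendsto_sum tendsto_power summable_LIMSEQ sm)
  then show "(\<Sum>w\<in>W. (\<Sum>m. d m w)\<^sup>2) \<le> C * geom_const l"
    by (rule LIMSEQ_le_const2) (use fin in blast)
qed

definition cell_variation :: "(point \<Rightarrow> real) \<Rightarrow> cell list \<Rightarrow> real" where
  "cell_variation u w = (\<Sum>p\<in>corners. \<Sum>q\<in>corners. (u (word_map w p) - u (word_map w q))\<^sup>2)"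

lemma cell_variation_nonneg: "0 \<le> cell_variation u w"
  unfolding cell_variation_def by (intro sum_nonneg) auto

lemma cell_variation_ge:
  assumes "p \<in> corners" "q \<in> corners"
  shows "(u (word_map w p) - u (word_map w q))\<^sup>2 \<le> cell_variation u w"
proof -
  have "(u (word_map w p) - u (word_map w q))\<^sup>2 \<le> (\<Sum>q\<in>corners. (u (word_map w p) - u (word_map w q))\<^sup>2)"
    by (rule member_le_sum) (use assms in auto)
  also have "\<dots> \<le> cell_variation u w"
    unfolding cell_variation_def
    by (rule member_le_sum[of p corners "\<lambda>p. \<Sum>q\<in>corners. (u (word_map w p) - u (word_map w q))\<^sup>2"])
       (use assms in \<open>auto intro: sum_nonneg\<close>)
  finally show ?thesis .
qed

lemma cell_variation_le:
  assumes "\<And>p q. p \<in> corners \<Longrightarrow> q \<in> corners \<Longrightarrow> (u (word_map w p) - u (word_map w q))\<^sup>2 \<le> e"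
  shows "cell_variation u w \<le> 16 * e"
proof -
  have "cell_variation u w \<le> (\<Sum>p\<in>corners. \<Sum>q\<in>corners. e)"
    unfolding cell_variation_def by (intro sum_mono assms)
  also have "\<dots> = 16 * e" by (simp only: sum_corners)
  finally show ?thesis .
qed

context eyebolted_cross
begin

definition vertex_energy :: "nat \<Rightarrow> (point \<Rightarrow> real) \<Rightarrow> real" where
  "vertex_energy n u = (\<Sum>w\<in>words I n. cell_variation u w)"

text \<open>The difference of two values at the vertices of any subcell of \<open>w\<close> of relative level \<open>j\<close> is at most
  \<open>deviation u j w\<close>. Its square summed over all \<open>w\<close> of one level is a vertex energy, so that the bounds on single
  cells remain square summable. The factor in \<open>osc_bound\<close> is twice that of \<open>level1_chain\<close>.\<close>

definition deviation :: "(point \<Rightarrow> real) \<Rightarrow> nat \<Rightarrow> cell list \<Rightarrow> real" where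
  "deviation u j w = sqrt (\<Sum>v\<in>words I j. cell_variation u (w @ v))"

definition osc_bound :: "(point \<Rightarrow> real) \<Rightarrow> cell list \<Rightarrow> real" where
  "osc_bound u w = 20 * (\<Sum>j. deviation u j w)"

lemma deviation_nonneg: "0 \<le> deviation u j w"
  unfolding deviation_def by (intro real_sqrt_ge_zero sum_nonneg cell_variation_nonneg)

lemma vertex_energy_nonneg: "0 \<le> vertex_energy n u"
  unfolding vertex_energy_def by (intro sum_nonneg cell_variation_nonneg)

lemma sum_deviation: "(\<Sum>w\<in>words I n. (deviation u j w)\<^sup>2) = vertex_energy (n + j) u"
  unfolding deviation_def vertex_energy_def sum_words_append
  by (intro sum.cong refl) (simp add: sum_nonneg cell_variation_nonneg)

lemma deviation_ge:
  assumes "v \<in> words I j" "p \<in> corners" "q \<in> corners"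
  shows "\<bar>u (word_map (w @ v) p) - u (word_map (w @ v) q)\<bar> \<le> deviation u j w"
proof -
  have "(u (word_map (w @ v) p) - u (word_map (w @ v) q))\<^sup>2 \<le> cell_variation u (w @ v)"
    by (rule cell_variation_ge[OF assms(2,3)])
  also have "\<dots> \<le> (\<Sum>v\<in>words I j. cell_variation u (w @ v))"
    by (rule member_le_sum[of v _ "\<lambda>v. cell_variation u (w @ v)"]) (use assms cell_variation_nonneg in auto)
  finally show ?thesis unfolding deviation_def by (metis real_sqrt_abs real_sqrt_le_mono)
qed

text \<open>From \<open>w\<close> to \<open>w @ v\<close> one passes to a first-level subcell \<open>m\<close> times.\<close>

lemma vertex_oscillation:
  assumes "v \<in> words I m" "p \<in> corners"
  shows "\<bar>u (word_map (w @ v) p) - u (word_map w (-1/2, -1/2))\<bar> \<le> 10 * (\<Sum>j\<le>m. deviation u j w)"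
  using assms
proof (induction m arbitrary: v p)
  case 0
  have "\<bar>u (word_map (w @ []) p) - u (word_map (w @ []) (-1/2, -1/2))\<bar> \<le> deviation u 0 w"
    by (rule deviation_ge) (use 0 in \<open>auto simp: corners_def\<close>)
  with 0 deviation_nonneg[of u 0 w] show ?case by simp
next
  case (Suc m)
  obtain v' i where v: "v' \<in> words I m" "i \<in> I" "v = v' @ [i]" using Suc.prems(1) by (rule words_snocE)
  define f where "f x = u (word_map (w @ v') x)" for x
  have "\<bar>f (cell_map i p) - f (-1/2, -1/2)\<bar> \<le> 10 * deviation u (Suc m) w"
  proof (rule level1_chain[OF I _ v(2) Suc.prems(2)])
    fix c p q assume c: "c \<in> I" "p \<in> corners" "q \<in> corners"
    have "\<bar>u (word_map (w @ (v' @ [c])) p) - u (word_map (w @ (v' @ [c])) q)\<bar> \<le> deviation u (Suc m) w"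
      by (rule deviation_ge) (use c v words_snoc in auto)
    then show "\<bar>f (cell_map c p) - f (cell_map c q)\<bar> \<le> deviation u (Suc m) w"
      by (simp add: f_def word_map_append)
  qed
  moreover have "f (cell_map i p) = u (word_map (w @ v) p)" by (simp add: f_def v word_map_append)
  moreover have "\<bar>f (-1/2, -1/2) - u (word_map w (-1/2, -1/2))\<bar> \<le> 10 * (\<Sum>j\<le>m. deviation u j w)"
    unfolding f_def by (rule Suc.IH[OF v(1)]) (simp add: corners_def)
  ultimately show ?case by simp
qed

lemma corners_in_all_vertices: "corners \<subseteq> all_vertices"
proof -
  have "vertices I 0 \<subseteq> all_vertices" unfolding all_vertices_def by blast
  then show ?thesis by simp
qed

lemma all_verticesE:
  assumes "x \<in> all_vertices"
  obtains m v p where "v \<in> words I m" "p \<in> corners" "x = word_map v p"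
  using assms unfolding all_vertices_def vertices_eq by blast

lemma word_map_vertex: "v \<in> words I m \<Longrightarrow> p \<in> corners \<Longrightarrow> word_map v p \<in> all_vertices"
  unfolding all_vertices_def vertices_eq by blast

lemma word_map_all_vertices:
  assumes "w \<in> words I n" "x \<in> all_vertices"
  shows "word_map w x \<in> all_vertices"
proof -
  obtain m v p where v: "v \<in> words I m" "p \<in> corners" "x = word_map v p" using assms(2) by (rule all_verticesE)
  have "word_map (w @ v) p \<in> all_vertices" by (rule word_map_vertex[OF words_append[OF assms(1) v(1)] v(2)])
  then show ?thesis by (simp add: v word_map_append)
qed

lemma range_on_cell:
  fixes v :: "point \<Rightarrow> real"
  assumes v: "continuous_on K v" and w: "w \<in> words I n" and x: "x \<in> K"
    and b: "\<And>y. y \<in> all_vertices \<Longrightarrow> m \<le> v (word_map w y) \<and> v (word_map w y) \<le> M"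
  shows "m \<le> v (word_map w x) \<and> v (word_map w x) \<le> M"
proof -
  have cont: "continuous_on (closure all_vertices) (\<lambda>x. v (word_map w x))"
    unfolding all_vertices_dense
    by (rule continuous_on_compose2[OF v continuous_on_word_map]) (use cell_subset_K[OF w] in blast)
  have xc: "x \<in> closure all_vertices" using x all_vertices_dense by simp
  have "v (word_map w x) \<le> M" by (rule continuous_le_on_closure[OF cont xc]) (use b in blast)
  moreover have "m \<le> v (word_map w x)" by (rule continuous_ge_on_closure[OF cont xc]) (use b in blast)
  ultimately show ?thesis by blast
qed

lemma all_vertices_cellE:
  assumes "x \<in> all_vertices"
  obtains w y where "w \<in> words I n" "y \<in> all_vertices" "x = word_map w y"
proof -
  obtain m where "x \<in> vertices I m" using assms by (auto simp: all_vertices_def)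
  then have "x \<in> vertices I (n + m)" using vertices_mono[of m "n + m"] by auto
  then obtain v p where v: "v \<in> words I (n + m)" "p \<in> corners" "x = word_map v p" by (auto simp: vertices_eq)
  obtain w v' where w: "w \<in> words I n" "v' \<in> words I m" "v = w @ v'" using v(1) by (rule words_appendE)
  show ?thesis
    by (rule that[of w "word_map v' p"]) (use v w word_map_vertex in \<open>auto simp: word_map_append\<close>)
qed

context
  fixes u :: "point \<Rightarrow> real" and C l :: real
  assumes l: "1 < l" and E: "\<And>n. vertex_energy n u \<le> C / l ^ n"
begin

lemma energy_bound_nonneg: "0 \<le> C"
  using E[of 0] vertex_energy_nonneg[of 0 u] by simp

lemma deviation_sum_bound: "(\<Sum>w\<in>words I n. (deviation u j w)\<^sup>2) \<le> (C / l ^ n) / l ^ j"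
  unfolding sum_deviation using E[of "n + j"] by (simp add: power_add)

lemma deviation_summable:
  assumes "w \<in> words I n"
  shows "summable (\<lambda>j. deviation u j w)"
proof (rule sum_squares_geometric(1)[OF _ l _ _ deviation_sum_bound assms])
  show "0 \<le> C / l ^ n" using energy_bound_nonneg l by simp
qed (auto simp: deviation_nonneg)

lemma osc_bound_sum: "(\<Sum>w\<in>words I n. (osc_bound u w)\<^sup>2) \<le> 400 * geom_const l * C / l ^ n"
proof -
  have "(\<Sum>w\<in>words I n. (\<Sum>j. deviation u j w)\<^sup>2) \<le> (C / l ^ n) * geom_const l"
    by (rule sum_squares_geometric(2)[OF _ l _ _ deviation_sum_bound])
       (use energy_bound_nonneg l deviation_nonneg in auto)
  then have "400 * (\<Sum>w\<in>words I n. (\<Sum>j. deviation u j w)\<^sup>2) \<le> 400 * ((C / l ^ n) * geom_const l)" by simp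
  then show ?thesis by (simp add: osc_bound_def power_mult_distrib sum_distrib_left mult_ac)
qed

lemma osc_bound_le: 
  assumes "w \<in> words I n"
  shows "osc_bound u w \<le> sqrt (400 * geom_const l * C / l ^ n)"
proof -
  have "(osc_bound u w)\<^sup>2 \<le> (\<Sum>w\<in>words I n. (osc_bound u w)\<^sup>2)"
    by (rule member_le_sum) (use assms in auto)
  also note osc_bound_sum
  finally show ?thesis by (rule real_le_rsqrt)
qed

lemma osc_on_vertices:
  assumes w: "w \<in> words I n" and "x \<in> all_vertices" "y \<in> all_vertices"
  shows "\<bar>u (word_map w x) - u (word_map w y)\<bar> \<le> osc_bound u w"
proof -
  have "\<bar>u (word_map w x) - u (word_map w (-1/2, -1/2))\<bar> \<le> 10 * (\<Sum>j. deviation u j w)"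
    if x: "x \<in> all_vertices" for x
  proof -
    obtain m v p where v: "v \<in> words I m" "p \<in> corners" "x = word_map v p" using x by (rule all_verticesE)
    have "\<bar>u (word_map (w @ v) p) - u (word_map w (-1/2, -1/2))\<bar> \<le> 10 * (\<Sum>j\<le>m. deviation u j w)"
      by (rule vertex_oscillation[OF v(1,2)])
    also have "\<dots> \<le> 10 * (\<Sum>j. deviation u j w)"
      using deviation_summable[OF w] deviation_nonneg by (intro mult_left_mono sum_le_suminf) auto
    finally show ?thesis by (simp add: v word_map_append)
  qed
  from this[OF assms(2)] this[OF assms(3)] show ?thesis unfolding osc_bound_def by linarith
qed

lemma osc_on_cell:
  assumes w: "w \<in> words I n" and u: "continuous_on K u" and x: "x \<in> K" and y: "y \<in> K"
  shows "\<bar>u (word_map w x) - u (word_map w y)\<bar> \<le> osc_bound u w"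
proof -
  have cont: "continuous_on (closure all_vertices) (\<lambda>x. u (word_map w x))"
    unfolding all_vertices_dense
    by (rule continuous_on_compose2[OF u continuous_on_word_map]) (use cell_subset_K[OF w] in blast)
  have 1: "\<bar>u (word_map w x) - u (word_map w y)\<bar> \<le> osc_bound u w" if y: "y \<in> all_vertices" for y
    by (rule continuous_le_on_closure[where S=all_vertices and f="\<lambda>x. \<bar>u (word_map w x) - u (word_map w y)\<bar>"])
       (use x y osc_on_vertices[OF w] all_vertices_dense in \<open>auto intro!: continuous_intros cont\<close>)
  show ?thesis
    by (rule continuous_le_on_closure[where S=all_vertices and f="\<lambda>y. \<bar>u (word_map w x) - u (word_map w y)\<bar>"])
       (use y 1 all_vertices_dense in \<open>auto intro!: continuous_intros cont\<close>)
qed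

text \<open>Close points lie in the same cell or in two cells with a common vertex, so a function of
  finite energy is uniformly continuous on the vertices.\<close>

lemma vertex_function_extends: "\<exists>v. continuous_on K v \<and> (\<forall>x\<in>all_vertices. v x = u x)"
proof -
  have "uniformly_continuous_on all_vertices u"
    unfolding uniformly_continuous_on_def
  proof (intro allI impI)
    fix e :: real assume "0 < e"
    have "(\<lambda>n. 400 * geom_const l * C / l ^ n) \<longlonglongrightarrow> 0"
      using l by (intro LIMSEQ_divide_realpow_zero)
    then have "(\<lambda>n. sqrt (400 * geom_const l * C / l ^ n)) \<longlonglongrightarrow> sqrt 0" by (rule tendsto_real_sqrt)
    then have "\<forall>\<^sub>F n in sequentially. sqrt (400 * geom_const l * C / l ^ n) < e / 2"
      by (rule order_tendstoD) (use \<open>0 < e\<close> in simp)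
    then obtain n where n: "sqrt (400 * geom_const l * C / l ^ n) < e / 2"
      by (auto simp: eventually_sequentially)
    show "\<exists>d>0. \<forall>x\<in>all_vertices. \<forall>x'\<in>all_vertices. dist x' x < d \<longrightarrow> dist (u x') (u x) < e"
    proof (intro exI[of _ "1 / 9 ^ n"] conjI ballI impI)
      fix x x' assume x: "x \<in> all_vertices" and x': "x' \<in> all_vertices" and d: "dist x' x < 1 / 9 ^ n"
      obtain w y where w: "w \<in> words I n" "y \<in> all_vertices" "x = word_map w y"
        using x by (rule all_vertices_cellE)
      obtain w' y' where w': "w' \<in> words I n" "y' \<in> all_vertices" "x' = word_map w' y'"
        using x' by (rule all_vertices_cellE)
      have "neighbours w' w"
        using w w' d all_vertices_in_K K_subset_square
        by (intro close_cells_are_neighbours[of w' n w y' y]) (auto simp: length_words)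
      then obtain p q where pq: "p \<in> corners" "q \<in> corners" "word_map w' p = word_map w q"
        using neighbours_share_vertex[OF I w'(1) w(1)] by blast
      have "\<bar>u x' - u (word_map w' p)\<bar> \<le> osc_bound u w'"
        unfolding w'(3) using w' pq corners_in_all_vertices by (intro osc_on_vertices) auto
      moreover have "\<bar>u (word_map w q) - u x\<bar> \<le> osc_bound u w"
        unfolding w(3) using w pq corners_in_all_vertices by (intro osc_on_vertices) auto
      ultimately show "dist (u x') (u x) < e"
        using osc_bound_le[OF w(1)] osc_bound_le[OF w'(1)] n pq(3) by (simp add: dist_real_def)
    qed simp
  qed
  then obtain v where "uniformly_continuous_on (closure all_vertices) v" "\<And>x. x \<in> all_vertices \<Longrightarrow> u x = v x"
    by (rule uniformly_continuous_on_extension_on_closure) blast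
  then show ?thesis
    using uniformly_continuous_imp_continuous unfolding all_vertices_dense by metis
qed

end

lemma vertex_energy_cong:
  assumes "\<And>x. x \<in> all_vertices \<Longrightarrow> u x = v x"
  shows "vertex_energy n u = vertex_energy n v"
  unfolding vertex_energy_def cell_variation_def
  by (intro sum.cong refl) (simp add: assms word_map_vertex)

section \<open>Extending vertex functions cell by cell\<close>

lemma vertex_1_in_square: "x \<in> vertices I 1 \<Longrightarrow> x \<in> unit_square"
  using K_subset_square vertex_in_K unfolding vertices_eq by blast

text \<open>Distinct cells of the same level meet only in vertices, where the prescribed functions agree.\<close>

lemma cellwise_extension:
  fixes f :: "point \<Rightarrow> real"
  assumes v: "\<And>w p. w \<in> words I n \<Longrightarrow> p \<in> corners \<Longrightarrow> v w p = f (word_map w p)"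
  shows "\<exists>g. (\<forall>x\<in>vertices I n. g x = f x) \<and> (\<forall>w\<in>words I n. \<forall>x\<in>vertices I 1. g (word_map w x) = v w x)"
proof -
  define P where "P y z \<longleftrightarrow> fst z \<in> words I n \<and> snd z \<in> vertices I 1 \<and> y = word_map (fst z) (snd z)" for y z
  define g where "g y = (if y \<in> vertices I n then f y else let z = SOME z. P y z in v (fst z) (snd z))" for y
  have "g (word_map w x) = v w x" if w: "w \<in> words I n" and x: "x \<in> vertices I 1" for w x
  proof (cases "word_map w x \<in> vertices I n")
    case True
    then obtain w' p where w': "w' \<in> words I n" "p \<in> corners" "word_map w x = word_map w' p"
      by (auto simp: vertices_eq)
    have "x \<in> corners"
    proof (cases "w = w'")
      case False
      then show ?thesis
        using cells_overlap_at_corners[OF I w w'(1) False vertex_1_in_square[OF x] corners_in_square[OF w'(2)] w'(3)] by simp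
    qed (use w' in auto)
    then show ?thesis using v[OF w] True by (simp add: g_def)
  next
    case False
    define z where "z = (SOME z. P (word_map w x) z)"
    have "P (word_map w x) (w, x)" using w x by (simp add: P_def)
    then have z: "P (word_map w x) z" unfolding z_def by (rule someI)
    have "fst z = w"
    proof (rule ccontr)
      assume ne: "fst z \<noteq> w"
      then have "x \<in> corners"
        using cells_overlap_at_corners[OF I w _ ne[symmetric] vertex_1_in_square[OF x] vertex_1_in_square[of "snd z"]] z
        by (auto simp: P_def)
      then show False using False w by (auto simp: vertices_eq)
    qed
    then have "word_map w x = word_map w (snd z)" using z by (simp add: P_def)
    then have "snd z = x" by simp
    then show ?thesis using \<open>fst z = w\<close> False by (simp add: g_def z_def[symmetric] Let_def)
  qed
  then show ?thesis by (intro exI[of _ g]) (auto simp: g_def)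
qed

lemma cell_map_in_vertices_1: "i \<in> I \<Longrightarrow> p \<in> corners \<Longrightarrow> cell_map i p \<in> vertices I 1"
  by auto

text \<open>Iterating an extension rule for single cells. \<open>A\<close> is the condition on the corner values
  under which the rule applies, \<open>e\<close> the energy of a cell.\<close>

lemma extension_scheme:
  fixes A :: "(point \<Rightarrow> real) \<Rightarrow> bool" and e :: "cell list \<Rightarrow> (point \<Rightarrow> real) \<Rightarrow> real"
  assumes rule: "\<And>w n f m M. w \<in> words I n \<Longrightarrow> A f \<Longrightarrow> (\<And>p. p \<in> corners \<Longrightarrow> m \<le> f p \<and> f p \<le> M) \<Longrightarrow>
      \<exists>v. (\<forall>p\<in>corners. v p = f p) \<and> (\<forall>x. m \<le> v x \<and> v x \<le> M) \<and> (\<forall>i\<in>I. A (v \<circ> cell_map i)) \<and>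
        (\<Sum>i\<in>I. e (w @ [i]) (v \<circ> cell_map i)) \<le> e w f"
    and A_cong: "\<And>f g. (\<And>p. p \<in> corners \<Longrightarrow> f p = g p) \<Longrightarrow> A f = A g"
    and e_cong: "\<And>w f g. (\<And>p. p \<in> corners \<Longrightarrow> f p = g p) \<Longrightarrow> e w f = e w g"
    and A: "\<And>w. w \<in> words I N \<Longrightarrow> A (f \<circ> word_map w)"
  shows "\<exists>u. (\<forall>x\<in>vertices I N. u x = f x) \<and>
    (\<forall>n. \<forall>w\<in>words I (N + n). A (u \<circ> word_map w)) \<and>
    (\<forall>n. (\<Sum>w\<in>words I (N + n). e w (u \<circ> word_map w)) \<le> (\<Sum>w\<in>words I N. e w (f \<circ> word_map w))) \<and>
    (\<forall>w\<in>words I N. \<forall>m M. (\<forall>p\<in>corners. m \<le> f (word_map w p) \<and> f (word_map w p) \<le> M) \<longrightarrow>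
       (\<forall>x\<in>all_vertices. m \<le> u (word_map w x) \<and> u (word_map w x) \<le> M))"
proof -
  let ?en = "\<lambda>n f. \<Sum>w\<in>words I n. e w (f \<circ> word_map w)"
  let ?adm = "\<lambda>n f. \<forall>w\<in>words I n. A (f \<circ> word_map w)"
  let ?Q = "\<lambda>n f g. (\<forall>x\<in>vertices I n. g x = f x) \<and> ?en (Suc n) g \<le> ?en n f \<and>
    (\<forall>w\<in>words I n. \<forall>m M. (\<forall>p\<in>corners. m \<le> f (word_map w p) \<and> f (word_map w p) \<le> M) \<longrightarrow>
       (\<forall>i\<in>I. \<forall>p\<in>corners. m \<le> g (word_map (w @ [i]) p) \<and> g (word_map (w @ [i]) p) \<le> M))"
  have step: "\<exists>g. ?adm (Suc n) g \<and> ?Q n f g" if adm: "?adm n f" for n f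
  proof -
    let ?m = "\<lambda>w. Min ((f \<circ> word_map w) ` corners)" and ?M = "\<lambda>w. Max ((f \<circ> word_map w) ` corners)"
    have "\<forall>w\<in>words I n. \<exists>v. (\<forall>p\<in>corners. v p = (f \<circ> word_map w) p) \<and> (\<forall>x. ?m w \<le> v x \<and> v x \<le> ?M w) \<and>
        (\<forall>i\<in>I. A (v \<circ> cell_map i)) \<and> (\<Sum>i\<in>I. e (w @ [i]) (v \<circ> cell_map i)) \<le> e w (f \<circ> word_map w)"
    proof
      fix w assume w: "w \<in> words I n"
      show "\<exists>v. (\<forall>p\<in>corners. v p = (f \<circ> word_map w) p) \<and> (\<forall>x. ?m w \<le> v x \<and> v x \<le> ?M w) \<and>
        (\<forall>i\<in>I. A (v \<circ> cell_map i)) \<and> (\<Sum>i\<in>I. e (w @ [i]) (v \<circ> cell_map i)) \<le> e w (f \<circ> word_map w)"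
      proof (rule rule[OF w])
        show "A (f \<circ> word_map w)" using adm w by blast
      qed auto
    qed
    from bchoice[OF this] obtain v where
      "\<forall>w\<in>words I n. (\<forall>p\<in>corners. v w p = (f \<circ> word_map w) p) \<and> (\<forall>x. ?m w \<le> v w x \<and> v w x \<le> ?M w) \<and>
        (\<forall>i\<in>I. A (v w \<circ> cell_map i)) \<and> (\<Sum>i\<in>I. e (w @ [i]) (v w \<circ> cell_map i)) \<le> e w (f \<circ> word_map w)" ..
    then have v: "\<forall>p\<in>corners. v w p = (f \<circ> word_map w) p" "\<forall>x. ?m w \<le> v w x \<and> v w x \<le> ?M w"
      "\<forall>i\<in>I. A (v w \<circ> cell_map i)" "(\<Sum>i\<in>I. e (w @ [i]) (v w \<circ> cell_map i)) \<le> e w (f \<circ> word_map w)"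
      if "w \<in> words I n" for w
      using that by simp_all
    obtain g where g: "\<forall>x\<in>vertices I n. g x = f x" "\<forall>w\<in>words I n. \<forall>x\<in>vertices I 1. g (word_map w x) = v w x"
      using cellwise_extension[of n v f] v(1) by auto
    have gv: "(g \<circ> word_map (w @ [i])) p = (v w \<circ> cell_map i) p" if "w \<in> words I n" "i \<in> I" "p \<in> corners" for w i p
    proof -
      have "g (word_map w (cell_map i p)) = v w (cell_map i p)"
        using g(2) that(1) cell_map_in_vertices_1[OF that(2,3)] by blast
      then show ?thesis by (simp add: word_map_append)
    qed
    have "?adm (Suc n) g"
    proof
      fix w assume "w \<in> words I (Suc n)"
      then obtain w' i where w: "w' \<in> words I n" "i \<in> I" "w = w' @ [i]" by (rule words_snocE)
      have "A (g \<circ> word_map (w' @ [i])) = A (v w' \<circ> cell_map i)"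
        by (rule A_cong) (rule gv[OF w(1,2)])
      then show "A (g \<circ> word_map w)" using v(3)[OF w(1)] w by blast
    qed
    moreover have "?en (Suc n) g \<le> ?en n f"
      unfolding sum_words_snoc
    proof (rule sum_mono)
      fix w assume w: "w \<in> words I n"
      have "(\<Sum>i\<in>I. e (w @ [i]) (g \<circ> word_map (w @ [i]))) = (\<Sum>i\<in>I. e (w @ [i]) (v w \<circ> cell_map i))"
        by (intro sum.cong refl e_cong gv w)
      with v(4)[OF w] show "(\<Sum>i\<in>I. e (w @ [i]) (g \<circ> word_map (w @ [i]))) \<le> e w (f \<circ> word_map w)" by simp
    qed
    moreover have "m \<le> g (word_map (w @ [i]) p) \<and> g (word_map (w @ [i]) p) \<le> M"
      if w: "w \<in> words I n" and mM: "\<forall>p\<in>corners. m \<le> f (word_map w p) \<and> f (word_map w p) \<le> M"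
        and ip: "i \<in> I" "p \<in> corners" for w m M i p
    proof -
      have ne: "corners \<noteq> {}" by (simp add: corners_def)
      have "m \<le> ?m w" "?M w \<le> M" using mM ne by auto
      moreover have "?m w \<le> v w (cell_map i p) \<and> v w (cell_map i p) \<le> ?M w" using v(2)[OF w] by blast
      ultimately show ?thesis using gv[OF w ip] by auto
    qed
    ultimately show ?thesis using g(1) by (intro exI[of _ g]) blast
  qed
  obtain F where F0: "F 0 = f" and adm: "\<And>k. ?adm (N + k) (F k)" and Q: "\<And>k. ?Q (N + k) (F k) (F (Suc k))"
  proof -
    have "\<exists>F. \<forall>k. (?adm (N + k) (F k) \<and> (k = 0 \<longrightarrow> F k = f)) \<and> ?Q (N + k) (F k) (F (Suc k))"
    proof (rule dependent_nat_choice)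
      show "\<exists>g. ?adm (N + 0) g \<and> (0 = (0::nat) \<longrightarrow> g = f)" using A by auto
      fix g k assume "?adm (N + k) g \<and> (k = 0 \<longrightarrow> g = f)"
      then show "\<exists>h. (?adm (N + Suc k) h \<and> (Suc k = 0 \<longrightarrow> h = f)) \<and> ?Q (N + k) g h"
        using step[of "N + k" g] by simp
    qed
    then obtain F where F: "\<forall>k. (?adm (N + k) (F k) \<and> (k = 0 \<longrightarrow> F k = f)) \<and> ?Q (N + k) (F k) (F (Suc k))" ..
    show ?thesis
    proof (rule that[of F])
      show "F 0 = f" using F[THEN spec, THEN conjunct1, THEN conjunct2, of 0] by simp
      show "?adm (N + k) (F k)" for k using F[THEN spec, THEN conjunct1, THEN conjunct1] .
      show "?Q (N + k) (F k) (F (Suc k))" for k using F[THEN spec, THEN conjunct2] .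
    qed
  qed
  have stable: "F (k + j) x = F k x" if "x \<in> vertices I (N + k)" for k j x
  proof (induction j)
    case (Suc j)
    have "x \<in> vertices I (N + (k + j))" using that vertices_mono[of "N + k" "N + (k + j)"] by auto
    then show ?case using Q[of "k + j"] Suc by simp
  qed simp
  define u where "u x = F (LEAST k. x \<in> vertices I (N + k)) x" for x
  have uF: "u x = F k x" if "x \<in> vertices I (N + k)" for k x
  proof -
    let ?l = "LEAST k. x \<in> vertices I (N + k)"
    have l: "x \<in> vertices I (N + ?l)" by (rule LeastI[of _ k]) (rule that)
    have "?l \<le> k" by (rule Least_le) (rule that)
    then obtain j where "k = ?l + j" using le_Suc_ex by blast
    then show ?thesis using stable[OF l, of j] by (simp add: u_def)
  qed
  have uFw: "(u \<circ> word_map w) p = (F k \<circ> word_map w) p" if "w \<in> words I (N + k)" "p \<in> corners" for w k p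
  proof -
    have "word_map w p \<in> vertices I (N + k)" using that unfolding vertices_eq by blast
    then show ?thesis by (simp add: uF)
  qed
  have en: "?en (N + k) (F k) \<le> ?en N f" for k
  proof (induction k)
    case (Suc k)
    have "?en (N + Suc k) (F (Suc k)) \<le> ?en (N + k) (F k)"
      using Q[of k, THEN conjunct2, THEN conjunct1] unfolding add_Suc_right .
    then show ?case using Suc by (rule order_trans)
  qed (simp add: F0)
  have range: "m \<le> F k (word_map (w @ v) p) \<and> F k (word_map (w @ v) p) \<le> M"
    if w: "w \<in> words I N" and mM: "\<forall>p\<in>corners. m \<le> f (word_map w p) \<and> f (word_map w p) \<le> M"
      and "v \<in> words I k" "p \<in> corners" for w m M k v p
    using that(3,4)
  proof (induction k arbitrary: v p)
    case 0
    then show ?case using mM by (simp add: F0)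
  next
    case (Suc k)
    obtain v' i where v: "v' \<in> words I k" "i \<in> I" "v = v' @ [i]" using Suc.prems(1) by (rule words_snocE)
    have "w @ v' \<in> words I (N + k)" using w v words_append by blast
    moreover have "\<forall>p\<in>corners. m \<le> F k (word_map (w @ v') p) \<and> F k (word_map (w @ v') p) \<le> M"
      using Suc.IH[OF v(1)] by blast
    ultimately have "m \<le> F (Suc k) (word_map ((w @ v') @ [i]) p) \<and> F (Suc k) (word_map ((w @ v') @ [i]) p) \<le> M"
      using Q[of k] v(2) Suc.prems(2) by blast
    then show ?case by (simp add: v)
  qed
  show ?thesis
  proof (intro exI[of _ u] conjI allI ballI impI)
    show "u x = f x" if "x \<in> vertices I N" for x using uF[of x 0] that F0 by simp
    show "A (u \<circ> word_map w)" if "w \<in> words I (N + n)" for n w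
    proof -
      have "A (u \<circ> word_map w) = A (F n \<circ> word_map w)" by (rule A_cong) (rule uFw[OF that])
      then show ?thesis using adm[of n] that by blast
    qed
    show "?en (N + n) u \<le> ?en N f" for n
    proof -
      have "?en (N + n) u = ?en (N + n) (F n)" by (intro sum.cong refl e_cong uFw)
      then show ?thesis using en[of n] by simp
    qed
    fix w m M x assume w: "w \<in> words I N" and mM: "\<forall>p\<in>corners. m \<le> f (word_map w p) \<and> f (word_map w p) \<le> M"
      and x: "x \<in> all_vertices"
    obtain k v p where v: "v \<in> words I k" "p \<in> corners" "x = word_map v p" using x by (rule all_verticesE)
    have "w @ v \<in> words I (N + k)" using w v words_append by blast
    then have "u (word_map (w @ v) p) = F k (word_map (w @ v) p)" using uFw v(2) by auto
    then show "m \<le> u (word_map w x)" "u (word_map w x) \<le> M"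
      using range[OF w mM v(1,2)] by (simp_all add: v word_map_append)
  qed
qed

end

section \<open>Continuous functions are dense in the square integrable functions\<close>

context eyebolted_cross
begin

context
  fixes \<nu> :: "point measure"
  assumes sets_\<nu>: "sets \<nu> = sets (restrict_space borel K)" and fin_\<nu>: "finite_measure \<nu>"
begin

lemma space_\<nu>: "space \<nu> = K"
  using sets_eq_imp_space_eq[OF sets_\<nu>] by (simp add: space_restrict_space)

lemma cont_measurable: "continuous_on K u \<Longrightarrow> u \<in> borel_measurable \<nu>"
  by (subst measurable_cong_sets[OF sets_\<nu> refl]) (rule borel_measurable_continuous_on_restrict)

lemma cont_bounded:
  fixes u :: "point \<Rightarrow> real"
  assumes "continuous_on K u"
  obtains B where "0 \<le> B" "\<And>x. x \<in> K \<Longrightarrow> \<bar>u x\<bar> \<le> B"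
proof -
  have "bounded (u ` K)" by (intro compact_imp_bounded compact_continuous_image assms compact_K)
  then obtain B where "\<forall>x\<in>K. \<bar>u x\<bar> \<le> B" by (auto simp: bounded_iff)
  then show ?thesis using that[of "max 0 B"] by fastforce
qed

lemma bounded_in_lsq:
  assumes "u \<in> borel_measurable \<nu>" "\<And>x. x \<in> K \<Longrightarrow> \<bar>u x\<bar> \<le> B"
  shows "u \<in> lsq \<nu>"
proof -
  interpret finite_measure \<nu> by (rule fin_\<nu>)
  have "integrable \<nu> (\<lambda>x. (u x)\<^sup>2)"
  proof (rule integrable_const_bound[of _ "B\<^sup>2"])
    show "AE x in \<nu>. norm ((u x)\<^sup>2) \<le> B\<^sup>2"
    proof (rule AE_I2)
      fix x assume "x \<in> space \<nu>"
      then have "\<bar>u x\<bar> \<le> \<bar>B\<bar>" using assms(2)[of x] by (simp add: space_\<nu>)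
      then show "norm ((u x)\<^sup>2) \<le> B\<^sup>2" by (simp add: abs_le_square_iff)
    qed
  qed (use assms(1) in simp)
  with assms(1) show ?thesis by (simp add: lsq_def)
qed

lemma cont_in_lsq:
  assumes "continuous_on K u"
  shows "u \<in> lsq \<nu>"
proof -
  obtain B where "\<And>x. x \<in> K \<Longrightarrow> \<bar>u x\<bar> \<le> B" using cont_bounded[OF assms] by blast
  then show ?thesis using bounded_in_lsq[OF cont_measurable[OF assms]] by blast
qed

lemma lsq_add:
  assumes "f \<in> lsq \<nu>" "g \<in> lsq \<nu>"
  shows "(\<lambda>x. f x + g x) \<in> lsq \<nu>"
    and "(LINT x|\<nu>. (f x + g x)\<^sup>2) \<le> 2 * (LINT x|\<nu>. (f x)\<^sup>2) + 2 * (LINT x|\<nu>. (g x)\<^sup>2)"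
proof -
  have [measurable]: "f \<in> borel_measurable \<nu>" "g \<in> borel_measurable \<nu>" using assms by (auto simp: lsq_def)
  have i: "integrable \<nu> (\<lambda>x. (f x)\<^sup>2)" "integrable \<nu> (\<lambda>x. (g x)\<^sup>2)" using assms by (auto simp: lsq_def)
  have b: "(a + c)\<^sup>2 \<le> 2 * a\<^sup>2 + 2 * c\<^sup>2" for a c :: real
  proof -
    have "2 * a\<^sup>2 + 2 * c\<^sup>2 - (a + c)\<^sup>2 = (a - c)\<^sup>2" by (simp add: power2_eq_square algebra_simps)
    then show ?thesis by (metis diff_ge_0_iff_ge zero_le_power2)
  qed
  have ib: "integrable \<nu> (\<lambda>x. 2 * (f x)\<^sup>2 + 2 * (g x)\<^sup>2)" using i by simp
  have ii: "integrable \<nu> (\<lambda>x. (f x + g x)\<^sup>2)"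
    by (rule Bochner_Integration.integrable_bound[OF ib]) (auto intro!: AE_I2 b simp: b)
  then show "(\<lambda>x. f x + g x) \<in> lsq \<nu>" by (simp add: lsq_def)
  have "(LINT x|\<nu>. (f x + g x)\<^sup>2) \<le> (LINT x|\<nu>. 2 * (f x)\<^sup>2 + 2 * (g x)\<^sup>2)"
    by (rule integral_mono[OF ii ib b])
  also have "\<dots> = 2 * (LINT x|\<nu>. (f x)\<^sup>2) + 2 * (LINT x|\<nu>. (g x)\<^sup>2)" using i by simp
  finally show "(LINT x|\<nu>. (f x + g x)\<^sup>2) \<le> 2 * (LINT x|\<nu>. (f x)\<^sup>2) + 2 * (LINT x|\<nu>. (g x)\<^sup>2)" .
qed

lemma lsq_scale:
  assumes "f \<in> lsq \<nu>"
  shows "(\<lambda>x. k * f x) \<in> lsq \<nu>"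
    and "(LINT x|\<nu>. (k * f x)\<^sup>2) = k\<^sup>2 * (LINT x|\<nu>. (f x)\<^sup>2)"
  using assms by (auto simp: lsq_def power_mult_distrib)

lemma lsq_diff: "f \<in> lsq \<nu> \<Longrightarrow> g \<in> lsq \<nu> \<Longrightarrow> (\<lambda>x. f x - g x) \<in> lsq \<nu>"
  using lsq_add(1)[of f "\<lambda>x. -1 * g x"] lsq_scale(1)[of g "-1"] by simp

lemma lsq_diff_cont: "u \<in> cont_funs K \<Longrightarrow> f \<in> lsq \<nu> \<Longrightarrow> (\<lambda>x. u x - f x) \<in> lsq \<nu>"
  by (rule lsq_diff) (auto simp: cont_funs_def intro: cont_in_lsq)

definition approximable :: "(point \<Rightarrow> real) \<Rightarrow> bool" where
  "approximable f \<longleftrightarrow> f \<in> lsq \<nu> \<and> (\<forall>\<epsilon>>0. \<exists>u\<in>cont_funs K. (LINT x|\<nu>. (u x - f x)\<^sup>2) < \<epsilon>)"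

lemma approximable_add:
  assumes "approximable f" "approximable g"
  shows "approximable (\<lambda>x. f x + g x)"
  unfolding approximable_def
proof (intro conjI allI impI)
  show "(\<lambda>x. f x + g x) \<in> lsq \<nu>" using assms by (intro lsq_add) (auto simp: approximable_def)
  fix \<epsilon> :: real assume "0 < \<epsilon>"
  then have e: "0 < \<epsilon> / 4" by simp
  obtain u where u: "u \<in> cont_funs K" "(LINT x|\<nu>. (u x - f x)\<^sup>2) < \<epsilon> / 4"
    using assms(1) e unfolding approximable_def by blast
  obtain v where v: "v \<in> cont_funs K" "(LINT x|\<nu>. (v x - g x)\<^sup>2) < \<epsilon> / 4"
    using assms(2) e unfolding approximable_def by blast
  note uv = u v
  have l: "(\<lambda>x. u x - f x) \<in> lsq \<nu>" "(\<lambda>x. v x - g x) \<in> lsq \<nu>"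
    using uv assms by (auto intro!: lsq_diff_cont simp: approximable_def)
  have "(LINT x|\<nu>. ((u x - f x) + (v x - g x))\<^sup>2) \<le> 2 * (LINT x|\<nu>. (u x - f x)\<^sup>2) + 2 * (LINT x|\<nu>. (v x - g x)\<^sup>2)"
    by (rule lsq_add(2)[OF l])
  also have "\<dots> < \<epsilon>" using uv by simp
  finally have "(LINT x|\<nu>. ((u x + v x) - (f x + g x))\<^sup>2) < \<epsilon>" by (simp add: algebra_simps)
  moreover have "(\<lambda>x. u x + v x) \<in> cont_funs K" using uv by (auto simp: cont_funs_def intro: continuous_intros)
  ultimately show "\<exists>u\<in>cont_funs K. (LINT x|\<nu>. (u x - (f x + g x))\<^sup>2) < \<epsilon>"
    by (intro bexI[of _ "\<lambda>x. u x + v x"])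
qed

lemma approximable_scale:
  assumes "approximable f"
  shows "approximable (\<lambda>x. k * f x)"
  unfolding approximable_def
proof (intro conjI allI impI)
  show "(\<lambda>x. k * f x) \<in> lsq \<nu>" using assms by (intro lsq_scale) (auto simp: approximable_def)
  fix \<epsilon> :: real assume "0 < \<epsilon>"
  moreover have k: "0 < k\<^sup>2 + 1" by (rule add_nonneg_pos) simp_all
  ultimately have "0 < \<epsilon> / (k\<^sup>2 + 1)" by simp
  then obtain u where u: "u \<in> cont_funs K" "(LINT x|\<nu>. (u x - f x)\<^sup>2) < \<epsilon> / (k\<^sup>2 + 1)"
    using assms unfolding approximable_def by blast
  have l: "(\<lambda>x. u x - f x) \<in> lsq \<nu>"
    using u assms by (auto intro!: lsq_diff_cont simp: approximable_def)
  let ?i = "LINT x|\<nu>. (u x - f x)\<^sup>2"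
  have "(LINT x|\<nu>. (k * (u x - f x))\<^sup>2) = k\<^sup>2 * ?i" by (rule lsq_scale(2)[OF l])
  also have "\<dots> \<le> (k\<^sup>2 + 1) * ?i" by (intro mult_right_mono) auto
  also have "\<dots> < \<epsilon>" using u(2) k by (simp add: field_simps)
  finally have "(LINT x|\<nu>. (k * u x - k * f x)\<^sup>2) < \<epsilon>" by (simp add: right_diff_distrib)
  moreover have "(\<lambda>x. k * u x) \<in> cont_funs K" using u by (auto simp: cont_funs_def intro: continuous_intros)
  ultimately show "\<exists>u\<in>cont_funs K. (LINT x|\<nu>. (u x - k * f x)\<^sup>2) < \<epsilon>"
    by (intro bexI[of _ "\<lambda>x. k * u x"])
qed

text \<open>Between a compact subset and an open superset of nearly the same measure there is a Urysohn
  function.\<close>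

lemma approximable_indicator:
  assumes A: "A \<in> sets \<nu>"
  shows "approximable (indicator A)"
  unfolding approximable_def
proof (intro conjI allI impI)
  interpret finite_measure \<nu> by (rule fin_\<nu>)
  show "indicator A \<in> lsq \<nu>"
    by (rule bounded_in_lsq[of _ 1]) (use A in \<open>auto simp: indicator_def\<close>)
  fix \<epsilon> :: real assume \<epsilon>: "0 < \<epsilon>"
  have id: "(\<lambda>x. x) \<in> measurable \<nu> borel"
    by (subst measurable_cong_sets[OF sets_\<nu> refl]) (rule measurable_restrict_space1, simp)
  define N where "N = distr \<nu> borel (\<lambda>x. x)"
  have N: "emeasure N B = emeasure \<nu> (B \<inter> K)" if "B \<in> sets borel" for B
    using that id by (simp add: N_def emeasure_distr space_\<nu>)
  have sN: "sets N = sets borel" by (simp add: N_def)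
  have fN: "emeasure N (space N) \<noteq> \<infinity>" using emeasure_finite[of K] by (simp add: N_def emeasure_distr id space_\<nu>)
  have AK: "A \<subseteq> K" "A \<in> sets borel"
    using A sets.sets_into_space[OF A] compact_imp_closed[OF compact_K] by (auto simp: sets_\<nu> space_\<nu> sets_restrict_space)
  have NA: "emeasure N A < \<infinity>" "emeasure N A = ennreal (measure \<nu> A)"
    using N[OF AK(2)] AK(1) by (simp_all add: Int_absorb2 emeasure_eq_measure)
  have "emeasure N A < emeasure N A + ennreal (\<epsilon> / 2)" using NA \<epsilon> by simp
  then obtain U where U: "A \<subseteq> U" "open U" "emeasure N U < emeasure N A + ennreal (\<epsilon> / 2)"
  proof -
    assume less: "emeasure N A < emeasure N A + ennreal (\<epsilon> / 2)"
    have "(INF U\<in>{U. A \<subseteq> U \<and> open U}. emeasure N U) < emeasure N A + ennreal (\<epsilon> / 2)"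
      unfolding outer_regular[OF sN fN AK(2), symmetric] by (rule less)
    then show ?thesis using that unfolding INF_less_iff by blast
  qed
  have "\<exists>C. C \<subseteq> A \<and> compact C \<and> emeasure N A < emeasure N C + ennreal (\<epsilon> / 2)"
  proof (rule ccontr)
    assume "\<not> ?thesis"
    then have le: "emeasure N C + ennreal (\<epsilon> / 2) \<le> emeasure N A" if "C \<subseteq> A" "compact C" for C
      using that by (meson not_le)
    have "emeasure N A + ennreal (\<epsilon> / 2) = (SUP C\<in>{C. C \<subseteq> A \<and> compact C}. emeasure N C + ennreal (\<epsilon> / 2))"
      unfolding inner_regular[OF sN fN AK(2)] by (rule ennreal_SUP_add_left[symmetric]) auto
    also have "\<dots> \<le> emeasure N A" by (rule SUP_least) (use le in auto)
    finally show False using NA \<epsilon> by (simp add: not_less[symmetric])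
  qed
  then obtain C where C: "C \<subseteq> A" "compact C" "emeasure N A < emeasure N C + ennreal (\<epsilon> / 2)" by blast
  obtain g :: "point \<Rightarrow> real" where g: "continuous_on UNIV g" "\<And>x. g x \<in> closed_segment 0 1"
    "\<And>x. x \<in> - U \<Longrightarrow> g x = 0" "\<And>x. x \<in> C \<Longrightarrow> g x = 1"
    by (rule Urysohn[of "- U" C 0 1]) (use U C in \<open>auto simp: compact_imp_closed\<close>)
  have g01: "0 \<le> g x" "g x \<le> 1" for x using g(2)[of x] by (auto simp: closed_segment_eq_real_ivl)
  have CU: "C \<in> sets borel" "U \<in> sets borel" using C U by (auto simp: compact_imp_closed)
  have inK: "C \<in> sets \<nu>" "U \<inter> K \<in> sets \<nu>"
    using CU C AK compact_imp_closed[OF compact_K] by (auto simp: sets_\<nu> sets_restrict_space_iff)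
  have mU: "measure \<nu> (U \<inter> K) < measure \<nu> A + \<epsilon> / 2"
    using U(3) N[OF CU(2)] NA(2) \<epsilon> by (simp add: emeasure_eq_measure ennreal_plus[symmetric] ennreal_less_iff del: ennreal_plus)
  have mC: "measure \<nu> A < measure \<nu> C + \<epsilon> / 2"
    using C(3) N[OF CU(1)] NA(2) \<epsilon> C(1) AK(1)
    by (simp add: emeasure_eq_measure ennreal_plus[symmetric] ennreal_less_iff Int_absorb2 del: ennreal_plus)
  have "(LINT x|\<nu>. (g x - indicator A x)\<^sup>2) \<le> (LINT x|\<nu>. indicator (U \<inter> K - C) x)"
  proof (rule integral_mono)
    have gc: "continuous_on K g" using g(1) by (rule continuous_on_subset) simp
    have "(\<lambda>x. g x - indicator A x) \<in> lsq \<nu>"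
      by (rule lsq_diff[OF cont_in_lsq[OF gc]]) (rule bounded_in_lsq[of _ 1], use A in \<open>auto simp: indicator_def\<close>)
    then show "integrable \<nu> (\<lambda>x. (g x - indicator A x)\<^sup>2)" by (simp add: lsq_def)
    show "integrable \<nu> (indicator (U \<inter> K - C) :: point \<Rightarrow> real)" using inK by (simp add: emeasure_eq_measure)
    fix x assume x: "x \<in> space \<nu>"
    show "(g x - indicator A x)\<^sup>2 \<le> indicator (U \<inter> K - C) x"
    proof (cases "x \<in> U \<inter> K - C")
      case True
      have "\<bar>g x - indicator A x\<bar> \<le> 1" using g01[of x] by (auto simp: indicator_def)
      then show ?thesis using True by (simp add: abs_square_le_1)
    next
      case False
      then have "x \<in> C \<or> x \<notin> U" using x space_\<nu> by auto
      then have "g x = indicator A x"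
      proof
        assume "x \<in> C" then show ?thesis using g(4)[of x] C(1) by (auto simp: indicator_def)
      next
        assume "x \<notin> U" then show ?thesis using g(3)[of x] U(1) by (auto simp: indicator_def)
      qed
      then show ?thesis by simp
    qed
  qed
  also have "\<dots> = measure \<nu> (U \<inter> K - C)" using sets.sets_into_space[of "U \<inter> K - C" \<nu>] inK by (simp add: Int_absorb2 space_\<nu>)
  also have "\<dots> = measure \<nu> (U \<inter> K) - measure \<nu> C"
    using inK C(1) U(1) AK(1) by (intro finite_measure_Diff) auto
  also have "\<dots> < \<epsilon>" using mU mC by linarith
  finally have "(LINT x|\<nu>. (g x - indicator A x)\<^sup>2) < \<epsilon>" .
  moreover have "g \<in> cont_funs K" using g(1) by (auto simp: cont_funs_def intro: continuous_on_subset)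
  ultimately show "\<exists>u\<in>cont_funs K. (LINT x|\<nu>. (u x - indicator A x)\<^sup>2) < \<epsilon>" by blast
qed

lemma approximable_simple:
  assumes s: "simple_function \<nu> (s :: point \<Rightarrow> real)"
  shows "\<exists>s'. approximable s' \<and> (\<forall>x\<in>K. s' x = s x)"
proof -
  have fin: "finite (s ` K)" using s by (simp add: simple_function_def space_\<nu>)
  have sets: "s -` {y} \<inter> K \<in> sets \<nu>" for y using simple_functionD(2)[OF s, of "{y}"] by (simp add: space_\<nu>)
  have "approximable (\<lambda>x. \<Sum>y\<in>Y. y * indicator (s -` {y} \<inter> K) x)" if "finite Y" for Y
    using that
  proof (induction Y)
    case empty
    have "(\<lambda>x. 0) \<in> lsq \<nu>" by (simp add: lsq_def)
    moreover have "(\<lambda>x. 0) \<in> cont_funs K" by (simp add: cont_funs_def)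
    ultimately show ?case unfolding approximable_def by (auto intro!: bexI[of _ "\<lambda>x. 0"])
  next
    case (insert y Y)
    show ?case unfolding sum.insert[OF insert.hyps]
      by (rule approximable_add[OF approximable_scale[OF approximable_indicator[OF sets[of y]]] insert.IH])
  qed
  from this[OF fin] have "approximable (\<lambda>x. \<Sum>y\<in>s ` K. y * indicator (s -` {y} \<inter> K) x)" .
  moreover have "(\<Sum>y\<in>s ` K. y * indicator (s -` {y} \<inter> K) x) = s x" if "x \<in> K" for x
  proof -
    have "(\<Sum>y\<in>s ` K. y * indicator (s -` {y} \<inter> K) x) = (\<Sum>y\<in>s ` K. if y = s x then y else 0)"
      by (rule sum.cong) (use that in \<open>auto simp: indicator_def\<close>)
    then show ?thesis using fin that by (simp add: sum.delta)
  qed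
  ultimately show ?thesis by blast
qed

lemma approximable_lsq:
  assumes f: "f \<in> lsq \<nu>"
  shows "approximable f"
  unfolding approximable_def
proof (intro conjI allI impI f)
  fix \<epsilon> :: real assume \<epsilon>: "0 < \<epsilon>"
  have [measurable]: "f \<in> borel_measurable \<nu>" and fi: "integrable \<nu> (\<lambda>x. (f x)\<^sup>2)" using f by (auto simp: lsq_def)
  obtain F where F: "\<And>i. simple_function \<nu> (F i)" "\<And>x. x \<in> space \<nu> \<Longrightarrow> (\<lambda>i. F i x) \<longlonglongrightarrow> f x"
     "\<And>i x. x \<in> space \<nu> \<Longrightarrow> dist (F i x) 0 \<le> 2 * dist (f x) 0"
    using borel_measurable_implies_sequence_metric[OF \<open>f \<in> borel_measurable \<nu>\<close>, of 0] by metis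
  have [measurable]: "F i \<in> borel_measurable \<nu>" for i using F(1) by (rule borel_measurable_simple_function)
  have "(\<lambda>i. LINT x|\<nu>. (F i x - f x)\<^sup>2) \<longlonglongrightarrow> (LINT x|\<nu>. 0)"
  proof (rule integral_dominated_convergence[where w="\<lambda>x. 9 * (f x)\<^sup>2"])
    show "AE x in \<nu>. (\<lambda>i. (F i x - f x)\<^sup>2) \<longlonglongrightarrow> 0"
    proof (rule AE_I2)
      fix x assume "x \<in> space \<nu>"
      then have "(\<lambda>i. (F i x - f x)\<^sup>2) \<longlonglongrightarrow> (f x - f x)\<^sup>2" by (intro tendsto_intros F(2))
      then show "(\<lambda>i. (F i x - f x)\<^sup>2) \<longlonglongrightarrow> 0" by simp
    qed
    show "AE x in \<nu>. norm ((F i x - f x)\<^sup>2) \<le> 9 * (f x)\<^sup>2" for i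
    proof (rule AE_I2)
      fix x assume "x \<in> space \<nu>"
      then have "\<bar>F i x - f x\<bar> \<le> \<bar>3 * f x\<bar>" using F(3)[of x i] by (simp add: abs_if split: if_splits)
      then have "(F i x - f x)\<^sup>2 \<le> (3 * f x)\<^sup>2" by (simp add: abs_le_square_iff)
      then show "norm ((F i x - f x)\<^sup>2) \<le> 9 * (f x)\<^sup>2" by (simp add: power_mult_distrib)
    qed
  qed (use fi in auto)
  then have "\<forall>\<^sub>F i in sequentially. (LINT x|\<nu>. (F i x - f x)\<^sup>2) < \<epsilon> / 4"
    by (rule order_tendstoD) (use \<epsilon> in simp)
  then obtain i where i: "(LINT x|\<nu>. (F i x - f x)\<^sup>2) < \<epsilon> / 4" by (auto simp: eventually_sequentially)
  obtain s where s: "approximable s" "\<forall>x\<in>K. s x = F i x" using approximable_simple[OF F(1)] by blast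
  obtain u where u: "u \<in> cont_funs K" "(LINT x|\<nu>. (u x - s x)\<^sup>2) < \<epsilon> / 4"
  proof -
    have "0 < \<epsilon> / 4" using \<epsilon> by simp
    then show ?thesis using s(1) that unfolding approximable_def by blast
  qed
  have si: "(LINT x|\<nu>. (s x - f x)\<^sup>2) = (LINT x|\<nu>. (F i x - f x)\<^sup>2)"
    by (rule Bochner_Integration.integral_cong) (use s(2) space_\<nu> in auto)
  have l: "(\<lambda>x. u x - s x) \<in> lsq \<nu>" "(\<lambda>x. s x - f x) \<in> lsq \<nu>"
    using lsq_diff_cont[OF u(1)] lsq_diff[OF _ f] s(1) by (auto simp: approximable_def)
  have "(LINT x|\<nu>. ((u x - s x) + (s x - f x))\<^sup>2) < \<epsilon>"
    using lsq_add(2)[OF l] u(2) i si by linarith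
  then show "\<exists>u\<in>cont_funs K. (LINT x|\<nu>. (u x - f x)\<^sup>2) < \<epsilon>" using u(1) by auto
qed

lemma dense_in_lsqI:
  assumes "\<And>g \<epsilon>. continuous_on K g \<Longrightarrow> 0 < \<epsilon> \<Longrightarrow> \<exists>u\<in>A. u \<in> lsq \<nu> \<and> (LINT x|\<nu>. (u x - g x)\<^sup>2) < \<epsilon>"
  shows "dense_in_lsq \<nu> A"
  unfolding dense_in_lsq_def
proof (intro ballI allI impI)
  fix f :: "point \<Rightarrow> real" and \<epsilon> :: real assume f: "f \<in> lsq \<nu>" and \<epsilon>: "0 < \<epsilon>"
  have e: "0 < \<epsilon>\<^sup>2 / 4" using \<epsilon> by simp
  then obtain g where g: "g \<in> cont_funs K" "(LINT x|\<nu>. (g x - f x)\<^sup>2) < \<epsilon>\<^sup>2 / 4"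
    using approximable_lsq[OF f] unfolding approximable_def by blast
  obtain u where u: "u \<in> A" "u \<in> lsq \<nu>" "(LINT x|\<nu>. (u x - g x)\<^sup>2) < \<epsilon>\<^sup>2 / 4"
    using assms[of g, OF _ e] g(1) by (auto simp: cont_funs_def)
  have l: "(\<lambda>x. u x - g x) \<in> lsq \<nu>" "(\<lambda>x. g x - f x) \<in> lsq \<nu>"
    using lsq_diff[OF u(2) cont_in_lsq[of g]] lsq_diff_cont[OF g(1) f] g(1) by (auto simp: cont_funs_def)
  have "(LINT x|\<nu>. ((u x - g x) + (g x - f x))\<^sup>2) < \<epsilon>\<^sup>2"
    using lsq_add(2)[OF l] u(3) g(2) by linarith
  then have "sqrt (LINT x|\<nu>. (u x - f x)\<^sup>2) < sqrt (\<epsilon>\<^sup>2)" by (intro real_sqrt_less_mono) simp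
  then have "lsq_norm \<nu> (\<lambda>x. u x - f x) < \<epsilon>" using \<epsilon> by (simp add: lsq_norm_def)
  then show "\<exists>u\<in>A. lsq_norm \<nu> (\<lambda>x. u x - f x) < \<epsilon>" using u(1) by blast
qed

lemma dense_in_lsq_if_dense_in_cont:
  assumes A: "A \<subseteq> cont_funs K" and d: "dense_in_cont K A"
  shows "dense_in_lsq \<nu> A"
proof (rule dense_in_lsqI)
  interpret finite_measure \<nu> by (rule fin_\<nu>)
  fix g :: "point \<Rightarrow> real" and \<epsilon> :: real assume g: "continuous_on K g" and \<epsilon>: "0 < \<epsilon>"
  define m where "m = measure \<nu> K + 1"
  have m: "0 < m" by (simp add: m_def add_nonneg_pos)
  have "0 < sqrt (\<epsilon> / m)" using \<epsilon> m by simp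
  then obtain u where u: "u \<in> A" "\<forall>x\<in>K. \<bar>u x - g x\<bar> < sqrt (\<epsilon> / m)"
    using d g unfolding dense_in_cont_def cont_funs_def by blast
  have ul: "u \<in> lsq \<nu>" using u(1) A cont_in_lsq by (auto simp: cont_funs_def)
  have "(\<lambda>x. u x - g x) \<in> lsq \<nu>" by (intro lsq_diff ul cont_in_lsq g)
  then have i: "integrable \<nu> (\<lambda>x. (u x - g x)\<^sup>2)" by (simp add: lsq_def)
  have "(LINT x|\<nu>. (u x - g x)\<^sup>2) \<le> (LINT x|\<nu>. \<epsilon> / m)"
  proof (rule integral_mono[OF i])
    fix x assume "x \<in> space \<nu>"
    then have "\<bar>u x - g x\<bar>\<^sup>2 \<le> (sqrt (\<epsilon> / m))\<^sup>2" using u(2) by (intro power_mono) (auto simp: space_\<nu> less_imp_le)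
    then show "(u x - g x)\<^sup>2 \<le> \<epsilon> / m" using \<epsilon> m by simp
  qed simp
  also have "\<dots> = \<epsilon> * (measure \<nu> K / m)" by (simp add: space_\<nu>)
  also have "\<dots> < \<epsilon> * 1" using \<epsilon> m by (intro mult_strict_left_mono) (auto simp: m_def divide_less_eq)
  finally show "\<exists>u\<in>A. u \<in> lsq \<nu> \<and> (LINT x|\<nu>. (u x - g x)\<^sup>2) < \<epsilon>" using u(1) ul by auto
qed

end

lemma AE_eq_imp_eq_on_K:
  assumes \<nu>: "full_radon_measure K \<nu>" and u: "continuous_on K u" and v: "continuous_on K v"
    and ae: "AE x in \<nu>. u x = (v x :: real)" and x: "x \<in> K"
  shows "u x = v x"
proof (rule ccontr)
  assume "u x \<noteq> v x"
  have cont: "continuous_on K (\<lambda>x. u x - v x)" by (intro continuous_intros u v)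
  then have "openin (top_of_set K) (K \<inter> (\<lambda>x. u x - v x) -` (- {0}))"
    by (rule continuous_openin_preimage_gen) auto
  then obtain U where U: "open U" "K \<inter> (\<lambda>x. u x - v x) -` (- {0}) = K \<inter> U" by (auto simp: openin_open)
  have "x \<in> U \<inter> K" using U(2) x \<open>u x \<noteq> v x\<close> by auto
  then have pos: "emeasure \<nu> (U \<inter> K) > 0" using \<nu> U(1) unfolding full_radon_measure_def by blast
  have s: "sets \<nu> = sets (restrict_space borel K)" using \<nu> by (simp add: full_radon_measure_def)
  have "U \<inter> K \<in> sets \<nu>" using U(1) compact_imp_closed[OF compact_K] by (simp add: s sets_restrict_space_iff)
  moreover have "AE x in \<nu>. x \<notin> U \<inter> K" using ae
  proof eventually_elim
    case (elim x)
    then have "x \<notin> K \<inter> (\<lambda>x. u x - v x) -` (- {0})" by simp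
    then show ?case unfolding U(2) by blast
  qed
  ultimately have "U \<inter> K \<in> null_sets \<nu>" by (simp add: AE_iff_null_sets)
  with pos show False by (simp add: null_sets_def)
qed

section \<open>Functions with small oscillation on cells are Besov functions\<close>

lemma card_cells_containing: "card {w \<in> words I n. x \<in> word_map w ` K} \<le> 9"
proof (cases "{w \<in> words I n. x \<in> word_map w ` K} = {}")
  case False
  then obtain v where v: "v \<in> words I n" "x \<in> word_map v ` K" by blast
  have "{w \<in> words I n. x \<in> word_map w ` K} \<subseteq> {w \<in> words I n. neighbours w v}"
  proof
    fix w assume "w \<in> {w \<in> words I n. x \<in> word_map w ` K}"
    then obtain y z where "w \<in> words I n" "y \<in> K" "z \<in> K" "word_map w y = x" "word_map v z = x" using v by auto
    then show "w \<in> {w \<in> words I n. neighbours w v}"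
      using close_cells_are_neighbours[of w n v y z] v K_subset_square by (auto simp: length_words)
  qed
  then have "card {w \<in> words I n. x \<in> word_map w ` K} \<le> card {w \<in> words I n. neighbours w v}" by (intro card_mono) auto
  also have "\<dots> \<le> 9" by (rule card_neighbours[OF I v(1)])
  finally show ?thesis .
next
  case True
  show ?thesis unfolding True by simp
qed

lemma cells_meeting_are_neighbours:
  assumes "v \<in> words I n" "w \<in> words I n" "x \<in> word_map v ` K" "y \<in> word_map w ` K" "dist x y < 1 / 9 ^ n"
  shows "neighbours v w"
proof -
  obtain a b where "a \<in> K" "x = word_map v a" "b \<in> K" "y = word_map w b" using assms(3,4) by blast
  then show ?thesis
    using close_cells_are_neighbours[of v n w a b] assms K_subset_square by (auto simp: length_words)
qed

lemma sum_neighbours_le: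
  assumes "\<And>w. w \<in> words I n \<Longrightarrow> 0 \<le> (h w :: real)"
  shows "(\<Sum>w\<in>words I n. \<Sum>w'\<in>{w' \<in> words I n. neighbours w' w}. h w + h w') \<le> 18 * (\<Sum>w\<in>words I n. h w)"
proof -
  have 1: "(\<Sum>w\<in>words I n. \<Sum>w'\<in>{w' \<in> words I n. neighbours w' w}. h w) \<le> 9 * (\<Sum>w\<in>words I n. h w)"
    unfolding sum_distrib_left
  proof (rule sum_mono)
    fix w assume w: "w \<in> words I n"
    have "(\<Sum>w'\<in>{w' \<in> words I n. neighbours w' w}. h w) = real (card {w' \<in> words I n. neighbours w' w}) * h w" by simp
    also have "\<dots> \<le> 9 * h w" using card_neighbours[OF I w] assms[OF w] by (intro mult_right_mono) auto
    finally show "(\<Sum>w'\<in>{w' \<in> words I n. neighbours w' w}. h w) \<le> 9 * h w" .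
  qed
  have "(\<Sum>w\<in>words I n. \<Sum>w'\<in>{w' \<in> words I n. neighbours w' w}. h w') =
      (\<Sum>w'\<in>words I n. \<Sum>w\<in>{w \<in> words I n. neighbours w' w}. h w')"
    by (rule sum.swap_restrict) auto
  also have "\<dots> = (\<Sum>w\<in>words I n. \<Sum>w'\<in>{w' \<in> words I n. neighbours w' w}. h w)"
    by (simp add: neighbours_sym)
  finally show ?thesis using 1 by (simp add: sum.distrib)
qed

lemma besov_scaling: "9 powr (dimH + 2 * \<sigma>) = 441 * 9 powr (2 * \<sigma> - dimH)"
proof -
  have "9 powr (dimH + 2 * \<sigma>) = 9 powr dimH * 9 powr dimH * 9 powr (2 * \<sigma> - dimH)"
    by (simp add: powr_add[symmetric])
  then show ?thesis by (simp only: cells_scaling_dimension)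
qed

lemma power9_powr_general: "((1::real) / 9 ^ n) powr (- s) = (9 powr s) ^ n"
proof -
  have "((1::real) / 9 ^ n) powr (- s) = (9 ^ n) powr s"
    by (simp add: powr_minus powr_divide divide_simps)
  also have "\<dots> = (9 powr s) ^ n"
    by (simp add: powr_realpow[symmetric] powr_powr powr_power mult.commute)
  finally show ?thesis .
qed

text \<open>Points at a distance less than \<open>9\<^sup>-\<^sup>n\<close> lie in neighbouring cells of level \<open>n\<close>, and a pair of cells has
  measure \<open>441\<^sup>-\<^sup>n\<close>; as \<open>441 = 9 powr (2 * dimH)\<close>, this accounts for the rate \<open>9 powr (2 * \<sigma> - dimH)\<close>.\<close>

lemma besov_if_small_oscillation:
  fixes u :: "point \<Rightarrow> real"
  assumes u: "continuous_on K u" and \<sigma>: "0 < \<sigma>"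
    and osc: "\<And>n w x y. w \<in> words I n \<Longrightarrow> x \<in> K \<Longrightarrow> y \<in> K \<Longrightarrow> \<bar>u (word_map w x) - u (word_map w y)\<bar> \<le> h w"
    and sum: "\<And>n. (\<Sum>w\<in>words I n. (h w)\<^sup>2) \<le> C / l ^ n"
    and l: "9 powr (2 * \<sigma> - dimH) \<le> l"
  shows "u \<in> besov dimH \<mu> \<sigma>"
proof -
  let ?q = "9 powr (2 * \<sigma> - dimH)"
  have q: "0 < ?q" by simp
  have C: "0 \<le> C" using order_trans[OF zero_le_power2[of "h []"]] sum[of 0] by simp
  define B where "B = 441 * ?q * (36 * C)"
  have "ennreal (r powr (- dimH - 2 * \<sigma>)) *
      (\<integral>\<^sup>+ x. (\<integral>\<^sup>+ y. ennreal (\<bar>u x - u y\<bar>\<^sup>2) * indicator (ball x r) y \<partial>\<mu>) \<partial>\<mu>) \<le> ennreal B"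
    if r: "0 < r" "r < 1" for r
  proof -
    obtain n :: nat where n: "1 / 9 ^ Suc n \<le> r" "r < 1 / 9 ^ n" using scale_between_powers[OF r] .
    let ?W = "words I n" and ?N = "\<lambda>w. {w' \<in> words I n. neighbours w' w}"
    let ?c = "\<lambda>w w'. 2 * ((h w)\<^sup>2 + (h w')\<^sup>2)"
    let ?i = "\<lambda>w. indicator (word_map w ` K) :: point \<Rightarrow> ennreal"
    have pw: "ennreal (\<bar>u x - u y\<bar>\<^sup>2) * indicator (ball x r) y \<le> (\<Sum>w\<in>?W. ?i w x * (\<Sum>w'\<in>?N w. ennreal (?c w w') * ?i w' y))"
      if x: "x \<in> K" and y: "y \<in> K" for x y
    proof (cases "y \<in> ball x r")
      case True
      obtain w a where w: "w \<in> ?W" "a \<in> K" "x = word_map w a" using K_cellE[OF x] by blast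
      obtain w' b where w': "w' \<in> ?W" "b \<in> K" "y = word_map w' b" using K_cellE[OF y] by blast
      have nb: "neighbours w' w"
        using True n(2) w w' by (intro cells_meeting_are_neighbours[of w' n w y x]) (auto simp: dist_commute)
      obtain p q where pq: "p \<in> corners" "q \<in> corners" "word_map w' p = word_map w q"
        using neighbours_share_vertex[OF I w'(1) w(1) nb] by blast
      have "\<bar>u x - u (word_map w q)\<bar> \<le> h w" unfolding w(3) using w pq corners_in_K by (intro osc) auto
      moreover have "\<bar>u (word_map w' p) - u y\<bar> \<le> h w'" unfolding w'(3) using w' pq corners_in_K by (intro osc) auto
      ultimately have "\<bar>u x - u y\<bar> \<le> h w + h w'" using pq(3) by simp
      then have "\<bar>u x - u y\<bar>\<^sup>2 \<le> (h w + h w')\<^sup>2" by (intro power_mono) auto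
      also have "\<dots> \<le> ?c w w'"
        using zero_le_power2[of "h w - h w'"] by (simp add: power2_eq_square algebra_simps)
      finally have "ennreal (\<bar>u x - u y\<bar>\<^sup>2) \<le> ennreal (?c w w')" by (rule ennreal_leI)
      also have "\<dots> = ?i w x * (ennreal (?c w w') * ?i w' y)"
        using w w' by (simp add: indicator_def)
      also have "\<dots> \<le> ?i w x * (\<Sum>w'\<in>?N w. ennreal (?c w w') * ?i w' y)"
        using w' nb by (intro mult_left_mono member_le_sum[of w' "?N w" "\<lambda>w'. ennreal (?c w w') * ?i w' y"]) auto
      also have "\<dots> \<le> (\<Sum>w\<in>?W. ?i w x * (\<Sum>w'\<in>?N w. ennreal (?c w w') * ?i w' y))"
        using w by (intro member_le_sum[of w ?W "\<lambda>w. ?i w x * (\<Sum>w'\<in>?N w. ennreal (?c w w') * ?i w' y)"]) auto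
      finally show ?thesis using True by simp
    qed simp
    have inner: "(\<integral>\<^sup>+ y. ennreal (\<bar>u x - u y\<bar>\<^sup>2) * indicator (ball x r) y \<partial>\<mu>) \<le>
        (\<Sum>w\<in>?W. ?i w x * (\<Sum>w'\<in>?N w. ennreal (?c w w') * ennreal (1 / 21 ^ n)))" if x: "x \<in> K" for x
    proof -
      have "(\<integral>\<^sup>+ y. ennreal (\<bar>u x - u y\<bar>\<^sup>2) * indicator (ball x r) y \<partial>\<mu>) \<le>
         (\<integral>\<^sup>+ y. (\<Sum>w\<in>?W. ?i w x * (\<Sum>w'\<in>?N w. ennreal (?c w w') * ?i w' y)) \<partial>\<mu>)"
        using pw[OF x] by (intro nn_integral_mono) simp
      also have "\<dots> = (\<Sum>w\<in>?W. ?i w x * (\<Sum>w'\<in>?N w. ennreal (?c w w') * emeasure \<mu> (word_map w' ` K)))"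
      proof -
        have m: "(\<lambda>y. ennreal (?c w w') * ?i w' y) \<in> borel_measurable \<mu>" if "w' \<in> ?N w" for w w'
          using that by (intro borel_measurable_times_ennreal borel_measurable_indicator cell_in_sets) auto
        have "(\<integral>\<^sup>+ y. (\<Sum>w\<in>?W. ?i w x * (\<Sum>w'\<in>?N w. ennreal (?c w w') * ?i w' y)) \<partial>\<mu>) =
           (\<Sum>w\<in>?W. \<integral>\<^sup>+ y. ?i w x * (\<Sum>w'\<in>?N w. ennreal (?c w w') * ?i w' y) \<partial>\<mu>)"
          by (rule nn_integral_sum) (intro borel_measurable_times_ennreal borel_measurable_const borel_measurable_sum m)
        also have "\<dots> = (\<Sum>w\<in>?W. ?i w x * (\<Sum>w'\<in>?N w. ennreal (?c w w') * emeasure \<mu> (word_map w' ` K)))"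
        proof (rule sum.cong[OF refl])
          fix w
          have "(\<integral>\<^sup>+ y. ?i w x * (\<Sum>w'\<in>?N w. ennreal (?c w w') * ?i w' y) \<partial>\<mu>) =
            ?i w x * (\<integral>\<^sup>+ y. (\<Sum>w'\<in>?N w. ennreal (?c w w') * ?i w' y) \<partial>\<mu>)"
            by (rule nn_integral_cmult) (intro borel_measurable_sum m)
          also have "(\<integral>\<^sup>+ y. (\<Sum>w'\<in>?N w. ennreal (?c w w') * ?i w' y) \<partial>\<mu>) =
            (\<Sum>w'\<in>?N w. \<integral>\<^sup>+ y. ennreal (?c w w') * ?i w' y \<partial>\<mu>)"
            by (rule nn_integral_sum) (rule m)
          also have "\<dots> = (\<Sum>w'\<in>?N w. ennreal (?c w w') * emeasure \<mu> (word_map w' ` K))"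
            by (intro sum.cong refl nn_integral_cmult_indicator cell_in_sets) auto
          finally show "(\<integral>\<^sup>+ y. ?i w x * (\<Sum>w'\<in>?N w. ennreal (?c w w') * ?i w' y) \<partial>\<mu>) =
            ?i w x * (\<Sum>w'\<in>?N w. ennreal (?c w w') * emeasure \<mu> (word_map w' ` K))" .
        qed
        finally show ?thesis .
      qed
      also have "\<dots> = (\<Sum>w\<in>?W. ?i w x * (\<Sum>w'\<in>?N w. ennreal (?c w w') * ennreal (1 / 21 ^ n)))"
        by (intro sum.cong refl arg_cong2[where f="(*)"]) (auto simp: emeasure_cell)
      finally show ?thesis .
    qed
    have "(\<integral>\<^sup>+ x. (\<integral>\<^sup>+ y. ennreal (\<bar>u x - u y\<bar>\<^sup>2) * indicator (ball x r) y \<partial>\<mu>) \<partial>\<mu>) \<le>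
       (\<integral>\<^sup>+ x. (\<Sum>w\<in>?W. (\<Sum>w'\<in>?N w. ennreal (?c w w') * ennreal (1 / 21 ^ n)) * ?i w x) \<partial>\<mu>)"
      using inner by (intro nn_integral_mono) (simp add: mult.commute)
    also have "\<dots> = (\<Sum>w\<in>?W. (\<Sum>w'\<in>?N w. ennreal (?c w w') * ennreal (1 / 21 ^ n)) * emeasure \<mu> (word_map w ` K))"
      by (subst nn_integral_sum) (auto intro!: sum.cong nn_integral_cmult_indicator cell_in_sets borel_measurable_times_ennreal borel_measurable_indicator)
    also have "\<dots> = (\<Sum>w\<in>?W. (\<Sum>w'\<in>?N w. ennreal (?c w w') * ennreal (1 / 21 ^ n)) * ennreal (1 / 21 ^ n))"
      by (intro sum.cong refl arg_cong2[where f="(*)"]) (auto simp: emeasure_cell)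
    also have "\<dots> = ennreal (\<Sum>w\<in>?W. (\<Sum>w'\<in>?N w. ?c w w' * (1 / 21 ^ n)) * (1 / 21 ^ n))"
    proof -
      have "(\<Sum>w'\<in>?N w. ennreal (?c w w') * ennreal (1 / 21 ^ n)) * ennreal (1 / 21 ^ n) =
         ennreal ((\<Sum>w'\<in>?N w. ?c w w' * (1 / 21 ^ n)) * (1 / 21 ^ n))" for w
      proof -
        have "(\<Sum>w'\<in>?N w. ennreal (?c w w') * ennreal (1 / 21 ^ n)) = (\<Sum>w'\<in>?N w. ennreal (?c w w' * (1 / 21 ^ n)))"
          by (intro sum.cong refl ennreal_mult[symmetric]) auto
        also have "\<dots> = ennreal (\<Sum>w'\<in>?N w. ?c w w' * (1 / 21 ^ n))" by (rule sum_ennreal) simp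
        finally show ?thesis by (simp add: ennreal_mult[symmetric] sum_nonneg del: times_divide_eq_right)
      qed
      then show ?thesis by (simp only:) (rule sum_ennreal, simp add: sum_nonneg)
    qed
    also have "(\<Sum>w\<in>?W. (\<Sum>w'\<in>?N w. ?c w w' * (1 / 21 ^ n)) * (1 / 21 ^ n)) =
       2 * (\<Sum>w\<in>?W. \<Sum>w'\<in>?N w. (h w)\<^sup>2 + (h w')\<^sup>2) / 441 ^ n"
      by (simp add: sum_distrib_left sum_distrib_right sum_divide_distrib power_mult_distrib[symmetric])
    also have "\<dots> \<le> 2 * (18 * (C / l ^ n)) / 441 ^ n"
      using sum_neighbours_le[of n "\<lambda>w. (h w)\<^sup>2"] sum[of n] by (intro divide_right_mono) auto
    also have "\<dots> \<le> 36 * C / (441 * ?q) ^ n"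
    proof -
      have "?q ^ n \<le> l ^ n" using q l by (intro power_mono) auto
      then have "C / l ^ n \<le> C / ?q ^ n" using q C by (intro divide_left_mono) (auto intro!: mult_pos_pos zero_less_power less_le_trans[OF q l])
      then have "2 * (18 * (C / l ^ n)) / 441 ^ n \<le> 2 * (18 * (C / ?q ^ n)) / 441 ^ n"
        by (intro divide_right_mono) auto
      then show ?thesis by (simp add: power_mult_distrib mult.commute)
    qed
    finally have I: "(\<integral>\<^sup>+ x. (\<integral>\<^sup>+ y. ennreal (\<bar>u x - u y\<bar>\<^sup>2) * indicator (ball x r) y \<partial>\<mu>) \<partial>\<mu>)
        \<le> ennreal (36 * C / (441 * ?q) ^ n)" by (simp add: ennreal_leI)
    have "r powr (- (dimH + 2 * \<sigma>)) \<le> (1 / 9 ^ Suc n) powr (- (dimH + 2 * \<sigma>))"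
    proof (rule powr_mono2')
      show "- (dimH + 2 * \<sigma>) \<le> 0" using dimH_pos \<sigma> by linarith
    qed (use n in auto)
    also have "\<dots> = (441 * ?q) ^ Suc n" by (simp only: power9_powr_general besov_scaling)
    finally have R: "r powr (- dimH - 2 * \<sigma>) \<le> (441 * ?q) ^ Suc n" by simp
    have "ennreal (r powr (- dimH - 2 * \<sigma>)) *
      (\<integral>\<^sup>+ x. (\<integral>\<^sup>+ y. ennreal (\<bar>u x - u y\<bar>\<^sup>2) * indicator (ball x r) y \<partial>\<mu>) \<partial>\<mu>) \<le>
      ennreal ((441 * ?q) ^ Suc n) * ennreal (36 * C / (441 * ?q) ^ n)"
      by (intro mult_mono I ennreal_leI R) auto
    also have "\<dots> = ennreal B"
      using q C by (simp add: ennreal_mult[symmetric] B_def del: ennreal_power)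
    finally show ?thesis .
  qed
  then have "besov_seminorm_sq dimH \<mu> \<sigma> u \<le> ennreal B"
    unfolding besov_seminorm_sq_def by (intro SUP_least) auto
  also have "\<dots> < \<infinity>" by simp
  finally show ?thesis using cont_in_lsq[OF sets_\<mu> finite_measure_\<mu> u] by (simp add: besov_def)
qed

text \<open>The converse estimate below shows that the bound on the vertex energies characterizes the
  Besov space.\<close>

lemma besov_if_vertex_energy:
  assumes "continuous_on K u" "0 < \<sigma>" "1 < l" "9 powr (2 * \<sigma> - dimH) \<le> l"
    and "\<And>n. vertex_energy n u \<le> C / l ^ n"
  shows "u \<in> besov dimH \<mu> \<sigma>"
  by (rule besov_if_small_oscillation[where h="osc_bound u", OF assms(1,2)])
     (use osc_on_cell[OF assms(3,5) _ assms(1)] osc_bound_sum[OF assms(3,5)] assms(4) in auto)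

end

section \<open>Besov functions have small oscillation on cells\<close>

context eyebolted_cross
begin

lemma lsq_integrable:
  assumes "u \<in> lsq \<mu>"
  shows "integrable \<mu> u"
proof -
  interpret finite_measure \<mu> by (rule finite_measure_\<mu>)
  show ?thesis using assms by (auto simp: lsq_def intro: square_integrable_imp_integrable)
qed

definition cell_average :: "(point \<Rightarrow> real) \<Rightarrow> cell list \<Rightarrow> real" where
  "cell_average u w = 21 ^ length w * (LINT x|\<mu>. indicator (word_map w ` K) x * u x)"

text \<open>The mean of the squared distance of \<open>u\<close> to \<open>c\<close> is least when \<open>c\<close> is the average, and grows quadratically.\<close>

lemma variance_bound:
  assumes u: "u \<in> lsq \<mu>" and w: "w \<in> words I n"
  shows "ennreal ((c - cell_average u w)\<^sup>2 / 21 ^ n) \<le>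
    (\<integral>\<^sup>+ y. ennreal ((c - u y)\<^sup>2) * indicator (word_map w ` K) y \<partial>\<mu>)"
proof -
  let ?i = "indicator (word_map w ` K) :: point \<Rightarrow> real" and ?A = "cell_average u w"
  have [measurable]: "u \<in> borel_measurable \<mu>" "word_map w ` K \<in> sets \<mu>"
    using u cell_in_sets[OF w] by (auto simp: lsq_def)
  have i1: "integrable \<mu> u" by (rule lsq_integrable[OF u])
  have i2: "integrable \<mu> (\<lambda>x. (u x)\<^sup>2)" using u by (simp add: lsq_def)
  have ii: "integrable \<mu> ?i" by (simp add: emeasure_cell[OF w])
  have iu: "integrable \<mu> (\<lambda>x. ?i x * u x)"
    using integrable_mult_indicator[OF cell_in_sets[OF w] i1] by simp
  have iu2: "integrable \<mu> (\<lambda>x. ?i x * (u x)\<^sup>2)"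
    using integrable_mult_indicator[OF cell_in_sets[OF w] i2] by simp
  have int: "integrable \<mu> (\<lambda>x. ?i x * (c - u x)\<^sup>2)"
  proof -
    have "(\<lambda>x. ?i x * (c - u x)\<^sup>2) = (\<lambda>x. c\<^sup>2 * ?i x - 2 * c * (?i x * u x) + ?i x * (u x)\<^sup>2)"
      by (simp add: fun_eq_iff power2_diff algebra_simps)
    then show ?thesis using ii iu iu2 by simp
  qed
  have avg: "(LINT x|\<mu>. ?i x * u x) = ?A / 21 ^ n" by (simp add: cell_average_def length_words[OF w])
  have m: "(LINT x|\<mu>. ?i x) = 1 / 21 ^ n"
    using measure_cell[OF w] cell_subset_K[OF w] by (simp add: Int_absorb2)
  have "(c - ?A)\<^sup>2 / 21 ^ n = ((c - ?A)\<^sup>2 - 2 * (c - ?A) * (- ?A)) * (LINT x|\<mu>. ?i x) - 2 * (c - ?A) * (LINT x|\<mu>. ?i x * u x)"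
    unfolding avg m by (simp add: field_simps)
  also have "\<dots> = (LINT x|\<mu>. ((c - ?A)\<^sup>2 - 2 * (c - ?A) * (- ?A)) * ?i x - 2 * (c - ?A) * (?i x * u x))"
    using ii iu by simp
  also have "\<dots> \<le> (LINT x|\<mu>. ?i x * (c - u x)\<^sup>2)"
  proof (rule integral_mono[OF _ int])
    show "integrable \<mu> (\<lambda>x. ((c - ?A)\<^sup>2 - 2 * (c - ?A) * (- ?A)) * ?i x - 2 * (c - ?A) * (?i x * u x))"
      using ii iu by simp
    fix x
    have "(c - u x)\<^sup>2 - ((c - ?A)\<^sup>2 - 2 * (c - ?A) * (- ?A) - 2 * (c - ?A) * u x) = (?A - u x)\<^sup>2"
      by (simp add: power2_eq_square algebra_simps)
    then have "(c - ?A)\<^sup>2 - 2 * (c - ?A) * (- ?A) - 2 * (c - ?A) * u x \<le> (c - u x)\<^sup>2"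
      by (metis diff_ge_0_iff_ge zero_le_power2)
    then show "((c - ?A)\<^sup>2 - 2 * (c - ?A) * (- ?A)) * ?i x - 2 * (c - ?A) * (?i x * u x) \<le> ?i x * (c - u x)\<^sup>2"
      by (auto simp: indicator_def)
  qed
  finally have le: "(c - ?A)\<^sup>2 / 21 ^ n \<le> (LINT x|\<mu>. ?i x * (c - u x)\<^sup>2)" .
  have "(\<integral>\<^sup>+ y. ennreal ((c - u y)\<^sup>2) * indicator (word_map w ` K) y \<partial>\<mu>) = (\<integral>\<^sup>+ y. ennreal (?i y * (c - u y)\<^sup>2) \<partial>\<mu>)"
    by (intro nn_integral_cong) (auto simp: indicator_def)
  also have "\<dots> = ennreal (LINT x|\<mu>. ?i x * (c - u x)\<^sup>2)"
    by (rule nn_integral_eq_integral[OF int]) (auto intro!: AE_I2)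
  finally show ?thesis using le by (simp add: ennreal_leI)
qed

definition cell_pair_energy :: "(point \<Rightarrow> real) \<Rightarrow> cell list \<Rightarrow> cell list \<Rightarrow> ennreal" where
  "cell_pair_energy u w w' = (\<integral>\<^sup>+ x. (\<integral>\<^sup>+ y. ennreal ((u x - u y)\<^sup>2) * indicator (word_map w' ` K) y \<partial>\<mu>) * indicator (word_map w ` K) x \<partial>\<mu>)"

lemma cell_pair_energy_ge_single:
  assumes u: "u \<in> lsq \<mu>" and w: "w \<in> words I n" and w': "w' \<in> words I m"
  shows "(\<integral>\<^sup>+ x. ennreal ((u x - cell_average u w')\<^sup>2) * indicator (word_map w ` K) x \<partial>\<mu>) \<le> ennreal (21 ^ m) * cell_pair_energy u w w'"
proof -
  have [measurable]: "u \<in> borel_measurable \<mu>" using u by (simp add: lsq_def)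
  have e: "ennreal ((c - cell_average u w')\<^sup>2) = ennreal (21 ^ m) * ennreal ((c - cell_average u w')\<^sup>2 / 21 ^ m)" for c
    by (simp add: ennreal_mult[symmetric])
  have "(\<integral>\<^sup>+ x. ennreal ((u x - cell_average u w')\<^sup>2) * indicator (word_map w ` K) x \<partial>\<mu>) =
     (\<integral>\<^sup>+ x. ennreal (21 ^ m) * (ennreal ((u x - cell_average u w')\<^sup>2 / 21 ^ m) * indicator (word_map w ` K) x) \<partial>\<mu>)"
    by (subst e) (simp only: mult.assoc)
  also have "\<dots> = ennreal (21 ^ m) * (\<integral>\<^sup>+ x. ennreal ((u x - cell_average u w')\<^sup>2 / 21 ^ m) * indicator (word_map w ` K) x \<partial>\<mu>)"
    by (rule nn_integral_cmult) (use cell_in_sets[OF w] in measurable)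
  also have "\<dots> \<le> ennreal (21 ^ m) * cell_pair_energy u w w'"
    unfolding cell_pair_energy_def
    by (intro mult_left_mono nn_integral_mono mult_right_mono variance_bound[OF u w']) auto
  finally show ?thesis .
qed

lemma cell_pair_energy_ge:
  assumes u: "u \<in> lsq \<mu>" and w: "w \<in> words I n" and w': "w' \<in> words I m"
  shows "ennreal ((cell_average u w - cell_average u w')\<^sup>2) \<le> ennreal (21 ^ n * 21 ^ m) * cell_pair_energy u w w'"
proof -
  have "ennreal ((cell_average u w - cell_average u w')\<^sup>2) = ennreal (21 ^ n) * ennreal ((cell_average u w' - cell_average u w)\<^sup>2 / 21 ^ n)"
    by (simp add: ennreal_mult[symmetric] power2_commute)
  also have "\<dots> \<le> ennreal (21 ^ n) * (\<integral>\<^sup>+ x. ennreal ((cell_average u w' - u x)\<^sup>2) * indicator (word_map w ` K) x \<partial>\<mu>)"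
    by (intro mult_left_mono variance_bound[OF u w]) auto
  also have "\<dots> = ennreal (21 ^ n) * (\<integral>\<^sup>+ x. ennreal ((u x - cell_average u w')\<^sup>2) * indicator (word_map w ` K) x \<partial>\<mu>)"
    by (simp add: power2_commute)
  also have "\<dots> \<le> ennreal (21 ^ n) * (ennreal (21 ^ m) * cell_pair_energy u w w')"
    by (intro mult_left_mono cell_pair_energy_ge_single[OF u w w']) auto
  also have "\<dots> = ennreal (21 ^ n * 21 ^ m) * cell_pair_energy u w w'"
    by (simp add: ennreal_mult mult.assoc)
  finally show ?thesis .
qed

lemma ball_integral_measurable:
  assumes "u \<in> borel_measurable \<mu>"
  shows "(\<lambda>(x, y). ennreal (\<bar>u x - u y\<bar>\<^sup>2) * indicator (ball x r) y) \<in> borel_measurable (\<mu> \<Otimes>\<^sub>M \<mu>)"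
proof -
  have [measurable]: "u \<in> borel_measurable \<mu>" by fact
  have id: "(\<lambda>x. x) \<in> measurable \<mu> borel"
    by (subst measurable_cong_sets[OF sets_\<mu> refl]) (rule measurable_restrict_space1, simp)
  have [measurable]: "(\<lambda>z. fst z) \<in> measurable (\<mu> \<Otimes>\<^sub>M \<mu>) (borel :: point measure)"
    by (rule measurable_compose[OF measurable_fst id])
  have [measurable]: "(\<lambda>z. snd z) \<in> measurable (\<mu> \<Otimes>\<^sub>M \<mu>) (borel :: point measure)"
    by (rule measurable_compose[OF measurable_snd id])
  have eq: "(\<lambda>(x, y). ennreal (\<bar>u x - u y\<bar>\<^sup>2) * indicator (ball x r) y) =
     (\<lambda>z. ennreal (\<bar>u (fst z) - u (snd z)\<bar>\<^sup>2) * (if dist (fst z) (snd z) < r then 1 else 0))"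
    by (auto simp: fun_eq_iff indicator_def)
  show ?thesis unfolding eq by measurable
qed

text \<open>Points of neighbouring cells have distance at most \<open>3 / 9 ^ n\<close>, and a point lies in at most nine cells,
  so a pair of points is counted at most \<open>81\<close> times.\<close>

lemma sum_cell_pair_energy:
  assumes u: "u \<in> lsq \<mu>"
  shows "(\<Sum>w\<in>words I n. \<Sum>w'\<in>{w' \<in> words I n. neighbours w' w}. cell_pair_energy u w w') \<le>
    81 * (\<integral>\<^sup>+ x. (\<integral>\<^sup>+ y. ennreal (\<bar>u x - u y\<bar>\<^sup>2) * indicator (ball x (4 / 9 ^ n)) y \<partial>\<mu>) \<partial>\<mu>)"
proof -
  interpret finite_measure \<mu> by (rule finite_measure_\<mu>)
  let ?W = "words I n" and ?N = "\<lambda>w. {w' \<in> words I n. neighbours w' w}"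
  let ?i = "\<lambda>w. indicator (word_map w ` K) :: point \<Rightarrow> ennreal"
  let ?G = "\<lambda>x y. ennreal (\<bar>u x - u y\<bar>\<^sup>2) * indicator (ball x (4 / 9 ^ n)) y"
  have [measurable]: "u \<in> borel_measurable \<mu>" using u by (simp add: lsq_def)
  have cell[measurable]: "word_map w ` K \<in> sets \<mu>" if "w \<in> ?W" for w using cell_in_sets[OF that] .
  have Gm[measurable]: "(\<lambda>y. ?G x y) \<in> borel_measurable \<mu>" if "x \<in> K" for x
    using measurable_Pair2[OF ball_integral_measurable[OF \<open>u \<in> borel_measurable \<mu>\<close>]] that by simp
  have Gm2: "(\<lambda>x. \<integral>\<^sup>+ y. ?G x y \<partial>\<mu>) \<in> borel_measurable \<mu>"
    using borel_measurable_nn_integral[OF ball_integral_measurable[OF \<open>u \<in> borel_measurable \<mu>\<close>]] by simp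
  have cnt: "(\<Sum>w\<in>?W. ?i w x) \<le> 9" for x
  proof -
    have "(\<Sum>w\<in>?W. ?i w x) = (\<Sum>w\<in>{w \<in> ?W. x \<in> word_map w ` K}. 1)"
      by (rule sum.mono_neutral_cong_right) (auto simp: indicator_def)
    also have "\<dots> = of_nat (card {w \<in> ?W. x \<in> word_map w ` K})" by simp
    also have "\<dots> \<le> of_nat 9" by (intro of_nat_mono card_cells_containing)
    finally show ?thesis by simp
  qed
  have near: "(ennreal ((u x - u y)\<^sup>2) * ?i w' y) * ?i w x \<le> ?G x y * ?i w' y * ?i w x"
    if w: "w \<in> ?W" and w': "w' \<in> ?N w" for w w' x y
  proof (cases "x \<in> word_map w ` K \<and> y \<in> word_map w' ` K")
    case True
    have w'': "w' \<in> ?W" "neighbours w' w" using w' by auto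
    obtain p q where pq: "p \<in> corners" "q \<in> corners" "word_map w' p = word_map w q"
      using neighbours_share_vertex[OF I w''(1) w w''(2)] by blast
    have "word_map w q \<in> word_map w ` K" "word_map w' p \<in> word_map w' ` K" using pq(1,2) corners_in_K by blast+
    then have "dist x (word_map w q) \<le> 3/2 / 9 ^ n" "dist (word_map w' p) y \<le> 3/2 / 9 ^ n"
      using True cell_diameter[OF _ _ w] cell_diameter[OF _ _ w''(1)] by blast+
    then have "dist x y \<le> 3 / 9 ^ n" using dist_triangle[of x y "word_map w q"] pq(3)
    proof -
      have "3/2 / 9 ^ n + 3/2 / 9 ^ n = (3 / 9 ^ n :: real)" by simp
      moreover assume "dist x (word_map w q) \<le> 3/2 / 9 ^ n" "dist (word_map w' p) y \<le> 3/2 / 9 ^ n"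
      ultimately show ?thesis using dist_triangle[of x y "word_map w q"] unfolding pq(3) by linarith
    qed
    also have "\<dots> < 4 / 9 ^ n" by (simp add: divide_strict_right_mono)
    finally show ?thesis by simp
  qed (auto simp: indicator_def)
  have "cell_pair_energy u w w' \<le> (\<integral>\<^sup>+ x. (\<integral>\<^sup>+ y. ?G x y * ?i w' y \<partial>\<mu>) * ?i w x \<partial>\<mu>)"
    if w: "w \<in> ?W" and w': "w' \<in> ?N w" for w w'
    unfolding cell_pair_energy_def
  proof (intro nn_integral_mono)
    fix x assume x: "x \<in> space \<mu>"
    show "(\<integral>\<^sup>+ y. ennreal ((u x - u y)\<^sup>2) * ?i w' y \<partial>\<mu>) * ?i w x \<le> (\<integral>\<^sup>+ y. ?G x y * ?i w' y \<partial>\<mu>) * ?i w x"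
    proof (cases "x \<in> word_map w ` K")
      case True
      then show ?thesis using near[OF w w', of x] by (auto intro!: nn_integral_mono)
    qed simp
  qed
  then have "(\<Sum>w\<in>?W. \<Sum>w'\<in>?N w. cell_pair_energy u w w') \<le> (\<Sum>w\<in>?W. \<Sum>w'\<in>?W. \<integral>\<^sup>+ x. (\<integral>\<^sup>+ y. ?G x y * ?i w' y \<partial>\<mu>) * ?i w x \<partial>\<mu>)"
    by (intro sum_mono order_trans[OF sum_mono sum_mono2]) auto
  also have "\<dots> = (\<integral>\<^sup>+ x. (\<integral>\<^sup>+ y. ?G x y * (\<Sum>w'\<in>?W. ?i w' y) \<partial>\<mu>) * (\<Sum>w\<in>?W. ?i w x) \<partial>\<mu>)"
  proof -
    have m1: "(\<lambda>x. \<integral>\<^sup>+ y. ?G x y * ?i w' y \<partial>\<mu>) \<in> borel_measurable \<mu>" if w': "w' \<in> ?W" for w'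
    proof -
      have "(\<lambda>(x, y). ?G x y * ?i w' y) \<in> borel_measurable (\<mu> \<Otimes>\<^sub>M \<mu>)"
      proof -
        have "(\<lambda>z. ?i w' (snd z)) \<in> borel_measurable (\<mu> \<Otimes>\<^sub>M \<mu>)"
          by (rule measurable_compose[OF measurable_snd borel_measurable_indicator[OF cell[OF w']]])
        from borel_measurable_times_ennreal[OF ball_integral_measurable[OF \<open>u \<in> borel_measurable \<mu>\<close>] this]
        show ?thesis by (simp add: case_prod_beta)
      qed
      from borel_measurable_nn_integral[OF this] show ?thesis by simp
    qed
    have "(\<Sum>w\<in>?W. \<Sum>w'\<in>?W. \<integral>\<^sup>+ x. (\<integral>\<^sup>+ y. ?G x y * ?i w' y \<partial>\<mu>) * ?i w x \<partial>\<mu>) =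
       (\<integral>\<^sup>+ x. (\<Sum>w\<in>?W. \<Sum>w'\<in>?W. (\<integral>\<^sup>+ y. ?G x y * ?i w' y \<partial>\<mu>) * ?i w x) \<partial>\<mu>)"
    proof -
      have mm: "(\<lambda>x. (\<integral>\<^sup>+ y. ?G x y * ?i w' y \<partial>\<mu>) * ?i w x) \<in> borel_measurable \<mu>" if "w \<in> ?W" "w' \<in> ?W" for w w'
        by (intro borel_measurable_times_ennreal m1 borel_measurable_indicator cell that)
      show ?thesis
        by (subst nn_integral_sum, intro borel_measurable_sum mm, assumption, assumption)
           (intro sum.cong refl nn_integral_sum[symmetric] mm)
    qed
    also have "\<dots> = (\<integral>\<^sup>+ x. (\<integral>\<^sup>+ y. ?G x y * (\<Sum>w'\<in>?W. ?i w' y) \<partial>\<mu>) * (\<Sum>w\<in>?W. ?i w x) \<partial>\<mu>)"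
    proof (rule nn_integral_cong)
      fix x assume x: "x \<in> space \<mu>"
      have "(\<integral>\<^sup>+ y. ?G x y * (\<Sum>w'\<in>?W. ?i w' y) \<partial>\<mu>) = (\<Sum>w'\<in>?W. \<integral>\<^sup>+ y. ?G x y * ?i w' y \<partial>\<mu>)"
        unfolding sum_distrib_left
        by (rule nn_integral_sum) (use x Gm cell in \<open>auto intro!: borel_measurable_times_ennreal borel_measurable_indicator\<close>)
      then show "(\<Sum>w\<in>?W. \<Sum>w'\<in>?W. (\<integral>\<^sup>+ y. ?G x y * ?i w' y \<partial>\<mu>) * ?i w x) =
          (\<integral>\<^sup>+ y. ?G x y * (\<Sum>w'\<in>?W. ?i w' y) \<partial>\<mu>) * (\<Sum>w\<in>?W. ?i w x)"
        by (simp add: sum_distrib_left sum_distrib_right)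
    qed
    finally show ?thesis .
  qed
  also have "\<dots> \<le> (\<integral>\<^sup>+ x. (\<integral>\<^sup>+ y. ?G x y * 9 \<partial>\<mu>) * 9 \<partial>\<mu>)"
    by (intro nn_integral_mono mult_mono mult_left_mono cnt) auto
  also have "\<dots> = (\<integral>\<^sup>+ x. (\<integral>\<^sup>+ y. ?G x y \<partial>\<mu>) * 81 \<partial>\<mu>)"
  proof (rule nn_integral_cong)
    fix x assume "x \<in> space \<mu>"
    then have "(\<integral>\<^sup>+ y. ?G x y * 9 \<partial>\<mu>) = (\<integral>\<^sup>+ y. ?G x y \<partial>\<mu>) * 9" by (intro nn_integral_multc Gm) simp
    then show "(\<integral>\<^sup>+ y. ?G x y * 9 \<partial>\<mu>) * 9 = (\<integral>\<^sup>+ y. ?G x y \<partial>\<mu>) * 81" by (simp only: mult.assoc) simp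
  qed
  also have "\<dots> = (\<integral>\<^sup>+ x. (\<integral>\<^sup>+ y. ?G x y \<partial>\<mu>) \<partial>\<mu>) * 81"
    by (rule nn_integral_multc[OF Gm2])
  finally show ?thesis by (simp add: mult.commute)
qed

context
  fixes u :: "point \<Rightarrow> real" and \<sigma> :: real
  assumes \<sigma>: "0 < \<sigma>" and \<sigma>_large: "dimH < 2 * \<sigma>" and u: "u \<in> besov dimH \<mu> \<sigma>"
begin

abbreviation "rate \<equiv> 9 powr (2 * \<sigma> - dimH)"

lemma rate_gt_1: "1 < rate"
proof -
  have "9 powr 0 < 9 powr (2 * \<sigma> - dimH)" using \<sigma>_large by (intro powr_less_mono) auto
  then show ?thesis by simp
qed

lemma u_lsq: "u \<in> lsq \<mu>" using u by (simp add: besov_def)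

text \<open>The Besov seminorm is used at the radius \<open>4 / 9 ^ n\<close>, which is less than \<open>1\<close> for \<open>n \<ge> 1\<close>.\<close>

lemma cell_pair_energy_decay:
  "\<exists>C\<ge>0. \<forall>n\<ge>1.
    ennreal (441 ^ n) * (\<Sum>w\<in>words I n. \<Sum>w'\<in>{w' \<in> words I n. neighbours w' w}. cell_pair_energy u w w') \<le> ennreal (C / rate ^ n)"
proof -
  define s where "s = enn2real (besov_seminorm_sq dimH \<mu> \<sigma> u)"
  have s: "besov_seminorm_sq dimH \<mu> \<sigma> u = ennreal s"
    using u by (simp add: s_def besov_def less_top[symmetric])
  have s0: "0 \<le> s" by (simp add: s_def)
  define C where "C = 81 * (s * 4 powr (dimH + 2 * \<sigma>))"
  show ?thesis
  proof (intro exI[of _ C] conjI allI impI)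
    show "0 \<le> C" using s0 by (simp add: C_def)
    fix n :: nat assume n: "1 \<le> n"
    define r :: real where "r = 4 / 9 ^ n"
    have "(9::real) ^ 1 \<le> 9 ^ n" using n by (intro power_increasing) auto
    then have r: "0 < r" "r < 1" by (simp_all add: r_def)
    let ?I = "\<integral>\<^sup>+ x. (\<integral>\<^sup>+ y. ennreal (\<bar>u x - u y\<bar>\<^sup>2) * indicator (ball x r) y \<partial>\<mu>) \<partial>\<mu>"
    have "ennreal (r powr (- dimH - 2 * \<sigma>)) * ?I \<le> besov_seminorm_sq dimH \<mu> \<sigma> u"
      unfolding besov_seminorm_sq_def by (rule SUP_upper) (use r in auto)
    then have "ennreal (r powr (dimH + 2 * \<sigma>)) * (ennreal (r powr (- dimH - 2 * \<sigma>)) * ?I) \<le> ennreal (r powr (dimH + 2 * \<sigma>)) * ennreal s"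
      unfolding s by (rule mult_left_mono) simp
    moreover have "ennreal (r powr (dimH + 2 * \<sigma>)) * ennreal (r powr (- dimH - 2 * \<sigma>)) = 1"
      using r by (simp add: ennreal_mult[symmetric] powr_add[symmetric])
    ultimately have I: "?I \<le> ennreal (r powr (dimH + 2 * \<sigma>) * s)"
      by (simp add: mult.assoc[symmetric] ennreal_mult[symmetric] s0)
    have "r powr (dimH + 2 * \<sigma>) = 4 powr (dimH + 2 * \<sigma>) * (1 / 9 ^ n) powr (dimH + 2 * \<sigma>)"
      unfolding r_def by (subst powr_mult[symmetric]) auto
    also have "(1 / 9 ^ n) powr (dimH + 2 * \<sigma>) = 1 / (441 * rate) ^ n"
    proof -
      have "(1 / 9 ^ n) powr (dimH + 2 * \<sigma>) = 1 / ((1 / 9 ^ n) powr (- (dimH + 2 * \<sigma>)))"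
        by (simp add: powr_minus divide_simps)
      then show ?thesis by (simp only: power9_powr_general besov_scaling)
    qed
    finally have rp: "r powr (dimH + 2 * \<sigma>) = 4 powr (dimH + 2 * \<sigma>) * (1 / (441 * rate) ^ n)" .
    have "ennreal (441 ^ n) * (\<Sum>w\<in>words I n. \<Sum>w'\<in>{w' \<in> words I n. neighbours w' w}. cell_pair_energy u w w') \<le>
       ennreal (441 ^ n) * (81 * ennreal (r powr (dimH + 2 * \<sigma>) * s))"
      by (intro mult_left_mono order_trans[OF sum_cell_pair_energy[OF u_lsq]] I[unfolded r_def, folded r_def]) (use I in \<open>auto simp: r_def\<close>)
    also have "\<dots> = ennreal (441 ^ n * (81 * (r powr (dimH + 2 * \<sigma>) * s)))"
      using s0 by (simp add: ennreal_mult)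
    also have "441 ^ n * (81 * (r powr (dimH + 2 * \<sigma>) * s)) = C / rate ^ n"
      unfolding rp C_def by (simp add: power_mult_distrib)
    finally show "ennreal (441 ^ n) * (\<Sum>w\<in>words I n. \<Sum>w'\<in>{w' \<in> words I n. neighbours w' w}. cell_pair_energy u w w') \<le> ennreal (C / rate ^ n)" .
  qed
qed

text \<open>The bounds \<open>j\<close> are multiples of the energy of a cell paired with itself, which dominates the pairs
  of the cell and one of its subcells. They are kept apart from the cruder first bound because they can
  be summed over all cells of a level.\<close>

lemma average_increments:
  "\<exists>C j. 0 \<le> C \<and>
    (\<forall>n w w'. 1 \<le> n \<longrightarrow> w \<in> words I n \<longrightarrow> w' \<in> words I n \<longrightarrow> neighbours w' w \<longrightarrow>
        (cell_average u w - cell_average u w')\<^sup>2 \<le> C / rate ^ n) \<and>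
    (\<forall>n w i. 1 \<le> n \<longrightarrow> w \<in> words I n \<longrightarrow> i \<in> I \<longrightarrow> (cell_average u w - cell_average u (w @ [i]))\<^sup>2 \<le> j w) \<and>
    (\<forall>w. 0 \<le> j w) \<and>
    (\<forall>n. 1 \<le> n \<longrightarrow> (\<Sum>w\<in>words I n. j w) \<le> C / rate ^ n) \<and>
    (\<forall>n. 1 \<le> n \<longrightarrow> (\<Sum>w\<in>words I n. \<integral>\<^sup>+ x. ennreal ((u x - cell_average u w)\<^sup>2) * indicator (word_map w ` K) x \<partial>\<mu>) \<le> ennreal (C / rate ^ n / 21 ^ n))"
proof -
  obtain C where C: "0 \<le> C" and dec: "\<And>n. 1 \<le> n \<Longrightarrow>
    ennreal (441 ^ n) * (\<Sum>w\<in>words I n. \<Sum>w'\<in>{w' \<in> words I n. neighbours w' w}. cell_pair_energy u w w') \<le> ennreal (C / rate ^ n)"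
    using cell_pair_energy_decay by blast
  have q: "0 < rate ^ n" for n by simp
  let ?e = "cell_pair_energy u"
  have e1: "?e w w' \<le> (\<Sum>w\<in>words I n. \<Sum>w'\<in>{w' \<in> words I n. neighbours w' w}. ?e w w')"
    if "w \<in> words I n" "w' \<in> words I n" "neighbours w' w" for n w w'
  proof -
    have "?e w w' \<le> (\<Sum>w'\<in>{w' \<in> words I n. neighbours w' w}. ?e w w')"
      by (rule member_le_sum) (use that in auto)
    also have "\<dots> \<le> (\<Sum>w\<in>words I n. \<Sum>w'\<in>{w' \<in> words I n. neighbours w' w}. ?e w w')"
      by (rule member_le_sum[of w _ "\<lambda>w. \<Sum>w'\<in>{w' \<in> words I n. neighbours w' w}. ?e w w'"]) (use that in auto)
    finally show ?thesis .
  qed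
  have e2: "ennreal (441 ^ n) * ?e w w' \<le> ennreal (C / rate ^ n)"
    if "1 \<le> n" "w \<in> words I n" "w' \<in> words I n" "neighbours w' w" for n w w'
    by (rule order_trans[OF mult_left_mono[OF e1[OF that(2-4)]] dec[OF that(1)]]) simp
  have two: "(21::real) ^ n * 21 ^ n = 441 ^ n" for n by (simp add: power_mult_distrib[symmetric])
  define j where "j w = 21 * enn2real (ennreal (441 ^ length w) * ?e w w)" for w
  have jfin: "ennreal (441 ^ n) * ?e w w = ennreal (j w / 21)" if "1 \<le> n" "w \<in> words I n" for n w
    using e2[OF that that(2)] neq_top_trans[OF ennreal_neq_top] by (simp add: j_def length_words[OF that(2)] less_top[symmetric])
  show ?thesis
  proof (intro exI[of _ "21 * C"] exI[of _ j] conjI allI impI)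
    show "0 \<le> 21 * C" using C by simp
    show "0 \<le> j w" for w by (simp add: j_def)
    show "(cell_average u w - cell_average u w')\<^sup>2 \<le> 21 * C / rate ^ n"
      if "1 \<le> n" "w \<in> words I n" "w' \<in> words I n" "neighbours w' w" for n w w'
    proof -
      have "ennreal ((cell_average u w - cell_average u w')\<^sup>2) \<le> ennreal (C / rate ^ n)"
        using order_trans[OF cell_pair_energy_ge[OF u_lsq that(2,3), unfolded two] e2[OF that]] .
      then have "(cell_average u w - cell_average u w')\<^sup>2 \<le> C / rate ^ n"
        using C by (subst (asm) ennreal_le_iff) auto
      also have "\<dots> \<le> 21 * C / rate ^ n" using C q[of n] by (intro divide_right_mono) auto
      finally show ?thesis .
    qed
    show "(cell_average u w - cell_average u (w @ [i]))\<^sup>2 \<le> j w" if "1 \<le> n" "w \<in> words I n" "i \<in> I" for n w i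
    proof -
      have sub: "word_map (w @ [i]) ` K \<subseteq> word_map w ` K"
        using word_map_in_K[of "[i]" 1] that(3) by (auto simp: word_map_append words_def)
      have "?e w (w @ [i]) \<le> ?e w w" unfolding cell_pair_energy_def
        using sub by (intro nn_integral_mono mult_right_mono mult_left_mono) (auto simp: indicator_def)
      then have "ennreal (21 ^ n * 21 ^ Suc n) * ?e w (w @ [i]) \<le> ennreal (21 ^ n * 21 ^ Suc n) * ?e w w"
        by (rule mult_left_mono) simp
      also have "(21::real) ^ n * 21 ^ Suc n = 21 * 441 ^ n" using two[of n] by simp
      also have "ennreal (21 * 441 ^ n) * ?e w w = 21 * (ennreal (441 ^ n) * ?e w w)"
        by (simp add: ennreal_mult mult.assoc)
      also have "\<dots> = ennreal (j w)" unfolding jfin[OF that(1,2)]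
      proof -
        have "21 * ennreal (j w / 21) = ennreal 21 * ennreal (j w / 21)" by simp
        also have "\<dots> = ennreal (21 * (j w / 21))" by (rule ennreal_mult[symmetric]) (auto simp: j_def)
        finally show "21 * ennreal (j w / 21) = ennreal (j w)" by simp
      qed
      finally have "ennreal (21 * 441 ^ n) * ?e w (w @ [i]) \<le> ennreal (j w)" .
      moreover have "(21::real) ^ n * 21 ^ Suc n = 21 * 441 ^ n" using two[of n] by simp
      ultimately have "ennreal (21 ^ n * 21 ^ Suc n) * ?e w (w @ [i]) \<le> ennreal (j w)" by (simp only:)
      with cell_pair_energy_ge[OF u_lsq that(2) words_snoc[OF that(2,3)]]
      have "ennreal ((cell_average u w - cell_average u (w @ [i]))\<^sup>2) \<le> ennreal (j w)" by (rule order_trans)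
      then show ?thesis by (subst (asm) ennreal_le_iff) (auto simp: j_def)
    qed
    have diag: "(\<Sum>w\<in>words I n. ennreal (441 ^ n) * ?e w w) \<le> ennreal (C / rate ^ n)" if "1 \<le> n" for n
    proof -
      have "(\<Sum>w\<in>words I n. ?e w w) \<le> (\<Sum>w\<in>words I n. \<Sum>w'\<in>{w' \<in> words I n. neighbours w' w}. ?e w w')"
      proof (rule sum_mono)
        fix w assume "w \<in> words I n"
        then show "?e w w \<le> (\<Sum>w'\<in>{w' \<in> words I n. neighbours w' w}. ?e w w')"
          by (intro member_le_sum) auto
      qed
      then have "ennreal (441 ^ n) * (\<Sum>w\<in>words I n. ?e w w) \<le>
          ennreal (441 ^ n) * (\<Sum>w\<in>words I n. \<Sum>w'\<in>{w' \<in> words I n. neighbours w' w}. ?e w w')"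
        by (rule mult_left_mono) simp
      also have "\<dots> \<le> ennreal (C / rate ^ n)" by (rule dec[OF that])
      finally show ?thesis unfolding sum_distrib_left .
    qed
    show "(\<Sum>w\<in>words I n. j w) \<le> 21 * C / rate ^ n" if "1 \<le> n" for n
    proof -
      have "ennreal (\<Sum>w\<in>words I n. j w / 21) = (\<Sum>w\<in>words I n. ennreal (441 ^ n) * ?e w w)"
        by (subst sum_ennreal[symmetric]) (auto simp: jfin[OF that] j_def intro!: sum.cong)
      also have "\<dots> \<le> ennreal (C / rate ^ n)" by (rule diag[OF that])
      finally have "(\<Sum>w\<in>words I n. j w / 21) \<le> C / rate ^ n"
        using C by (subst (asm) ennreal_le_iff) auto
      then show ?thesis by (simp add: sum_divide_distrib[symmetric] mult.commute)
    qed
    show "(\<Sum>w\<in>words I n. \<integral>\<^sup>+ x. ennreal ((u x - cell_average u w)\<^sup>2) * indicator (word_map w ` K) x \<partial>\<mu>) \<le> ennreal (21 * C / rate ^ n / 21 ^ n)"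
      if "1 \<le> n" for n
    proof -
      have "(\<Sum>w\<in>words I n. \<integral>\<^sup>+ x. ennreal ((u x - cell_average u w)\<^sup>2) * indicator (word_map w ` K) x \<partial>\<mu>)
         \<le> (\<Sum>w\<in>words I n. ennreal (21 ^ n) * ?e w w)"
        by (intro sum_mono cell_pair_energy_ge_single[OF u_lsq])
      also have "\<dots> = (\<Sum>w\<in>words I n. ennreal (1 / 21 ^ n) * (ennreal (441 ^ n) * ?e w w))"
      proof -
        have "ennreal (1 / 21 ^ n) * ennreal (441 ^ n) = ennreal (21 ^ n)"
          unfolding two[symmetric] by (subst ennreal_mult[symmetric]) auto
        then show ?thesis by (simp only: mult.assoc[symmetric])
      qed
      also have "\<dots> \<le> ennreal (1 / 21 ^ n) * ennreal (C / rate ^ n)"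
        by (subst sum_distrib_left[symmetric]) (rule mult_left_mono[OF diag[OF that]], simp)
      also have "\<dots> \<le> ennreal (21 * C / rate ^ n / 21 ^ n)"
        using C q[of n] by (subst ennreal_mult[symmetric]) (auto intro!: ennreal_leI divide_right_mono simp: field_simps)
      finally show ?thesis .
    qed
  qed
qed


text \<open>The averages of \<open>u\<close> over cells that shrink to a point \<open>x\<close> converge geometrically and uniformly; the
  limit \<open>v\<close> is continuous because averages over neighbouring cells are close, and it equals \<open>u\<close> almost
  everywhere because \<open>u\<close> is close to its averages in the mean. The values of \<open>v\<close> at the vertices of a cell \<open>w\<close> are
  reached along the subcells at the vertex, and the increments on the way are square summable over \<open>w\<close>.\<close>

theorem besov_continuous_representative:
  "\<exists>v. continuous_on K v \<and> (AE x in \<mu>. u x = v x) \<and> (\<exists>C. \<forall>n. vertex_energy n v \<le> C / rate ^ n)"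
proof -
  let ?A = "cell_average u"
  from average_increments obtain C j where C: "0 \<le> C"
    and nb0: "\<forall>n w w'. 1 \<le> n \<longrightarrow> w \<in> words I n \<longrightarrow> w' \<in> words I n \<longrightarrow> neighbours w' w \<longrightarrow> (?A w - ?A w')\<^sup>2 \<le> C / rate ^ n"
    and child0: "\<forall>n w i. 1 \<le> n \<longrightarrow> w \<in> words I n \<longrightarrow> i \<in> I \<longrightarrow> (?A w - ?A (w @ [i]))\<^sup>2 \<le> j w"
    and j0: "\<forall>w. 0 \<le> j w"
    and sumj0: "\<forall>n. 1 \<le> n \<longrightarrow> (\<Sum>w\<in>words I n. j w) \<le> C / rate ^ n"
    and dev0: "\<forall>n. 1 \<le> n \<longrightarrow> (\<Sum>w\<in>words I n. \<integral>\<^sup>+ x. ennreal ((u x - ?A w)\<^sup>2) * indicator (word_map w ` K) x \<partial>\<mu>) \<le> ennreal (C / rate ^ n / 21 ^ n)"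
    by (elim exE conjE)
  note nb = nb0[rule_format] and child = child0[rule_format] and sumj = sumj0[rule_format] and dev = dev0[rule_format]
  define q where "q = 1 / sqrt rate"
  have q: "0 < q" "q < 1" using rate_gt_1 by (auto simp: q_def real_less_rsqrt)
  define E where "E n = sqrt C * q ^ n" for n :: nat
  have E: "sqrt (C / rate ^ n) = E n" for n
    by (simp add: E_def q_def real_sqrt_divide real_sqrt_power power_divide)
  have E0: "0 \<le> E n" for n using C q by (simp add: E_def)
  have nb': "\<bar>?A w - ?A w'\<bar> \<le> E n" if "1 \<le> n" "w \<in> words I n" "w' \<in> words I n" "neighbours w' w" for n w w'
    using nb[OF that] unfolding E[symmetric] by (metis real_sqrt_abs real_sqrt_le_mono)
  have child': "\<bar>?A w - ?A (w @ [i])\<bar> \<le> E n" if "1 \<le> n" "w \<in> words I n" "i \<in> I" for n w i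
  proof -
    have "j w \<le> (\<Sum>w\<in>words I n. j w)" by (rule member_le_sum) (use that j0 in auto)
    then have "(?A w - ?A (w @ [i]))\<^sup>2 \<le> C / rate ^ n" using child[OF that] sumj[OF that(1)] by linarith
    then show ?thesis unfolding E[symmetric] by (metis real_sqrt_abs real_sqrt_le_mono)
  qed
  define W where "W n x = (SOME w. w \<in> words I n \<and> x \<in> word_map w ` K)" for n x
  have W: "W n x \<in> words I n" "x \<in> word_map (W n x) ` K" if "x \<in> K" for n x
  proof -
    have "\<exists>w. w \<in> words I n \<and> x \<in> word_map w ` K" using K_cells[of n] that by blast
    then have "W n x \<in> words I n \<and> x \<in> word_map (W n x) ` K" unfolding W_def by (rule someI_ex)
    then show "W n x \<in> words I n" "x \<in> word_map (W n x) ` K" by auto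
  qed
  have same: "\<bar>?A w - ?A (W n x)\<bar> \<le> E n" if "1 \<le> n" "w \<in> words I n" "x \<in> word_map w ` K" for n w x
  proof -
    have x: "x \<in> K" using that cell_subset_K by blast
    show ?thesis
      using nb'[OF that(1,2) W(1)[OF x]] cells_meeting_are_neighbours[OF W(1)[OF x] that(2) W(2)[OF x] that(3)] by simp
  qed
  define a where "a n x = ?A (W n x)" for n x
  have step: "\<bar>a n x - a (Suc n) x\<bar> \<le> 2 * E n" if n: "1 \<le> n" and x: "x \<in> K" for n x
  proof -
    obtain w i where w: "w \<in> words I n" "i \<in> I" "W (Suc n) x = w @ [i]" using W(1)[OF x] by (rule words_snocE)
    have "x \<in> word_map w ` K"
      using W(2)[OF x, of "Suc n"] w word_map_in_K[of "[i]" 1] by (auto simp: word_map_append words_def)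
    then have "\<bar>?A w - a n x\<bar> \<le> E n" unfolding a_def using same[OF n w(1)] by blast
    moreover have "\<bar>?A w - a (Suc n) x\<bar> \<le> E n" unfolding a_def w(3) by (rule child'[OF n w(1,2)])
    ultimately show ?thesis by linarith
  qed
  define G where "G = 2 / (1 - q)"
  have tel: "\<bar>a n x - a (n + k) x\<bar> \<le> G * E n" if "1 \<le> n" "x \<in> K" for n k x
  proof -
    have "\<bar>a n x - a (n + k) x\<bar> \<le> (\<Sum>i<k. 2 * E (n + i))"
    proof (induction k)
      case (Suc k)
      show ?case using Suc step[of "n + k" x] that by simp
    qed simp
    also have "\<dots> = 2 * E n * (\<Sum>i<k. q ^ i)" by (simp add: E_def power_add sum_distrib_left mult_ac)
    also have "\<dots> \<le> 2 * E n * (\<Sum>i. q ^ i)"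
      using q E0[of n] by (intro mult_left_mono sum_le_suminf summable_geometric) auto
    also have "\<dots> = G * E n" using q by (simp add: suminf_geometric G_def)
    finally show ?thesis .
  qed
  have Elim: "E \<longlonglongrightarrow> 0" unfolding E_def using q by (intro tendsto_mult_right_zero LIMSEQ_realpow_zero) auto
  have conv: "convergent (\<lambda>n. a n x)" if "x \<in> K" for x
  proof (rule Cauchy_convergent, rule metric_CauchyI)
    fix e :: real assume "0 < e"
    have "(\<lambda>n. G * E n) \<longlonglongrightarrow> 0" using tendsto_mult_right_zero[OF Elim] by simp
    then have "\<forall>\<^sub>F n in sequentially. G * E n < e / 2" by (rule order_tendstoD) (use \<open>0 < e\<close> in simp)
    then obtain N where N: "\<And>n. n \<ge> N \<Longrightarrow> G * E n < e / 2" by (auto simp: eventually_sequentially)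
    let ?M = "max 1 N"
    have "\<bar>a ?M x - a m x\<bar> < e / 2" if "m \<ge> ?M" for m
      using tel[of ?M x "m - ?M"] N[of ?M] that \<open>x \<in> K\<close> by simp
    then show "\<exists>M. \<forall>m\<ge>M. \<forall>n\<ge>M. dist (a m x) (a n x) < e"
    proof (intro exI[of _ ?M] allI impI)
      fix m n assume "?M \<le> m" "?M \<le> n"
      then have "\<bar>a ?M x - a m x\<bar> < e / 2" "\<bar>a ?M x - a n x\<bar> < e / 2"
        using \<open>\<And>m. m \<ge> ?M \<Longrightarrow> \<bar>a ?M x - a m x\<bar> < e / 2\<close> by blast+
      then show "dist (a m x) (a n x) < e" unfolding dist_real_def by linarith
    qed
  qed
  define v where "v x = lim (\<lambda>n. a n x)" for x
  have lim: "(\<lambda>n. a n x) \<longlonglongrightarrow> v x" if "x \<in> K" for x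
    using conv[OF that] by (simp add: v_def convergent_LIMSEQ_iff)
  have va: "\<bar>a n x - v x\<bar> \<le> G * E n" if "1 \<le> n" "x \<in> K" for n x
  proof -
    have "(\<lambda>k. \<bar>a n x - a (k + n) x\<bar>) \<longlonglongrightarrow> \<bar>a n x - v x\<bar>"
      by (intro tendsto_intros LIMSEQ_ignore_initial_segment lim that)
    then show ?thesis by (rule LIMSEQ_le_const2) (use tel[OF that] in \<open>auto simp: add.commute\<close>)
  qed
  have "uniformly_continuous_on K v"
    unfolding uniformly_continuous_on_def
  proof (intro allI impI)
    fix e :: real assume "0 < e"
    have "(\<lambda>n. (2 * G + 1) * E n) \<longlonglongrightarrow> 0" using tendsto_mult_right_zero[OF Elim] by simp
    then have "\<forall>\<^sub>F n in sequentially. (2 * G + 1) * E n < e" by (rule order_tendstoD) (use \<open>0 < e\<close> in simp)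
    then obtain N where N: "\<And>n. n \<ge> N \<Longrightarrow> (2 * G + 1) * E n < e" by (auto simp: eventually_sequentially)
    define n where "n = max 1 N"
    have n: "1 \<le> n" "(2 * G + 1) * E n < e" using N[of n] by (auto simp: n_def)
    show "\<exists>d>0. \<forall>x\<in>K. \<forall>x'\<in>K. dist x' x < d \<longrightarrow> dist (v x') (v x) < e"
    proof (intro exI[of _ "1 / 9 ^ n"] conjI ballI impI)
      fix x x' assume x: "x \<in> K" and x': "x' \<in> K" and d: "dist x' x < 1 / 9 ^ n"
      have "\<bar>a n x - a n x'\<bar> \<le> E n"
        unfolding a_def using cells_meeting_are_neighbours[OF W(1)[OF x'] W(1)[OF x] W(2)[OF x'] W(2)[OF x] d]
        by (rule nb'[OF n(1) W(1)[OF x] W(1)[OF x']])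
      then have "\<bar>v x' - v x\<bar> \<le> (2 * G + 1) * E n"
        using va[OF n(1) x] va[OF n(1) x'] by (simp add: distrib_right)
      then show "dist (v x') (v x) < e" using n(2) by (simp add: dist_real_def)
    qed simp
  qed
  then have cont: "continuous_on K v" by (rule uniformly_continuous_imp_continuous)
  have ae: "AE x in \<mu>. u x = v x"
  proof -
    have [measurable]: "u \<in> borel_measurable \<mu>" "v \<in> borel_measurable \<mu>"
      using u_lsq cont_measurable[OF sets_\<mu> finite_measure_\<mu> cont] by (auto simp: lsq_def)
    have bd: "(\<integral>\<^sup>+ x. ennreal ((u x - v x)\<^sup>2) \<partial>\<mu>) \<le> ennreal (2 * (C / rate ^ n / 21 ^ n) + 2 * (G * E n)\<^sup>2)" if n: "1 \<le> n" for n
    proof -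
      let ?i = "\<lambda>w. indicator (word_map w ` K) :: point \<Rightarrow> ennreal"
      have "ennreal ((u x - v x)\<^sup>2) \<le> 2 * (\<Sum>w\<in>words I n. ennreal ((u x - ?A w)\<^sup>2) * ?i w x) + ennreal (2 * (G * E n)\<^sup>2)"
        if x: "x \<in> K" for x
      proof -
        have "(u x - v x)\<^sup>2 \<le> 2 * (u x - a n x)\<^sup>2 + 2 * (a n x - v x)\<^sup>2"
          using zero_le_power2[of "(u x - a n x) - (a n x - v x)"] by (simp add: power2_eq_square algebra_simps)
        also have "(a n x - v x)\<^sup>2 \<le> (G * E n)\<^sup>2"
          using power_mono[OF va[OF n x], of 2] by simp
        finally have "ennreal ((u x - v x)\<^sup>2) \<le> ennreal (2 * (u x - a n x)\<^sup>2 + 2 * (G * E n)\<^sup>2)" by (intro ennreal_leI) simp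
        also have "\<dots> = 2 * (ennreal ((u x - a n x)\<^sup>2) * ?i (W n x) x) + ennreal (2 * (G * E n)\<^sup>2)"
          using W(2)[OF x, of n] by (simp add: ennreal_plus[symmetric] ennreal_mult del: ennreal_plus)
             (simp add: ennreal_mult)
        also have "\<dots> \<le> 2 * (\<Sum>w\<in>words I n. ennreal ((u x - ?A w)\<^sup>2) * ?i w x) + ennreal (2 * (G * E n)\<^sup>2)"
          unfolding a_def
          by (intro add_right_mono mult_left_mono member_le_sum[of "W n x" _ "\<lambda>w. ennreal ((u x - ?A w)\<^sup>2) * ?i w x"]) (use W(1)[OF x] in auto)
        finally show ?thesis .
      qed
      then have "(\<integral>\<^sup>+ x. ennreal ((u x - v x)\<^sup>2) \<partial>\<mu>) \<le>
          (\<integral>\<^sup>+ x. 2 * (\<Sum>w\<in>words I n. ennreal ((u x - ?A w)\<^sup>2) * ?i w x) + ennreal (2 * (G * E n)\<^sup>2) \<partial>\<mu>)"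
        by (intro nn_integral_mono) simp
      also have "\<dots> = 2 * (\<Sum>w\<in>words I n. \<integral>\<^sup>+ x. ennreal ((u x - ?A w)\<^sup>2) * ?i w x \<partial>\<mu>) + ennreal (2 * (G * E n)\<^sup>2) * emeasure \<mu> K"
      proof -
        have m: "(\<lambda>x. ennreal ((u x - ?A w)\<^sup>2) * ?i w x) \<in> borel_measurable \<mu>" if "w \<in> words I n" for w
          using cell_in_sets[OF that] by measurable
        have ms: "(\<lambda>x. \<Sum>w\<in>words I n. ennreal ((u x - ?A w)\<^sup>2) * ?i w x) \<in> borel_measurable \<mu>"
          by (rule borel_measurable_sum[OF m])
        have "(\<integral>\<^sup>+ x. 2 * (\<Sum>w\<in>words I n. ennreal ((u x - ?A w)\<^sup>2) * ?i w x) + ennreal (2 * (G * E n)\<^sup>2) \<partial>\<mu>) =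
            (\<integral>\<^sup>+ x. 2 * (\<Sum>w\<in>words I n. ennreal ((u x - ?A w)\<^sup>2) * ?i w x) \<partial>\<mu>) + (\<integral>\<^sup>+ x. ennreal (2 * (G * E n)\<^sup>2) \<partial>\<mu>)"
          by (intro nn_integral_add borel_measurable_times_ennreal ms) auto
        also have "(\<integral>\<^sup>+ x. 2 * (\<Sum>w\<in>words I n. ennreal ((u x - ?A w)\<^sup>2) * ?i w x) \<partial>\<mu>) =
            2 * (\<integral>\<^sup>+ x. (\<Sum>w\<in>words I n. ennreal ((u x - ?A w)\<^sup>2) * ?i w x) \<partial>\<mu>)"
          by (rule nn_integral_cmult[OF ms])
        also have "(\<integral>\<^sup>+ x. (\<Sum>w\<in>words I n. ennreal ((u x - ?A w)\<^sup>2) * ?i w x) \<partial>\<mu>) =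
            (\<Sum>w\<in>words I n. \<integral>\<^sup>+ x. ennreal ((u x - ?A w)\<^sup>2) * ?i w x \<partial>\<mu>)"
          by (rule nn_integral_sum[OF m])
        also have "(\<integral>\<^sup>+ x. ennreal (2 * (G * E n)\<^sup>2) \<partial>\<mu>) = ennreal (2 * (G * E n)\<^sup>2) * emeasure \<mu> K"
          by (simp only: nn_integral_const space_\<mu>)
        finally show ?thesis .
      qed
      also have "\<dots> \<le> 2 * ennreal (C / rate ^ n / 21 ^ n) + ennreal (2 * (G * E n)\<^sup>2)"
        using dev[OF n] by (simp add: emeasure_K mult_left_mono)
      also have "\<dots> = ennreal (2 * (C / rate ^ n / 21 ^ n) + 2 * (G * E n)\<^sup>2)"
      proof -
        have "ennreal (2 * (C / rate ^ n / 21 ^ n)) = ennreal 2 * ennreal (C / rate ^ n / 21 ^ n)"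
          by (rule ennreal_mult) (use C in auto)
        moreover have "ennreal (2 * (C / rate ^ n / 21 ^ n) + 2 * (G * E n)\<^sup>2) =
            ennreal (2 * (C / rate ^ n / 21 ^ n)) + ennreal (2 * (G * E n)\<^sup>2)"
          by (rule ennreal_plus) (use C in auto)
        ultimately show ?thesis by (simp only: ennreal_numeral)
      qed
      finally show ?thesis .
    qed
    have "(\<lambda>n. 2 * (C / rate ^ n / 21 ^ n) + 2 * (G * E n)\<^sup>2) \<longlonglongrightarrow> 2 * 0 + 2 * (G * 0)\<^sup>2"
    proof (intro tendsto_intros Elim)
      have "(\<lambda>n. C / (rate * 21) ^ n) \<longlonglongrightarrow> 0"
        using rate_gt_1 by (intro LIMSEQ_divide_realpow_zero) simp
      then show "(\<lambda>n. C / rate ^ n / 21 ^ n) \<longlonglongrightarrow> 0" by (simp add: power_mult_distrib)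
    qed
    then have "(\<lambda>n. ennreal (2 * (C / rate ^ n / 21 ^ n) + 2 * (G * E n)\<^sup>2)) \<longlonglongrightarrow> ennreal (2 * 0 + 2 * (G * 0)\<^sup>2)"
      by (rule tendsto_ennrealI)
    then have "(\<integral>\<^sup>+ x. ennreal ((u x - v x)\<^sup>2) \<partial>\<mu>) \<le> ennreal (2 * 0 + 2 * (G * 0)\<^sup>2)"
      by (rule LIMSEQ_le_const) (use bd in blast)
    then have "(\<integral>\<^sup>+ x. ennreal ((u x - v x)\<^sup>2) \<partial>\<mu>) = 0" by simp
    then have "AE x in \<mu>. ennreal ((u x - v x)\<^sup>2) = 0" by (subst (asm) nn_integral_0_iff_AE) auto
    then show ?thesis by eventually_elim simp
  qed
  \<comment> \<open>\<open>c p\<close> is the cell at the corner \<open>p\<close>, so that \<open>w @ replicate m (c p)\<close> shrinks to the vertex \<open>word_map w p\<close>.\<close>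
  have vert: "vertex_energy n v \<le> 256 * (C * geom_const rate) / rate ^ n" if n: "1 \<le> n" for n
  proof -
    have "\<forall>p\<in>corners. \<exists>c. c \<in> I \<and> cell_map c p = p" using corner_fixed by metis
    then obtain c where c: "\<And>p. p \<in> corners \<Longrightarrow> c p \<in> I" "\<And>p. p \<in> corners \<Longrightarrow> cell_map (c p) p = p" by metis
    define d where "d p m w = \<bar>?A (w @ replicate m (c p)) - ?A (w @ replicate (Suc m) (c p))\<bar>" for p m w
    define S where "S p w = (\<Sum>m. d p m w)" for p w
    have rep: "replicate m (c p) \<in> words I m" if "p \<in> corners" for m p using c(1)[OF that] by (auto simp: words_def)
    have dsum: "(\<Sum>w\<in>words I n. (d p m w)\<^sup>2) \<le> (C / rate ^ n) / rate ^ m" if p: "p \<in> corners" for p m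
    proof -
      have "(\<Sum>w\<in>words I n. (d p m w)\<^sup>2) \<le> (\<Sum>w\<in>words I n. j (w @ replicate m (c p)))"
      proof (rule sum_mono)
        fix w assume w: "w \<in> words I n"
        have "w @ replicate m (c p) \<in> words I (n + m)" by (rule words_append[OF w rep[OF p]])
        from child[OF _ this c(1)[OF p]] n
        show "(d p m w)\<^sup>2 \<le> j (w @ replicate m (c p))"
          by (simp add: d_def replicate_append_same)
      qed
      also have "\<dots> \<le> (\<Sum>w\<in>words I n. \<Sum>v\<in>words I m. j (w @ v))"
        by (intro sum_mono member_le_sum[of "replicate m (c p)" _ "\<lambda>v. j (_ @ v)"]) (use j0 rep[OF p] in auto)
      also have "\<dots> \<le> C / rate ^ (n + m)" unfolding sum_words_append[symmetric] using n by (intro sumj) simp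
      finally show ?thesis by (simp add: power_add)
    qed
    have C': "0 \<le> C / rate ^ n" using C by simp
    note gm = sum_squares_geometric[OF _ rate_gt_1 C' _ dsum]
    have sm: "summable (\<lambda>m. d p m w)" if "p \<in> corners" "w \<in> words I n" for p w
      by (rule gm(1)[OF _ _ that]) (auto simp: d_def)
    have S2: "(\<Sum>w\<in>words I n. (S p w)\<^sup>2) \<le> C / rate ^ n * geom_const rate" if "p \<in> corners" for p
      unfolding S_def by (rule gm(2)[OF _ _ that]) (auto simp: d_def)
    have vS: "\<bar>v (word_map w p) - ?A w\<bar> \<le> S p w" if p: "p \<in> corners" and w: "w \<in> words I n" for p w
    proof -
      have fp: "word_map (replicate m (c p)) p = p" for m by (induction m) (auto simp: c(2)[OF p])
      let ?x = "word_map w p"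
      have x: "?x \<in> K" by (rule vertex_in_K[OF w p])
      have "\<bar>?A (w @ replicate m (c p)) - a (n + m) ?x\<bar> \<le> E (n + m)" for m
      proof -
        have "?x = word_map (w @ replicate m (c p)) p" by (simp add: word_map_append fp)
        then have "?x \<in> word_map (w @ replicate m (c p)) ` K" using p corners_in_K by blast
        then show ?thesis unfolding a_def using n by (intro same words_append w rep p) auto
      qed
      then have "(\<lambda>m. ?A (w @ replicate m (c p)) - a (m + n) ?x) \<longlonglongrightarrow> 0"
        by (intro Lim_null_comparison[OF _ LIMSEQ_ignore_initial_segment[OF Elim, of n]]) (auto simp: add.commute)
      from tendsto_add[OF this LIMSEQ_ignore_initial_segment[OF lim[OF x], of n]]
      have lA: "(\<lambda>m. ?A (w @ replicate m (c p))) \<longlonglongrightarrow> v ?x" by simp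
      have "\<bar>?A (w @ replicate m (c p)) - ?A w\<bar> \<le> S p w" for m
      proof -
        have "\<bar>?A (w @ replicate m (c p)) - ?A w\<bar> \<le> (\<Sum>i<m. d p i w)"
        proof (induction m)
          case (Suc m)
          have "\<bar>?A (w @ replicate (Suc m) (c p)) - ?A (w @ replicate m (c p))\<bar> = d p m w" by (simp add: d_def abs_minus_commute)
          with Suc show ?case by (simp del: replicate_Suc)
        qed simp
        also have "\<dots> \<le> S p w" unfolding S_def by (rule sum_le_suminf[OF sm[OF p w]]) (auto simp: d_def)
        finally show ?thesis .
      qed
      moreover have "(\<lambda>m. \<bar>?A (w @ replicate m (c p)) - ?A w\<bar>) \<longlonglongrightarrow> \<bar>v ?x - ?A w\<bar>" by (intro tendsto_intros lA)
      ultimately show ?thesis by (intro LIMSEQ_le_const2) auto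
    qed
    have "cell_variation v w \<le> 16 * (4 * (\<Sum>p\<in>corners. (S p w)\<^sup>2))" if w: "w \<in> words I n" for w
    proof (rule cell_variation_le)
      fix p q' assume pq: "p \<in> corners" "q' \<in> corners"
      have le: "(v (word_map w r) - ?A w)\<^sup>2 \<le> (\<Sum>p\<in>corners. (S p w)\<^sup>2)" if r: "r \<in> corners" for r
      proof -
        have "(v (word_map w r) - ?A w)\<^sup>2 \<le> (S r w)\<^sup>2" using power_mono[OF vS[OF r w], of 2] by simp
        also have "\<dots> \<le> (\<Sum>p\<in>corners. (S p w)\<^sup>2)" by (rule member_le_sum[of r _ "\<lambda>p. (S p w)\<^sup>2"]) (use r in auto)
        finally show ?thesis .
      qed
      have "(v (word_map w p) - v (word_map w q'))\<^sup>2 \<le> 2 * (v (word_map w p) - ?A w)\<^sup>2 + 2 * (v (word_map w q') - ?A w)\<^sup>2"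
        using zero_le_power2[of "(v (word_map w p) - ?A w) + (v (word_map w q') - ?A w)"] by (simp add: power2_eq_square algebra_simps)
      then show "(v (word_map w p) - v (word_map w q'))\<^sup>2 \<le> 4 * (\<Sum>p\<in>corners. (S p w)\<^sup>2)"
        using le[OF pq(1)] le[OF pq(2)] by linarith
    qed
    then have "vertex_energy n v \<le> (\<Sum>w\<in>words I n. 16 * (4 * (\<Sum>p\<in>corners. (S p w)\<^sup>2)))"
      unfolding vertex_energy_def by (rule sum_mono)
    also have "\<dots> = 64 * (\<Sum>p\<in>corners. \<Sum>w\<in>words I n. (S p w)\<^sup>2)"
      by (subst sum.swap) (simp add: sum_distrib_left)
    also have "\<dots> \<le> 64 * (\<Sum>p\<in>corners. C / rate ^ n * geom_const rate)" by (intro mult_left_mono sum_mono S2) auto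
    also have "\<dots> = 256 * (C * geom_const rate) / rate ^ n" by (simp only: sum_corners) simp
    finally show ?thesis .
  qed
  have "vertex_energy n v \<le> max (vertex_energy 0 v) (256 * (C * geom_const rate)) / rate ^ n" for n
  proof (cases "n = 0")
    case False
    then have "vertex_energy n v \<le> 256 * (C * geom_const rate) / rate ^ n" by (intro vert) simp
    also have "\<dots> \<le> max (vertex_energy 0 v) (256 * (C * geom_const rate)) / rate ^ n" by (intro divide_right_mono) auto
    finally show ?thesis .
  qed simp
  with cont ae show ?thesis by blast
qed

end

end

section \<open>Dirichlet forms from compatible star networks\<close>

definition star_bilinear :: "real \<Rightarrow> real \<Rightarrow> (point \<Rightarrow> real) \<Rightarrow> (point \<Rightarrow> real) \<Rightarrow> real" where
  "star_bilinear a b f g = 1/2 * (\<Sum>p\<in>corners. \<Sum>q\<in>corners. mesh a b p q * ((f p - f q) * (g p - g q)))"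

lemma star_bilinear_diag: "star_bilinear a b f f = star_energy a b f"
  by (simp add: star_bilinear_def star_energy_def power2_eq_square)

lemma star_bilinear_sym: "star_bilinear a b f g = star_bilinear a b g f"
  by (simp add: star_bilinear_def mult.commute)

lemma star_bilinear_add: "star_bilinear a b (\<lambda>x. f x + g x) h = star_bilinear a b f h + star_bilinear a b g h"
proof -
  have "mesh a b p q * ((f p + g p - (f q + g q)) * (h p - h q)) =
     mesh a b p q * ((f p - f q) * (h p - h q)) + mesh a b p q * ((g p - g q) * (h p - h q))" for p q
    by (simp add: algebra_simps)
  then show ?thesis unfolding star_bilinear_def by (simp only: sum.distrib distrib_left)
qed

lemma star_bilinear_scale: "star_bilinear a b (\<lambda>x. k * f x) h = k * star_bilinear a b f h"
proof -
  have "mesh a b p q * ((k * f p - k * f q) * (h p - h q)) = k * (mesh a b p q * ((f p - f q) * (h p - h q)))" for p q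
    by (simp add: algebra_simps)
  then show ?thesis unfolding star_bilinear_def by (simp only: sum_distrib_left[symmetric] mult.left_commute[of "1/2" k])
qed

text \<open>The star of the cell \<open>w\<close> has the arm resistances \<open>ar w, br w\<close>; the assumption
  \<open>refine\<close> says that the network of its subcells reduces to it, and \<open>decay\<close> that cells are small in
  the resistance metric.\<close>

locale star_form = eyebolted_cross +
  fixes ar br :: "cell list \<Rightarrow> real" and R l :: real
  assumes ar_pos: "\<And>w. 0 < ar w" and br_pos: "\<And>w. 0 < br w"
    and refine: "\<And>n w. w \<in> words I n \<Longrightarrow> \<exists>\<kappa> a b. 0 < \<kappa> \<and> 0 < a \<and> 0 < b \<and>
        (\<forall>i\<in>I. ar (w @ [i]) = cell_scale \<kappa> i * a \<and> br (w @ [i]) = cell_scale \<kappa> i * b) \<and>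
        ar w = 9 * a \<and> br w = renorm \<kappa> a b"
    and l: "1 < l" and decay: "\<And>n w. w \<in> words I n \<Longrightarrow> ar w \<le> R / l ^ n \<and> br w \<le> R / l ^ n"
begin

definition conductance :: conductances where
  "conductance w x y = mesh (ar w) (br w) (inv (word_map w) x) (inv (word_map w) y)"

definition network_energy :: "nat \<Rightarrow> (point \<Rightarrow> real) \<Rightarrow> real" where
  "network_energy n u = (\<Sum>w\<in>words I n. star_energy (ar w) (br w) (u \<circ> word_map w))"

definition network_bilinear :: "nat \<Rightarrow> (point \<Rightarrow> real) \<Rightarrow> (point \<Rightarrow> real) \<Rightarrow> real" where
  "network_bilinear n u v = (\<Sum>w\<in>words I n. star_bilinear (ar w) (br w) (u \<circ> word_map w) (v \<circ> word_map w))"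

lemma conductance_vertex: "conductance w (word_map w p) (word_map w q) = mesh (ar w) (br w) p q"
  by (simp add: conductance_def inv_f_f[OF inj_word_map])

lemma level_energy_eq: "level_energy I conductance n u = network_energy n u"
  unfolding level_energy_def network_energy_def
proof (rule sum.cong[OF refl])
  fix w
  have inj: "inj_on (word_map w) corners" using inj_word_map by (rule inj_on_subset) simp
  show "1/2 * (\<Sum>x\<in>word_vertices w. \<Sum>y\<in>word_vertices w. conductance w x y * \<bar>u x - u y\<bar>\<^sup>2) =
      star_energy (ar w) (br w) (u \<circ> word_map w)"
    unfolding word_vertices_def sum.reindex[OF inj] star_energy_def comp_apply conductance_vertex power2_abs ..
qed

lemma positive: "positive_conductances I conductance"
  unfolding positive_conductances_def word_vertices_def
  using conductance_vertex mesh_pos[OF ar_pos br_pos] mesh_sym by auto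

lemma subcell_energy:
  assumes "w \<in> words I n"
  shows "\<exists>\<kappa> a b. 0 < \<kappa> \<and> 0 < a \<and> 0 < b \<and> ar w = 9 * a \<and> br w = renorm \<kappa> a b \<and>
    (\<forall>f. (\<Sum>i\<in>I. star_energy (ar (w @ [i])) (br (w @ [i])) (f \<circ> cell_map i)) = level1_energy lr ul \<kappa> a b f)"
proof -
  obtain \<kappa> a b where k: "0 < \<kappa>" "0 < a" "0 < b"
    "\<forall>i\<in>I. ar (w @ [i]) = cell_scale \<kappa> i * a \<and> br (w @ [i]) = cell_scale \<kappa> i * b" "ar w = 9 * a" "br w = renorm \<kappa> a b"
    using refine[OF assms] by blast
  have "(\<Sum>i\<in>I. star_energy (ar (w @ [i])) (br (w @ [i])) (f \<circ> cell_map i)) = level1_energy lr ul \<kappa> a b f" for f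
    unfolding level1_energy_def I[symmetric] using k(4) by (intro sum.cong) auto
  with k show ?thesis by blast
qed

lemma network_energy_Suc:
  "network_energy (Suc n) u = (\<Sum>w\<in>words I n. \<Sum>i\<in>I. star_energy (ar (w @ [i])) (br (w @ [i])) ((u \<circ> word_map w) \<circ> cell_map i))"
  unfolding network_energy_def sum_words_snoc by (simp add: word_map_append comp_assoc o_def)

lemma network_energy_mono: "network_energy n u \<le> network_energy (Suc n) u"
  unfolding network_energy_Suc unfolding network_energy_def
proof (rule sum_mono)
  fix w assume "w \<in> words I n"
  from subcell_energy[OF this] show "star_energy (ar w) (br w) (u \<circ> word_map w) \<le>
      (\<Sum>i\<in>I. star_energy (ar (w @ [i])) (br (w @ [i])) ((u \<circ> word_map w) \<circ> cell_map i))"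
    using level1_energy_lower[of _ _ _ "u \<circ> word_map w" lr ul] by auto
qed

lemma network_energy_incseq: "incseq (\<lambda>n. network_energy n u)"
  by (rule incseq_SucI) (rule network_energy_mono)

lemma network_energy_nonneg: "0 \<le> network_energy n u"
  unfolding network_energy_def by (intro sum_nonneg star_energy_nonneg ar_pos br_pos)

lemma network_energy_cong:
  assumes "\<And>x. x \<in> vertices I n \<Longrightarrow> u x = v x"
  shows "network_energy n u = network_energy n v"
  unfolding network_energy_def
proof (intro sum.cong refl star_energy_cong)
  fix w p assume "w \<in> words I n" "p \<in> corners"
  then have "word_map w p \<in> vertices I n" by (auto simp: vertices_eq)
  then show "(u \<circ> word_map w) p = (v \<circ> word_map w) p" using assms by simp
qed

lemma network_energy_cong_K: "(\<And>x. x \<in> K \<Longrightarrow> u x = v x) \<Longrightarrow> network_energy n u = network_energy n v"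
proof (rule network_energy_cong)
  fix x assume "\<And>x. x \<in> K \<Longrightarrow> u x = v x" "x \<in> vertices I n"
  then show "u x = v x" using all_vertices_in_K unfolding all_vertices_def by blast
qed

text \<open>Minimizing the energy level by level, which is possible in each cell separately.\<close>

lemma harmonic_extension:
  fixes f :: "point \<Rightarrow> real"
  shows "\<exists>u. (\<forall>x\<in>vertices I N. u x = f x) \<and> (\<forall>n\<ge>N. network_energy n u = network_energy N f) \<and>
    (\<forall>w\<in>words I N. \<forall>m M. (\<forall>p\<in>corners. m \<le> f (word_map w p) \<and> f (word_map w p) \<le> M) \<longrightarrow>
       (\<forall>x\<in>all_vertices. m \<le> u (word_map w x) \<and> u (word_map w x) \<le> M))"
proof -
  have "\<exists>u. (\<forall>x\<in>vertices I N. u x = f x) \<and>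
    (\<forall>n. \<forall>w\<in>words I (N + n). True) \<and>
    (\<forall>n. (\<Sum>w\<in>words I (N + n). star_energy (ar w) (br w) (u \<circ> word_map w)) \<le> (\<Sum>w\<in>words I N. star_energy (ar w) (br w) (f \<circ> word_map w))) \<and>
    (\<forall>w\<in>words I N. \<forall>m M. (\<forall>p\<in>corners. m \<le> f (word_map w p) \<and> f (word_map w p) \<le> M) \<longrightarrow>
       (\<forall>x\<in>all_vertices. m \<le> u (word_map w x) \<and> u (word_map w x) \<le> M))"
  proof (rule extension_scheme[where A="\<lambda>_. True" and e="\<lambda>w. star_energy (ar w) (br w)"])
    fix w n and f :: "point \<Rightarrow> real" and m M
    assume w: "w \<in> words I n" and f: "\<And>p. p \<in> corners \<Longrightarrow> m \<le> f p \<and> f p \<le> M"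
    obtain \<kappa> a b where k: "0 < \<kappa>" "0 < a" "0 < b" "ar w = 9 * a" "br w = renorm \<kappa> a b"
      "\<forall>f. (\<Sum>i\<in>I. star_energy (ar (w @ [i])) (br (w @ [i])) (f \<circ> cell_map i)) = level1_energy lr ul \<kappa> a b f"
      using subcell_energy[OF w] by blast
    obtain v where "\<forall>p\<in>corners. v p = f p" "\<forall>x. m \<le> v x \<and> v x \<le> M"
       "level1_energy lr ul \<kappa> a b v = star_energy (9 * a) (renorm \<kappa> a b) f"
    proof -
      have "\<exists>v. (\<forall>p\<in>corners. v p = f p) \<and> (\<forall>x. m \<le> v x \<and> v x \<le> M) \<and>
          level1_energy lr ul \<kappa> a b v = star_energy (9 * a) (renorm \<kappa> a b) f"
        by (rule level1_minimizer[OF k(2,3,1)]) (rule f)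
      then show ?thesis using that by blast
    qed
    then show "\<exists>v. (\<forall>p\<in>corners. v p = f p) \<and> (\<forall>x. m \<le> v x \<and> v x \<le> M) \<and> (\<forall>i\<in>I. True) \<and>
        (\<Sum>i\<in>I. star_energy (ar (w @ [i])) (br (w @ [i])) (v \<circ> cell_map i)) \<le> star_energy (ar w) (br w) f"
      using k by (intro exI[of _ v]) simp
  qed (auto intro: star_energy_cong)
  then obtain u where u: "\<forall>x\<in>vertices I N. u x = f x"
    "\<And>n. network_energy (N + n) u \<le> network_energy N f"
    "\<forall>w\<in>words I N. \<forall>m M. (\<forall>p\<in>corners. m \<le> f (word_map w p) \<and> f (word_map w p) \<le> M) \<longrightarrow>
       (\<forall>x\<in>all_vertices. m \<le> u (word_map w x) \<and> u (word_map w x) \<le> M)"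
    unfolding network_energy_def by blast
  have "network_energy n u = network_energy N f" if "n \<ge> N" for n
  proof (rule antisym)
    show "network_energy n u \<le> network_energy N f" using u(2)[of "n - N"] that by simp
    have "network_energy N f = network_energy N u" by (rule network_energy_cong) (use u(1) in simp)
    also have "\<dots> \<le> network_energy n u" using network_energy_incseq that by (auto simp: incseq_def)
    finally show "network_energy N f \<le> network_energy n u" .
  qed
  with u(1,3) show ?thesis by blast
qed

lemma compatible: "compatible I conductance"
  unfolding compatible_def Let_def level_energy_eq
proof (intro allI conjI ballI)
  fix n and f :: "point \<Rightarrow> real"
  obtain u where "\<forall>x\<in>vertices I n. u x = f x" "\<forall>k\<ge>n. network_energy k u = network_energy n f"
    using harmonic_extension[of n f] by blast
  then show "network_energy n f \<in> {network_energy (Suc n) v |v. \<forall>x\<in>vertices I n. v x = f x}"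
    using le_SucI[OF order_refl, of n] by (intro CollectI exI[of _ u]) metis
  fix e assume "e \<in> {network_energy (Suc n) v |v. \<forall>x\<in>vertices I n. v x = f x}"
  then obtain v where v: "e = network_energy (Suc n) v" "\<forall>x\<in>vertices I n. v x = f x" by blast
  have "network_energy n f = network_energy n v" by (rule network_energy_cong) (use v in simp)
  also have "\<dots> \<le> e" unfolding v(1) by (rule network_energy_mono)
  finally show "network_energy n f \<le> e" .
qed

lemma vertex_energy_le: "vertex_energy n u \<le> 32 * R * network_energy n u / l ^ n"
proof -
  have "cell_variation u w \<le> 32 * R / l ^ n * star_energy (ar w) (br w) (u \<circ> word_map w)" if w: "w \<in> words I n" for w
  proof -
    have Rl: "0 < R / l ^ n" using decay[OF w] ar_pos[of w] by linarith
    have "cell_variation u w \<le> 16 * (2 * (R / l ^ n) * star_energy (ar w) (br w) (u \<circ> word_map w))"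
    proof (rule cell_variation_le)
      fix p q assume "p \<in> corners" "q \<in> corners"
      then have "((u \<circ> word_map w) p - (u \<circ> word_map w) q)\<^sup>2 / (2 * (R / l ^ n)) \<le> star_energy (ar w) (br w) (u \<circ> word_map w)"
        using decay[OF w] ar_pos br_pos by (intro star_energy_ge_diff) auto
      then show "(u (word_map w p) - u (word_map w q))\<^sup>2 \<le> 2 * (R / l ^ n) * star_energy (ar w) (br w) (u \<circ> word_map w)"
      proof -
        assume *: "((u \<circ> word_map w) p - (u \<circ> word_map w) q)\<^sup>2 / (2 * (R / l ^ n)) \<le> star_energy (ar w) (br w) (u \<circ> word_map w)"
        have "0 < 2 * (R / l ^ n)" using Rl by linarith
        from iffD1[OF pos_divide_le_eq[OF this] *] show ?thesis by (simp only: comp_apply mult.commute)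
      qed
    qed
    then show ?thesis by simp
  qed
  then have "vertex_energy n u \<le> (\<Sum>w\<in>words I n. 32 * R / l ^ n * star_energy (ar w) (br w) (u \<circ> word_map w))"
    unfolding vertex_energy_def by (rule sum_mono)
  then show ?thesis by (simp add: network_energy_def sum_distrib_left sum_divide_distrib)
qed

lemma R_pos: "0 < R"
  using decay[of "[]" 0] ar_pos[of "[]"] by simp

abbreviation "form_dom \<equiv> energy_domain I K conductance"

definition energy :: "(point \<Rightarrow> real) \<Rightarrow> real" where
  "energy u = enn2real (limit_energy I conductance u)"

lemma limit_energy_SUP: "limit_energy I conductance u = (SUP n. ennreal (network_energy n u))"
  unfolding limit_energy_def level_energy_eq
  by (rule limI, rule LIMSEQ_SUP) (auto intro!: incseq_SucI ennreal_leI network_energy_mono)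

lemma domI:
  assumes "continuous_on K u" "\<And>n. network_energy n u \<le> B"
  shows "u \<in> form_dom"
proof -
  have "limit_energy I conductance u \<le> ennreal B"
    unfolding limit_energy_SUP by (intro SUP_least ennreal_leI assms)
  then have "limit_energy I conductance u < \<infinity>" by (rule le_less_trans) simp
  then show ?thesis using assms(1) by (simp add: energy_domain_def cont_funs_def)
qed

lemma domD:
  assumes "u \<in> form_dom"
  shows "continuous_on K u" "limit_energy I conductance u = ennreal (energy u)" "network_energy n u \<le> energy u"
    "(\<lambda>n. network_energy n u) \<longlonglongrightarrow> energy u" "0 \<le> energy u"
proof -
  show "continuous_on K u" using assms by (simp add: energy_domain_def cont_funs_def)
  show e0: "0 \<le> energy u" by (simp add: energy_def)
  show le: "limit_energy I conductance u = ennreal (energy u)"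
    using assms by (simp add: energy_def energy_domain_def less_top[symmetric])
  have "ennreal (network_energy n u) \<le> ennreal (energy u)" for n
    unfolding le[symmetric] limit_energy_SUP by (rule SUP_upper) simp
  then show n: "network_energy n u \<le> energy u" for n using e0 by simp
  have "(\<lambda>n. ennreal (network_energy n u)) \<longlonglongrightarrow> ennreal (energy u)"
    unfolding le[symmetric] limit_energy_SUP
    by (rule LIMSEQ_SUP) (auto intro!: incseq_SucI ennreal_leI network_energy_mono)
  then show "(\<lambda>n. network_energy n u) \<longlonglongrightarrow> energy u"
    by (subst (asm) tendsto_ennreal_iff) (auto simp: e0 network_energy_nonneg)
qed

lemma energy_le: 
  assumes "\<And>n. network_energy n u \<le> B" "u \<in> form_dom"
  shows "energy u \<le> B"
  using LIMSEQ_le_const2[OF domD(4)[OF assms(2)]] assms(1) by blast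

lemma network_bilinear_diag: "network_bilinear n u u = network_energy n u"
  by (simp add: network_bilinear_def network_energy_def star_bilinear_diag)

lemma network_bilinear_sym: "network_bilinear n u v = network_bilinear n v u"
  unfolding network_bilinear_def by (intro sum.cong refl star_bilinear_sym)

lemma network_bilinear_add: "network_bilinear n (\<lambda>x. u x + v x) h = network_bilinear n u h + network_bilinear n v h"
  unfolding network_bilinear_def sum.distrib[symmetric]
  by (intro sum.cong refl) (simp add: star_bilinear_add[symmetric] o_def)

lemma network_bilinear_scale: "network_bilinear n (\<lambda>x. k * u x) h = k * network_bilinear n u h"
  unfolding network_bilinear_def sum_distrib_left
  by (intro sum.cong refl) (simp add: star_bilinear_scale[symmetric] o_def)

lemma network_energy_scale: "network_energy n (\<lambda>x. k * u x) = k\<^sup>2 * network_energy n u"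
  unfolding network_bilinear_diag[symmetric]
  by (simp add: network_bilinear_scale network_bilinear_sym[of n u "\<lambda>x. k * u x"] power2_eq_square)

lemma network_energy_add:
  "network_energy n (\<lambda>x. u x + v x) = network_energy n u + 2 * network_bilinear n u v + network_energy n v"
  unfolding network_bilinear_diag[symmetric]
  by (simp add: network_bilinear_add network_bilinear_sym[of n _ "\<lambda>x. u x + v x"])
     (simp add: network_bilinear_sym[of n v u])

lemma network_energy_diff:
  "network_energy n (\<lambda>x. u x - v x) = network_energy n u - 2 * network_bilinear n u v + network_energy n v"
  using network_energy_add[of n u "\<lambda>x. -1 * v x"] network_energy_scale[of n "-1" v]
    network_bilinear_scale[of n "-1" v u] network_bilinear_sym[of n u] by simp

lemma network_energy_parallelogram:
  "network_energy n (\<lambda>x. u x + v x) \<le> 2 * network_energy n u + 2 * network_energy n v"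
  "network_energy n (\<lambda>x. u x - v x) \<le> 2 * network_energy n u + 2 * network_energy n v"
  using network_energy_add[of n u v] network_energy_diff[of n u v]
    network_energy_nonneg[of n "\<lambda>x. u x - v x"] network_energy_nonneg[of n "\<lambda>x. u x + v x"] by linarith+

lemma form_dom_add: assumes "u \<in> form_dom" "v \<in> form_dom" shows "(\<lambda>x. u x + v x) \<in> form_dom"
proof (rule domI)
  show "continuous_on K (\<lambda>x. u x + v x)" using domD(1) assms by (intro continuous_intros) auto
  show "network_energy n (\<lambda>x. u x + v x) \<le> 2 * energy u + 2 * energy v" for n
    using network_energy_parallelogram(1)[of n u v] domD(3)[OF assms(1), of n] domD(3)[OF assms(2), of n] by linarith
qed

lemma form_dom_diff: assumes "u \<in> form_dom" "v \<in> form_dom" shows "(\<lambda>x. u x - v x) \<in> form_dom"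
proof (rule domI)
  show "continuous_on K (\<lambda>x. u x - v x)" using domD(1) assms by (intro continuous_intros) auto
  show "network_energy n (\<lambda>x. u x - v x) \<le> 2 * energy u + 2 * energy v" for n
    using network_energy_parallelogram(2)[of n u v] domD(3)[OF assms(1), of n] domD(3)[OF assms(2), of n] by linarith
qed

lemma form_dom_scale: assumes "u \<in> form_dom" shows "(\<lambda>x. k * u x) \<in> form_dom"
proof (rule domI)
  show "continuous_on K (\<lambda>x. k * u x)" using domD(1) assms by (intro continuous_intros) auto
  show "network_energy n (\<lambda>x. k * u x) \<le> k\<^sup>2 * energy u" for n
    unfolding network_energy_scale using domD(3)[OF assms] by (intro mult_left_mono) auto
qed

abbreviation "form \<equiv> energy_form I conductance"

lemma form_limit:
  assumes "u \<in> form_dom" "v \<in> form_dom"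
  shows "(\<lambda>n. network_bilinear n u v) \<longlonglongrightarrow> form u v"
proof -
  have "(\<lambda>n. (network_energy n (\<lambda>x. u x + v x) - network_energy n (\<lambda>x. u x - v x)) / 4) \<longlonglongrightarrow>
     (energy (\<lambda>x. u x + v x) - energy (\<lambda>x. u x - v x)) / 4"
    by (intro tendsto_intros domD(4) form_dom_add form_dom_diff assms) simp
  then show ?thesis by (simp add: network_energy_add network_energy_diff energy_form_def energy_def)
qed

lemma form_diag: "u \<in> form_dom \<Longrightarrow> form u u = energy u"
  using LIMSEQ_unique[OF form_limit[of u u, unfolded network_bilinear_diag] domD(4)[of u]] by simp

lemma form_sym: "u \<in> form_dom \<Longrightarrow> v \<in> form_dom \<Longrightarrow> form u v = form v u"
  using LIMSEQ_unique[OF form_limit[of u v]] form_limit[of v u] by (simp add: network_bilinear_sym[of _ u v])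

lemma form_add:
  assumes "u \<in> form_dom" "v \<in> form_dom" "h \<in> form_dom"
  shows "form (\<lambda>x. u x + v x) h = form u h + form v h"
proof (rule LIMSEQ_unique[OF form_limit[OF form_dom_add[OF assms(1,2)] assms(3)]])
  show "(\<lambda>n. network_bilinear n (\<lambda>x. u x + v x) h) \<longlonglongrightarrow> form u h + form v h"
    unfolding network_bilinear_add by (intro tendsto_intros form_limit assms)
qed

lemma form_scale:
  assumes "u \<in> form_dom" "h \<in> form_dom"
  shows "form (\<lambda>x. k * u x) h = k * form u h"
proof (rule LIMSEQ_unique[OF form_limit[OF form_dom_scale[OF assms(1)] assms(2)]])
  show "(\<lambda>n. network_bilinear n (\<lambda>x. k * u x) h) \<longlonglongrightarrow> k * form u h"
    unfolding network_bilinear_scale by (intro tendsto_intros form_limit assms)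
qed

text \<open>The resistance estimate: functions of finite energy are controlled in the sup norm.\<close>

definition res_const :: real where "res_const = 400 * geom_const l * (32 * R)"

lemma res_const_nonneg: "0 \<le> res_const"
  using R_pos by (simp add: res_const_def geom_const_def)

lemma vertex_energy_dom:
  assumes "u \<in> form_dom"
  shows "vertex_energy n u \<le> 32 * R * energy u / l ^ n"
proof -
  have "32 * R * network_energy n u / l ^ n \<le> 32 * R * energy u / l ^ n"
    using domD(3)[OF assms] R_pos l by (intro divide_right_mono mult_left_mono) auto
  with vertex_energy_le[of n u] show ?thesis by linarith
qed

lemma oscillation_le_energy:
  assumes u: "u \<in> form_dom" and "x \<in> K" "y \<in> K"
  shows "(u x - u y)\<^sup>2 \<le> res_const * energy u"
proof -
  have "\<bar>u (word_map [] x) - u (word_map [] y)\<bar> \<le> osc_bound u []"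
    by (rule osc_on_cell[OF l vertex_energy_dom[OF u], where n=0]) (use assms domD(1)[OF u] in auto)
  also have "\<dots> \<le> sqrt (400 * geom_const l * (32 * R * energy u) / l ^ 0)"
    by (rule osc_bound_le[OF l vertex_energy_dom[OF u]]) simp
  finally have "\<bar>u x - u y\<bar>\<^sup>2 \<le> (sqrt (res_const * energy u))\<^sup>2"
    by (intro power_mono) (auto simp: res_const_def mult.assoc)
  then show ?thesis using res_const_nonneg domD(5)[OF u] by simp
qed

lemma sup_le_form_norm:
  assumes u: "u \<in> form_dom" and x: "x \<in> K"
  shows "(u x)\<^sup>2 \<le> (2 * res_const + 2) * form_norm_sq \<mu> form u"
proof -
  interpret finite_measure \<mu> by (rule finite_measure_\<mu>)
  have ul: "integrable \<mu> (\<lambda>y. (u y)\<^sup>2)"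
    using cont_in_lsq[OF sets_\<mu> finite_measure_\<mu> domD(1)[OF u]] by (simp add: lsq_def)
  have m1: "measure \<mu> K = 1" using measure_cell[of "[]" 0] by simp
  have "(LINT y|\<mu>. (u x)\<^sup>2) \<le> (LINT y|\<mu>. 2 * (res_const * energy u) + 2 * (u y)\<^sup>2)"
  proof (rule integral_mono)
    fix y assume y: "y \<in> space \<mu>"
    have "(u x)\<^sup>2 \<le> 2 * (u x - u y)\<^sup>2 + 2 * (u y)\<^sup>2"
      using zero_le_power2[of "(u x - u y) - u y"] by (simp add: power2_eq_square algebra_simps)
    then show "(u x)\<^sup>2 \<le> 2 * (res_const * energy u) + 2 * (u y)\<^sup>2"
      using oscillation_le_energy[OF u x, of y] y by simp
  qed (use ul in auto)
  also have "\<dots> = 2 * (res_const * energy u) + 2 * (LINT y|\<mu>. (u y)\<^sup>2)"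
    using ul m1 by simp
  finally have "(u x)\<^sup>2 \<le> 2 * (res_const * energy u) + 2 * (LINT y|\<mu>. (u y)\<^sup>2)" using m1 by simp
  also have "\<dots> \<le> (2 * res_const + 2) * energy u + (2 * res_const + 2) * (LINT y|\<mu>. (u y)\<^sup>2)"
    using res_const_nonneg domD(5)[OF u] by (intro add_mono) (auto intro!: mult_right_mono simp: mult.assoc[symmetric])
  also have "\<dots> = (2 * res_const + 2) * form_norm_sq \<mu> form u"
    by (simp add: form_norm_sq_def form_diag[OF u] lsq_norm_def distrib_left)
  finally show ?thesis .
qed

text \<open>A Cauchy sequence converges uniformly, and the energy of the limit is controlled on each level.\<close>

lemma form_closed:
  assumes f: "\<And>n::nat. f n \<in> form_dom"
    and cauchy: "\<And>\<epsilon>. 0 < \<epsilon> \<Longrightarrow> \<exists>N. \<forall>m\<ge>N. \<forall>n\<ge>N. form_norm_sq \<mu> form (\<lambda>x. f m x - f n x) < \<epsilon>"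
  shows "\<exists>u\<in>form_dom. (\<lambda>n. form_norm_sq \<mu> form (\<lambda>x. f n x - u x)) \<longlonglongrightarrow> 0"
proof -
  interpret finite_measure \<mu> by (rule finite_measure_\<mu>)
  have m1: "measure \<mu> K = 1" using measure_cell[of "[]" 0] by simp
  let ?c = "2 * res_const + 2"
  have c: "0 < ?c" using res_const_nonneg by simp
  have "uniformly_Cauchy_on K f"
    unfolding uniformly_Cauchy_on_def
  proof (intro allI impI)
    fix e :: real assume e: "0 < e"
    then have "0 < e\<^sup>2 / ?c" using c by simp
    then obtain N where N: "\<forall>m\<ge>N. \<forall>n\<ge>N. form_norm_sq \<mu> form (\<lambda>x. f m x - f n x) < e\<^sup>2 / ?c" using cauchy by blast
    have "dist (f m x) (f n x) < e" if "x \<in> K" "m \<ge> N" "n \<ge> N" for x m n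
    proof -
      have "(f m x - f n x)\<^sup>2 \<le> ?c * form_norm_sq \<mu> form (\<lambda>x. f m x - f n x)"
        by (rule sup_le_form_norm[OF form_dom_diff[OF f f] that(1)])
      also have "\<dots> < e\<^sup>2" using N that(2,3) c by (simp add: pos_less_divide_eq mult.commute)
      finally have "\<bar>f m x - f n x\<bar> < e" using e by (metis abs_of_pos power2_less_imp_less power2_abs less_imp_le)
      then show ?thesis by (simp add: dist_real_def)
    qed
    then show "\<exists>M. \<forall>x\<in>K. \<forall>m\<ge>M. \<forall>n\<ge>M. dist (f m x) (f n x) < e" by blast
  qed
  then obtain u where u: "uniform_limit K f u sequentially"
    using Cauchy_uniformly_convergent unfolding uniformly_convergent_on_def by blast
  have cu: "continuous_on K u"
    by (rule uniform_limit_theorem[OF _ u]) (use domD(1)[OF f] in auto)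
  have pt: "(\<lambda>n. f n x) \<longlonglongrightarrow> u x" if "x \<in> K" for x using tendsto_uniform_limitI[OF u that] .
  have en: "network_energy k (\<lambda>x. f n x - u x) \<le> e"
    if N: "\<forall>m\<ge>N. \<forall>n\<ge>N. form_norm_sq \<mu> form (\<lambda>x. f m x - f n x) < e" and n: "n \<ge> N" for k n N e
  proof -
    have "(\<lambda>m. network_energy k (\<lambda>x. f n x - f m x)) \<longlonglongrightarrow> network_energy k (\<lambda>x. f n x - u x)"
      unfolding network_energy_def star_energy_def comp_apply
      by (intro tendsto_intros pt vertex_in_K)
    moreover have "network_energy k (\<lambda>x. f n x - f m x) \<le> e" if m: "m \<ge> N" for m
    proof -
      have "network_energy k (\<lambda>x. f n x - f m x) \<le> energy (\<lambda>x. f n x - f m x)" by (rule domD(3)[OF form_dom_diff[OF f f]])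
      also have "\<dots> \<le> form_norm_sq \<mu> form (\<lambda>x. f n x - f m x)"
        by (simp add: form_norm_sq_def form_diag[OF form_dom_diff[OF f f]])
      also have "\<dots> < e" using N n m by blast
      finally show ?thesis by simp
    qed
    ultimately show ?thesis by (intro LIMSEQ_le_const2) auto
  qed
  have diff: "(\<lambda>x. f n x - u x) \<in> form_dom" if N: "\<forall>m\<ge>N. \<forall>n\<ge>N. form_norm_sq \<mu> form (\<lambda>x. f m x - f n x) < e" and n: "n \<ge> N" for n N e
    by (rule domI[OF _ en[OF N n]]) (intro continuous_intros cu domD(1)[OF f])
  obtain N1 where N1: "\<forall>m\<ge>N1. \<forall>n\<ge>N1. form_norm_sq \<mu> form (\<lambda>x. f m x - f n x) < 1" using cauchy[of 1] by auto
  have "(\<lambda>x. f N1 x - (f N1 x - u x)) \<in> form_dom" by (rule form_dom_diff[OF f diff[OF N1 order_refl]])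
  then have ud: "u \<in> form_dom" by simp
  have "(\<lambda>n. form_norm_sq \<mu> form (\<lambda>x. f n x - u x)) \<longlonglongrightarrow> 0"
  proof (rule LIMSEQ_I)
    fix e :: real assume e: "0 < e"
    obtain N where N: "\<forall>m\<ge>N. \<forall>n\<ge>N. form_norm_sq \<mu> form (\<lambda>x. f m x - f n x) < e / 4" using cauchy[of "e / 4"] e by auto
    have "\<forall>\<^sub>F n in sequentially. \<forall>x\<in>K. dist (f n x) (u x) < sqrt (e / 4)"
      using u e unfolding uniform_limit_iff by simp
    then obtain M where M: "\<And>n x. n \<ge> M \<Longrightarrow> x \<in> K \<Longrightarrow> dist (f n x) (u x) < sqrt (e / 4)"
      by (auto simp: eventually_sequentially)
    have "norm (form_norm_sq \<mu> form (\<lambda>x. f n x - u x) - 0) < e" if n: "n \<ge> max M N" for n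
    proof -
      have d: "(\<lambda>x. f n x - u x) \<in> form_dom" by (rule form_dom_diff[OF f ud])
      have E: "energy (\<lambda>x. f n x - u x) \<le> e / 4" by (rule energy_le[OF en[OF N] d]) (use n in simp)
      have il: "integrable \<mu> (\<lambda>x. (f n x - u x)\<^sup>2)"
        using cont_in_lsq[OF sets_\<mu> finite_measure_\<mu> domD(1)[OF d]] by (simp add: lsq_def)
      have "(LINT x|\<mu>. (f n x - u x)\<^sup>2) \<le> (LINT x|\<mu>. e / 4)"
      proof (rule integral_mono[OF il])
        fix x assume "x \<in> space \<mu>"
        then have "\<bar>f n x - u x\<bar>\<^sup>2 \<le> (sqrt (e / 4))\<^sup>2" using M[of n x] n by (intro power_mono) (auto simp: dist_real_def)
        then show "(f n x - u x)\<^sup>2 \<le> e / 4" using e by simp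
      qed simp
      also have "\<dots> = e / 4" using m1 by simp
      finally have L: "(LINT x|\<mu>. (f n x - u x)\<^sup>2) \<le> e / 4" .
      have "form_norm_sq \<mu> form (\<lambda>x. f n x - u x) = energy (\<lambda>x. f n x - u x) + (LINT x|\<mu>. (f n x - u x)\<^sup>2)"
        by (simp add: form_norm_sq_def form_diag[OF d] lsq_norm_def)
      moreover have "0 \<le> (LINT x|\<mu>. (f n x - u x)\<^sup>2)" by simp
      ultimately show ?thesis using E L domD(5)[OF d] e by simp
    qed
    then show "\<exists>no. \<forall>n\<ge>no. norm (form_norm_sq \<mu> form (\<lambda>x. f n x - u x) - 0) < e" by blast
  qed
  with ud show ?thesis by blast
qed

lemma form_dom_extension:
  fixes f :: "point \<Rightarrow> real"
  shows "\<exists>v\<in>form_dom. (\<forall>x\<in>vertices I N. v x = f x) \<and> energy v = network_energy N f \<and>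
    (\<forall>w\<in>words I N. \<forall>m M. (\<forall>p\<in>corners. m \<le> f (word_map w p) \<and> f (word_map w p) \<le> M) \<longrightarrow>
       (\<forall>x\<in>K. m \<le> v (word_map w x) \<and> v (word_map w x) \<le> M))"
proof -
  obtain u where u: "\<forall>x\<in>vertices I N. u x = f x" "\<forall>n\<ge>N. network_energy n u = network_energy N f"
    "\<forall>w\<in>words I N. \<forall>m M. (\<forall>p\<in>corners. m \<le> f (word_map w p) \<and> f (word_map w p) \<le> M) \<longrightarrow>
       (\<forall>x\<in>all_vertices. m \<le> u (word_map w x) \<and> u (word_map w x) \<le> M)"
    using harmonic_extension[of N f] by blast
  have nb: "network_energy n u \<le> network_energy N f" for n
    using network_energy_incseq[of u] u(2) by (cases "n \<ge> N") (auto simp: incseq_def, metis nat_le_linear order_refl)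
  have ve: "vertex_energy n u \<le> (32 * R * network_energy N f) / l ^ n" for n
  proof -
    have "32 * R * network_energy n u / l ^ n \<le> 32 * R * network_energy N f / l ^ n"
      using nb R_pos l by (intro divide_right_mono mult_left_mono) auto
    with vertex_energy_le[of n u] show ?thesis by linarith
  qed
  obtain v where v: "continuous_on K v" "\<forall>x\<in>all_vertices. v x = u x"
    using vertex_function_extends[OF l ve] by blast
  have nv: "network_energy n v = network_energy n u" for n
    by (rule network_energy_cong) (use v(2) in \<open>auto simp: all_vertices_def\<close>)
  have vd: "v \<in> form_dom" by (rule domI[OF v(1)]) (use nv nb in simp)
  have "energy v = network_energy N f"
  proof (rule LIMSEQ_unique[OF domD(4)[OF vd]])
    show "(\<lambda>n. network_energy n v) \<longlonglongrightarrow> network_energy N f"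
      using u(2) by (intro tendsto_eventually) (auto simp: nv eventually_sequentially)
  qed
  moreover have "m \<le> v (word_map w x) \<and> v (word_map w x) \<le> M"
    if w: "w \<in> words I N" and mM: "\<forall>p\<in>corners. m \<le> f (word_map w p) \<and> f (word_map w p) \<le> M" and x: "x \<in> K" for w m M x
  proof (rule range_on_cell[OF v(1) w x])
    fix y assume y: "y \<in> all_vertices"
    have "m \<le> u (word_map w y) \<and> u (word_map w y) \<le> M" using u(3) w mM y by blast
    then show "m \<le> v (word_map w y) \<and> v (word_map w y) \<le> M" using v(2) word_map_all_vertices[OF w y] by simp
  qed
  moreover have "\<forall>x\<in>vertices I N. v x = f x" using v(2) u(1) by (auto simp: all_vertices_def)
  ultimately show ?thesis using vd by blast
qed

text \<open>The harmonic extension of the values on the vertices of a fine level lies, on each cell, between the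
  extreme values at the vertices of the cell.\<close>

lemma form_dom_dense: "dense_in_cont K form_dom"
  unfolding dense_in_cont_def
proof (intro ballI allI impI)
  fix g :: "point \<Rightarrow> real" and \<epsilon> :: real assume g: "g \<in> cont_funs K" and \<epsilon>: "0 < \<epsilon>"
  have "uniformly_continuous_on K g"
    using g compact_uniformly_continuous[OF _ compact_K] by (simp add: cont_funs_def)
  then obtain d where d: "0 < d" "\<And>x y. x \<in> K \<Longrightarrow> y \<in> K \<Longrightarrow> dist y x < d \<Longrightarrow> dist (g y) (g x) < \<epsilon> / 3"
    using \<epsilon> unfolding uniformly_continuous_on_def by (metis divide_pos_pos zero_less_numeral)
  have "(\<lambda>n. (3/2) / 9 ^ n :: real) \<longlonglongrightarrow> 0" by (rule LIMSEQ_divide_realpow_zero) simp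
  then have "\<forall>\<^sub>F n in sequentially. (3/2) / 9 ^ n < d" using d(1) by (rule order_tendstoD)
  then obtain N where N: "(3/2) / 9 ^ N < d" by (auto simp: eventually_sequentially)
  obtain v where v: "v \<in> form_dom" "\<forall>w\<in>words I N. \<forall>m M. (\<forall>p\<in>corners. m \<le> g (word_map w p) \<and> g (word_map w p) \<le> M) \<longrightarrow>
       (\<forall>x\<in>K. m \<le> v (word_map w x) \<and> v (word_map w x) \<le> M)"
    using form_dom_extension[of N g] by blast
  have "\<bar>v x - g x\<bar> < \<epsilon>" if x: "x \<in> K" for x
  proof -
    obtain w y where w: "w \<in> words I N" "y \<in> K" "x = word_map w y" using K_cellE[OF x] by blast
    have "g x - \<epsilon> / 3 \<le> g (word_map w p) \<and> g (word_map w p) \<le> g x + \<epsilon> / 3" if p: "p \<in> corners" for p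
    proof -
      have "dist (word_map w p) x \<le> 3/2 / 9 ^ N"
        using cell_diameter[OF _ _ w(1), of "word_map w p" x] w p corners_in_K by blast
      then have "dist (g (word_map w p)) (g x) < \<epsilon> / 3" using N x vertex_in_K[OF w(1) p] by (intro d(2)) auto
      then show ?thesis by (simp add: dist_real_def abs_if split: if_splits)
    qed
    then have "g x - \<epsilon> / 3 \<le> v x \<and> v x \<le> g x + \<epsilon> / 3" using v(2) w by blast
    then show ?thesis using \<epsilon> by (simp add: abs_if)
  qed
  with v(1) show "\<exists>u\<in>form_dom. \<forall>x\<in>K. \<bar>u x - g x\<bar> < \<epsilon>" by blast
qed

lemma form_dom_subset_cont: "form_dom \<subseteq> cont_funs K"
  by (auto simp: energy_domain_def)

lemma dirichlet: "dirichlet_form \<mu> form form_dom"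
  unfolding dirichlet_form_def
proof (intro conjI ballI allI impI)
  show "form_dom \<subseteq> lsq \<mu>" using cont_in_lsq[OF sets_\<mu> finite_measure_\<mu>] domD(1) by blast
  show "(\<lambda>x. 0) \<in> form_dom"
    by (rule domI[of _ 0]) (auto simp: network_energy_def star_energy_def)
  show "dense_in_lsq \<mu> form_dom"
    by (rule dense_in_lsq_if_dense_in_cont[OF sets_\<mu> finite_measure_\<mu> form_dom_subset_cont form_dom_dense])
  show "0 \<le> form u u" if "u \<in> form_dom" for u using domD(5)[OF that] form_diag[OF that] by simp
  show "form u h = form v h" if "u \<in> form_dom" "v \<in> form_dom" "h \<in> form_dom" "AE x in \<mu>. u x = v x" for u v h
  proof -
    have "u x = v x" if "x \<in> K" for x
      by (rule AE_eq_imp_eq_on_K[OF full_support_\<mu>]) (use that \<open>u \<in> form_dom\<close> \<open>v \<in> form_dom\<close> \<open>AE x in \<mu>. u x = v x\<close> domD(1) in auto)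
    then have "network_energy n (\<lambda>x. u x + h x) = network_energy n (\<lambda>x. v x + h x)"
      "network_energy n (\<lambda>x. u x - h x) = network_energy n (\<lambda>x. v x - h x)" for n
      by (auto intro!: network_energy_cong_K)
    then show ?thesis by (simp add: energy_form_def limit_energy_SUP)
  qed
  show "\<exists>u\<in>form_dom. (\<lambda>n. form_norm_sq \<mu> form (\<lambda>x. f n x - u x)) \<longlonglongrightarrow> 0"
    if "(\<forall>n. f n \<in> form_dom) \<and> (\<forall>\<epsilon>>0. \<exists>N. \<forall>m\<ge>N. \<forall>n\<ge>N. form_norm_sq \<mu> form (\<lambda>x. f m x - f n x) < \<epsilon>)" for f :: "nat \<Rightarrow> _"
    by (rule form_closed) (use that in auto)
  fix u assume u: "u \<in> form_dom"
  define v where "v x = min 1 (max 0 (u x))" for x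
  have le: "network_energy n v \<le> network_energy n u" for n
    unfolding network_energy_def
    by (intro sum_mono star_energy_contraction ar_pos br_pos) (auto simp: v_def min_def max_def)
  have vd: "v \<in> form_dom"
  proof (rule domI)
    show "continuous_on K v" unfolding v_def by (intro continuous_intros domD(1)[OF u])
    show "network_energy n v \<le> energy u" for n using le[of n] domD(3)[OF u, of n] by linarith
  qed
  have "energy v \<le> energy u"
    by (rule energy_le[OF _ vd]) (use le domD(3)[OF u] order_trans in blast)
  then show "\<exists>v\<in>form_dom. (AE x in \<mu>. v x = min 1 (max 0 (u x))) \<and> form v v \<le> form u u"
    using vd u by (intro bexI[of _ v]) (auto simp: form_diag v_def)
qed (auto intro: form_dom_add form_dom_scale form_sym form_add form_scale)

lemma regular: "regular_form K \<mu> form form_dom"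
proof -
  have "form_dom \<inter> cont_funs K = form_dom" using form_dom_subset_cont by blast
  moreover have "form_norm_sq \<mu> form (\<lambda>x. u x - u x) = 0" if "u \<in> form_dom" for u
    using form_scale[OF that that, of 0] form_dom_scale[OF that, of 0]
      form_scale[OF that form_dom_scale[OF that, of 0], of 0] by (simp add: form_norm_sq_def lsq_norm_def)
  ultimately show ?thesis unfolding regular_form_def using form_dom_dense by (metis real_sqrt_zero)
qed

lemma nonzero_in_support:
  assumes u: "continuous_on K u" and x: "x \<in> K" "u x \<noteq> (0::real)"
  shows "x \<in> ae_support K \<mu> u"
  unfolding ae_support_def
proof (intro CollectI conjI allI impI notI)
  fix U assume U: "open U \<and> x \<in> U" and ae: "AE y in \<mu>. y \<in> U \<longrightarrow> u y = 0"
  have "openin (top_of_set K) (K \<inter> u -` (- {0}))"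
    by (rule continuous_openin_preimage_gen[OF u]) auto
  then obtain V where V: "open V" "K \<inter> u -` (- {0}) = K \<inter> V" by (auto simp: openin_open)
  have "x \<in> (U \<inter> V) \<inter> K" using U V x by blast
  then have pos: "emeasure \<mu> ((U \<inter> V) \<inter> K) > 0"
    using full_support_\<mu> open_Int[of U V] U V(1) unfolding full_radon_measure_def by blast
  have "(U \<inter> V) \<inter> K \<in> sets \<mu>"
    using U V compact_imp_closed[OF compact_K] by (simp add: sets_\<mu> sets_restrict_space_iff)
  moreover have "AE y in \<mu>. y \<notin> (U \<inter> V) \<inter> K" using ae
  proof eventually_elim
    case (elim y)
    show ?case
    proof
      assume y: "y \<in> (U \<inter> V) \<inter> K"
      then have "y \<in> K \<inter> u -` (- {0})" unfolding V(2) by blast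
      then show False using elim y by simp
    qed
  qed
  ultimately have "(U \<inter> V) \<inter> K \<in> null_sets \<mu>" by (simp add: AE_iff_null_sets)
  with pos show False by (simp add: null_sets_def)
qed (rule x(1))

text \<open>On levels whose cells are smaller than the distance of the supports, no cell meets both of them.\<close>

lemma local: "local_form K \<mu> form form_dom"
  unfolding local_form_def
proof (intro ballI impI)
  fix u v assume u: "u \<in> form_dom" and v: "v \<in> form_dom"
    and s: "compact (ae_support K \<mu> u) \<and> compact (ae_support K \<mu> v) \<and> ae_support K \<mu> u \<inter> ae_support K \<mu> v = {}"
  obtain d where d: "0 < d" "\<And>x y. x \<in> ae_support K \<mu> u \<Longrightarrow> y \<in> ae_support K \<mu> v \<Longrightarrow> d \<le> dist x y"
  proof -
    have "\<exists>d>0. \<forall>x\<in>ae_support K \<mu> u. \<forall>y\<in>ae_support K \<mu> v. d \<le> dist x y"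
      using s by (intro separate_compact_closed compact_imp_closed) auto
    then show ?thesis using that by blast
  qed
  have "(\<lambda>n. (3/2) / 9 ^ n :: real) \<longlonglongrightarrow> 0" by (rule LIMSEQ_divide_realpow_zero) simp
  then have "\<forall>\<^sub>F n in sequentially. (3/2) / 9 ^ n < d" using d(1) by (rule order_tendstoD)
  then have "\<forall>\<^sub>F n in sequentially. network_bilinear n u v = 0"
  proof eventually_elim
    case (elim n)
    have "star_bilinear (ar w) (br w) (u \<circ> word_map w) (v \<circ> word_map w) = 0" if w: "w \<in> words I n" for w
    proof -
      have "(\<forall>p\<in>corners. u (word_map w p) = 0) \<or> (\<forall>p\<in>corners. v (word_map w p) = 0)"
      proof (rule ccontr)
        assume "\<not> ?thesis"
        then obtain p q where pq: "p \<in> corners" "u (word_map w p) \<noteq> 0" "q \<in> corners" "v (word_map w q) \<noteq> 0" by blast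
        have "d \<le> dist (word_map w p) (word_map w q)"
          by (intro d(2) nonzero_in_support domD(1) u v vertex_in_K[OF w] pq)
        moreover have "word_map w p \<in> word_map w ` K" "word_map w q \<in> word_map w ` K" using pq corners_in_K by blast+
        then have "dist (word_map w p) (word_map w q) \<le> 3/2 / 9 ^ n" by (rule cell_diameter[OF _ _ w])
        ultimately show False using elim by linarith
      qed
      then show ?thesis unfolding star_bilinear_def by auto
    qed
    then show ?case by (simp add: network_bilinear_def)
  qed
  then have "(\<lambda>n. network_bilinear n u v) \<longlonglongrightarrow> 0" by (rule tendsto_eventually)
  with form_limit[OF u v] show "form u v = 0" by (rule LIMSEQ_unique)
qed

theorem constructed: "constructed_form I K conductance"
  unfolding constructed_form_def local_regular_dirichlet_form_on_def
  using positive compatible full_support_\<mu> dirichlet regular local by blast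

end

section \<open>The self-similar form\<close>

text \<open>The scaling of the end cells that makes \<open>renorm (balance t) a (t * a) = 9 * (t * a)\<close>, so that the ratio
  of the arm resistances is preserved.\<close>

definition balance :: "real \<Rightarrow> real" where
  "balance t = 1 + t / (2 * (1 + t))"

lemma balance_bounds:
  assumes "0 < t"
  shows "1 < balance t" "balance t < 2" "balance t \<le> 1 + t / 2"
proof -
  have "0 < t / (2 * (1 + t))" "t / (2 * (1 + t)) < 1" "t / (2 * (1 + t)) \<le> t / 2"
    using assms by (auto simp: field_simps)
  then show "1 < balance t" "balance t < 2" "balance t \<le> 1 + t / 2" by (auto simp: balance_def)
qed

definition self_similar_arm :: "real \<Rightarrow> real \<Rightarrow> cell list \<Rightarrow> real" where
  "self_similar_arm s t w = s * prod_list (map (\<lambda>i. cell_scale (balance t) i / 9) w)"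

lemma star_energy_scale:
  assumes "0 < c"
  shows "star_energy (c * a) (c * b) f = inverse c * star_energy a b f"
proof -
  have "arm_conductance (c * a) (c * b) p = inverse c * arm_conductance a b p" for p
    by (simp add: arm_conductance_def field_simps)
  moreover have "2 / (c * a) + 2 / (c * b) = inverse c * (2 / a + 2 / b)"
    by (simp add: field_simps add_divide_distrib)
  ultimately have "mesh (c * a) (c * b) p q = inverse c * mesh a b p q" for p q
    using assms by (simp add: mesh_def)
  then show ?thesis
    unfolding star_energy_def by (simp add: sum_distrib_left mult_ac)
qed

text \<open>With unequal arms the corners can be told apart by the energies of their indicators; the primal energy
  treats all corners alike.\<close>

lemma star_energy_corner_indicator:
  assumes "0 < s"
  shows "star_energy s (2 * s) (indicator {(-1/2, -1/2)}) = 2 / (3 * s)"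
    and "star_energy s (2 * s) (indicator {(1/2, -1/2)}) = 5 / (12 * s)"
  using assms by (simp_all add: star_energy_eq star4_def field_simps power2_eq_square)

context eyebolted_cross
begin

lemma self_similar_star_form:
  assumes s: "0 < s" and t: "0 < t"
  shows "star_form I lr ul K (self_similar_arm s t) (\<lambda>w. t * self_similar_arm s t w) (s * (1 + t)) (9 / balance t)"
proof
  have b: "1 < balance t" "balance t < 2" using balance_bounds[OF t] by auto
  have arm0: "0 < self_similar_arm s t w" for w
    unfolding self_similar_arm_def using s b by (induction w) (auto simp: cell_scale_def zero_less_mult_iff)
  show "0 < self_similar_arm s t w" for w by (rule arm0)
  then show "0 < t * self_similar_arm s t w" for w using t by simp
  show "1 < 9 / balance t" using b by simp
  have app: "self_similar_arm s t (w @ [i]) = cell_scale (balance t) i * (self_similar_arm s t w / 9)" for w i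
    by (simp add: self_similar_arm_def)
  show "\<exists>\<kappa> a b. 0 < \<kappa> \<and> 0 < a \<and> 0 < b \<and>
      (\<forall>i\<in>I. self_similar_arm s t (w @ [i]) = cell_scale \<kappa> i * a \<and> t * self_similar_arm s t (w @ [i]) = cell_scale \<kappa> i * b) \<and>
      self_similar_arm s t w = 9 * a \<and> t * self_similar_arm s t w = renorm \<kappa> a b" if "w \<in> words I n" for n w
  proof (rule exI[of _ "balance t"], rule exI[of _ "self_similar_arm s t w / 9"],
      rule exI[of _ "t * (self_similar_arm s t w / 9)"], intro conjI ballI)
    let ?a = "self_similar_arm s t w / 9"
    have a: "0 < ?a" using arm0[of w] by simp
    have "t * ?a / (?a + t * ?a) = t / (1 + t)"
    proof -
      have "t * ?a / (?a + t * ?a) = (t * ?a) / ((1 + t) * ?a)" by (simp add: algebra_simps)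
      also have "\<dots> = t / (1 + t)" using a by simp
      finally show ?thesis .
    qed
    moreover have "2 * balance t = 2 + t / (1 + t)"
    proof -
      define r where "r = t / (1 + t)"
      have half: "t / (2 * (1 + t)) = r / 2" unfolding r_def by (simp only: divide_divide_eq_left mult.commute)
      have "2 * (1 + r / 2) = 2 + r" by simp
      then show ?thesis unfolding balance_def half r_def .
    qed
    then have "7 + 2 * balance t - t / (1 + t) = 9" by simp
    ultimately show "t * self_similar_arm s t w = renorm (balance t) ?a (t * ?a)" by (simp add: renorm_def)
  qed (use b arm0[of w] t app in auto)
  show "self_similar_arm s t w \<le> s * (1 + t) / (9 / balance t) ^ n \<and> t * self_similar_arm s t w \<le> s * (1 + t) / (9 / balance t) ^ n"
    if "w \<in> words I n" for n w
  proof -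
    have "self_similar_arm s t w \<le> s * (balance t / 9) ^ length w"
    proof (induction w)
      case (Cons i w)
      have e: "self_similar_arm s t (i # w) = cell_scale (balance t) i / 9 * self_similar_arm s t w"
        by (simp add: self_similar_arm_def)
      have "\<dots> \<le> balance t / 9 * (s * (balance t / 9) ^ length w)"
        using b Cons arm0[of w] by (intro mult_mono) (auto simp: cell_scale_def)
      then show ?case unfolding e by (simp add: mult_ac)
    qed (simp add: self_similar_arm_def)
    also have "\<dots> = s / (9 / balance t) ^ n" using length_words[OF that] b by (simp add: power_divide)
    finally have le: "self_similar_arm s t w \<le> s / (9 / balance t) ^ n" .
    have q: "0 < (9 / balance t) ^ n" using b by simp
    have "s / (9 / balance t) ^ n \<le> s * (1 + t) / (9 / balance t) ^ n"
      using q s t by (intro divide_right_mono) (auto simp: algebra_simps)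
    moreover have "t * self_similar_arm s t w \<le> t * (s / (9 / balance t) ^ n)"
      by (rule mult_left_mono[OF le less_imp_le[OF t]])
    moreover have "t * (s / (9 / balance t) ^ n) \<le> s * (1 + t) / (9 / balance t) ^ n"
      unfolding times_divide_eq_right using q s t by (intro divide_right_mono) (auto simp: algebra_simps)
    ultimately show ?thesis using le by linarith
  qed
qed

lemma self_similar_identity:
  assumes s: "0 < s" and t: "0 < t"
  shows "energy_self_similar I K (star_form.conductance (self_similar_arm s t) (\<lambda>w. t * self_similar_arm s t w))"
proof -
  interpret star_form I lr ul K "self_similar_arm s t" "\<lambda>w. t * self_similar_arm s t w" "s * (1 + t)" "9 / balance t"
    by (rule self_similar_star_form[OF s t])
  have b: "1 < balance t" "balance t < 2" using balance_bounds[OF t] by auto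
  define \<tau> where "\<tau> i = cell_scale (balance t) i / 9" for i
  have \<tau>: "0 < \<tau> i" "\<tau> i < 1" for i using b by (auto simp: \<tau>_def cell_scale_def)
  have rec: "network_energy (Suc n) u = (\<Sum>i\<in>I. inverse (\<tau> i) * network_energy n (u \<circ> cell_map i))" for n u
    unfolding network_energy_def sum_words_Cons sum_distrib_left
  proof (intro sum.cong refl)
    fix i w
    have "self_similar_arm s t (i # w) = \<tau> i * self_similar_arm s t w" by (simp add: self_similar_arm_def \<tau>_def)
    then show "star_energy (self_similar_arm s t (i # w)) (t * self_similar_arm s t (i # w)) (u \<circ> word_map (i # w)) =
        inverse (\<tau> i) * star_energy (self_similar_arm s t w) (t * self_similar_arm s t w) ((u \<circ> cell_map i) \<circ> word_map w)"
      using star_energy_scale[OF \<tau>(1)[of i], of "self_similar_arm s t w" "t * self_similar_arm s t w"]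
      by (simp add: mult.left_commute comp_assoc)
  qed
  have lim: "(\<lambda>n. ennreal (network_energy n u)) \<longlonglongrightarrow> limit_energy I conductance u" for u
    unfolding limit_energy_SUP by (rule LIMSEQ_SUP) (auto intro!: incseq_SucI ennreal_leI network_energy_mono)
  have "limit_energy I conductance u = (\<Sum>i\<in>I. ennreal (inverse (\<tau> i)) * limit_energy I conductance (u \<circ> cell_map i))" for u
  proof (rule LIMSEQ_unique)
    show "(\<lambda>n. ennreal (network_energy (Suc n) u)) \<longlonglongrightarrow> limit_energy I conductance u"
      using lim by (rule LIMSEQ_Suc)
    have "ennreal (network_energy (Suc n) u) = (\<Sum>i\<in>I. ennreal (inverse (\<tau> i)) * ennreal (network_energy n (u \<circ> cell_map i)))" for n
    proof -
      have nn: "0 \<le> inverse (\<tau> i) * network_energy n (u \<circ> cell_map i)" for i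
        using \<tau>(1)[of i] network_energy_nonneg by simp
      have "ennreal (network_energy (Suc n) u) = (\<Sum>i\<in>I. ennreal (inverse (\<tau> i) * network_energy n (u \<circ> cell_map i)))"
        unfolding rec by (rule sum_ennreal[symmetric]) (rule nn)
      also have "\<dots> = (\<Sum>i\<in>I. ennreal (inverse (\<tau> i)) * ennreal (network_energy n (u \<circ> cell_map i)))"
        by (intro sum.cong refl ennreal_mult) (use \<tau>(1) network_energy_nonneg in \<open>auto simp: less_imp_le\<close>)
      finally show ?thesis .
    qed
    then show "(\<lambda>n. ennreal (network_energy (Suc n) u)) \<longlonglongrightarrow> (\<Sum>i\<in>I. ennreal (inverse (\<tau> i)) * limit_energy I conductance (u \<circ> cell_map i))"
      by (simp only:) (intro tendsto_sum ennreal_tendsto_cmult lim, simp)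
  qed
  with \<tau> show ?thesis unfolding energy_self_similar_def by blast
qed

end

section \<open>The reverse recursive form\<close>

text \<open>The ratio of the arm resistances after the reduction of a network of equal cells.\<close>

definition ratio_map :: "real \<Rightarrow> real" where
  "ratio_map t = t * (1 - t / (9 * (1 + t)))"

lemma renorm_ratio_map:
  assumes "0 < a" "0 < t"
  shows "renorm 1 a (t * a) = 9 * a * ratio_map t"
proof -
  have "t * a / (a + t * a) = t / (1 + t)"
  proof -
    have "t * a / (a + t * a) = (t * a) / ((1 + t) * a)" by (simp add: algebra_simps)
    also have "\<dots> = t / (1 + t)" using assms by simp
    finally show ?thesis .
  qed
  moreover have "9 * (1 - t / (9 * (1 + t))) = 9 - t / (1 + t)" using assms by (simp add: field_simps)
  ultimately show ?thesis unfolding renorm_def ratio_map_def by (simp add: algebra_simps)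
qed

lemma ratio_map_bounds:
  assumes "0 < t"
  shows "0 < ratio_map t" "ratio_map t \<le> t" "8 / 9 * t \<le> ratio_map t"
proof -
  have "0 \<le> t / (9 * (1 + t))" "t / (9 * (1 + t)) \<le> 1 / 9" using assms by (auto simp: field_simps)
  then have "8 / 9 \<le> 1 - t / (9 * (1 + t))" "1 - t / (9 * (1 + t)) \<le> 1" by auto
  then have "t * (8 / 9) \<le> ratio_map t" "ratio_map t \<le> t * 1"
    unfolding ratio_map_def using assms by (intro mult_left_mono; simp)+
  then show "ratio_map t \<le> t" "8 / 9 * t \<le> ratio_map t" "0 < ratio_map t" using assms by auto
qed

lemma ratio_map_surj:
  assumes "0 < s"
  obtains t where "0 < t" "t \<le> 9 / 8 * s" "ratio_map t = s"
proof -
  have "\<exists>t\<ge>s. t \<le> 9 / 8 * s \<and> ratio_map t = s"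
  proof (rule IVT')
    show "ratio_map s \<le> s" using ratio_map_bounds[OF assms] by simp
    show "s \<le> ratio_map (9 / 8 * s)" using ratio_map_bounds(3)[of "9 / 8 * s"] assms by simp
    show "continuous_on {s..9 / 8 * s} ratio_map"
      unfolding ratio_map_def using assms by (intro continuous_intros) auto
  qed (use assms in auto)
  then obtain t where "s \<le> t" "t \<le> 9 / 8 * s" "ratio_map t = s" by blast
  then show ?thesis using that[of t] assms by simp
qed

text \<open>The sequence starts at a value other than \<open>1\<close>, so that the form is not a multiple of the primal one
  already on level \<open>0\<close>.\<close>

lemma ratio_sequence:
  obtains t :: "nat \<Rightarrow> real" where "t 0 = 2" "\<And>n. 0 < t n" "\<And>n. t n \<le> 2 * (9 / 8) ^ n" "\<And>n. ratio_map (t (Suc n)) = t n"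
proof -
  have "\<exists>t. \<forall>n. (0 < t n \<and> (n = 0 \<longrightarrow> t n = (2::real))) \<and> (t (Suc n) \<le> 9 / 8 * t n \<and> ratio_map (t (Suc n)) = t n)"
  proof (rule dependent_nat_choice)
    show "\<exists>x::real. 0 < x \<and> (0 = (0::nat) \<longrightarrow> x = 2)" by (intro exI[of _ 2]) simp
    fix x :: real and n :: nat assume "0 < x \<and> (n = 0 \<longrightarrow> x = 2)"
    then obtain t where "0 < t" "t \<le> 9 / 8 * x" "ratio_map t = x" using ratio_map_surj by blast
    then show "\<exists>y. (0 < y \<and> (Suc n = 0 \<longrightarrow> y = 2)) \<and> (y \<le> 9 / 8 * x \<and> ratio_map y = x)" by auto
  qed
  then obtain t where t: "\<And>n. 0 < t n \<and> (n = 0 \<longrightarrow> t n = (2::real))" "\<And>n. t (Suc n) \<le> 9 / 8 * t n" "\<And>n. ratio_map (t (Suc n)) = t n"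
    by blast
  have "t n \<le> 2 * (9 / 8) ^ n" for n
  proof (induction n)
    case (Suc n)
    then show ?case using t(2)[of n] by simp
  qed (use t(1)[of 0] in simp)
  then show ?thesis using that[of t] t by auto
qed

context eyebolted_cross
begin

lemma reverse_recursive_star_form:
  assumes s: "0 < s" and t: "\<And>n. 0 < t n" "\<And>n. t n \<le> 2 * (9 / 8) ^ n" "\<And>n. ratio_map (t (Suc n)) = t n"
  shows "star_form I lr ul K (\<lambda>w. s / 9 ^ length w) (\<lambda>w. t (length w) * (s / 9 ^ length w)) (2 * s) 8"
proof
  show "0 < s / 9 ^ length w" for w :: "cell list" using s by simp
  show "0 < t (length w) * (s / 9 ^ length w)" for w :: "cell list" using s t(1) by simp
  show "\<exists>\<kappa> a b. 0 < \<kappa> \<and> 0 < a \<and> 0 < b \<and>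
      (\<forall>i\<in>I. s / 9 ^ length (w @ [i]) = cell_scale \<kappa> i * a \<and> t (length (w @ [i])) * (s / 9 ^ length (w @ [i])) = cell_scale \<kappa> i * b) \<and>
      s / 9 ^ length w = 9 * a \<and> t (length w) * (s / 9 ^ length w) = renorm \<kappa> a b" if "w \<in> words I n" for n w
  proof (rule exI[of _ 1], rule exI[of _ "s / 9 ^ Suc n"], rule exI[of _ "t (Suc n) * (s / 9 ^ Suc n)"], intro conjI ballI)
    have "renorm 1 (s / 9 ^ Suc n) (t (Suc n) * (s / 9 ^ Suc n)) = 9 * (s / 9 ^ Suc n) * t n"
      using renorm_ratio_map[of "s / 9 ^ Suc n" "t (Suc n)"] s t(1)[of "Suc n"] t(3)[of n] by simp
    then show "t (length w) * (s / 9 ^ length w) = renorm 1 (s / 9 ^ Suc n) (t (Suc n) * (s / 9 ^ Suc n))"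
      using length_words[OF that] by simp
  qed (use s t(1) length_words[OF that] in \<open>auto simp: cell_scale_def\<close>)
  show "s / 9 ^ length w \<le> 2 * s / 8 ^ n \<and> t (length w) * (s / 9 ^ length w) \<le> 2 * s / 8 ^ n" if "w \<in> words I n" for n w
  proof
    have "s / 9 ^ n \<le> s / 8 ^ n" using s by (intro divide_left_mono power_mono) auto
    also have "\<dots> \<le> 2 * s / 8 ^ n" using s by (intro divide_right_mono) auto
    finally show "s / 9 ^ length w \<le> 2 * s / 8 ^ n" using length_words[OF that] by simp
    have "t n * (s / 9 ^ n) \<le> 2 * (9 / 8) ^ n * (s / 9 ^ n)" using t(2)[of n] s by (intro mult_right_mono) auto
    also have "\<dots> = 2 * s / 8 ^ n" by (simp add: power_divide)
    finally show "t (length w) * (s / 9 ^ length w) \<le> 2 * s / 8 ^ n" using length_words[OF that] by simp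
  qed
qed simp

end

context star_form
begin

lemma network_energy_0: "network_energy 0 u = star_energy (ar []) (br []) u"
  by (simp add: network_energy_def)

lemma non_primal_if_unbalanced:
  assumes "br [] = 2 * ar []"
  shows "non_primal I conductance"
  unfolding non_primal_def
proof
  let ?f = "indicator {(-1/2, -1/2)} :: point \<Rightarrow> real" and ?g = "indicator {(1/2, -1/2)} :: point \<Rightarrow> real"
  assume "\<forall>n. \<exists>k. \<forall>u. level_energy I conductance n u = k * level_energy I (\<lambda>w x y. 1) n u"
  then obtain k where k: "\<And>u. network_energy 0 u = k * level_energy I (\<lambda>w x y. 1) 0 u"
    unfolding level_energy_eq by blast
  have "level_energy I (\<lambda>w x y. 1) 0 ?f = 3" "level_energy I (\<lambda>w x y. 1) 0 ?g = 3"
    by (simp_all add: level_energy_def word_vertices_def corners_def)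
  then have "network_energy 0 ?f = network_energy 0 ?g" using k[of ?f] k[of ?g] by simp
  then show False
    unfolding network_energy_0 assms star_energy_corner_indicator[OF ar_pos] using ar_pos[of "[]"] by (simp add: field_simps)
qed

end

section \<open>Which functions belong to the Besov spaces\<close>

context eyebolted_cross
begin

lemma star_energy_balanced: "0 < r \<Longrightarrow> star_energy r r f = (\<Sum>p\<in>corners. \<Sum>q\<in>corners. (f p - f q)\<^sup>2) / (8 * r)"
proof -
  assume r: "0 < r"
  have "mesh r r p q = 1 / (4 * r)" for p q using r by (simp add: mesh_def arm_conductance_def field_simps)
  then show ?thesis by (simp add: star_energy_def sum_divide_distrib)
qed

text \<open>Tracing the uniform network of level \<open>n\<close> to the corners: the ratio of the arm resistances
  becomes the \<open>n\<close>-th iterate of the ratio map at 1.\<close>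

lemma trace_to_corners:
  "star_energy 1 ((ratio_map ^^ n) 1) v \<le> 9 ^ n / 8 * vertex_energy n v"
proof -
  have pos: "0 < (ratio_map ^^ k) 1" for k by (induction k) (auto intro: ratio_map_bounds(1))
  have step: "(\<Sum>w\<in>words I m. star_energy (1 / 9 ^ m) (ratio_map t * (1 / 9 ^ m)) (v \<circ> word_map w)) \<le>
      (\<Sum>w\<in>words I (Suc m). star_energy (1 / 9 ^ Suc m) (t * (1 / 9 ^ Suc m)) (v \<circ> word_map w))" if t: "0 < t" for m t
    unfolding sum_words_snoc
  proof (rule sum_mono)
    fix w
    let ?a = "1 / 9 ^ Suc m :: real"
    have "star_energy (9 * ?a) (renorm 1 ?a (t * ?a)) (v \<circ> word_map w) \<le> level1_energy lr ul 1 ?a (t * ?a) (v \<circ> word_map w)"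
      using t by (intro level1_energy_lower) auto
    also have "\<dots> = (\<Sum>i\<in>I. star_energy ?a (t * ?a) (v \<circ> word_map (w @ [i])))"
      unfolding level1_energy_def I[symmetric]
      by (intro sum.cong refl) (simp add: cell_scale_def word_map_append comp_assoc)
    also have "renorm 1 ?a (t * ?a) = ratio_map t * (1 / 9 ^ m)" using renorm_ratio_map[of ?a t] t by simp
    finally show "star_energy (1 / 9 ^ m) (ratio_map t * (1 / 9 ^ m)) (v \<circ> word_map w) \<le>
       (\<Sum>i\<in>I. star_energy ?a (t * ?a) (v \<circ> word_map (w @ [i])))" by (simp add: o_def)
  qed
  have "(\<Sum>w\<in>words I m. star_energy (1 / 9 ^ m) ((ratio_map ^^ k) 1 * (1 / 9 ^ m)) (v \<circ> word_map w)) \<le>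
      (\<Sum>w\<in>words I (m + k). star_energy (1 / 9 ^ (m + k)) (1 / 9 ^ (m + k)) (v \<circ> word_map w))" for m k
  proof (induction k arbitrary: m)
    case (Suc k)
    show ?case using order_trans[OF step[OF pos[of k], of m] Suc.IH[of "Suc m"]] by (simp add: o_def)
  qed simp
  from this[of 0 n] have "star_energy 1 ((ratio_map ^^ n) 1) v \<le> (\<Sum>w\<in>words I n. star_energy (1 / 9 ^ n) (1 / 9 ^ n) (v \<circ> word_map w))"
    by simp
  also have "\<dots> = 9 ^ n / 8 * vertex_energy n v"
    by (simp add: star_energy_balanced vertex_energy_def cell_variation_def sum_distrib_left sum_divide_distrib mult.commute)
  finally show ?thesis .
qed

text \<open>For \<open>t \<le> 1\<close> one has \<open>ratio_map t \<le> t (1 - t / 18)\<close>, so \<open>1 / t\<close> grows by at least \<open>1 / 18\<close> in each step.\<close>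

lemma ratio_iterates: "0 < (ratio_map ^^ n) 1" "(ratio_map ^^ n) 1 \<le> 1" "1 + n / 18 \<le> 1 / (ratio_map ^^ n) 1"
proof -
  have "0 < (ratio_map ^^ n) 1 \<and> (ratio_map ^^ n) 1 \<le> 1 \<and> 1 + n / 18 \<le> 1 / (ratio_map ^^ n) 1"
  proof (induction n)
    case (Suc n)
    define t where "t = (ratio_map ^^ n) 1"
    have t: "0 < t" "t \<le> 1" "1 + n / 18 \<le> 1 / t" using Suc by (auto simp: t_def)
    have b: "0 < ratio_map t" "ratio_map t \<le> 1" using ratio_map_bounds[OF t(1)] t(2) by auto
    have "t / 18 \<le> t / (9 * (1 + t))" using t by (intro divide_left_mono) auto
    then have "ratio_map t \<le> t * (1 - t / 18)" unfolding ratio_map_def using t by (intro mult_left_mono) auto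
    then have "ratio_map t * (1 / t + 1 / 18) \<le> t * (1 - t / 18) * (1 / t + 1 / 18)"
      using t by (intro mult_right_mono) (auto intro: add_nonneg_nonneg)
    also have "\<dots> = 1 - (t / 18)\<^sup>2" using t by (simp add: field_simps power2_eq_square)
    also have "\<dots> \<le> 1" by simp
    finally have "1 / t + 1 / 18 \<le> 1 / ratio_map t" using b(1) by (simp add: field_simps)
    then show ?case using t(3) b by (simp add: t_def[symmetric] add_divide_distrib)
  qed simp
  then show "0 < (ratio_map ^^ n) 1" "(ratio_map ^^ n) 1 \<le> 1" "1 + n / 18 \<le> 1 / (ratio_map ^^ n) 1" by auto
qed

text \<open>The diagonal \<open>\<overline>p\<^sub>2\<overline>p\<^sub>4\<close> of the reduced network has resistance \<open>2 t\<^sub>n\<close> for the \<open>n\<close>-th iterate \<open>t\<^sub>n\<close>, and the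
  energies of the networks are bounded.\<close>

lemma critical_functions_identify:
  assumes "\<And>n. vertex_energy n v \<le> C / 9 ^ n"
  shows "v (1/2, -1/2) = v (-1/2, 1/2)"
proof -
  let ?d = "(v (1/2, -1/2) - v (-1/2, 1/2))\<^sup>2"
  have "?d * (1 + n / 18) \<le> C / 4" for n :: nat
  proof -
    let ?t = "(ratio_map ^^ n) 1"
    note t = ratio_iterates[of n]
    have "?d / (2 * ?t) \<le> star_energy 1 ?t v"
      unfolding star_energy_eq by (rule star4_ge_through(2)) (use t in auto)
    also have "\<dots> \<le> 9 ^ n / 8 * vertex_energy n v" by (rule trace_to_corners)
    also have "\<dots> \<le> 9 ^ n / 8 * (C / 9 ^ n)" using assms by (intro mult_left_mono) auto
    finally have "?d * (1 / ?t) \<le> C / 4" by (simp add: mult.commute)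
    moreover have "?d * (1 + n / 18) \<le> ?d * (1 / ?t)" using t(3) by (intro mult_left_mono) auto
    ultimately show ?thesis by linarith
  qed
  then have le: "?d * (1 + n / 18) \<le> C / 4" for n :: nat .
  have "?d = 0"
  proof (rule ccontr)
    assume "?d \<noteq> 0"
    then have d: "0 < ?d" by (metis zero_less_power2 power_zero_numeral)
    obtain n :: nat where "18 * (C / 4) / ?d < n" using reals_Archimedean2 by blast
    then have "18 * (C / 4) < ?d * n" using d by (simp add: field_simps)
    moreover have "?d * (1 + n / 18) = ?d + ?d * n / 18" by (simp add: algebra_simps)
    ultimately show False using le[of n] d by linarith
  qed
  then show ?thesis by simp
qed

text \<open>The energies of the uniform networks on any cell tend to \<open>0\<close>, while the resistances between its
  corners stay bounded.\<close>

lemma supercritical_functions_constant: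
  assumes l: "9 < l" and v: "continuous_on K v" and E: "\<And>n. vertex_energy n v \<le> C / l ^ n" and x: "x \<in> K" "y \<in> K"
  shows "v x = v y"
proof -
  have shift: "vertex_energy n (v \<circ> word_map w) \<le> (C / l ^ m) / l ^ n" if w: "w \<in> words I m" for w m n
  proof -
    have "vertex_energy n (v \<circ> word_map w) = (\<Sum>u\<in>words I n. cell_variation v (w @ u))"
      by (simp add: vertex_energy_def cell_variation_def word_map_append)
    also have "\<dots> \<le> (\<Sum>w\<in>words I m. \<Sum>u\<in>words I n. cell_variation v (w @ u))"
      by (rule member_le_sum[of w _ "\<lambda>w. \<Sum>u\<in>words I n. cell_variation v (w @ u)"])
         (use w in \<open>auto intro!: sum_nonneg cell_variation_nonneg\<close>)
    also have "\<dots> = vertex_energy (m + n) v" unfolding vertex_energy_def sum_words_append ..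
    also have "\<dots> \<le> (C / l ^ m) / l ^ n" using E[of "m + n"] by (simp add: power_add)
    finally show ?thesis .
  qed
  have corner: "f p = f q" if f: "\<And>n. vertex_energy n f \<le> D / l ^ n" and pq: "p \<in> corners" "q \<in> corners" for f D p q
  proof -
    have "(f p - f q)\<^sup>2 \<le> D / 4 / (l / 9) ^ n" for n
    proof -
      have "(f p - f q)\<^sup>2 / (2 * 1) \<le> star_energy 1 ((ratio_map ^^ n) 1) f"
        using pq ratio_iterates[of n] by (intro star_energy_ge_diff) auto
      also have "\<dots> \<le> 9 ^ n / 8 * vertex_energy n f" by (rule trace_to_corners)
      also have "\<dots> \<le> 9 ^ n / 8 * (D / l ^ n)" using f by (intro mult_left_mono) auto
      finally show ?thesis by (simp add: power_divide field_simps)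
    qed
    moreover have "(\<lambda>n. D / 4 / (l / 9) ^ n) \<longlonglongrightarrow> 0" using l by (intro LIMSEQ_divide_realpow_zero) simp
    ultimately have "(f p - f q)\<^sup>2 \<le> 0" by (intro LIMSEQ_le_const[of _ 0]) auto
    then show ?thesis by simp
  qed
  have "v (word_map w p) = v (word_map w q)" if w: "w \<in> words I n" and "p \<in> corners" "q \<in> corners" for w n p q
    using corner[of "v \<circ> word_map w" "C / l ^ n", OF shift[OF w] that(2,3)] by simp
  then have "(v (word_map w p) - v (word_map w q))\<^sup>2 = 0" if "w \<in> words I n" "p \<in> corners" "q \<in> corners" for w n p q
    using that by (metis diff_self power_zero_numeral)
  then have "vertex_energy n v = 0" for n
    unfolding vertex_energy_def cell_variation_def by (intro sum.neutral ballI)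
  then have E0: "vertex_energy n v \<le> 0 / 2 ^ n" for n by simp
  have "\<bar>v (word_map [] x) - v (word_map [] y)\<bar> \<le> osc_bound v []"
    by (rule osc_on_cell[where n=0, OF _ E0 _ v]) (use x in auto)
  also have "\<dots> \<le> sqrt (400 * geom_const 2 * 0 / 2 ^ 0)" by (rule osc_bound_le[OF _ E0]) auto
  finally show ?thesis by simp
qed

lemma besov_supercritical:
  assumes \<sigma>: "1 + dimH < 2 * \<sigma>" and u: "u \<in> besov dimH \<mu> \<sigma>"
  shows "\<exists>k. AE x in \<mu>. u x = k"
proof -
  have s: "0 < \<sigma>" "dimH < 2 * \<sigma>" using \<sigma> dimH_pos by linarith+
  obtain v C where v: "continuous_on K v" "AE x in \<mu>. u x = v x" "\<And>n. vertex_energy n v \<le> C / (9 powr (2 * \<sigma> - dimH)) ^ n"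
    using besov_continuous_representative[OF s u] by blast
  have "9 powr 1 < 9 powr (2 * \<sigma> - dimH)" using \<sigma> by (intro powr_less_mono) auto
  then have l: "9 < 9 powr (2 * \<sigma> - dimH)" by simp
  obtain x0 where x0: "x0 \<in> K" using K_ne by blast
  have "AE x in \<mu>. u x = v x0"
    using v(2) AE_space
  proof eventually_elim
    case (elim x)
    then show ?case using supercritical_functions_constant[OF l v(1,3) _ x0, of x] by simp
  qed
  then show ?thesis by blast
qed

text \<open>The self-similar form with ratio \<open>t\<close> has resistances of order \<open>(9 / balance t)\<^sup>-\<^sup>n\<close>, and \<open>balance t \<le> 1 + t / 2\<close>.\<close>

lemma besov_subcritical_dense:
  assumes \<sigma>: "0 < \<sigma>" "2 * \<sigma> < 1 + dimH"
  shows "dense_in_cont K (besov dimH \<mu> \<sigma> \<inter> cont_funs K)"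
proof -
  let ?q = "9 powr (2 * \<sigma> - dimH)"
  have "?q < 9 powr 1" using \<sigma> by (intro powr_less_mono) auto
  then have q: "0 < ?q" "?q < 9" by auto
  \<comment> \<open>chosen such that \<open>1 + t / 2 = 9 / ?q\<close>\<close>
  define t where "t = 2 * (9 / ?q - 1)"
  have "1 < 9 / ?q" using q by (simp add: less_divide_eq)
  then have t: "0 < t" unfolding t_def by (intro mult_pos_pos) simp_all
  note b = balance_bounds[OF t]
  interpret star_form I lr ul K "self_similar_arm 1 t" "\<lambda>w. t * self_similar_arm 1 t w" "1 * (1 + t)" "9 / balance t"
    by (rule self_similar_star_form[OF _ t]) simp
  have "1 + t / 2 = 9 / ?q" by (simp add: t_def add_divide_distrib diff_divide_distrib)
  with b(3) have "balance t \<le> 9 / ?q" by (simp only:)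
  then have ql: "?q \<le> 9 / balance t" using q b by (simp add: field_simps)
  have "form_dom \<subseteq> besov dimH \<mu> \<sigma> \<inter> cont_funs K"
  proof
    fix u assume u: "u \<in> form_dom"
    have "u \<in> besov dimH \<mu> \<sigma>"
      by (rule besov_if_vertex_energy[OF domD(1)[OF u] \<sigma>(1) l ql vertex_energy_dom[OF u]])
    then show "u \<in> besov dimH \<mu> \<sigma> \<inter> cont_funs K" using u form_dom_subset_cont by blast
  qed
  then show ?thesis using form_dom_dense unfolding dense_in_cont_def by (meson subsetD)
qed

lemma nonconstant_if_dense:
  assumes d: "dense_in_cont K (A \<inter> cont_funs K)"
  shows "\<exists>u\<in>A. \<not> (\<exists>k. AE x in \<mu>. u x = k)"
proof -
  have "fst \<in> cont_funs K" by (simp add: cont_funs_def continuous_on_fst[OF continuous_on_id])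
  then obtain u where u: "u \<in> A" "u \<in> cont_funs K" "\<forall>x\<in>K. \<bar>u x - fst x\<bar> < 1/4"
    using d unfolding dense_in_cont_def by (metis IntD1 IntD2 zero_less_divide_1_iff zero_less_numeral)
  have p: "(-1/2, -1/2) \<in> K" "(1/2, 1/2) \<in> K" using corners_in_K by (auto simp: corners_def)
  have "\<not> (AE x in \<mu>. u x = k)" for k
  proof
    assume ae: "AE x in \<mu>. u x = k"
    have "u x = k" if "x \<in> K" for x
      by (rule AE_eq_imp_eq_on_K[OF full_support_\<mu> _ continuous_on_const ae that]) (use u(2) in \<open>simp add: cont_funs_def\<close>)
    from this[OF p(1)] this[OF p(2)] u(3)[rule_format, OF p(1)] u(3)[rule_format, OF p(2)]
    show False by (simp add: abs_if split: if_splits)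
  qed
  then show ?thesis using u(1) by blast
qed

abbreviation "critical \<equiv> 1/2 * (1 + dimH)"

lemma critical_rate: "9 powr (2 * critical - dimH) = 9"
proof -
  have "2 * (1/2 * (1 + x)) - x = 1" for x :: real by (simp add: field_simps)
  from this[of dimH] show ?thesis by (simp only:) simp
qed

lemma critical_less_iff: "critical < \<sigma> \<longleftrightarrow> 1 + dimH < 2 * \<sigma>"
  and less_critical_iff: "\<sigma> < critical \<longleftrightarrow> 2 * \<sigma> < 1 + dimH"
  and critical_pos: "0 < critical" and critical_large: "dimH < 2 * critical"
proof -
  have "1/2 * (1 + x) < \<sigma> \<longleftrightarrow> 1 + x < 2 * \<sigma>" "\<sigma> < 1/2 * (1 + x) \<longleftrightarrow> 2 * \<sigma> < 1 + x"
    "0 < x \<Longrightarrow> 0 < 1/2 * (1 + x)" "x < 2 * (1/2 * (1 + x))" for x :: real by auto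
  from this[of dimH] dimH_pos
  show "critical < \<sigma> \<longleftrightarrow> 1 + dimH < 2 * \<sigma>" "\<sigma> < critical \<longleftrightarrow> 2 * \<sigma> < 1 + dimH"
    "0 < critical" "dimH < 2 * critical" by blast+
qed

lemma sigma_star_eq: "sigma_star K dimH \<mu> = ereal critical"
  and sigma_sharp_eq: "sigma_sharp dimH \<mu> = ereal critical"
proof -
  let ?S = "{\<sigma>. 0 < \<sigma> \<and> dense_in_cont K (besov dimH \<mu> \<sigma> \<inter> cont_funs K)}"
  let ?N = "{\<sigma>. 0 < \<sigma> \<and> (\<exists>u\<in>besov dimH \<mu> \<sigma>. \<not> (\<exists>k. AE x in \<mu>. u x = k))}"
  have sub: "?S \<subseteq> ?N" using nonconstant_if_dense by blast
  have up: "\<sigma> \<le> critical" if "\<sigma> \<in> ?N" for \<sigma>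
  proof (rule ccontr)
    assume "\<not> \<sigma> \<le> critical"
    then have "1 + dimH < 2 * \<sigma>" by (simp only: critical_less_iff[symmetric] not_le)
    then show False using besov_supercritical that by blast
  qed
  have low: "\<sigma> \<in> ?S" if "0 < \<sigma>" "\<sigma> < critical" for \<sigma>
  proof -
    have "2 * \<sigma> < 1 + dimH" using that(2) by (simp only: less_critical_iff)
    then show ?thesis using besov_subcritical_dense[OF that(1)] that(1) by blast
  qed
  note c0 = critical_pos
  define c where "c = critical"
  have "ereal c \<le> (SUP \<sigma>\<in>?S. ereal \<sigma>)"
  proof (rule ereal_le_real)
    fix z assume z: "(SUP \<sigma>\<in>?S. ereal \<sigma>) \<le> ereal z"
    have "y \<le> z" if "0 < y" "y < c" for y
    proof -
      have "ereal y \<le> (SUP \<sigma>\<in>?S. ereal \<sigma>)" by (rule SUP_upper[OF low]) (use that in \<open>simp_all add: c_def\<close>)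
      then have "ereal y \<le> ereal z" using z by (rule order_trans)
      then show ?thesis by simp
    qed
    then have "c \<le> z" using c0 dense_le_bounded[of 0 c z] by (simp add: c_def)
    then show "ereal c \<le> ereal z" by simp
  qed
  then have "ereal critical \<le> (SUP \<sigma>\<in>?S. ereal \<sigma>)" by (simp only: c_def)
  moreover have "(SUP \<sigma>\<in>?S. ereal \<sigma>) \<le> (SUP \<sigma>\<in>?N. ereal \<sigma>)" by (rule SUP_subset_mono[OF sub order_refl])
  moreover have "(SUP \<sigma>\<in>?N. ereal \<sigma>) \<le> ereal critical" by (rule SUP_least) (use up in simp)
  ultimately show "sigma_star K dimH \<mu> = ereal critical" "sigma_sharp dimH \<mu> = ereal critical"
    unfolding sigma_star_def sigma_sharp_def by auto
qed

lemma critical_representative: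
  assumes "u \<in> besov dimH \<mu> critical"
  obtains v C where "continuous_on K v" "AE x in \<mu>. u x = v x" "\<And>n. vertex_energy n v \<le> C / 9 ^ n"
proof -
  show ?thesis using besov_continuous_representative[OF critical_pos critical_large assms] that unfolding critical_rate by blast
qed

lemma critical_not_dense: "\<not> dense_in_cont K (besov dimH \<mu> critical \<inter> cont_funs K)"
proof
  assume d: "dense_in_cont K (besov dimH \<mu> critical \<inter> cont_funs K)"
  have "fst \<in> cont_funs K" by (simp add: cont_funs_def continuous_on_fst[OF continuous_on_id])
  then obtain u where u: "u \<in> besov dimH \<mu> critical" "u \<in> cont_funs K" "\<forall>x\<in>K. \<bar>u x - fst x\<bar> < 1/4"
    using d unfolding dense_in_cont_def by (metis IntD1 IntD2 zero_less_divide_1_iff zero_less_numeral)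
  obtain v C where v: "continuous_on K v" "AE x in \<mu>. u x = v x" "\<And>n. vertex_energy n v \<le> C / 9 ^ n"
    using critical_representative[OF u(1)] by blast
  have eq: "u x = v x" if "x \<in> K" for x
    by (rule AE_eq_imp_eq_on_K[OF full_support_\<mu> _ v(1,2) that]) (use u(2) in \<open>simp add: cont_funs_def\<close>)
  have p: "(1/2, -1/2) \<in> K" "(-1/2, 1/2) \<in> K" using corners_in_K by (auto simp: corners_def)
  have "u (1/2, -1/2) = u (-1/2, 1/2)"
    unfolding eq[OF p(1)] eq[OF p(2)] by (rule critical_functions_identify[OF v(3)])
  then show False using u(3)[rule_format, OF p(1)] u(3)[rule_format, OF p(2)] by (simp add: abs_if split: if_splits)
qed


section \<open>The critical Besov space is dense in the square integrable functions\<close>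

text \<open>Given one constant for each cell of a level \<open>n\<close>, its vertices of relative level \<open>m\<close> receive this
  constant, except those on the diagonal \<open>\<overline>p\<^sub>2\<overline>p\<^sub>4\<close> of the cell and at its corners, which receive the value
  \<open>0\<close>. This is consistent, because different cells meet only at corners, and \<open>p\<^sub>2\<close> and \<open>p\<^sub>4\<close> of any subcell
  have equal values: they lie on a line parallel to the diagonal \<open>\<overline>p\<^sub>2\<overline>p\<^sub>4\<close>, and
  if this line is not the diagonal itself, neither of them is a corner of the cell.\<close>

definition exceptional :: "point set" where
  "exceptional = {x. fst x + snd x = 0} \<union> corners"

definition exceptional_words :: "nat \<Rightarrow> cell list set" where
  "exceptional_words m = {v \<in> words I m. \<exists>p\<in>corners. word_map v p \<in> exceptional}"

text \<open>The subcells with an exceptional vertex lie along the two diagonals.\<close>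

lemma exceptional_index:
  assumes v: "v \<in> exceptional_words m"
  shows "fst (word_index v) + snd (word_index v) = 0 \<or> fst (word_index v) = snd (word_index v)"
proof -
  obtain p where p: "p \<in> corners" "word_map v p \<in> exceptional" "v \<in> words I m"
    using v by (auto simp: exceptional_words_def)
  obtain i j where ij: "word_index v = (i, j)" by fastforce
  have ev: "even (i + j)" using word_index_even[OF I p(3)] ij by simp
  obtain e f where ef: "p = (of_int e / 2, of_int f / 2)" "\<bar>e\<bar> = 1" "\<bar>f\<bar> = (1::int)"
  proof -
    have "p = (of_int 1 / 2, of_int 1 / 2) \<or> p = (of_int (-1) / 2, of_int 1 / 2) \<or> p = (of_int 1 / 2, of_int (-1) / 2) \<or> p = (of_int (-1) / 2, of_int (-1) / 2)"
      using p(1) by (auto simp: corners_def)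
    then show ?thesis
      by (elim disjE) (use that[of 1 1] that[of "-1" 1] that[of 1 "-1"] that[of "-1" "-1"] in simp_all)
  qed
  have x: "fst (word_map v p) = of_int (2 * i + e) / (2 * 9 ^ m)" "snd (word_map v p) = of_int (2 * j + f) / (2 * 9 ^ m)"
    using length_words[OF p(3)] by (simp_all add: word_map_eq ij ef(1) field_simps)
  show ?thesis
  proof (cases "fst (word_map v p) + snd (word_map v p) = 0")
    case True
    then have "of_int (2 * i + e) + of_int (2 * j + f) = (0::real)"
      unfolding x by (simp add: add_divide_distrib[symmetric])
    then have "2 * i + e + (2 * j + f) = 0" by linarith
    then show ?thesis using ef(2,3) ev ij by (simp add: abs_if split: if_splits) presburger+
  next
    case False
    then have "word_map v p \<in> corners" using p(2) by (auto simp: exceptional_def)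
    then have "\<bar>fst (word_map v p)\<bar> = 1/2" "\<bar>snd (word_map v p)\<bar> = 1/2" "fst (word_map v p) = snd (word_map v p)"
      using False by (auto simp: corners_iff abs_if split: if_splits)
    then have "of_int (2 * i + e) / (2 * 9 ^ m) = (of_int (2 * j + f) / (2 * 9 ^ m) :: real)" unfolding x by simp
    then have "of_int (2 * i + e) = (of_int (2 * j + f) :: real)" by simp
    then have eq: "2 * i + e = 2 * j + f" by linarith
    have "i - j \<noteq> 1" "j - i \<noteq> 1" using ev by presburger+
    then show ?thesis using eq ef(2,3) ij by (simp add: abs_if split: if_splits)
  qed
qed

lemma card_exceptional_words: "card (exceptional_words m) \<le> 2 * 9 ^ m"
proof -
  have c: "card {v \<in> words I m. P v} \<le> 9 ^ m" if inj: "inj_on (\<lambda>v. fst (word_index v)) {v \<in> words I m. P v}" for P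
  proof -
    define N where "N = (9 ^ m - 1) div (2 :: int)"
    have odd: "odd ((9::int) ^ m)" by simp
    have N: "2 * N + 1 = 9 ^ m" using odd by (simp add: N_def)
    have "(\<lambda>v. fst (word_index v)) ` {v \<in> words I m. P v} \<subseteq> {- N..N}"
    proof (intro image_subsetI)
      fix v assume "v \<in> {v \<in> words I m. P v}"
      then have "2 * \<bar>fst (word_index v)\<bar> + 1 \<le> 9 ^ m" using word_index_bound[OF I] by auto
      then show "fst (word_index v) \<in> {- N..N}" using N by auto
    qed
    then have "card {v \<in> words I m. P v} \<le> card {- N..N}" by (intro card_inj_on_le[OF inj]) auto
    also have "card {- N..N} = nat (2 * N + 1)" by simp
    also have "\<dots> = 9 ^ m" unfolding N by (simp add: nat_power_eq)
    finally show ?thesis .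
  qed
  have "exceptional_words m \<subseteq> {v \<in> words I m. fst (word_index v) + snd (word_index v) = 0} \<union>
     {v \<in> words I m. fst (word_index v) = snd (word_index v)}"
    using exceptional_index by (auto simp: exceptional_words_def)
  then have "card (exceptional_words m) \<le> card ({v \<in> words I m. fst (word_index v) + snd (word_index v) = 0} \<union>
     {v \<in> words I m. fst (word_index v) = snd (word_index v)})"
    by (intro card_mono) auto
  also have "\<dots> \<le> card {v \<in> words I m. fst (word_index v) + snd (word_index v) = 0} +
     card {v \<in> words I m. fst (word_index v) = snd (word_index v)}" by (rule card_Un_le)
  also have "\<dots> \<le> 9 ^ m + 9 ^ m"
  proof (intro add_mono c)
    show "inj_on (\<lambda>v. fst (word_index v)) {v \<in> words I m. fst (word_index v) + snd (word_index v) = 0}"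
    proof (rule inj_onI)
      fix v w assume *: "v \<in> {v \<in> words I m. fst (word_index v) + snd (word_index v) = 0}"
        "w \<in> {v \<in> words I m. fst (word_index v) + snd (word_index v) = 0}" "fst (word_index v) = fst (word_index w)"
      then have "snd (word_index v) = snd (word_index w)" by auto
      with * show "v = w" by (intro word_index_inj[OF I, of v m w] prod_eqI) auto
    qed
    show "inj_on (\<lambda>v. fst (word_index v)) {v \<in> words I m. fst (word_index v) = snd (word_index v)}"
    proof (rule inj_onI)
      fix v w assume *: "v \<in> {v \<in> words I m. fst (word_index v) = snd (word_index v)}"
        "w \<in> {v \<in> words I m. fst (word_index v) = snd (word_index v)}" "fst (word_index v) = fst (word_index w)"
      then have "snd (word_index v) = snd (word_index w)" by auto
      with * show "v = w" by (intro word_index_inj[OF I, of v m w] prod_eqI) auto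
    qed
  qed
  finally show ?thesis by simp
qed

lemma exceptional_antidiagonal:
  assumes v: "v \<in> words I m" and e: "word_map v (1/2, -1/2) \<in> exceptional \<or> word_map v (-1/2, 1/2) \<in> exceptional"
  shows "word_map v (1/2, -1/2) \<in> exceptional \<and> word_map v (-1/2, 1/2) \<in> exceptional"
proof -
  obtain i j where ij: "word_index v = (i, j)" by fastforce
  have bd: "2 * \<bar>i\<bar> + 1 \<le> 9 ^ m" "2 * \<bar>j\<bar> + 1 \<le> 9 ^ m" using word_index_bound[OF I v] ij by auto
  then have "of_int (2 * \<bar>i\<bar> + 1) \<le> (of_int (9 ^ m) :: real)" "of_int (2 * \<bar>j\<bar> + 1) \<le> (of_int (9 ^ m) :: real)"
    by (simp_all only: of_int_le_iff)
  then have bd': "2 * \<bar>real_of_int i\<bar> + 1 \<le> 9 ^ m" "2 * \<bar>real_of_int j\<bar> + 1 \<le> 9 ^ m" by simp_all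
  have s: "fst (word_map v (1/2, -1/2)) + snd (word_map v (1/2, -1/2)) = (of_int i + of_int j) / 9 ^ m"
    "fst (word_map v (-1/2, 1/2)) + snd (word_map v (-1/2, 1/2)) = (of_int i + of_int j) / 9 ^ m"
    using length_words[OF v] by (simp_all add: word_map_eq ij add_divide_distrib[symmetric])
  \<comment> \<open>A cell inside the square cannot have its vertex \<open>p\<^sub>2\<close> or \<open>p\<^sub>4\<close> at \<open>p\<^sub>1\<close> or \<open>p\<^sub>3\<close>.\<close>
  have ne: "word_map v (1/2, -1/2) \<notin> corners" "word_map v (-1/2, 1/2) \<notin> corners" if "of_int i + of_int j \<noteq> (0::real)"
  proof -
    have "\<not> (\<bar>(1/2 + real_of_int i) / 9 ^ m\<bar> = 1/2 \<and> \<bar>(-1/2 + real_of_int j) / 9 ^ m\<bar> = 1/2)"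
      "\<not> (\<bar>(-1/2 + real_of_int i) / 9 ^ m\<bar> = 1/2 \<and> \<bar>(1/2 + real_of_int j) / 9 ^ m\<bar> = 1/2)"
      using bd' that by (auto simp: abs_if field_simps split: if_splits)
    then show "word_map v (1/2, -1/2) \<notin> corners" "word_map v (-1/2, 1/2) \<notin> corners"
      using length_words[OF v] by (auto simp: corners_iff word_map_eq ij)
  qed
  show ?thesis
  proof (cases "of_int i + of_int j = (0::real)")
    case True
    then show ?thesis using s by (simp add: exceptional_def)
  next
    case False
    then have "word_map v (1/2, -1/2) \<notin> exceptional" "word_map v (-1/2, 1/2) \<notin> exceptional"
      using ne s by (auto simp: exceptional_def)
    with e show ?thesis by blast
  qed
qed

lemma spine_energy_cong: "(\<And>p. p \<in> corners \<Longrightarrow> f p = g p) \<Longrightarrow> spine_energy f = spine_energy g"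
  by (simp add: spine_energy_def corners_def)

lemma spine_extension_vertices:
  fixes f :: "point \<Rightarrow> real"
  assumes f: "\<And>w. w \<in> words I N \<Longrightarrow> f (word_map w (1/2, -1/2)) = f (word_map w (-1/2, 1/2))"
  shows "\<exists>v\<in>besov dimH \<mu> critical. continuous_on K v \<and>
    (\<forall>w\<in>words I N. \<forall>m M. (\<forall>p\<in>corners. m \<le> f (word_map w p) \<and> f (word_map w p) \<le> M) \<longrightarrow>
       (\<forall>x\<in>K. m \<le> v (word_map w x) \<and> v (word_map w x) \<le> M))"
proof -
  let ?A = "\<lambda>f :: point \<Rightarrow> real. f (1/2, -1/2) = f (-1/2, 1/2)"
  let ?e = "\<lambda>w f. 9 ^ length w * spine_energy f"
  have "\<exists>u. (\<forall>x\<in>vertices I N. u x = f x) \<and>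
    (\<forall>n. \<forall>w\<in>words I (N + n). ?A (u \<circ> word_map w)) \<and>
    (\<forall>n. (\<Sum>w\<in>words I (N + n). ?e w (u \<circ> word_map w)) \<le> (\<Sum>w\<in>words I N. ?e w (f \<circ> word_map w))) \<and>
    (\<forall>w\<in>words I N. \<forall>m M. (\<forall>p\<in>corners. m \<le> f (word_map w p) \<and> f (word_map w p) \<le> M) \<longrightarrow>
       (\<forall>x\<in>all_vertices. m \<le> u (word_map w x) \<and> u (word_map w x) \<le> M))"
  proof (rule extension_scheme)
    fix w n and f :: "point \<Rightarrow> real" and m M
    assume w: "w \<in> words I n" and A: "?A f" and f: "\<And>p. p \<in> corners \<Longrightarrow> m \<le> f p \<and> f p \<le> M"
    have "\<exists>v. (\<forall>p\<in>corners. v p = f p) \<and> (\<forall>x. m \<le> v x \<and> v x \<le> M) \<and>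
      (\<forall>c\<in>I. v (cell_map c (1/2, -1/2)) = v (cell_map c (-1/2, 1/2))) \<and>
      (\<Sum>c\<in>I. spine_energy (v \<circ> cell_map c)) \<le> spine_energy f / 9"
      unfolding I by (rule spine_extension[OF A]) (rule f)
    then obtain v where v: "\<forall>p\<in>corners. v p = f p" "\<forall>x. m \<le> v x \<and> v x \<le> M"
      "\<forall>c\<in>I. v (cell_map c (1/2, -1/2)) = v (cell_map c (-1/2, 1/2))"
      "(\<Sum>c\<in>I. spine_energy (v \<circ> cell_map c)) \<le> spine_energy f / 9" by blast
    have "(\<Sum>i\<in>I. ?e (w @ [i]) (v \<circ> cell_map i)) = 9 * 9 ^ length w * (\<Sum>i\<in>I. spine_energy (v \<circ> cell_map i))"
      by (simp add: sum_distrib_left)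
    also have "\<dots> \<le> 9 * 9 ^ length w * (spine_energy f / 9)" by (rule mult_left_mono[OF v(4)]) simp
    finally have "(\<Sum>i\<in>I. ?e (w @ [i]) (v \<circ> cell_map i)) \<le> ?e w f" by simp
    with v(1-3) show "\<exists>v. (\<forall>p\<in>corners. v p = f p) \<and> (\<forall>x. m \<le> v x \<and> v x \<le> M) \<and> (\<forall>i\<in>I. ?A (v \<circ> cell_map i)) \<and>
        (\<Sum>i\<in>I. ?e (w @ [i]) (v \<circ> cell_map i)) \<le> ?e w f" by (intro exI[of _ v]) simp
  next
    show "?A f = ?A g" if "\<And>p. p \<in> corners \<Longrightarrow> f p = g p" for f g using that by (simp add: corners_def)
    show "?e w f = ?e w g" if "\<And>p. p \<in> corners \<Longrightarrow> f p = g p" for w f g using spine_energy_cong[OF that] by simp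
    show "?A (f \<circ> word_map w)" if "w \<in> words I N" for w using f[OF that] by simp
  qed
  then obtain u where u: "\<And>n w. w \<in> words I (N + n) \<Longrightarrow> ?A (u \<circ> word_map w)"
    "\<And>n. (\<Sum>w\<in>words I (N + n). ?e w (u \<circ> word_map w)) \<le> (\<Sum>w\<in>words I N. ?e w (f \<circ> word_map w))"
    "\<forall>w\<in>words I N. \<forall>m M. (\<forall>p\<in>corners. m \<le> f (word_map w p) \<and> f (word_map w p) \<le> M) \<longrightarrow>
       (\<forall>x\<in>all_vertices. m \<le> u (word_map w x) \<and> u (word_map w x) \<le> M)" by blast
  define E where "E = (\<Sum>w\<in>words I N. ?e w (f \<circ> word_map w))"
  have E0: "0 \<le> E" unfolding E_def by (intro sum_nonneg) (simp add: spine_energy_def)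
  have late: "vertex_energy (N + n) u \<le> 32 * E / 9 ^ (N + n)" for n
  proof -
    have "cell_variation u w \<le> 32 * spine_energy (u \<circ> word_map w)" if w: "w \<in> words I (N + n)" for w
    proof -
      have "cell_variation u w \<le> 16 * (2 * spine_energy (u \<circ> word_map w))"
      proof (rule cell_variation_le)
        fix p q assume pq: "p \<in> corners" "q \<in> corners"
        define a b c where "a = u (word_map w (-1/2, -1/2))" "b = u (word_map w (1/2, -1/2))" "c = u (word_map w (1/2, 1/2))"
        have d: "u (word_map w (-1/2, 1/2)) = b" using u(1)[OF w] by (simp add: a_b_c_def)
        have sp: "spine_energy (u \<circ> word_map w) = (a - b)\<^sup>2 + (c - b)\<^sup>2" by (simp add: spine_energy_def a_b_c_def)
        have ac: "(a - c)\<^sup>2 \<le> 2 * ((a - b)\<^sup>2 + (c - b)\<^sup>2)"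
          using zero_le_power2[of "(a - b) + (c - b)"] by (simp add: power2_eq_square algebra_simps)
        have nn: "0 \<le> (a - b)\<^sup>2" "0 \<le> (c - b)\<^sup>2" by simp_all
        have *: "(s - t)\<^sup>2 \<le> 2 * ((a - b)\<^sup>2 + (c - b)\<^sup>2)" if "s \<in> {a, b, c}" "t \<in> {a, b, c}" for s t
          using that ac nn power2_commute[of a b] power2_commute[of b c] power2_commute[of a c] by auto
        have "u (word_map w p) \<in> {a, b, c}" if "p \<in> corners" for p
          using that d by (auto simp: corners_def a_b_c_def)
        then show "(u (word_map w p) - u (word_map w q))\<^sup>2 \<le> 2 * spine_energy (u \<circ> word_map w)"
          unfolding sp using * pq by blast
      qed
      then show ?thesis by simp
    qed
    then have "vertex_energy (N + n) u \<le> (\<Sum>w\<in>words I (N + n). 32 * spine_energy (u \<circ> word_map w))"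
      unfolding vertex_energy_def by (rule sum_mono)
    also have "\<dots> = 32 * (\<Sum>w\<in>words I (N + n). ?e w (u \<circ> word_map w)) / 9 ^ (N + n)"
      unfolding sum_distrib_left sum_divide_distrib
      by (intro sum.cong refl) (simp add: length_words)
    also have "\<dots> \<le> 32 * E / 9 ^ (N + n)" using u(2)[of n] by (intro divide_right_mono) (auto simp: E_def)
    finally show ?thesis .
  qed
  define C where "C = 32 * E + (\<Sum>k<N. 9 ^ k * vertex_energy k u)"
  have C0: "0 \<le> (\<Sum>k<N. 9 ^ k * vertex_energy k u)" by (intro sum_nonneg) (simp add: vertex_energy_nonneg)
  have all: "vertex_energy n u \<le> C / 9 ^ n" for n
  proof (cases "n < N")
    case True
    have "9 ^ n * vertex_energy n u \<le> (\<Sum>k<N. 9 ^ k * vertex_energy k u)"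
      by (rule member_le_sum[of n _ "\<lambda>k. 9 ^ k * vertex_energy k u"]) (use True vertex_energy_nonneg in auto)
    then have "9 ^ n * vertex_energy n u \<le> C" using E0 by (simp add: C_def)
    then show ?thesis by (simp add: field_simps)
  next
    case False
    then have "vertex_energy n u \<le> 32 * E / 9 ^ n" using late[of "n - N"] by simp
    also have "\<dots> \<le> C / 9 ^ n" using C0 by (intro divide_right_mono) (auto simp: C_def)
    finally show ?thesis .
  qed
  obtain v where v: "continuous_on K v" "\<forall>x\<in>all_vertices. v x = u x"
    using vertex_function_extends[of 9 u C, OF _ all] by auto
  have vE: "vertex_energy n v \<le> C / 9 ^ n" for n using all[of n] vertex_energy_cong[of v u n] v(2) by simp
  have "v \<in> besov dimH \<mu> critical"
    by (rule besov_if_vertex_energy[OF v(1) critical_pos, of 9, OF _ _ vE]) (simp, simp only: critical_rate order_refl)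
  moreover have "m \<le> v (word_map w x) \<and> v (word_map w x) \<le> M"
    if w: "w \<in> words I N" and mM: "\<forall>p\<in>corners. m \<le> f (word_map w p) \<and> f (word_map w p) \<le> M" and x: "x \<in> K" for w m M x
  proof (rule range_on_cell[OF v(1) w x])
    fix y assume y: "y \<in> all_vertices"
    have "m \<le> u (word_map w y) \<and> u (word_map w y) \<le> M" using u(3) w mM y by blast
    then show "m \<le> v (word_map w y) \<and> v (word_map w y) \<le> M" using v(2) word_map_all_vertices[OF w y] by simp
  qed
  ultimately show ?thesis using v(1) by blast
qed

text \<open>A continuous function is nearly constant on the cells of a level \<open>n\<close>. Replacing it by such constants,
  modified at the exceptional vertices, causes an error on at most \<open>2 \<cdot> 9 ^ m\<close> of the \<open>21 ^ m\<close> subcells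
  of each cell only, which is negligible for large \<open>m\<close>.\<close>

lemma critical_dense_lsq: "dense_in_lsq \<mu> (besov dimH \<mu> critical)"
proof (rule dense_in_lsqI[OF sets_\<mu> finite_measure_\<mu>])
  fix g :: "point \<Rightarrow> real" and \<epsilon> :: real assume g: "continuous_on K g" and \<epsilon>: "0 < \<epsilon>"
  obtain B where B: "0 \<le> B" "\<And>x. x \<in> K \<Longrightarrow> \<bar>g x\<bar> \<le> B" using cont_bounded[OF sets_\<mu> finite_measure_\<mu> g] by blast
  define \<delta> where "\<delta> = sqrt (\<epsilon> / 4)"
  have \<delta>: "0 < \<delta>" "\<delta>\<^sup>2 = \<epsilon> / 4" using \<epsilon> by (auto simp: \<delta>_def)
  have "uniformly_continuous_on K g" by (rule compact_uniformly_continuous[OF g compact_K])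
  then obtain d where d: "0 < d" "\<And>x y. x \<in> K \<Longrightarrow> y \<in> K \<Longrightarrow> dist y x < d \<Longrightarrow> dist (g y) (g x) < \<delta>"
    using \<delta>(1) unfolding uniformly_continuous_on_def by blast
  have "(\<lambda>n. (3/2) / 9 ^ n :: real) \<longlonglongrightarrow> 0" by (rule LIMSEQ_divide_realpow_zero) simp
  then have "\<forall>\<^sub>F n in sequentially. (3/2) / 9 ^ n < d" using d(1) by (rule order_tendstoD)
  then obtain n where n: "(3/2) / 9 ^ n < d" by (auto simp: eventually_sequentially)
  have "(\<lambda>m. 8 * B\<^sup>2 / (21/9) ^ m :: real) \<longlonglongrightarrow> 0" by (rule LIMSEQ_divide_realpow_zero) simp
  then have "\<forall>\<^sub>F m in sequentially. 8 * B\<^sup>2 / (21/9) ^ m < \<epsilon> / 4" by (rule order_tendstoD) (use \<epsilon> in simp)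
  then obtain m where m: "8 * B\<^sup>2 / (21/9) ^ m < \<epsilon> / 4" by (auto simp: eventually_sequentially)
  define c where "c w = g (word_map w (-1/2, -1/2))" for w
  \<comment> \<open>\<open>c w\<close> is the constant for the cell \<open>w\<close>; \<open>f\<close> prescribes the values at the vertices of level \<open>n + m\<close>.\<close>
  define bad where "bad y \<longleftrightarrow> (\<exists>w\<in>words I n. \<exists>x\<in>vertices I m. x \<in> exceptional \<and> y = word_map w x)" for y
  define f where "f y = (if bad y then 0 else c (SOME w. w \<in> words I n \<and> y \<in> word_map w ` vertices I m))" for y
  have sq: "x \<in> unit_square" if "x \<in> vertices I m" for x
    using that K_subset_square all_vertices_in_K unfolding all_vertices_def by blast
  have fx: "f (word_map w x) = (if x \<in> exceptional then 0 else c w)" if w: "w \<in> words I n" and x: "x \<in> vertices I m" for w x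
  proof (cases "x \<in> exceptional")
    case False
    have only: "w' = w \<and> x' = x" if w': "w' \<in> words I n" and x': "x' \<in> vertices I m" and e: "word_map w x = word_map w' x'" for w' x'
    proof -
      have "w = w'"
        using cells_overlap_at_corners[OF I w w' _ sq[OF x] sq[OF x'] e] False by (auto simp: exceptional_def)
      with e show ?thesis by simp
    qed
    then have nb: "\<not> bad (word_map w x)" using False by (auto simp: bad_def)
    have "(SOME w'. w' \<in> words I n \<and> word_map w x \<in> word_map w' ` vertices I m) = w"
      by (rule some_equality) (use w x only in blast)+
    then show ?thesis using nb False by (simp add: f_def)
  next
    case True
    then have "bad (word_map w x)" using w x by (auto simp: bad_def)
    then show ?thesis using True by (simp add: f_def)
  qed
  have vert: "word_map v p \<in> vertices I m" if "v \<in> words I m" "p \<in> corners" for v p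
    using that by (auto simp: vertices_eq)
  have fw: "f (word_map (w @ v) p) = (if word_map v p \<in> exceptional then 0 else c w)"
    if "w \<in> words I n" "v \<in> words I m" "p \<in> corners" for w v p
    using fx[OF that(1) vert[OF that(2,3)]] by (simp add: word_map_append)
  have pc: "(-1/2, -1/2) \<in> corners" "(1/2, -1/2) \<in> corners" "(-1/2, 1/2) \<in> corners" by (simp_all add: corners_def)
  have adm: "f (word_map w' (1/2, -1/2)) = f (word_map w' (-1/2, 1/2))" if w': "w' \<in> words I (n + m)" for w'
  proof -
    obtain w v where wv: "w \<in> words I n" "v \<in> words I m" "w' = w @ v" using w' by (rule words_appendE)
    show ?thesis unfolding wv(3) fw[OF wv(1,2) pc(2)] fw[OF wv(1,2) pc(3)]
      using exceptional_antidiagonal[OF wv(2)] by auto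
  qed
  obtain v where v: "v \<in> besov dimH \<mu> critical" "continuous_on K v"
    and range: "\<forall>w\<in>words I (n + m). \<forall>a b. (\<forall>p\<in>corners. a \<le> f (word_map w p) \<and> f (word_map w p) \<le> b) \<longrightarrow>
       (\<forall>x\<in>K. a \<le> v (word_map w x) \<and> v (word_map w x) \<le> b)"
    using spine_extension_vertices[of "n + m" f, OF adm] by blast
  have cB: "\<bar>c w\<bar> \<le> B" if "w \<in> words I n" for w
    unfolding c_def by (rule B(2)) (rule vertex_in_K[OF that pc(1)])
  have good: "v (word_map (w @ u) x) = c w" if w: "w \<in> words I n" and u: "u \<in> words I m" "u \<notin> exceptional_words m" and x: "x \<in> K" for w u x
  proof -
    have "f (word_map (w @ u) p) = c w" if "p \<in> corners" for p
      using fw[OF w u(1) that] u that by (auto simp: exceptional_words_def)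
    then have "\<forall>p\<in>corners. c w \<le> f (word_map (w @ u) p) \<and> f (word_map (w @ u) p) \<le> c w" by simp
    then have "c w \<le> v (word_map (w @ u) x) \<and> v (word_map (w @ u) x) \<le> c w"
      using range words_append[OF w u(1)] x by blast
    then show ?thesis by simp
  qed
  have bound: "\<bar>v (word_map (w @ u) x)\<bar> \<le> B" if w: "w \<in> words I n" and u: "u \<in> words I m" and x: "x \<in> K" for w u x
  proof -
    have "- B \<le> f (word_map (w @ u) p) \<and> f (word_map (w @ u) p) \<le> B" if "p \<in> corners" for p
      using fw[OF w u(1) that] cB[OF w] B(1) by auto
    then have "- B \<le> v (word_map (w @ u) x) \<and> v (word_map (w @ u) x) \<le> B"
      using range words_append[OF w u] x by blast
    then show ?thesis by (simp add: abs_le_iff)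
  qed
  interpret finite_measure \<mu> by (rule finite_measure_\<mu>)
  let ?X = "exceptional_words m"
  have X: "?X \<subseteq> words I m" "finite ?X" by (auto simp: exceptional_words_def)
  let ?i = "\<lambda>w u. indicator (word_map (w @ u) ` K) :: point \<Rightarrow> real"
  have pw: "(v x - g x)\<^sup>2 \<le> \<delta>\<^sup>2 + (\<Sum>w\<in>words I n. \<Sum>u\<in>?X. 4 * B\<^sup>2 * ?i w u x)" if x: "x \<in> K" for x
  proof -
    obtain w' y where w': "w' \<in> words I (n + m)" "y \<in> K" "x = word_map w' y" using K_cellE[OF x] by blast
    obtain w u where wu: "w \<in> words I n" "u \<in> words I m" "w' = w @ u" using w'(1) by (rule words_appendE)
    have nn: "0 \<le> (\<Sum>w\<in>words I n. \<Sum>u\<in>?X. 4 * B\<^sup>2 * ?i w u x)" by (intro sum_nonneg) auto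
    show ?thesis
    proof (cases "u \<in> ?X")
      case False
      have vx: "v x = c w" using good[OF wu(1,2) False w'(2)] w'(3) wu(3) by simp
      have xw: "x \<in> word_map w ` K" using w' wu word_map_in_K[OF wu(2)] by (auto simp: word_map_append)
      have "word_map w (-1/2, -1/2) \<in> word_map w ` K" using pc(1) corners_in_K by blast
      then have "dist (word_map w (-1/2, -1/2)) x \<le> 3/2 / 9 ^ n" using xw by (rule cell_diameter[OF _ _ wu(1)])
      then have "dist (c w) (g x) < \<delta>" unfolding c_def using n by (intro d(2) x vertex_in_K[OF wu(1) pc(1)]) simp
      then have "\<bar>v x - g x\<bar> \<le> \<delta>" by (simp add: vx dist_real_def)
      then have "\<bar>v x - g x\<bar>\<^sup>2 \<le> \<delta>\<^sup>2" by (intro power_mono) auto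
      then show ?thesis using nn by simp
    next
      case True
      have "\<bar>v x - g x\<bar> \<le> 2 * B" using bound[OF wu(1,2) w'(2)] B(2)[OF x] w'(3) wu(3) by simp
      then have "\<bar>v x - g x\<bar>\<^sup>2 \<le> (2 * B)\<^sup>2" by (intro power_mono) auto
      also have "\<dots> = 4 * B\<^sup>2 * ?i w u x" using w' wu by (simp add: power_mult_distrib)
      also have "\<dots> \<le> (\<Sum>u\<in>?X. 4 * B\<^sup>2 * ?i w u x)"
        by (rule member_le_sum[of u ?X "\<lambda>u. 4 * B\<^sup>2 * ?i w u x"]) (use True X in auto)
      also have "\<dots> \<le> (\<Sum>w\<in>words I n. \<Sum>u\<in>?X. 4 * B\<^sup>2 * ?i w u x)"
        by (rule member_le_sum[of w _ "\<lambda>w. \<Sum>u\<in>?X. 4 * B\<^sup>2 * ?i w u x"]) (use wu in \<open>auto intro!: sum_nonneg\<close>)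
      finally have "(v x - g x)\<^sup>2 \<le> (\<Sum>w\<in>words I n. \<Sum>u\<in>?X. 4 * B\<^sup>2 * ?i w u x)" by simp
      then show ?thesis using zero_le_power2[of \<delta>] by linarith
    qed
  qed
  have cell: "word_map (w @ u) ` K \<in> sets \<mu>" "measure \<mu> (word_map (w @ u) ` K) = 1 / 21 ^ (n + m)" "word_map (w @ u) ` K \<subseteq> K"
    if "w \<in> words I n" "u \<in> ?X" for w u
  proof -
    have "w @ u \<in> words I (n + m)" using that X(1) words_append by blast
    then show "word_map (w @ u) ` K \<in> sets \<mu>" "measure \<mu> (word_map (w @ u) ` K) = 1 / 21 ^ (n + m)" "word_map (w @ u) ` K \<subseteq> K"
      using cell_in_sets measure_cell cell_subset_K by blast+
  qed
  have il: "integrable \<mu> (\<lambda>x. 4 * B\<^sup>2 * ?i w u x)" if "w \<in> words I n" "u \<in> ?X" for w u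
    using cell(1)[OF that] by (intro integrable_mult_right) (simp add: emeasure_eq_measure)
  have iS: "integrable \<mu> (\<lambda>x. \<Sum>w\<in>words I n. \<Sum>u\<in>?X. 4 * B\<^sup>2 * ?i w u x)"
    by (intro Bochner_Integration.integrable_sum il)
  have vl: "v \<in> lsq \<mu>" by (rule cont_in_lsq[OF sets_\<mu> finite_measure_\<mu> v(2)])
  have "(\<lambda>x. v x - g x) \<in> lsq \<mu>"
    by (intro lsq_diff[OF sets_\<mu> finite_measure_\<mu>] vl cont_in_lsq[OF sets_\<mu> finite_measure_\<mu> g])
  then have iv: "integrable \<mu> (\<lambda>x. (v x - g x)\<^sup>2)" by (simp add: lsq_def)
  have "(LINT x|\<mu>. (v x - g x)\<^sup>2) \<le> (LINT x|\<mu>. \<delta>\<^sup>2 + (\<Sum>w\<in>words I n. \<Sum>u\<in>?X. 4 * B\<^sup>2 * ?i w u x))"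
    by (rule integral_mono[OF iv]) (use pw iS in auto)
  also have "\<dots> = \<delta>\<^sup>2 * measure \<mu> K + (LINT x|\<mu>. (\<Sum>w\<in>words I n. \<Sum>u\<in>?X. 4 * B\<^sup>2 * ?i w u x))"
    using iS by simp
  also have "(LINT x|\<mu>. (\<Sum>w\<in>words I n. \<Sum>u\<in>?X. 4 * B\<^sup>2 * ?i w u x)) = (\<Sum>w\<in>words I n. \<Sum>u\<in>?X. LINT x|\<mu>. 4 * B\<^sup>2 * ?i w u x)"
    by (simp only: Bochner_Integration.integral_sum[OF Bochner_Integration.integrable_sum[OF il]] Bochner_Integration.integral_sum[OF il] cong: sum.cong)
  also have "\<dots> = (\<Sum>w\<in>words I n. \<Sum>u\<in>?X. 4 * B\<^sup>2 * (1 / 21 ^ (n + m)))"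
  proof (intro sum.cong refl)
    fix w u assume wu: "w \<in> words I n" "u \<in> ?X"
    have "(LINT x|\<mu>. ?i w u x) = measure \<mu> (word_map (w @ u) ` K)"
      using cell(3)[OF wu] by (simp add: Int_absorb2)
    then show "(LINT x|\<mu>. 4 * B\<^sup>2 * ?i w u x) = 4 * B\<^sup>2 * (1 / 21 ^ (n + m))"
      using cell(2)[OF wu] by simp
  qed
  also have "\<dots> = 4 * B\<^sup>2 * (real (card ?X) / 21 ^ m)"
    by (simp add: card_words_I power_add)
  also have "\<dots> \<le> 4 * B\<^sup>2 * (2 * 9 ^ m / 21 ^ m)"
  proof -
    have "real (card ?X) \<le> real (2 * 9 ^ m)" using card_exceptional_words by (simp only: of_nat_le_iff)
    then show ?thesis by (intro mult_left_mono divide_right_mono) auto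
  qed
  also have "\<dots> = 8 * B\<^sup>2 / (21/9) ^ m" by (simp only: power_divide) (simp add: field_simps)
  finally have "(LINT x|\<mu>. (v x - g x)\<^sup>2) \<le> \<delta>\<^sup>2 * measure \<mu> K + 8 * B\<^sup>2 / (21/9) ^ m" by simp
  moreover have "measure \<mu> K = 1" using measure_cell[of "[]" 0] by simp
  ultimately have "(LINT x|\<mu>. (v x - g x)\<^sup>2) < \<epsilon>" using m \<delta>(2) \<epsilon> by simp
  then show "\<exists>u\<in>besov dimH \<mu> critical. u \<in> lsq \<mu> \<and> (LINT x|\<mu>. (u x - g x)\<^sup>2) < \<epsilon>" using v(1) vl by blast
qed

section \<open>The two forms\<close>

lemma two_forms:
  "\<exists>c1 c2.
     constructed_form I K c1 \<and> non_primal I c1 \<and> energy_self_similar I K c1 \<and>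
     energy_domain I K c1 \<noteq> besov dimH \<mu> critical \<inter> cont_funs K \<and>
     constructed_form I K c2 \<and> non_primal I c2 \<and> reverse_recursive I c2 \<and>
     energy_domain I K c2 \<noteq> besov dimH \<mu> critical \<inter> cont_funs K \<and>
     (\<exists>u \<in> cont_funs K. limit_energy I c1 u \<noteq> limit_energy I c2 u)"
proof -
  interpret S: star_form I lr ul K "self_similar_arm 1 2" "\<lambda>w. 2 * self_similar_arm 1 2 w" "1 * (1 + 2)" "9 / balance 2"
    by (rule self_similar_star_form) simp_all
  obtain t :: "nat \<Rightarrow> real" where t: "t 0 = 2" "\<And>n. 0 < t n" "\<And>n. t n \<le> 2 * (9 / 8) ^ n" "\<And>n. ratio_map (t (Suc n)) = t n"
    by (rule ratio_sequence) (rule that)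
  interpret R: star_form I lr ul K "\<lambda>w. (1/2) / 9 ^ length w" "\<lambda>w. t (length w) * ((1/2) / 9 ^ length w)" "2 * (1/2)" 8
    by (rule reverse_recursive_star_form[OF _ t(2-4)]) simp
  have "energy_self_similar I K S.conductance" by (rule self_similar_identity) simp_all
  moreover have "non_primal I S.conductance" by (rule S.non_primal_if_unbalanced) (simp add: self_similar_arm_def)
  moreover have "non_primal I R.conductance" by (rule R.non_primal_if_unbalanced) (simp add: t)
  moreover have "reverse_recursive I R.conductance"
    unfolding reverse_recursive_def
  proof (intro exI[of _ "\<lambda>n. mesh ((1/2) / 9 ^ n) (t n * ((1/2) / 9 ^ n))"] allI ballI impI)
    fix n w p q assume "w \<in> words I n"
    then show "R.conductance w (word_map w p) (word_map w q) = mesh ((1/2) / 9 ^ n) (t n * ((1/2) / 9 ^ n)) p q"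
      unfolding R.conductance_vertex by (simp only: length_words)
  qed
  moreover have "S.form_dom \<noteq> besov dimH \<mu> critical \<inter> cont_funs K" using S.form_dom_dense critical_not_dense by metis
  moreover have "R.form_dom \<noteq> besov dimH \<mu> critical \<inter> cont_funs K" using R.form_dom_dense critical_not_dense by metis
  moreover have "\<exists>u \<in> cont_funs K. limit_energy I S.conductance u \<noteq> limit_energy I R.conductance u"
  proof -
    \<comment> \<open>The networks of level \<open>0\<close> have the resistances \<open>1, 2\<close> and \<open>1/2, 1\<close>, so the harmonic function \<open>u\<close> of the
      first form has at least twice the energy in the second one.\<close>
    let ?f = "indicator {(-1/2, -1/2)} :: point \<Rightarrow> real"
    obtain u where u: "u \<in> S.form_dom" "\<forall>x\<in>vertices I 0. u x = ?f x" "S.energy u = S.network_energy 0 ?f"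
      using S.form_dom_extension[of 0 ?f] by blast
    have e: "S.network_energy 0 ?f = 2 / 3"
      unfolding S.network_energy_0 using star_energy_corner_indicator(1)[of 1] by (simp add: self_similar_arm_def)
    have "R.network_energy 0 u = R.network_energy 0 ?f" by (rule R.network_energy_cong) (use u(2) in simp)
    also have "\<dots> = 4 / 3"
      unfolding R.network_energy_0 using star_energy_corner_indicator(1)[of "1/2"] by (simp add: t)
    finally have R0: "R.network_energy 0 u = 4 / 3" .
    have "ennreal (4 / 3) \<le> limit_energy I R.conductance u"
      unfolding R.limit_energy_SUP R0[symmetric] by (rule SUP_upper) simp
    moreover have "limit_energy I S.conductance u = ennreal (2 / 3)" using S.domD(2)[OF u(1)] u(3) e by simp
    moreover have "ennreal (2 / 3) < ennreal (4 / 3)" by (simp add: ennreal_less_iff)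
    ultimately have "limit_energy I S.conductance u \<noteq> limit_energy I R.conductance u" by (metis not_le)
    then show ?thesis using u(1) S.form_dom_subset_cont by blast
  qed
  ultimately show ?thesis using S.constructed R.constructed
    by - (rule exI[of _ S.conductance], rule exI[of _ R.conductance], intro conjI)
qed

end

theorem theorem1p2:
  fixes K :: "point set" and lr ul :: bool and I :: "cell set"
    and \<alpha> \<sigma> :: real and \<mu> :: "point measure"
  assumes "I = cross_cells lr ul"
    and "compact K" and "K \<noteq> {}" and "K = (\<Union>i\<in>I. cell_map i ` K)"
    and "\<alpha> = ln 21 / ln 9"
    and "\<mu> = normalized_hausdorff \<alpha> K"
    and "\<sigma> = 1/2 * (1 + ln 21 / ln 9)"
  shows "sigma_star K \<alpha> \<mu> = ereal \<sigma> \<and> sigma_sharp \<alpha> \<mu> = ereal \<sigma> \<and>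
    (\<forall>u \<in> besov \<alpha> \<mu> \<sigma>. \<exists>v \<in> cont_funs K. AE x in \<mu>. u x = v x) \<and>
    dense_in_lsq \<mu> (besov \<alpha> \<mu> \<sigma>) \<and>
    \<not> dense_in_cont K (besov \<alpha> \<mu> \<sigma> \<inter> cont_funs K) \<and>
    (\<exists>c1 c2.
       constructed_form I K c1 \<and> non_primal I c1 \<and> energy_self_similar I K c1 \<and>
       energy_domain I K c1 \<noteq> besov \<alpha> \<mu> \<sigma> \<inter> cont_funs K \<and>
       constructed_form I K c2 \<and> non_primal I c2 \<and> reverse_recursive I c2 \<and>
       energy_domain I K c2 \<noteq> besov \<alpha> \<mu> \<sigma> \<inter> cont_funs K \<and>
       (\<exists>u \<in> cont_funs K. limit_energy I c1 u \<noteq> limit_energy I c2 u))"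
proof -
  interpret X: eyebolted_cross I lr ul K by unfold_locales (fact assms(1-4))+
  have \<mu>: "\<mu> = X.\<mu>" by (simp add: assms(5,6) X.\<mu>_def)
  have rep: "\<forall>u \<in> besov \<alpha> \<mu> \<sigma>. \<exists>v \<in> cont_funs K. AE x in \<mu>. u x = v x"
  proof
    fix u assume "u \<in> besov \<alpha> \<mu> \<sigma>"
    then have "u \<in> besov X.dimH X.\<mu> X.critical" by (simp only: \<mu> assms(5,7))
    then obtain v where "continuous_on K v" "AE x in X.\<mu>. u x = v x" by (rule X.critical_representative)
    then show "\<exists>v \<in> cont_funs K. AE x in \<mu>. u x = v x" unfolding \<mu> cont_funs_def by blast
  qed
  show ?thesis
    using rep X.sigma_star_eq X.sigma_sharp_eq X.critical_dense_lsq X.critical_not_dense X.two_forms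
    unfolding \<mu> assms(5,7) by (intro conjI)
qed

end
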